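(* For any ergodic invertible measure-preserving transformations $T_1,T_2$ on some probability space $(X,\mu)$ and for any $F,G\in L^\infty(X)$, $$\lim_{N\to\infty}\frac1N\sum_{n=1}^N T_1^nF\cdot T_2^{\Omega(n)}G=\int_XF\,d\mu\int_XG\,d\mu\qquad\text{in }L^2(X).$$ The result remains true if $\Omega$ is replaced with $\Omega_{\mathcal{P}}$ for any set $\mathcal{P}$ of primes containing almost every prime, or more generally, with any finitely generated completely additive function $a:\mathbb{N}\to\mathbb{Z}$ such that the function $n\mapsto e(a(n)\alpha)$ is aperiodic for all $\alpha\in(0,1)\cap\mathbb{Q}$.
   Context: $\mathbb{N}=\{1,2,\dots\}$, $e(t)=e^{2\pi it}$. Every probability space $(X,\mu)$ is assumed regular: $X$ is a compact metric space with its Borel $\sigma$-algebra. $T^nF=F\circ T^n$. $T_1$ and $T_2$ are not assumed to commute. $\Omega(n)$ is the number of prime factors of $n$ counted with multiplicity; $\Omega_{\mathcal{P}}(n)$ is the number of prime factors of $n$ lying in $\mathcal{P}$, counted with multiplicity. A set $\mathcal{P}$ of primes contains almost every prime if $\sum_{p\text{ prime},\,p\notin\mathcal{P}}\frac1p<\infty$. A function $a:\mathbb{N}\to\mathbb{Z}$ is completely additive if $a(nm)=a(n)+a(m)$ for all $n,m\in\mathbb{N}$, and finitely generated if $\{a(p):p\text{ prime}\}$ is finite. A multiplicative function $f:\mathbb{N}\to\mathbb{C}$ is aperiodic if $\lim_{N\to\infty}\frac1N\sum_{n=1}^Nf(qn+r)=0$ for all $r,q\in\mathbb{N}$. *)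

theory Defs
  imports "HOL-Probability.Probability" "HOL-Number_Theory.Number_Theory"
begin

(* A compact subset X = space M of a metric type with the Borel sigma-algebra of the subspace. *)
definition regular_prob_space :: "'a::metric_space measure \<Rightarrow> bool" where
  "regular_prob_space M \<longleftrightarrow>
     prob_space M \<and> compact (space M) \<and> sets M = sets (restrict_space borel (space M))"

definition invertible_measure_preserving :: "'a measure \<Rightarrow> ('a \<Rightarrow> 'a) \<Rightarrow> bool" where
  "invertible_measure_preserving M T \<longleftrightarrow>
     T \<in> M \<rightarrow>\<^sub>M M \<and> distr M M T = M \<and>
     bij_betw T (space M) (space M) \<and> inv_into (space M) T \<in> M \<rightarrow>\<^sub>M M"

definition ergodic :: "'a measure \<Rightarrow> ('a \<Rightarrow> 'a) \<Rightarrow> bool" where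
  "ergodic M T \<longleftrightarrow>
     (\<forall>A \<in> sets M. T -` A \<inter> space M = A \<longrightarrow> measure M A = 0 \<or> measure M A = 1)"

definition int_iterate :: "'a measure \<Rightarrow> ('a \<Rightarrow> 'a) \<Rightarrow> int \<Rightarrow> 'a \<Rightarrow> 'a" where
  "int_iterate M T k =
     (if k \<ge> 0 then T ^^ nat k else inv_into (space M) T ^^ nat (- k))"

definition koopman :: "'a measure \<Rightarrow> ('a \<Rightarrow> 'a) \<Rightarrow> int \<Rightarrow> ('a \<Rightarrow> complex) \<Rightarrow> 'a \<Rightarrow> complex" where
  "koopman M T k F = (\<lambda>x. F (int_iterate M T k x))"

definition L_infinity :: "'a measure \<Rightarrow> ('a \<Rightarrow> complex) set" where
  "L_infinity M = {F \<in> borel_measurable M. \<exists>C. AE x in M. norm (F x) \<le> C}"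

definition L_two :: "'a measure \<Rightarrow> ('a \<Rightarrow> complex) set" where
  "L_two M = {F \<in> borel_measurable M. integrable M (\<lambda>x. (norm (F x))\<^sup>2)}"

definition L_two_norm :: "'a measure \<Rightarrow> ('a \<Rightarrow> complex) \<Rightarrow> real" where
  "L_two_norm M F = sqrt (LINT x|M. (norm (F x))\<^sup>2)"

definition tendsto_L_two :: "'a measure \<Rightarrow> (nat \<Rightarrow> 'a \<Rightarrow> complex) \<Rightarrow> ('a \<Rightarrow> complex) \<Rightarrow> bool" where
  "tendsto_L_two M S F \<longleftrightarrow>
     (\<forall>N. S N \<in> L_two M) \<and> F \<in> L_two M \<and>
     (\<lambda>N. L_two_norm M (\<lambda>x. S N x - F x)) \<longlonglongrightarrow> 0"

definition joint_average ::
  "'a measure \<Rightarrow> ('a \<Rightarrow> 'a) \<Rightarrow> ('a \<Rightarrow> 'a) \<Rightarrow> (nat \<Rightarrow> int) \<Rightarrow>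
   ('a \<Rightarrow> complex) \<Rightarrow> ('a \<Rightarrow> complex) \<Rightarrow> nat \<Rightarrow> 'a \<Rightarrow> complex" where
  "joint_average M T1 T2 a F G N = (\<lambda>x.
     (1 / of_nat N) * (\<Sum>n = 1..N. koopman M T1 (int n) F x * koopman M T2 (a n) G x))"

definition Omega :: "nat \<Rightarrow> nat" where
  "Omega n = size (prime_factorization n)"

definition Omega_in :: "nat set \<Rightarrow> nat \<Rightarrow> nat" where
  "Omega_in P n = size (filter_mset (\<lambda>p. p \<in> P) (prime_factorization n))"

definition contains_almost_every_prime :: "nat set \<Rightarrow> bool" where
  "contains_almost_every_prime P \<longleftrightarrow>
     (\<lambda>p. 1 / real p) summable_on {p. prime p \<and> p \<notin> P}"

(* Arithmetic functions live on the positive integers; their value at 0 is irrelevant. *)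
definition completely_additive :: "(nat \<Rightarrow> int) \<Rightarrow> bool" where
  "completely_additive a \<longleftrightarrow> (\<forall>n\<ge>1. \<forall>m\<ge>1. a (n * m) = a n + a m)"

definition finitely_generated :: "(nat \<Rightarrow> int) \<Rightarrow> bool" where
  "finitely_generated a \<longleftrightarrow> finite (a ` {p. prime p})"

definition e_char :: "real \<Rightarrow> complex" where
  "e_char t = exp (2 * of_real pi * \<i> * of_real t)"

(* Meant for multiplicative f only, but the limit condition makes sense for every f. *)
definition aperiodic :: "(nat \<Rightarrow> complex) \<Rightarrow> bool" where
  "aperiodic f \<longleftrightarrow>
     (\<forall>r\<ge>1. \<forall>q\<ge>1. (\<lambda>N. (1 / of_nat N) * (\<Sum>n = 1..N. f (q * n + r))) \<longlonglongrightarrow> 0)"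

end

theory Submission
  imports Defs "HOL-Real_Asymp.Real_Asymp" "HOL-Computational_Algebra.Squarefree"
begin

text \<open>
  After subtracting from \<open>F\<close> its projection \<open>F0\<close> to the functions invariant under a power
  \<open>T1^D\<close>, the correlations of the remainder along every progression whose step divides \<open>D\<close>
  average to 0. Writing \<open>G\<close> as a combination of two unimodular functions, Katai's criterion over a
  finite set of primes \<open>p\<close> with \<open>a p\<close> constant and with large reciprocal sum (via Turan-Kubilius)
  bounds the average of the remainder, because \<open>T2^(a (p * m)) G\<close> does not depend on such \<open>p\<close> and
  \<open>D\<close> may be chosen divisible by all differences of these primes. The function \<open>F0\<close> is periodic along
  orbits, so its part reduces to averages of \<open>T2^(a n) G\<close> over residue classes. By the spectral measure
  of \<open>G\<close> these tend to the expected limit once \<open>e_char (a n * \<theta>)\<close> has mean 0 on residue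
  classes for every non-integer \<open>\<theta>\<close>: for rational \<open>\<theta>\<close> this is aperiodicity, for irrational
  \<open>\<theta>\<close> (and for \<open>Omega_in P\<close>) it is a Halasz type mean value theorem for multiplicative
  functions with finitely many values at primes, applied to twists by Dirichlet characters.
\<close>

text \<open>What prevents plain orthogonality is that \<open>T1\<close> may have rational
  eigenvalues; hence the periodic part and the residue classes. Equal values
  \<open>a p = a q\<close> make the weights at \<open>p * m\<close> and \<open>q * m\<close>
  identical, so only correlations of \<open>T1\<close> with itself at times
  \<open>(p - q) * m\<close> survive and the two maps need not commute. A common weight drops out of
  a modulus only if it has modulus 1, which is why \<open>G\<close> is split. The Halasz type
  theorem is proved by elementary means. A mean value of nearly extremal modulus is close to most of
  the terms \<open>f m * A (x / m)\<close> that it averages with Selberg's weights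
  \<open>lambda2 m / m\<close>. These weights are chosen because they have a lower bound on every
  interval from \<open>y\<close> to \<open>(1 + \<delta>) * y\<close>, which Chebyshev's method does
  not give for primes. Finitely many values at primes leave finitely many multipliers, which rules
  out a slow rotation like n^(it). For \<open>Omega_in P\<close> one more fact is required: a
  Dirichlet character that is constant on almost every prime has the constant 1. This rests on L(1)
  \<noteq> 0 for real characters.\<close>

definition nups :: "real \<Rightarrow> nat set" where
  "nups x = {n. 1 \<le> n \<and> real n \<le> x}"

lemma nups_altdef: "nups x = {1..nat \<lfloor>x\<rfloor>}"
  unfolding nups_def by (auto simp: le_nat_floor le_floor_iff nat_le_iff) linarith+

lemma finite_nups [simp]: "finite (nups x)"
  by (simp add: nups_altdef)

lemma in_nups [simp]: "n \<in> nups x \<longleftrightarrow> 1 \<le> n \<and> real n \<le> x"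
  by (simp add: nups_def)

lemma card_nups: "card (nups x) = nat \<lfloor>x\<rfloor>"
  by (simp add: nups_altdef)

lemma card_nups_le: "x \<ge> 0 \<Longrightarrow> real (card (nups x)) \<le> x"
  by (simp add: card_nups)

lemma card_nups_ge: "x - 1 \<le> real (card (nups x))"
  by (simp add: card_nups) linarith

lemma nups_of_nat: "nups (real N) = {1..N}"
  by (auto simp: nups_def)

lemma nups_empty: "x < 1 \<Longrightarrow> nups x = {}"
  by (auto simp: nups_def)

lemma nups_mono: "x \<le> y \<Longrightarrow> nups x \<subseteq> nups y"
  by auto

text \<open>Summing a Dirichlet convolution over \<open>n\<close> up to \<open>x\<close>: the
  lattice points with \<open>d * m\<close> at most \<open>x\<close> are listed once by their product
  and once by \<open>d\<close>. With a real bound, \<open>x / real d\<close> needs no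
  rounding.\<close>

lemma sum_divisors_nups:
  fixes G :: "nat \<Rightarrow> nat \<Rightarrow> 'b::comm_monoid_add"
  shows "(\<Sum>n\<in>nups x. \<Sum>d | d dvd n. G d (n div d)) = (\<Sum>d\<in>nups x. \<Sum>m\<in>nups (x / real d). G d m)"
proof -
  have fin: "finite {d. d dvd n}" if "n \<in> nups x" for n
    using that by auto
  have "(\<Sum>n\<in>nups x. \<Sum>d | d dvd n. G d (n div d)) =
        (\<Sum>(n,d)\<in>Sigma (nups x) (\<lambda>n. {d. d dvd n}). G d (n div d))"
    by (subst sum.Sigma) (use fin in auto)
  also have "\<dots> = (\<Sum>(d,m)\<in>Sigma (nups x) (\<lambda>d. nups (x / real d)). G d m)"
  proof (rule sum.reindex_bij_witness[of _ "\<lambda>(d,m). (d*m, d)" "\<lambda>(n,d). (d, n div d)"], goal_cases)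
    case (1 a)
    then show ?case by auto
  next
    case (2 a)
    then obtain n d where a: "a = (n, d)" "1 \<le> n" "real n \<le> x" "d dvd n" by auto
    then obtain m where m: "n = d * m" by auto
    have d: "d \<ge> 1" "m \<ge> 1" using a(2) m by (cases d; cases m; auto)+
    have "real d \<le> real (d * m)" using d by (simp del: of_nat_mult)
    then have "real d \<le> x" using a m by linarith
    moreover have "real m \<le> x / real d" using a d m by (simp add: field_simps)
    ultimately show ?case using a d m by simp
  next
    case (3 b)
    then show ?case by auto
  next
    case (4 b)
    then obtain d m where b: "b = (d, m)" "1 \<le> d" "real d \<le> x" "1 \<le> m" "real m \<le> x / real d" by auto
    then have "real (d*m) \<le> x" by (simp add: field_simps)
    then show ?case using b by auto
  next
    case (5 a)
    then show ?case by auto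
  qed
  also have "\<dots> = (\<Sum>d\<in>nups x. \<Sum>m\<in>nups (x / real d). G d m)"
    by (subst sum.Sigma) auto
  finally show ?thesis .
qed

section \<open>Elementary estimates\<close>

definition logsum :: "real \<Rightarrow> real" where
  "logsum x = (\<Sum>n\<in>nups x. ln (real n))"

text \<open>Stirling up to a logarithm. Both inductions rest on \<open>ln (n + 1) - ln n\<close>
  lying between \<open>1 / (n + 1)\<close> and \<open>1 / n\<close>.\<close>

lemma ln_fact_bounds:
  fixes n :: nat assumes "n \<ge> 1"
  shows "real n * ln n - n \<le> (\<Sum>k=1..n. ln (real k))"
    and "(\<Sum>k=1..n. ln (real k)) \<le> real n * ln n - n + ln n + 1"
  using assms
proof (induction n rule: nat_induct_at_least)
  case base
  { case 1 then show ?case by simp }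
  { case 2 then show ?case by simp }
next
  case (Suc n)
  have up: "ln (real n + 1) \<le> ln (real n) + 1 / real n"
    using ln_diff_le_inverse[of "real n"] Suc.hyps by simp
  have low: "ln (real n) + 1 / (real n + 1) \<le> ln (real n + 1)"
  proof -
    have "ln (real n / (real n + 1)) \<le> real n / (real n + 1) - 1"
      using Suc.hyps by (intro ln_le_minus_one) (auto simp: field_simps)
    also have "\<dots> = - 1 / (real n + 1)" by (simp add: field_simps)
    finally show ?thesis using Suc.hyps by (simp add: ln_div)
  qed
  { case 1
    have "real n * ln (real n + 1) \<le> real n * (ln (real n) + 1 / real n)"
      using up by (intro mult_left_mono) auto
    also have "\<dots> = real n * ln n + 1" using Suc.hyps by (simp add: field_simps)
    finally show ?case using Suc.IH(1) by (simp add: algebra_simps) }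
  { case 2
    have "(real n + 1) * (ln (real n) + 1 / (real n + 1)) \<le> (real n + 1) * ln (real n + 1)"
      using low by (intro mult_left_mono) auto
    moreover have "(real n + 1) * (ln (real n) + 1 / (real n + 1)) = (real n + 1) * ln (real n) + 1"
      by (simp only: distrib_left) simp
    ultimately have "(real n + 1) * ln (real n) + 1 \<le> (real n + 1) * ln (real n + 1)" by linarith
    then show ?case using Suc.IH(2) by (simp add: algebra_simps) }
qed

text \<open>From integers to reals: \<open>t * ln t - t\<close> has derivative \<open>ln t\<close>,
  so moving from the floor of \<open>x\<close> to \<open>x\<close> changes it by at most
  \<open>ln x\<close>.\<close>

lemma logsum_bound:
  assumes "x \<ge> 1"
  shows "\<bar>logsum x - (x * ln x - x)\<bar> \<le> ln x + 1"
proof -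
  define n where "n = nat \<lfloor>x\<rfloor>"
  have n: "n \<ge> 1" "real n \<le> x" "x < real n + 1"
    using assms unfolding n_def by linarith+
  have ls: "logsum x = (\<Sum>k=1..n. ln (real k))"
    unfolding logsum_def n_def by (simp add: nups_altdef)
  have lnx: "ln (real n) \<le> ln x" using n by simp
  have mvt: "\<exists>z>real n. z < x \<and> (x * ln x - x) - (n * ln n - n) = (x - n) * ln z" if "real n < x"
  proof -
    have "\<exists>z>real n. z < x \<and> (\<lambda>t. t * ln t - t) x - (\<lambda>t. t * ln t - t) (real n) = (x - n) * ln z"
    proof (rule MVT2[OF that])
      fix t assume "real n \<le> t" "t \<le> x"
      then have "t > 0" using n by linarith
      have "((\<lambda>t. t * ln t - t) has_real_derivative (1 * ln t + 1 / t * t) - 1) (at t)"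
        by (intro DERIV_diff DERIV_mult DERIV_ident DERIV_ln_divide) fact
      then show "((\<lambda>t. t * ln t - t) has_real_derivative ln t) (at t)" using \<open>t > 0\<close> by simp
    qed
    then show ?thesis by simp
  qed
  have mono1: "real n * ln n - n \<le> x * ln x - x"
  proof -
    have "\<exists>z>0. (x * ln x - x) - (n * ln n - n) = (x - n) * ln z \<and> z \<ge> 1"
    proof (cases "real n = x")
      case True then show ?thesis by (intro exI[of _ 1]) auto
    next
      case False
      then have "real n < x" using n by simp
      then obtain z where "z > real n" "z < x" "(x * ln x - x) - (n * ln n - n) = (x - n) * ln z"
        using mvt[OF \<open>real n < x\<close>] by auto
      then show ?thesis using n by (intro exI[of _ z]) auto
    qed
    then obtain z where "z \<ge> 1" "(x * ln x - x) - (n * ln n - n) = (x - n) * ln z" by auto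
    moreover from this have "(x - n) * ln z \<ge> 0" using n by simp
    ultimately show ?thesis by linarith
  qed
  have mono2: "x * ln x - x \<le> real n * ln n - n + ln x"
  proof (cases "real n = x")
    case True then show ?thesis using assms by auto
  next
    case False
    then have "real n < x" using n by simp
    then obtain z where z: "z > real n" "z < x" "(x * ln x - x) - (n * ln n - n) = (x - n) * ln z"
      using mvt[OF \<open>real n < x\<close>] by auto
    have "(x - n) * ln z \<le> 1 * ln x" using z n by (intro mult_mono) auto
    then show ?thesis using z by linarith
  qed
  show ?thesis using ln_fact_bounds[OF n(1)] mono1 mono2 lnx unfolding ls by linarith
qed

section \<open>Chebyshev's bound\<close>

definition psi :: "real \<Rightarrow> real" where
  "psi x = (\<Sum>n\<in>nups x. mangoldt n)"

lemma psi_nonneg: "psi x \<ge> 0" unfolding psi_def by (intro sum_nonneg mangoldt_nonneg)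

lemma logsum_mangoldt:
  "logsum x = (\<Sum>d\<in>nups x. mangoldt d * real (card (nups (x / real d))))"
proof -
  have "logsum x = (\<Sum>n\<in>nups x. \<Sum>d | d dvd n. (\<lambda>d m. mangoldt d :: real) d (n div d))"
    unfolding logsum_def by (intro sum.cong refl) (subst mangoldt_sum, auto)
  also have "\<dots> = (\<Sum>d\<in>nups x. \<Sum>m\<in>nups (x / real d). mangoldt d)"
    by (rule sum_divisors_nups)
  also have "\<dots> = (\<Sum>d\<in>nups x. mangoldt d * real (card (nups (x / real d))))"
    by (simp add: mult.commute)
  finally show ?thesis .
qed

text \<open>Chebyshev's device: in \<open>logsum x - 2 * logsum (x / 2)\<close> the von Mangoldt
  function carries the weight floor of \<open>t\<close> minus twice the floor of
  \<open>t / 2\<close>, at \<open>t = x / d\<close>. This is never negative, and it equals 1 for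
  \<open>d\<close> between \<open>x / 2\<close> and \<open>x\<close>.\<close>

lemma psi_half: "x \<ge> 2 \<Longrightarrow> psi x - psi (x / 2) \<le> logsum x - 2 * logsum (x / 2)"
proof -
  assume x: "x \<ge> 2"
  define g where "g t = real (card (nups t)) - 2 * real (card (nups (t/2)))" for t
  have g0: "g t \<ge> 0" if "t \<ge> 0" for t
  proof -
    have "2 * \<lfloor>t / 2\<rfloor> \<le> \<lfloor>t\<rfloor>" by linarith
    moreover have "\<lfloor>t/2\<rfloor> \<ge> 0" using that by simp
    ultimately have "2 * nat \<lfloor>t/2\<rfloor> \<le> nat \<lfloor>t\<rfloor>" by linarith
    then show ?thesis unfolding g_def card_nups by linarith
  qed
  have g1: "g t = 1" if "t \<ge> 1" "t < 2" for t
  proof -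
    have "\<lfloor>t\<rfloor> = 1" "\<lfloor>t/2\<rfloor> = 0" using that by linarith+
    then show ?thesis by (simp add: g_def card_nups)
  qed
  have half: "logsum (x/2) = (\<Sum>d\<in>nups x. mangoldt d * real (card (nups (x / real d / 2))))"
  proof -
    have "logsum (x/2) = (\<Sum>d\<in>nups (x/2). mangoldt d * real (card (nups (x / real d / 2))))"
      unfolding logsum_mangoldt by (simp add: field_simps)
    also have "\<dots> = (\<Sum>d\<in>nups x. mangoldt d * real (card (nups (x / real d / 2))))"
    proof (rule sum.mono_neutral_left)
      show "\<forall>i\<in>nups x - nups (x / 2). mangoldt i * real (card (nups (x / real i / 2))) = 0"
      proof
        fix i assume "i \<in> nups x - nups (x/2)"
        then have "x / real i / 2 < 1" by (auto simp: field_simps)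
        then show "mangoldt i * real (card (nups (x / real i / 2))) = 0" by (simp add: nups_empty)
      qed
    qed (use x in auto)
    finally show ?thesis .
  qed
  have "psi x - psi (x/2) = (\<Sum>d\<in>nups x - nups (x/2). mangoldt d)"
    unfolding psi_def by (subst sum_diff) (use x in auto)
  also have "\<dots> = (\<Sum>d\<in>nups x - nups (x/2). mangoldt d * g (x / real d))"
  proof (intro sum.cong refl)
    fix d assume d: "d \<in> nups x - nups (x/2)"
    have "g (x / real d) = 1" using d by (intro g1) (auto simp: field_simps)
    then show "mangoldt d = mangoldt d * g (x / real d)" by simp
  qed
  also have "\<dots> \<le> (\<Sum>d\<in>nups x. mangoldt d * g (x / real d))"
    using x by (intro sum_mono2) (auto intro!: mult_nonneg_nonneg g0 mangoldt_nonneg)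
  also have "\<dots> = logsum x - 2 * logsum (x/2)"
    unfolding half unfolding logsum_mangoldt g_def
    by (simp add: algebra_simps sum_subtractf sum_distrib_left)
  finally show ?thesis .
qed

lemma ln_le_sqrt: "x \<ge> 1 \<Longrightarrow> ln x \<le> 2 * sqrt x"
proof -
  assume "x \<ge> 1"
  then have "ln x = 2 * ln (sqrt x)" by (simp add: ln_sqrt)
  moreover have "ln (sqrt x) \<le> sqrt x" using \<open>x \<ge> 1\<close> by (intro ln_bound) auto
  ultimately show ?thesis by simp
qed

theorem chebyshev_psi: "\<exists>C>0. \<forall>x\<ge>0. psi x \<le> C * x"
proof -
  have step: "psi x - psi (x/2) \<le> 7 * x" if x: "x \<ge> 2" for x
  proof -
    have "\<bar>logsum x - (x * ln x - x)\<bar> \<le> ln x + 1" using x by (intro logsum_bound) auto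
    moreover have "\<bar>logsum (x/2) - (x/2 * ln (x/2) - x/2)\<bar> \<le> ln (x/2) + 1"
      using x by (intro logsum_bound) auto
    moreover have l: "ln (x/2) = ln x - ln 2" using x by (simp add: ln_div)
    moreover have "ln x \<le> x - 1" using x by (intro ln_le_minus_one) auto
    moreover have l2: "ln 2 \<le> (1::real)" "ln 2 \<ge> (0::real)" using ln2_le_25_over_36 by auto
    moreover have "x * ln 2 \<le> x * 1" using l2 x by (intro mult_left_mono) auto
    moreover have "x/2 * ln (x/2) = x * ln x / 2 - x * ln 2 / 2" unfolding l by (simp add: field_simps)
    ultimately show ?thesis using psi_half[OF x] by argo
  qed
  \<comment> \<open>Repeated halving: \<open>7 * x + 14 * (x / 2) = 14 * x\<close>, so the constant
    is twice that of \<open>step\<close>.\<close>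
  have main: "psi x \<le> 14 * x" if "x \<ge> 0" "x < 2 ^ n" for n x
    using that
  proof (induction n arbitrary: x)
    case 0 then show ?case by (simp add: psi_def nups_empty)
  next
    case (Suc n)
    show ?case
    proof (cases "x \<ge> 2")
      case False
      have "psi x = 0"
      proof -
        have "nups x \<subseteq> {1}" using False by auto
        then have "psi x \<le> (\<Sum>n\<in>{1::nat}. mangoldt n)" unfolding psi_def
          by (intro sum_mono2) (auto intro: mangoldt_nonneg)
        then show ?thesis using psi_nonneg[of x] by simp
      qed
      then show ?thesis using Suc.prems by simp
    next
      case True
      have "psi (x/2) \<le> 14 * (x/2)" using Suc.prems by (intro Suc.IH) auto
      then show ?thesis using step[OF True] by simp
    qed
  qed
  have "psi x \<le> 14 * x" if "x \<ge> 0" for x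
  proof -
    obtain n where "x < 2 ^ n" using real_arch_pow[of 2 x] by auto
    then show ?thesis using main that by auto
  qed
  then show ?thesis by (intro exI[of _ 14]) auto
qed

section \<open>Rearrangement of divisor sums, and the Moebius function\<close>

lemma sum_nups_swap:
  "(\<Sum>d\<in>nups x. \<Sum>m\<in>nups (x / real d). g d m) = (\<Sum>m\<in>nups x. \<Sum>d\<in>nups (x / real m). g d m)"
proof -
  have "(\<Sum>d\<in>nups x. \<Sum>m\<in>nups (x / real d). g d m) = (\<Sum>n\<in>nups x. \<Sum>d | d dvd n. g d (n div d))"
    by (rule sum_divisors_nups[symmetric])
  also have "\<dots> = (\<Sum>n\<in>nups x. \<Sum>d | d dvd n. g (n div d) d)"
  proof (rule sum.cong[OF refl])
    fix n assume "n \<in> nups x"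
    then have n: "n > 0" by auto
    show "(\<Sum>d | d dvd n. g d (n div d)) = (\<Sum>d | d dvd n. g (n div d) d)"
      by (rule sum.reindex_bij_witness[of _ "\<lambda>d. n div d" "\<lambda>d. n div d"]) (use n in \<open>auto elim!: dvdE\<close>)
  qed
  also have "\<dots> = (\<Sum>m\<in>nups x. \<Sum>d\<in>nups (x / real m). g d m)"
    by (rule sum_divisors_nups)
  finally show ?thesis .
qed

lemma sum_divisors_assoc:
  fixes n :: nat assumes n: "n > 0"
  shows "(\<Sum>d | d dvd n. \<Sum>e | e dvd d. g e (d div e)) = (\<Sum>e | e dvd n. \<Sum>k | k dvd n div e. g e k)"
proof -
  have "(\<Sum>d | d dvd n. \<Sum>e | e dvd d. g e (d div e)) =
     (\<Sum>(d,e)\<in>Sigma {d. d dvd n} (\<lambda>d. {e. e dvd d}). g e (d div e))"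
    by (subst sum.Sigma) (use n in \<open>auto intro: finite_divisors_nat dvd_pos_nat\<close>)
  also have "\<dots> = (\<Sum>(e,k)\<in>Sigma {e. e dvd n} (\<lambda>e. {k. k dvd n div e}). g e k)"
    by (rule sum.reindex_bij_witness[of _ "\<lambda>(e,k). (e*k, e)" "\<lambda>(d,e). (e, d div e)"])
       (use n in \<open>auto elim!: dvdE intro: dvd_pos_nat simp: mult_dvd_mono\<close>)
  also have "\<dots> = (\<Sum>e | e dvd n. \<Sum>k | k dvd n div e. g e k)"
    by (subst sum.Sigma) (use n in \<open>auto intro!: finite_divisors_nat elim!: dvdE\<close>)
  finally show ?thesis .
qed

lemma sum_divisors_swap:
  fixes n :: nat assumes n: "n > 0"
  shows "(\<Sum>d | d dvd n. \<Sum>e | e dvd n div d. g d e) = (\<Sum>e | e dvd n. \<Sum>d | d dvd n div e. g d e)"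
proof -
  have "(\<Sum>d | d dvd n. \<Sum>e | e dvd n div d. g d e) =
     (\<Sum>(d,e)\<in>Sigma {d. d dvd n} (\<lambda>d. {e. e dvd n div d}). g d e)"
    by (subst sum.Sigma) (use n in \<open>auto intro!: finite_divisors_nat elim!: dvdE\<close>)
  also have "\<dots> = (\<Sum>(e,d)\<in>Sigma {e. e dvd n} (\<lambda>e. {d. d dvd n div e}). g d e)"
    by (rule sum.reindex_bij_witness[of _ "\<lambda>(e,k). (k, e)" "\<lambda>(e,k). (k, e)"])
       (use n in \<open>auto elim!: dvdE simp: mult.left_commute\<close>)
  also have "\<dots> = (\<Sum>e | e dvd n. \<Sum>d | d dvd n div e. g d e)"
    by (subst sum.Sigma) (use n in \<open>auto intro!: finite_divisors_nat elim!: dvdE\<close>)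
  finally show ?thesis .
qed

text \<open>Splitting off one prime; divisor sums of multiplicative functions are then computed
  prime by prime, for \<open>moebius_mu\<close> and later for real characters.\<close>

lemma sum_divisors_prime_power_mult:
  fixes p m :: nat
  assumes p: "prime p" "\<not> p dvd m" and m: "m > 0"
  shows "(\<Sum>d | d dvd p ^ e * m. h d) = (\<Sum>i\<le>e. \<Sum>d | d dvd m. h (p ^ i * d))"
proof -
  have p0: "p > 0" using p prime_gt_0_nat by blast
  have "(\<Sum>i\<le>e. \<Sum>d | d dvd m. h (p ^ i * d)) = (\<Sum>(i,d)\<in>{..e} \<times> {d. d dvd m}. h (p ^ i * d))"
    by (rule sum.cartesian_product)
  also have "\<dots> = (\<Sum>d | d dvd p ^ e * m. h d)"
  proof -
    have "bij_betw (\<lambda>(i, d). p ^ i * d) ({..e} \<times> {d. d dvd m}) {d. d dvd p ^ e * m}"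
    proof (rule bij_betw_imageI)
      show "inj_on (\<lambda>(i, d). p ^ i * d) ({..e} \<times> {d. d dvd m})"
      proof (rule inj_onI, clarify)
        fix i d j d' assume a: "p ^ i * d = p ^ j * d'" "d dvd m" "d' dvd m"
        have nd: "\<not> p dvd d" "\<not> p dvd d'" using a p by (meson dvd_trans)+
        have pos: "d > 0" "d' > 0" using a m by (auto intro: dvd_pos_nat)
        have "multiplicity p (p ^ i * d) = i" "multiplicity p (p ^ j * d') = j"
          using nd pos p p0 by (simp_all add: prime_elem_multiplicity_mult_distrib not_dvd_imp_multiplicity_0 prime_imp_prime_elem)
        then have "i = j" using a by simp
        then show "i = j \<and> d = d'" using a p0 by simp
      qed
      show "(\<lambda>(i, d). p ^ i * d) ` ({..e} \<times> {d. d dvd m}) = {d. d dvd p ^ e * m}"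
      proof (intro equalityI subsetI)
        fix d assume "d \<in> {d. d dvd p ^ e * m}"
        then obtain a b where ab: "d = a * b" "a dvd p ^ e" "b dvd m"
          using division_decomp by blast
        then obtain i where "i \<le> e" "a = p ^ i" using p divides_primepow_nat by blast
        then show "d \<in> (\<lambda>(i, d). p ^ i * d) ` ({..e} \<times> {d. d dvd m})" using ab by force
      qed (auto intro!: mult_dvd_mono le_imp_power_dvd)
    qed
    from sum.reindex_bij_betw[OF this, of h] show ?thesis by (simp add: case_prod_unfold)
  qed
  finally show ?thesis by simp
qed

lemma prime_power_split:
  fixes n p :: nat assumes "n > 0" "prime p" "p dvd n"
  obtains e m where "e \<ge> 1" "\<not> p dvd m" "m > 0" "n = p ^ e * m"
proof -
  obtain m where m: "n = p ^ multiplicity p n * m" "\<not> p dvd m"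
    using multiplicity_decompose'[of n p] assms by (metis neq0_conv not_prime_unit)
  have "multiplicity p n \<ge> 1" using assms
    by (metis not_dvd_imp_multiplicity_0 Suc_leI One_nat_def multiplicity_eq_zero_iff gr0I not_prime_unit)
  then show thesis using that[of "multiplicity p n" m] m assms(1) by (metis neq0_conv mult_0_right)
qed

definition moebius_mu :: "nat \<Rightarrow> real" where
  "moebius_mu n = (if squarefree n then (-1) ^ card (prime_factors n) else 0)"

lemma abs_moebius_le: "\<bar>moebius_mu n\<bar> \<le> 1"
  by (simp add: moebius_mu_def power_abs)

lemma moebius_mult_prime:
  assumes "prime p" "\<not> p dvd d" "d > 0"
  shows "moebius_mu (p * d) = - moebius_mu d"
proof -
  have cop: "coprime p d" using assms by (simp add: prime_imp_coprime)
  have sq: "squarefree (p * d) \<longleftrightarrow> squarefree d"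
    using assms cop by (auto simp: squarefree_mult_coprime squarefree_prime dest: squarefree_multD)
  have pf: "prime_factors (p * d) = insert p (prime_factors d)"
    using assms by (subst prime_factors_product) (auto simp: prime_factorization_prime)
  have "p \<notin> prime_factors d" using assms by auto
  then show ?thesis using sq pf by (simp add: moebius_mu_def)
qed

lemma moebius_sum:
  fixes n :: nat assumes "n > 0"
  shows "(\<Sum>d | d dvd n. moebius_mu d) = (if n = 1 then 1 else 0)"
proof (cases "n = 1")
  case True then show ?thesis by (simp add: moebius_mu_def)
next
  case False
  then obtain p where p: "prime p" "p dvd n" using prime_factor_nat by blast
  obtain e m where em: "e \<ge> 1" "\<not> p dvd m" "m > 0" "n = p ^ e * m"
    using prime_power_split[OF assms p] .
  have mu: "moebius_mu (p ^ i * d) = (if i = 0 then moebius_mu d else if i = 1 then - moebius_mu d else 0)"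
    if "d dvd m" for i d
  proof -
    have d: "\<not> p dvd d" "d > 0" using that em by (auto intro: dvd_pos_nat dest: dvd_trans)
    have "\<not> squarefree (p ^ i * d)" if "i \<ge> 2"
    proof
      assume "squarefree (p ^ i * d)"
      moreover have "p ^ 2 dvd p ^ i * d" using that by (simp add: le_imp_power_dvd)
      ultimately have "p dvd 1" unfolding squarefree_def by blast
      then show False using p by simp
    qed
    then show ?thesis using moebius_mult_prime[OF p(1) d] by (auto simp: moebius_mu_def)
  qed
  have "(\<Sum>d | d dvd n. moebius_mu d) = (\<Sum>i\<le>e. \<Sum>d | d dvd m. moebius_mu (p ^ i * d))"
    unfolding em(4) by (rule sum_divisors_prime_power_mult) (use p em in auto)
  also have "\<dots> = (\<Sum>i\<in>{0,1}. \<Sum>d | d dvd m. moebius_mu (p ^ i * d))"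
    using em(1) by (intro sum.mono_neutral_right) (auto simp: mu intro!: sum.neutral)
  also have "\<dots> = 0" using mu[of _ 0] mu[of _ 1] by (simp add: sum_negf)
  finally show ?thesis using False by simp
qed

text \<open>\<open>mangoldt\<close> is the Moebius inverse of \<open>ln\<close>, and
  \<open>ln (n / d) = ln n - ln d\<close>. The part with \<open>ln n\<close> vanishes because either
  \<open>n = 1\<close> or the divisor sum of \<open>moebius_mu\<close> is 0.\<close>

lemma moebius_ln_sum:
  fixes n :: nat assumes n: "n > 0"
  shows "(\<Sum>d | d dvd n. moebius_mu d * ln (real d)) = - mangoldt n"
proof -
  \<comment> \<open>The indicator of \<open>n div e = 1\<close> is inserted in order to be replaced
    by a divisor sum of \<open>moebius_mu\<close>.\<close>
  have "mangoldt n = (\<Sum>e | e dvd n. mangoldt e * (if n div e = 1 then 1 else (0::real)))"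
  proof -
    have "(\<Sum>e | e dvd n. mangoldt e * (if n div e = 1 then 1 else (0::real))) =
      (\<Sum>e \<in> {n}. mangoldt e * (if n div e = 1 then 1 else (0::real)))"
      using n by (intro sum.mono_neutral_right) (auto elim!: dvdE)
    then show ?thesis using n by simp
  qed
  also have "\<dots> = (\<Sum>e | e dvd n. \<Sum>d | d dvd n div e. mangoldt e * moebius_mu d)"
    unfolding sum_distrib_left[symmetric]
    by (intro sum.cong refl arg_cong2[where f = "(*)"] moebius_sum[symmetric]) (use n in \<open>auto elim!: dvdE\<close>)
  also have "\<dots> = (\<Sum>d | d dvd n. \<Sum>e | e dvd n div d. mangoldt e * moebius_mu d)"
    by (rule sum_divisors_swap[OF n])
  also have "\<dots> = (\<Sum>d | d dvd n. moebius_mu d * ln (real (n div d)))"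
  proof (intro sum.cong refl)
    fix d assume "d \<in> {d. d dvd n}"
    then have "n div d > 0" using n by (auto elim!: dvdE)
    have "(\<Sum>e | e dvd n div d. mangoldt e * moebius_mu d) = moebius_mu d * (\<Sum>e | e dvd n div d. mangoldt e)"
      by (simp add: sum_distrib_left mult.commute)
    also have "(\<Sum>e | e dvd n div d. mangoldt e) = ln (real (n div d))"
      using mangoldt_sum[of "n div d", where ?'a = real] \<open>n div d > 0\<close> by simp
    finally show "(\<Sum>e | e dvd n div d. mangoldt e * moebius_mu d) = moebius_mu d * ln (real (n div d))" .
  qed
  also have "\<dots> = (\<Sum>d | d dvd n. moebius_mu d * ln (real n) - moebius_mu d * ln (real d))"
    using n by (intro sum.cong refl) (auto elim!: dvdE simp: ln_mult algebra_simps)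
  also have "\<dots> = ln (real n) * (\<Sum>d | d dvd n. moebius_mu d) - (\<Sum>d | d dvd n. moebius_mu d * ln (real d))"
    by (simp add: sum_subtractf sum_distrib_left mult.commute)
  also have "ln (real n) * (\<Sum>d | d dvd n. moebius_mu d) = 0" using moebius_sum[OF n] by simp
  finally show ?thesis by simp
qed

text \<open>Moebius inversion with the extra factor \<open>ln (x / d)\<close>: the factor splits as
  \<open>ln x - ln d\<close>, and the second part produces \<open>mangoldt\<close>. If the inner
  sums of \<open>g\<close> are small, the right-hand side is small; Selberg's formula comes from
  \<open>g t = psi t - t + c\<close>.\<close>

lemma tatuzawa_iseki:
  fixes g :: "real \<Rightarrow> real"
  assumes x: "x \<ge> 1"
  shows "(\<Sum>d\<in>nups x. moebius_mu d * ln (x / real d) * (\<Sum>m\<in>nups (x / real d). g (x / real d / real m))) =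
           g x * ln x + (\<Sum>n\<in>nups x. mangoldt n * g (x / real n))"
proof -
  have "(\<Sum>d\<in>nups x. moebius_mu d * ln (x / real d) * (\<Sum>m\<in>nups (x / real d). g (x / real d / real m))) =
     (\<Sum>d\<in>nups x. \<Sum>m\<in>nups (x / real d). moebius_mu d * ln (x / real d) * g (x / (real d * real m)))"
    by (simp add: sum_distrib_left)
  also have "\<dots> = (\<Sum>n\<in>nups x. \<Sum>d | d dvd n. moebius_mu d * ln (x / real d) * g (x / (real d * real (n div d))))"
    by (rule sum_divisors_nups[symmetric])
  also have "\<dots> = (\<Sum>n\<in>nups x. g (x / real n) * (ln x * (if n = 1 then 1 else 0) + mangoldt n))"
  proof (intro sum.cong refl)
    fix n assume "n \<in> nups x"
    then have n: "n > 0" by auto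
    have "(\<Sum>d | d dvd n. moebius_mu d * ln (x / real d) * g (x / (real d * real (n div d)))) =
      (\<Sum>d | d dvd n. g (x / real n) * (ln x * moebius_mu d - moebius_mu d * ln (real d)))"
    proof (intro sum.cong refl)
      fix d assume "d \<in> {d. d dvd n}"
      then have d: "d dvd n" "d > 0" using n by (auto intro: dvd_pos_nat)
      have "real d * real (n div d) = real n" using d by (metis dvd_mult_div_cancel of_nat_mult)
      moreover have "ln (x / real d) = ln x - ln (real d)" using x d by (simp add: ln_div)
      moreover have "a * (b - c) * e = e * (b * a - a * c)" for a b c e :: real by (simp add: algebra_simps)
      ultimately show "moebius_mu d * ln (x / real d) * g (x / (real d * real (n div d))) =
        g (x / real n) * (ln x * moebius_mu d - moebius_mu d * ln (real d))" by simp
    qed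
    also have "\<dots> = g (x / real n) * (ln x * (\<Sum>d | d dvd n. moebius_mu d) - (\<Sum>d | d dvd n. moebius_mu d * ln (real d)))"
      by (simp add: sum_subtractf sum_distrib_left algebra_simps)
    finally show "(\<Sum>d | d dvd n. moebius_mu d * ln (x / real d) * g (x / (real d * real (n div d)))) =
        g (x / real n) * (ln x * (if n = 1 then 1 else 0) + mangoldt n)"
      using moebius_sum[OF n] moebius_ln_sum[OF n] by simp
  qed
  also have "\<dots> = (\<Sum>n\<in>nups x. (if n = 1 then g x * ln x else 0)) + (\<Sum>n\<in>nups x. mangoldt n * g (x / real n))"
    unfolding sum.distrib[symmetric] by (intro sum.cong refl) (auto simp: algebra_simps)
  also have "(\<Sum>n\<in>nups x. (if n = 1 then g x * ln x else 0)) = g x * ln x"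
    using x by (subst sum.delta) auto
  finally show ?thesis .
qed

section \<open>Harmonic sums and Mertens' estimate\<close>

lemma harmonic_nups:
  assumes "x \<ge> 1"
  shows "\<bar>(\<Sum>n\<in>nups x. 1 / real n) - ln x - euler_mascheroni\<bar> \<le> 2 / x"
proof -
  define n where "n = nat \<lfloor>x\<rfloor>"
  have n: "n \<ge> 1" "real n \<le> x" "x < real n + 1"
    using assms unfolding n_def by linarith+
  have h: "(\<Sum>n\<in>nups x. 1 / real n) = harm n"
    by (simp add: nups_altdef n_def harm_def inverse_eq_divide)
  have lim: "(\<lambda>n. harm n - ln (real n)) \<longlonglongrightarrow> (euler_mascheroni::real)"
    by (rule euler_mascheroni_LIMSEQ)
  have 1: "euler_mascheroni \<le> harm n - ln (real n)"
  proof -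
    have "(\<lambda>n. harm (Suc n) - ln (real (Suc n))) \<longlonglongrightarrow> (euler_mascheroni::real)"
      using lim by (rule LIMSEQ_Suc)
    then have "euler_mascheroni \<le> harm (Suc (n-1)) - ln (real (Suc (n-1)))"
      using decseq_harm_diff_ln by (intro decseq_ge[of "\<lambda>n. harm (Suc n) - ln (real (Suc n))"]) auto
    then show ?thesis using n by simp
  qed
  have 2: "harm n - ln (real n + 1) \<le> euler_mascheroni"
  proof -
    have inc: "incseq (\<lambda>n. harm n - ln (real n + 1))"
    proof (rule incseq_SucI)
      fix k show "harm k - ln (real k + 1) \<le> harm (Suc k) - ln (real (Suc k) + 1)"
        using ln_diff_le_inverse[of "real k + 1"] by (simp add: harm_Suc inverse_eq_divide add_ac)
    qed
    have "(\<lambda>n. (harm n - ln (real n)) - (ln (real n + 1) - ln (real n))) \<longlonglongrightarrow> (euler_mascheroni::real) - 0"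
      by (intro tendsto_diff lim) real_asymp
    then have "(\<lambda>n. harm n - ln (real n + 1)) \<longlonglongrightarrow> (euler_mascheroni::real)" by simp
    then show ?thesis using inc incseq_le by blast
  qed
  have 3: "ln (real n + 1) - ln (real n) \<le> 1 / real n" using ln_diff_le_inverse[of "real n"] n by simp
  have 4: "0 \<le> ln x - ln (real n)" "ln x \<le> ln (real n + 1)" using n assms by auto
  have 5: "1 / real n \<le> 2 / x" using n by (simp add: field_simps)
  show ?thesis unfolding h using 1 2 3 4 5 by linarith
qed

text \<open>Removing the floors in \<open>logsum_mangoldt\<close> turns \<open>logsum x\<close> into
  \<open>x\<close> times the sum in question and costs at most \<open>psi x\<close>, which is O(x)
  by Chebyshev's bound.\<close>

theorem mertens_mangoldt: "\<exists>C>0. \<forall>x\<ge>1. \<bar>(\<Sum>n\<in>nups x. mangoldt n / real n) - ln x\<bar> \<le> C"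
proof -
  obtain C where C: "C > 0" "\<And>x. x \<ge> 0 \<Longrightarrow> psi x \<le> C * x" using chebyshev_psi by blast
  have "\<bar>(\<Sum>n\<in>nups x. mangoldt n / real n) - ln x\<bar> \<le> C + 3" if x: "x \<ge> 1" for x
  proof -
    define s where "s = (\<Sum>n\<in>nups x. mangoldt n / real n)"
    have xs: "x * s = (\<Sum>n\<in>nups x. mangoldt n * (x / real n))"
      unfolding s_def by (simp add: sum_distrib_left mult.commute)
    have up: "logsum x \<le> x * s" unfolding logsum_mangoldt xs
      using x by (intro sum_mono mult_left_mono card_nups_le mangoldt_nonneg) auto
    have "x * s - psi x = (\<Sum>n\<in>nups x. mangoldt n * (x / real n - 1))"
      unfolding xs psi_def sum_subtractf[symmetric] by (simp add: algebra_simps)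
    also have "\<dots> \<le> logsum x" unfolding logsum_mangoldt
      by (intro sum_mono mult_left_mono card_nups_ge mangoldt_nonneg)
    finally have low: "x * s \<le> logsum x + C * x" using C(2)[of x] x by linarith
    have "\<bar>logsum x - (x * ln x - x)\<bar> \<le> ln x + 1" using x by (rule logsum_bound)
    moreover have "ln x \<le> x - 1" using x by (intro ln_le_minus_one) auto
    moreover have e: "x * (ln x + C + 3) = x * ln x + C * x + 3 * x" "x * (ln x - C - 3) = x * ln x - C * x - 3 * x"
      by (simp_all add: algebra_simps)
    moreover have "C * x \<ge> 0" using C(1) x by simp
    ultimately have "x * s \<le> x * ln x + C * x + 3 * x" "x * ln x - C * x - 3 * x \<le> x * s"
      using up low x by argo+
    then have "x * s \<le> x * (ln x + C + 3)" "x * (ln x - C - 3) \<le> x * s"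
      unfolding e .
    then have "s \<le> ln x + C + 3" "ln x - C - 3 \<le> s" using x by auto
    then show ?thesis unfolding s_def by linarith
  qed
  then show ?thesis using C(1) by (intro exI[of _ "C+3"]) auto
qed


section \<open>Selberg's symmetry formula\<close>

lemma sum_inverse_sqrt_nups:
  assumes "x \<ge> 0" shows "(\<Sum>n\<in>nups x. 1 / sqrt (real n)) \<le> 2 * sqrt x"
proof -
  have *: "(\<Sum>n=1..N. 1 / sqrt (real n)) \<le> 2 * sqrt (real N)" for N
  proof (induction N)
    case (Suc N)
    define a where "a = sqrt (real N)"
    define b where "b = sqrt (real (Suc N))"
    have ab: "0 \<le> a" "0 < b" "a \<le> b" "b * b - a * a = 1" by (auto simp: a_def b_def)
    have "1 = (b - a) * (b + a)" using ab by (simp add: algebra_simps)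
    also have "\<dots> \<le> (b - a) * (2 * b)" using ab by (intro mult_left_mono) auto
    finally have "1 / b \<le> 2 * (b - a)" using ab by (simp add: field_simps)
    then show ?case using Suc by (simp add: a_def b_def)
  qed simp
  have "(\<Sum>n\<in>nups x. 1 / sqrt (real n)) \<le> 2 * sqrt (real (nat \<lfloor>x\<rfloor>))"
    unfolding nups_altdef by (rule *)
  also have "\<dots> \<le> 2 * sqrt x" using assms by simp
  finally show ?thesis .
qed

text \<open>Selberg's von Mangoldt function of order two, the Moebius inverse of the square of
  \<open>ln\<close>. It vanishes at numbers with more than two distinct prime factors.\<close>

definition lambda2 :: "nat \<Rightarrow> real" where
  "lambda2 n = mangoldt n * ln (real n) + (\<Sum>d | d dvd n. mangoldt d * mangoldt (n div d))"

lemma lambda2_nonneg: "lambda2 n \<ge> 0"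
  unfolding lambda2_def
  by (cases "n = 0") (auto intro!: add_nonneg_nonneg sum_nonneg mult_nonneg_nonneg mangoldt_nonneg)

lemma lambda2_sum:
  fixes n :: nat assumes n: "n > 0"
  shows "(\<Sum>d | d dvd n. lambda2 d) = (ln (real n))\<^sup>2"
proof -
  have "(\<Sum>d | d dvd n. \<Sum>e | e dvd d. mangoldt e * mangoldt (d div e)) =
        (\<Sum>e | e dvd n. \<Sum>k | k dvd n div e. mangoldt e * (mangoldt k :: real))"
    by (rule sum_divisors_assoc[OF n])
  also have "\<dots> = (\<Sum>e | e dvd n. mangoldt e * ln (real (n div e)))"
    unfolding sum_distrib_left[symmetric]
    by (intro sum.cong refl arg_cong2[where f = "(*)"], subst mangoldt_sum) (use n in \<open>auto elim!: dvdE\<close>)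
  also have "\<dots> = (\<Sum>e | e dvd n. mangoldt e * ln (real n) - mangoldt e * ln (real e))"
    using n by (intro sum.cong refl) (auto elim!: dvdE simp: ln_mult algebra_simps)
  also have "\<dots> = (\<Sum>e | e dvd n. mangoldt e) * ln (real n) - (\<Sum>e | e dvd n. mangoldt e * ln (real e))"
    by (simp add: sum_subtractf sum_distrib_right)
  also have "(\<Sum>e | e dvd n. mangoldt e) = ln (real n)"
    using mangoldt_sum[of n, where ?'a = real] n by simp
  finally show ?thesis
    unfolding lambda2_def by (simp add: sum.distrib power2_eq_square)
qed

lemma sum_lambda2_nups:
  "(\<Sum>n\<in>nups x. lambda2 n) = (\<Sum>n\<in>nups x. mangoldt n * ln (real n)) + (\<Sum>n\<in>nups x. mangoldt n * psi (x / real n))"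
proof -
  have "(\<Sum>n\<in>nups x. \<Sum>d | d dvd n. mangoldt d * mangoldt (n div d)) = (\<Sum>n\<in>nups x. mangoldt n * psi (x / real n))"
    by (subst sum_divisors_nups) (simp add: psi_def sum_distrib_left)
  then show ?thesis by (simp add: lambda2_def sum.distrib)
qed

lemma sum_inverse_squares_nups: "(\<Sum>n\<in>nups x. 1 / (real n)\<^sup>2) \<le> 2"
proof -
  have *: "(\<Sum>n=1..N. 1 / (real n)\<^sup>2) \<le> 2 - 1 / real N" if "N \<ge> 1" for N
    using that
  proof (induction N rule: nat_induct_at_least)
    case (Suc k)
    have "1 / (real k + 1)\<^sup>2 \<le> 1 / real k - 1 / (real k + 1)"
    proof -
      have "1 / real k - 1 / (real k + 1) = 1 / (real k * (real k + 1))"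
        using Suc.hyps by (simp add: field_simps)
      moreover have "1 / (real k + 1)\<^sup>2 \<le> 1 / (real k * (real k + 1))"
        using Suc.hyps unfolding power2_eq_square by (intro divide_left_mono mult_right_mono) auto
      ultimately show ?thesis by simp
    qed
    then show ?case using Suc.IH by (simp add: add_ac)
  qed simp
  show ?thesis
  proof (cases "x < 1")
    case True then show ?thesis by (simp add: nups_empty)
  next
    case False
    then have "nat \<lfloor>x\<rfloor> \<ge> 1" by linarith
    from *[OF this] have "(\<Sum>n\<in>nups x. 1 / (real n)\<^sup>2) \<le> 2 - 1 / real (nat \<lfloor>x\<rfloor>)"
      unfolding nups_altdef .
    also have "\<dots> \<le> 2" by simp
    finally show ?thesis .
  qed
qed

text \<open>Bounding the logarithm by a harmonic sum and swapping the sums leaves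
  \<open>psi (x / m) / m\<close>, which is at most a constant times \<open>x / m^2\<close>.\<close>

lemma sum_mangoldt_ln_quotient: "\<exists>C>0. \<forall>x\<ge>1. (\<Sum>n\<in>nups x. mangoldt n * ln (x / real n)) \<le> C * x"
proof -
  obtain C where C: "C > 0" "\<And>x. x \<ge> 0 \<Longrightarrow> psi x \<le> C * x" using chebyshev_psi by blast
  have "(\<Sum>n\<in>nups x. mangoldt n * ln (x / real n)) \<le> 2 * C * x" if x: "x \<ge> 1" for x
  proof -
    have "(\<Sum>n\<in>nups x. mangoldt n * ln (x / real n)) \<le> (\<Sum>n\<in>nups x. mangoldt n * (\<Sum>m\<in>nups (x / real n). 1 / real m))"
    proof (intro sum_mono mult_left_mono mangoldt_nonneg)
      fix n assume "n \<in> nups x"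
      then have t: "x / real n \<ge> 1" by (auto simp: field_simps)
      have "ln (x / real n) \<le> ln (real (nat \<lfloor>x / real n\<rfloor>) + 1)"
        using t by (subst ln_le_cancel_iff) linarith+
      also have "\<dots> \<le> harm (nat \<lfloor>x / real n\<rfloor>)" by (rule ln_le_harm)
      also have "\<dots> = (\<Sum>m\<in>nups (x / real n). 1 / real m)" by (simp add: nups_altdef harm_def inverse_eq_divide)
      finally show "ln (x / real n) \<le> (\<Sum>m\<in>nups (x / real n). 1 / real m)" .
    qed
    also have "\<dots> = (\<Sum>m\<in>nups x. \<Sum>n\<in>nups (x / real m). mangoldt n * (1 / real m))"
      by (simp only: sum_distrib_left) (rule sum_nups_swap)
    also have "\<dots> = (\<Sum>m\<in>nups x. psi (x / real m) * (1 / real m))"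
      by (simp only: psi_def sum_distrib_right)
    also have "\<dots> \<le> (\<Sum>m\<in>nups x. C * (x / real m) * (1 / real m))"
      using x by (intro sum_mono mult_right_mono C(2)) auto
    also have "\<dots> = C * x * (\<Sum>m\<in>nups x. 1 / (real m)\<^sup>2)"
      by (simp add: sum_distrib_left power2_eq_square)
    also have "\<dots> \<le> C * x * 2" using C(1) x by (intro mult_left_mono sum_inverse_squares_nups) auto
    finally show ?thesis by simp
  qed
  then show ?thesis using C(1) by (intro exI[of _ "2 * C"]) auto
qed

lemma ln_mult_le_sqrt: "\<exists>K>0. \<forall>t\<ge>1. ln t * (ln t + c) \<le> K * sqrt (t::real)"
proof -
  have "ln t * (ln t + c) \<le> (16 + 2 * \<bar>c\<bar>) * sqrt t" if t: "t \<ge> 1" for t :: real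
  proof -
    \<comment> \<open>A fourth root, since the square of \<open>ln t\<close> has to stay below a
      multiple of \<open>sqrt t\<close>.\<close>
    define u where "u = sqrt (sqrt t)"
    have u: "u \<ge> 1" "sqrt t = u\<^sup>2" using t by (auto simp: u_def)
    have "ln t = 2 * ln (sqrt t)" using t by (simp add: ln_sqrt)
    also have "ln (sqrt t) = 2 * ln u" using t unfolding u_def by (simp add: ln_sqrt)
    also have "ln u \<le> u" using u by (intro ln_bound) auto
    finally have l: "ln t \<le> 4 * u" by simp
    have l0: "ln t \<ge> 0" using t by simp
    have "ln t * ln t \<le> (4 * u) * (4 * u)" using l l0 by (intro mult_mono) auto
    moreover have "ln t * c \<le> ln t * \<bar>c\<bar>" using l0 by (intro mult_left_mono) auto
    moreover have "ln t * \<bar>c\<bar> \<le> (2 * sqrt t) * \<bar>c\<bar>" using ln_le_sqrt[OF t] by (intro mult_right_mono) auto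
    ultimately show ?thesis using u(2) by (simp add: algebra_simps power2_eq_square)
  qed
  then show ?thesis by (intro exI[of _ "16 + 2 * \<bar>c\<bar>"]) auto
qed

lemma selberg_remainder:
  "\<exists>C>0. \<forall>x\<ge>1. \<bar>(psi x - x) * ln x + (\<Sum>n\<in>nups x. mangoldt n * (psi (x / real n) - x / real n))\<bar> \<le> C * x"
proof -
  \<comment> \<open>The constant that cancels all terms of order \<open>t\<close> in
    \<open>G t\<close>: \<open>logsum t\<close> contributes \<open>- t\<close>, and \<open>t\<close>
    times the harmonic sum contributes \<open>- euler_mascheroni * t\<close>, while the terms
    \<open>t * ln t\<close> cancel.\<close>
  define c :: real where "c = euler_mascheroni + 1"
  define g where "g t = psi t - t + c" for t
  define G where "G t = (\<Sum>m\<in>nups t. g (t / real m))" for t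
  obtain C where C: "C > 0" "\<And>x. x \<ge> 0 \<Longrightarrow> psi x \<le> C * x" using chebyshev_psi by blast
  have c0: "c > 0" using euler_mascheroni_pos by (simp add: c_def)
  have Gb: "\<bar>G t\<bar> \<le> ln t + (3 + c)" if t: "t \<ge> 1" for t
  proof -
    have ps: "(\<Sum>m\<in>nups t. psi (t / real m)) = logsum t"
    proof -
      have "(\<Sum>m\<in>nups t. psi (t / real m)) = (\<Sum>d\<in>nups t. \<Sum>m\<in>nups (t / real d). mangoldt d)"
        unfolding psi_def by (rule sum_nups_swap)
      then show ?thesis by (simp add: logsum_mangoldt mult.commute)
    qed
    have "G t = logsum t - t * (\<Sum>m\<in>nups t. 1 / real m) + c * real (card (nups t))"
      unfolding G_def g_def ps[symmetric] by (simp add: sum.distrib sum_subtractf sum_distrib_left)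
    also have "\<dots> = (logsum t - (t * ln t - t)) - t * ((\<Sum>m\<in>nups t. 1 / real m) - ln t - euler_mascheroni)
         + c * (real (card (nups t)) - t)"
      by (simp add: c_def algebra_simps)
    finally have "G t = \<dots>" .
    moreover have "\<bar>logsum t - (t * ln t - t)\<bar> \<le> ln t + 1" by (rule logsum_bound[OF t])
    moreover have "\<bar>t * ((\<Sum>m\<in>nups t. 1 / real m) - ln t - euler_mascheroni)\<bar> \<le> 2"
      using mult_left_mono[OF harmonic_nups[OF t], of t] t by (simp add: abs_mult)
    moreover have "\<bar>c * (real (card (nups t)) - t)\<bar> \<le> c"
    proof -
      have "\<bar>real (card (nups t)) - t\<bar> \<le> 1" using card_nups_le[of t] card_nups_ge[of t] t by auto
      from mult_left_mono[OF this, of c] show ?thesis using c0 by (simp add: abs_mult)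
    qed
    ultimately show ?thesis by linarith
  qed
  obtain K where K: "K > 0" "\<And>t. t \<ge> 1 \<Longrightarrow> ln t * (ln t + (3 + c)) \<le> K * sqrt (t::real)"
    using ln_mult_le_sqrt by blast
  \<comment> \<open>The trivial bound on \<open>moebius_mu\<close> suffices, because the inner sums
    are only logarithmic and the \<open>1 / sqrt d\<close> add up to at most
    \<open>2 * sqrt x\<close>.\<close>
  have main: "\<bar>g x * ln x + (\<Sum>n\<in>nups x. mangoldt n * g (x / real n))\<bar> \<le> 2 * K * x" if x: "x \<ge> 1" for x
  proof -
    have "\<bar>g x * ln x + (\<Sum>n\<in>nups x. mangoldt n * g (x / real n))\<bar> =
       \<bar>\<Sum>d\<in>nups x. moebius_mu d * ln (x / real d) * G (x / real d)\<bar>"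
      unfolding G_def by (subst tatuzawa_iseki[OF x]) simp
    also have "\<dots> \<le> (\<Sum>d\<in>nups x. K * sqrt (x / real d))"
    proof (rule order_trans[OF sum_abs sum_mono])
      fix d assume "d \<in> nups x"
      then have t: "x / real d \<ge> 1" by (auto simp: field_simps)
      have "\<bar>moebius_mu d * ln (x / real d) * G (x / real d)\<bar> \<le> 1 * ln (x / real d) * (ln (x / real d) + (3 + c))"
        unfolding abs_mult using t c0 by (intro mult_mono abs_moebius_le Gb) auto
      also have "\<dots> \<le> K * sqrt (x / real d)" using K(2)[OF t] by simp
      finally show "\<bar>moebius_mu d * ln (x / real d) * G (x / real d)\<bar> \<le> K * sqrt (x / real d)" .
    qed
    also have "\<dots> = K * sqrt x * (\<Sum>d\<in>nups x. 1 / sqrt (real d))"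
      by (simp add: sum_distrib_left real_sqrt_divide)
    also have "\<dots> \<le> K * sqrt x * (2 * sqrt x)"
      using x K(1) by (intro mult_left_mono sum_inverse_sqrt_nups) auto
    also have "\<dots> = 2 * K * x" using x by simp
    finally show ?thesis .
  qed
  have "\<bar>(psi x - x) * ln x + (\<Sum>n\<in>nups x. mangoldt n * (psi (x / real n) - x / real n))\<bar> \<le> (2 * K + c + c * C) * x"
    if x: "x \<ge> 1" for x
  proof -
    have "g x * ln x + (\<Sum>n\<in>nups x. mangoldt n * g (x / real n)) =
      (psi x - x) * ln x + (\<Sum>n\<in>nups x. mangoldt n * (psi (x / real n) - x / real n)) + c * ln x + c * psi x"
      unfolding g_def psi_def[of x] by (simp add: algebra_simps sum.distrib sum_distrib_left sum_subtractf)
    moreover have "\<bar>c * ln x\<bar> \<le> c * x" using c0 x by (auto simp: abs_mult intro!: ln_bound)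
    moreover have "\<bar>c * psi x\<bar> \<le> c * (C * x)" using c0 C(2)[of x] x psi_nonneg[of x]
      by (auto simp: abs_mult intro!: mult_left_mono)
    ultimately show ?thesis using main[OF x] by (simp add: algebra_simps)
  qed
  moreover have "2 * K + c + c * C > 0" using K c0 C by (intro add_pos_pos) auto
  ultimately show ?thesis by blast
qed

text \<open>\<open>selberg_remainder\<close> rewritten for \<open>lambda2\<close>: passing from
  \<open>ln x\<close> to \<open>ln n\<close> costs \<open>Q\<close>, and Mertens' estimate evaluates
  the terms \<open>x / n\<close> up to \<open>x * E\<close>.\<close>

theorem selberg_formula:
  "\<exists>C>0. \<forall>x\<ge>1. \<bar>(\<Sum>n\<in>nups x. lambda2 n) - 2 * x * ln x\<bar> \<le> C * x"
proof -
  obtain C1 where C1: "C1 > 0" "\<And>x. x \<ge> 1 \<Longrightarrow>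
      \<bar>(psi x - x) * ln x + (\<Sum>n\<in>nups x. mangoldt n * (psi (x / real n) - x / real n))\<bar> \<le> C1 * x"
    using selberg_remainder by blast
  obtain C2 where C2: "C2 > 0" "\<And>x. x \<ge> 1 \<Longrightarrow> (\<Sum>n\<in>nups x. mangoldt n * ln (x / real n)) \<le> C2 * x"
    using sum_mangoldt_ln_quotient by blast
  obtain C3 where C3: "C3 > 0" "\<And>x. x \<ge> 1 \<Longrightarrow> \<bar>(\<Sum>n\<in>nups x. mangoldt n / real n) - ln x\<bar> \<le> C3"
    using mertens_mangoldt by blast
  have "\<bar>(\<Sum>n\<in>nups x. lambda2 n) - 2 * x * ln x\<bar> \<le> (C1 + C2 + C3) * x" if x: "x \<ge> 1" for x
  proof -
    define R where "R = (psi x - x) * ln x + (\<Sum>n\<in>nups x. mangoldt n * (psi (x / real n) - x / real n))"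
    define Q where "Q = (\<Sum>n\<in>nups x. mangoldt n * ln (x / real n))"
    define E where "E = (\<Sum>n\<in>nups x. mangoldt n / real n) - ln x"
    have q: "Q = psi x * ln x - (\<Sum>n\<in>nups x. mangoldt n * ln (real n))"
    proof -
      have "Q = (\<Sum>n\<in>nups x. mangoldt n * ln x - mangoldt n * ln (real n))"
        unfolding Q_def using x by (intro sum.cong refl) (auto simp: ln_div algebra_simps)
      then show ?thesis by (simp add: psi_def sum_subtractf sum_distrib_right)
    qed
    have r: "R = (psi x - x) * ln x + (\<Sum>n\<in>nups x. mangoldt n * psi (x / real n)) - x * (\<Sum>n\<in>nups x. mangoldt n / real n)"
      unfolding R_def by (simp add: algebra_simps sum_subtractf sum_distrib_left)
    have "(\<Sum>n\<in>nups x. lambda2 n) - 2 * x * ln x = R - Q + x * E"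
      unfolding sum_lambda2_nups r q E_def by (simp add: algebra_simps)
    moreover have "\<bar>R\<bar> \<le> C1 * x" unfolding R_def by (rule C1(2)[OF x])
    moreover have "\<bar>Q\<bar> \<le> C2 * x"
    proof -
      have "Q \<ge> 0" unfolding Q_def using x
        by (intro sum_nonneg mult_nonneg_nonneg mangoldt_nonneg) (auto simp: field_simps)
      then show ?thesis using C2(2)[OF x] unfolding Q_def by simp
    qed
    moreover have "\<bar>x * E\<bar> \<le> C3 * x"
      using mult_left_mono[OF C3(2)[OF x], of x] x unfolding E_def by (simp add: abs_mult mult.commute)
    ultimately show ?thesis by (simp add: algebra_simps)
  qed
  then show ?thesis using C1 C2 C3 by (intro exI[of _ "C1 + C2 + C3"]) auto
qed

text \<open>Factoring the difference of squares reduces the claim to the sum of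
  \<open>ln x - ln n\<close>, which is O(x): most \<open>n\<close> up to \<open>x\<close> are close
  to \<open>x\<close> on a logarithmic scale.\<close>

lemma sum_ln_squared_diff:
  assumes x: "x \<ge> 1"
  shows "(\<Sum>n\<in>nups x. (ln x)\<^sup>2 - (ln (real n))\<^sup>2) \<le> 4 * x * ln x"
proof -
  define L where "L = ln x"
  have L0: "L \<ge> 0" using x by (simp add: L_def)
  have Lx: "L \<le> x - 1" unfolding L_def using x by (intro ln_le_minus_one) auto
  have "(\<Sum>n\<in>nups x. L\<^sup>2 - (ln (real n))\<^sup>2) \<le> (\<Sum>n\<in>nups x. 2 * L * (L - ln (real n)))"
  proof (rule sum_mono)
    fix n assume n: "n \<in> nups x"
    then have l: "0 \<le> ln (real n)" "ln (real n) \<le> L" by (auto simp: L_def)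
    have "L\<^sup>2 - (ln (real n))\<^sup>2 = (L + ln (real n)) * (L - ln (real n))" by (simp add: power2_eq_square algebra_simps)
    also have "\<dots> \<le> 2 * L * (L - ln (real n))" using l by (intro mult_right_mono) auto
    finally show "L\<^sup>2 - (ln (real n))\<^sup>2 \<le> 2 * L * (L - ln (real n))" .
  qed
  also have "\<dots> = 2 * L * (real (card (nups x)) * L - logsum x)"
    by (simp add: sum_distrib_left sum_subtractf logsum_def algebra_simps)
  also have "\<dots> \<le> 2 * L * (2 * x)"
  proof (intro mult_left_mono)
    have "real (card (nups x)) * L \<le> x * L" using card_nups_le[of x] x L0 by (intro mult_right_mono) auto
    moreover have "\<bar>logsum x - (x * L - x)\<bar> \<le> L + 1" unfolding L_def by (rule logsum_bound[OF x])
    ultimately show "real (card (nups x)) * L - logsum x \<le> 2 * x" using Lx by linarith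
  qed (use L0 in auto)
  finally show ?thesis by (simp add: L_def mult_ac)
qed

text \<open>As for Mertens' estimate, but starting from \<open>(ln n)^2\<close> as the divisor sum
  of \<open>lambda2\<close>: removing the floors costs the summatory function of
  \<open>lambda2\<close>, which is of order \<open>x * ln x\<close> by
  \<open>selberg_formula\<close>.\<close>

lemma sum_lambda2_div_bound:
  "\<exists>C>0. \<forall>x\<ge>1. \<bar>(\<Sum>m\<in>nups x. lambda2 m / real m) - (ln x)\<^sup>2\<bar> \<le> C * (1 + ln x)"
proof -
  obtain C where C: "C > 0" "\<And>x. x \<ge> 1 \<Longrightarrow> \<bar>(\<Sum>n\<in>nups x. lambda2 n) - 2 * x * ln x\<bar> \<le> C * x"
    using selberg_formula by blast
  have "\<bar>(\<Sum>m\<in>nups x. lambda2 m / real m) - (ln x)\<^sup>2\<bar> \<le> (8 + C) * (1 + ln x)" if x: "x \<ge> 1" for x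
  proof -
    define W where "W = (\<Sum>m\<in>nups x. lambda2 m / real m)"
    define L where "L = ln x"
    define Sq where "Sq = (\<Sum>n\<in>nups x. (ln (real n))\<^sup>2)"
    have L0: "L \<ge> 0" using x by (simp add: L_def)
    have Lx: "L \<le> x - 1" unfolding L_def using x by (intro ln_le_minus_one) auto
    have sq: "Sq = (\<Sum>d\<in>nups x. lambda2 d * real (card (nups (x / real d))))"
    proof -
      have "Sq = (\<Sum>n\<in>nups x. \<Sum>d | d dvd n. (\<lambda>d m. lambda2 d) d (n div d))"
        unfolding Sq_def by (intro sum.cong refl) (subst lambda2_sum, auto)
      also have "\<dots> = (\<Sum>d\<in>nups x. \<Sum>m\<in>nups (x / real d). lambda2 d)" by (rule sum_divisors_nups)
      finally show ?thesis by (simp add: mult.commute)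
    qed
    have xW: "x * W = (\<Sum>m\<in>nups x. lambda2 m * (x / real m))"
      unfolding W_def by (simp add: sum_distrib_left mult.commute)
    have up: "Sq \<le> x * W" unfolding sq xW
      using x by (intro sum_mono mult_left_mono card_nups_le lambda2_nonneg) auto
    have "x * W - (\<Sum>m\<in>nups x. lambda2 m) = (\<Sum>m\<in>nups x. lambda2 m * (x / real m - 1))"
      unfolding xW sum_subtractf[symmetric] by (simp add: algebra_simps)
    also have "\<dots> \<le> Sq" unfolding sq
      by (intro sum_mono mult_left_mono card_nups_ge lambda2_nonneg)
    finally have low: "x * W \<le> Sq + (2 * x * L + C * x)" using C(2)[OF x] unfolding L_def by linarith
    have Squ: "Sq \<le> x * L\<^sup>2"
    proof -
      have "Sq \<le> (\<Sum>n\<in>nups x. L\<^sup>2)" unfolding Sq_def L_def by (intro sum_mono power_mono) auto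
      also have "\<dots> \<le> x * L\<^sup>2" using card_nups_le[of x] x by (simp add: mult_right_mono)
      finally show ?thesis .
    qed
    have Sql: "Sq \<ge> x * L\<^sup>2 - 8 * x * L"
    proof -
      have "(\<Sum>n\<in>nups x. L\<^sup>2 - (ln (real n))\<^sup>2) \<le> 4 * x * L"
        unfolding L_def by (rule sum_ln_squared_diff[OF x])
      then have "real (card (nups x)) * L\<^sup>2 - Sq \<le> 4 * x * L" by (simp add: sum_subtractf Sq_def)
      moreover have "(x - 1) * L\<^sup>2 \<le> real (card (nups x)) * L\<^sup>2" by (intro mult_right_mono card_nups_ge) auto
      moreover have "L\<^sup>2 \<le> x * L" using Lx L0 by (simp add: power2_eq_square mult_right_mono)
      moreover have "x * L \<ge> 0" using x L0 by simp
      ultimately show ?thesis by (simp add: algebra_simps)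
    qed
    have xL: "x * L \<ge> 0" "C * x \<ge> 0" "C * (x * L) \<ge> 0" using x L0 C(1) by auto
    have e: "x * (L\<^sup>2 + (8 + C) * (1 + L)) = x * L\<^sup>2 + 8 * x + 8 * (x * L) + C * x + C * (x * L)"
        "x * (L\<^sup>2 - (8 + C) * (1 + L)) = x * L\<^sup>2 - 8 * x - 8 * (x * L) - C * x - C * (x * L)"
      by (simp_all add: algebra_simps)
    have "x * W \<le> x * (L\<^sup>2 + (8 + C) * (1 + L))"
      using low Squ xL x unfolding e by linarith
    moreover have "x * (L\<^sup>2 - (8 + C) * (1 + L)) \<le> x * W"
      using up Sql xL x unfolding e by linarith
    ultimately have "W \<le> L\<^sup>2 + (8 + C) * (1 + L)" "L\<^sup>2 - (8 + C) * (1 + L) \<le> W" using x by auto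
    then show ?thesis unfolding W_def L_def by linarith
  qed
  then show ?thesis using C(1) by (intro exI[of _ "8 + C"]) auto
qed

section \<open>Selberg's weights on almost primes and on short intervals\<close>

lemma nups_div_subset: "d \<ge> 1 \<Longrightarrow> nups (x / real d) \<subseteq> nups x"
proof
  fix m assume d: "d \<ge> 1" and m: "m \<in> nups (x / real d)"
  then have "real m * real d \<le> x" by (simp add: field_simps)
  moreover have "real m * 1 \<le> real m * real d" using d by (intro mult_left_mono) auto
  ultimately have "real m \<le> x" by linarith
  then show "m \<in> nups x" using m by simp
qed

lemma finite_nups_filter [simp]: "finite {n. Suc 0 \<le> n \<and> real n \<le> x \<and> Q n}"
  by (rule finite_subset[OF _ finite_nups[of x]]) auto

lemma sum_inverse_powr_nups: "\<exists>C>0. \<forall>x. (\<Sum>n\<in>nups x. 1 / (real n * sqrt (real n))) \<le> C"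
proof -
  have s: "summable (\<lambda>n. real n powr (-3/2))" by (subst summable_real_powr_iff) auto
  have "(\<Sum>n\<in>nups x. 1 / (real n * sqrt (real n))) \<le> (\<Sum>n. real n powr (-3/2)) + 1" for x
  proof -
    have "(\<Sum>n\<in>nups x. 1 / (real n * sqrt (real n))) = (\<Sum>n\<in>nups x. real n powr (-3/2))"
    proof (intro sum.cong refl)
      fix n assume "n \<in> nups x"
      then have n: "n > 0" by auto
      have "real n powr (-3/2) = 1 / (real n powr (3/2))" by (simp add: powr_minus_divide)
      also have "real n powr (3/2) = real n powr 1 * real n powr (1/2)"
        by (subst powr_add[symmetric]) simp
      also have "\<dots> = real n * sqrt (real n)" using n by (simp add: powr_half_sqrt)
      finally show "1 / (real n * sqrt (real n)) = real n powr (-3/2)" by simp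
    qed
    also have "\<dots> \<le> (\<Sum>n. real n powr (-3/2))" by (intro sum_le_suminf s) auto
    finally show ?thesis by simp
  qed
  moreover have "(\<Sum>n. real n powr (-3/2)) + 1 > 0" using suminf_nonneg[OF s] by (simp add: add_nonneg_pos)
  ultimately show ?thesis by blast
qed

lemma geometric_tail:
  fixes q :: real assumes q: "0 \<le> q" "q \<le> 1/2"
  shows "(\<Sum>k=2..K. q ^ k) \<le> 2 * q\<^sup>2"
proof -
  have "(\<Sum>k=2..K. q ^ k) \<le> 2 * q\<^sup>2 - q ^ K" if "K \<ge> 2"
    using that
  proof (induction K rule: nat_induct_at_least)
    case (Suc k)
    have "2 * q ^ Suc k \<le> q ^ k" using mult_right_mono[OF q(2), of "q ^ k"] q(1) by simp
    then show ?case using Suc by simp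
  qed simp
  moreover have "q ^ K \<ge> 0" using q by simp
  ultimately show ?thesis by (cases "K \<ge> 2") (force, simp)
qed

text \<open>For each prime the powers with exponent at least 2 contribute at most
  \<open>2 * ln p / p^2\<close>, and \<open>ln p \<le> 2 * sqrt p\<close> makes this
  summable.\<close>

lemma sum_mangoldt_nonprime: "\<exists>C>0. \<forall>x. (\<Sum>n\<in>{n\<in>nups x. \<not> prime n}. mangoldt n / real n) \<le> C"
proof -
  obtain C where C: "C > 0" "\<And>x. (\<Sum>n\<in>nups x. 1 / (real n * sqrt (real n))) \<le> C"
    using sum_inverse_powr_nups by blast
  have "(\<Sum>n\<in>{n\<in>nups x. \<not> prime n}. mangoldt n / real n) \<le> 4 * C" for x
  proof -
    define K where "K = nat \<lfloor>x\<rfloor>"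
    define I where "I = {p\<in>nups x. prime p} \<times> {2..K}"
    have "(\<Sum>n\<in>{n\<in>nups x. \<not> prime n}. mangoldt n / real n) =
          (\<Sum>n\<in>{n\<in>nups x. \<not> prime n \<and> primepow n}. mangoldt n / real n)"
      by (rule sum.mono_neutral_right) (auto simp: mangoldt_def)
    also have "\<dots> \<le> (\<Sum>n\<in>(\<lambda>(p,k). p ^ k) ` I. mangoldt n / real n)"
    proof (rule sum_mono2)
      show "{n\<in>nups x. \<not> prime n \<and> primepow n} \<subseteq> (\<lambda>(p,k). p ^ k) ` I"
      proof
        fix n assume "n \<in> {n\<in>nups x. \<not> prime n \<and> primepow n}"
        then have n: "1 \<le> n" "real n \<le> x" "\<not> prime n" "primepow n" by auto
        then obtain p k where pk: "prime p" "k > 0" "n = p ^ k" by (auto simp: primepow_def)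
        have p2: "p \<ge> 2" using pk prime_ge_2_nat by blast
        have "k \<noteq> 1" using n pk by auto
        then have k2: "k \<ge> 2" using pk by linarith
        have "k < 2 ^ k" by (rule less_exp)
        also have "(2::nat) ^ k \<le> p ^ k" using p2 by (rule power_mono) simp
        finally have kn: "k \<le> n" using pk by simp
        have "p \<le> n" using pk p2 self_le_power[of p k] by simp
        then have "real p \<le> x" using n by linarith
        moreover have "k \<le> K" using kn n unfolding K_def by linarith
        ultimately have "(p, k) \<in> I" using pk k2 p2 by (auto simp: I_def)
        then show "n \<in> (\<lambda>(p,k). p ^ k) ` I" using pk by force
      qed
    qed (auto simp: I_def intro: mangoldt_nonneg)
    also have "\<dots> \<le> (\<Sum>(p,k)\<in>I. mangoldt (p ^ k) / real (p ^ k))"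
      by (rule order_trans[OF sum_image_le]) (auto simp: I_def case_prod_unfold intro: mangoldt_nonneg)
    also have "\<dots> = (\<Sum>p\<in>{p\<in>nups x. prime p}. \<Sum>k=2..K. mangoldt (p ^ k) / real (p ^ k))"
      unfolding I_def by (rule sum.cartesian_product[symmetric])
    also have "\<dots> \<le> (\<Sum>p\<in>{p\<in>nups x. prime p}. 4 * (1 / (real p * sqrt (real p))))"
    proof (rule sum_mono)
      fix p assume "p \<in> {p\<in>nups x. prime p}"
      then have p: "prime p" "p \<ge> 2" using prime_ge_2_nat by auto
      have "(\<Sum>k=2..K. mangoldt (p ^ k) / real (p ^ k)) = ln (real p) * (\<Sum>k=2..K. (1 / real p) ^ k)"
        unfolding sum_distrib_left by (intro sum.cong refl) (use p in \<open>auto simp: power_one_over field_simps\<close>)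
      also have "\<dots> \<le> (2 * sqrt (real p)) * (2 * (1 / real p)\<^sup>2)"
        using p by (intro mult_mono ln_le_sqrt geometric_tail) (auto intro!: sum_nonneg)
      also have "\<dots> = 4 * (1 / (real p * sqrt (real p)))"
        using p by (simp add: field_simps power2_eq_square flip: real_sqrt_mult)
      finally show "(\<Sum>k=2..K. mangoldt (p ^ k) / real (p ^ k)) \<le> 4 * (1 / (real p * sqrt (real p)))" .
    qed
    also have "\<dots> \<le> (\<Sum>p\<in>nups x. 4 * (1 / (real p * sqrt (real p))))"
      by (rule sum_mono2) auto
    also have "\<dots> \<le> 4 * C" using C(2)[of x] by (simp only: sum_distrib_left[symmetric])
    finally show ?thesis .
  qed
  then show ?thesis using C(1) by (intro exI[of _ "4 * C"]) auto
qed

text \<open>These numbers carry almost all of the weight of \<open>lambda2\<close>, and a completely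
  multiplicative function with finitely many values at primes has finitely many values at
  them.\<close>

definition almost_prime2 :: "nat \<Rightarrow> bool" where
  "almost_prime2 m \<longleftrightarrow> prime m \<or> (\<exists>p q. prime p \<and> prime q \<and> m = p * q)"

text \<open>Only O(ln x) out of a total weight of order \<open>(ln x)^2\<close>: away from these
  numbers every nonzero term of \<open>lambda2\<close> involves a proper prime power. Those have
  bounded total weight by \<open>sum_mangoldt_nonprime\<close>, while the other factor contributes
  at most \<open>ln x + D\<close>.\<close>

lemma sum_lambda2_not_almost_prime:
  "\<exists>C>0. \<forall>x\<ge>1. (\<Sum>m\<in>{m\<in>nups x. \<not> almost_prime2 m}. lambda2 m / real m) \<le> C * (1 + ln x)"
proof -
  obtain C where C: "C > 0" "\<And>x. (\<Sum>n\<in>{n\<in>nups x. \<not> prime n}. mangoldt n / real n) \<le> C"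
    using sum_mangoldt_nonprime by blast
  obtain D where D: "D > 0" "\<And>x. x \<ge> 1 \<Longrightarrow> \<bar>(\<Sum>n\<in>nups x. mangoldt n / real n) - ln x\<bar> \<le> D"
    using mertens_mangoldt by blast
  have "(\<Sum>m\<in>{m\<in>nups x. \<not> almost_prime2 m}. lambda2 m / real m) \<le> (3 * C + 2 * C * D) * (1 + ln x)"
    if x: "x \<ge> 1" for x
  proof -
    define a where "a n = (mangoldt n / real n :: real)" for n
    define b where "b n = (if prime n then 0 else a n)" for n
    have a0: "a n \<ge> 0" "b n \<ge> 0" for n by (auto simp: a_def b_def mangoldt_nonneg)
    have bsum: "(\<Sum>n\<in>nups y. b n) \<le> C" for y
    proof -
      have "(\<Sum>n\<in>nups y. b n) = (\<Sum>n\<in>{n\<in>nups y. \<not> prime n}. a n)"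
        by (rule sum.mono_neutral_cong_right) (auto simp: b_def)
      then show ?thesis using C(2)[of y] by (simp add: a_def)
    qed
    have asum: "(\<Sum>n\<in>nups x. a n) \<le> ln x + D" using D(2)[OF x] unfolding a_def by linarith
    have lx: "ln x \<ge> 0" using x by simp
    define h where "h m = b m * ln x + (\<Sum>d | d dvd m. b d * a (m div d) + a d * b (m div d))" for m
    have h0: "h m \<ge> 0" for m unfolding h_def
      using a0 lx by (intro add_nonneg_nonneg sum_nonneg mult_nonneg_nonneg) auto
    have "(\<Sum>m\<in>{m\<in>nups x. \<not> almost_prime2 m}. lambda2 m / real m) \<le> (\<Sum>m\<in>{m\<in>nups x. \<not> almost_prime2 m}. h m)"
    proof (rule sum_mono)
      fix m assume "m \<in> {m\<in>nups x. \<not> almost_prime2 m}"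
      then have m: "m > 0" "real m \<le> x" "\<not> almost_prime2 m" by auto
      have "mangoldt m * ln (real m) / real m = b m * ln (real m)"
        using m by (simp add: b_def a_def almost_prime2_def)
      also have "\<dots> \<le> b m * ln x" using m a0 by (intro mult_left_mono) auto
      finally have 1: "mangoldt m * ln (real m) / real m \<le> b m * ln x" .
      have 2: "(\<Sum>d | d dvd m. mangoldt d * mangoldt (m div d)) / real m \<le>
         (\<Sum>d | d dvd m. b d * a (m div d) + a d * b (m div d))"
        unfolding sum_divide_distrib
      proof (rule sum_mono)
        fix d assume "d \<in> {d. d dvd m}"
        then obtain e where e: "m = d * e" by auto
        then have pos: "d > 0" "e > 0" using m by auto
        have np: "\<not> prime d \<or> \<not> prime e" using m e by (auto simp: almost_prime2_def)
        have "mangoldt d * mangoldt (m div d) / real m = a d * a e"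
          using e pos by (simp add: a_def)
        also have "\<dots> \<le> b d * a e + a d * b e"
          using np a0 by (auto simp: b_def)
        finally show "mangoldt d * mangoldt (m div d) / real m \<le> b d * a (m div d) + a d * b (m div d)"
          using e pos by simp
      qed
      show "lambda2 m / real m \<le> h m"
        using 1 2 unfolding lambda2_def h_def by (simp add: add_divide_distrib)
    qed
    also have "\<dots> \<le> (\<Sum>m\<in>nups x. h m)" by (rule sum_mono2) (use h0 in auto)
    also have "\<dots> = (\<Sum>m\<in>nups x. b m) * ln x +
        (\<Sum>d\<in>nups x. \<Sum>e\<in>nups (x / real d). b d * a e + a d * b e)"
      unfolding h_def sum.distrib[of "\<lambda>m. b m * ln x"] sum_distrib_right
      by (subst sum_divisors_nups) simp
    also have "\<dots> \<le> C * ln x + (\<Sum>d\<in>nups x. \<Sum>e\<in>nups x. b d * a e + a d * b e)"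
      using lx bsum a0
      by (intro add_mono mult_right_mono sum_mono sum_mono2 nups_div_subset) auto
    also have "(\<Sum>d\<in>nups x. \<Sum>e\<in>nups x. b d * a e + a d * b e) = 2 * ((\<Sum>d\<in>nups x. b d) * (\<Sum>e\<in>nups x. a e))"
      by (simp add: sum.distrib sum_product[symmetric] mult.commute[of "sum a _"])
    also have "(\<Sum>d\<in>nups x. b d) * (\<Sum>e\<in>nups x. a e) \<le> C * (ln x + D)"
      using asum bsum a0 C(1) by (intro mult_mono sum_nonneg) auto
    also have "C * ln x + 2 * (C * (ln x + D)) \<le> (3 * C + 2 * C * D) * (1 + ln x)"
      using C(1) D(1) lx by (simp add: algebra_simps)
    finally show ?thesis by simp
  qed
  moreover have "3 * C + 2 * C * D > 0" using C D by (intro add_pos_pos) auto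
  ultimately show ?thesis by blast
qed

text \<open>The reason for working with \<open>lambda2\<close>: Selberg's formula has the error O(x)
  against the main term \<open>2 * x * ln x\<close>, so its differences stay positive on
  multiplicative intervals of any fixed length. For \<open>mangoldt\<close>, Chebyshev's bounds give
  this only for long intervals.\<close>

lemma sum_lambda2_cell:
  assumes \<delta>: "0 < \<delta>" "\<delta> \<le> 1"
  shows "\<exists>Y\<ge>1. \<forall>y\<ge>Y. (\<Sum>m\<in>nups ((1 + \<delta>) * y) - nups y. lambda2 m / real m) \<ge> \<delta> / 2 * ln y"
proof -
  obtain C where C: "C > 0" "\<And>x. x \<ge> 1 \<Longrightarrow> \<bar>(\<Sum>n\<in>nups x. lambda2 n) - 2 * x * ln x\<bar> \<le> C * x"
    using selberg_formula by blast
  \<comment> \<open>From here on the error \<open>3 * C * y\<close> is at most half of the main term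
    \<open>2 * \<delta> * y * ln y\<close>; the bound \<open>m \<le> 2 * y\<close> costs another
    factor 2.\<close>
  define Y where "Y = exp (3 * C / \<delta>)"
  have Y1: "Y \<ge> 1" using C \<delta> by (simp add: Y_def)
  have "(\<Sum>m\<in>nups ((1 + \<delta>) * y) - nups y. lambda2 m / real m) \<ge> \<delta> / 2 * ln y" if y: "y \<ge> Y" for y
  proof -
    have y1: "y \<ge> 1" using y Y1 by simp
    have yy: "y \<le> (1 + \<delta>) * y" "(1 + \<delta>) * y \<ge> 1" using y1 \<delta>
      by (auto simp: algebra_simps) (smt (verit) mult_nonneg_nonneg)
    have ly: "ln y \<ge> 3 * C / \<delta>" using y y1 unfolding Y_def by (simp add: ln_ge_iff)
    then have ly': "\<delta> * ln y \<ge> 3 * C" using \<delta> by (simp add: field_simps)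
    have "(\<Sum>m\<in>nups ((1 + \<delta>) * y) - nups y. lambda2 m) =
       (\<Sum>m\<in>nups ((1 + \<delta>) * y). lambda2 m) - (\<Sum>m\<in>nups y. lambda2 m)"
      by (rule sum_diff) (use nups_mono[OF yy(1)] in simp_all)
    also have "\<dots> \<ge> (2 * ((1 + \<delta>) * y) * ln ((1 + \<delta>) * y) - C * ((1 + \<delta>) * y)) - (2 * y * ln y + C * y)"
      using C(2)[OF yy(2)] C(2)[OF y1] by linarith
    finally have 1: "(\<Sum>m\<in>nups ((1 + \<delta>) * y) - nups y. lambda2 m) \<ge>
       (2 * ((1 + \<delta>) * y) * ln ((1 + \<delta>) * y) - C * ((1 + \<delta>) * y)) - (2 * y * ln y + C * y)" .
    have "2 * ((1 + \<delta>) * y) * ln ((1 + \<delta>) * y) \<ge> 2 * ((1 + \<delta>) * y) * ln y"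
      using yy y1 \<delta> by (intro mult_left_mono) auto
    moreover have "C * ((1 + \<delta>) * y) \<le> C * (2 * y)" using C y1 \<delta> by (intro mult_left_mono mult_right_mono) auto
    ultimately have 2: "(\<Sum>m\<in>nups ((1 + \<delta>) * y) - nups y. lambda2 m) \<ge> 2 * y * (\<delta> * ln y) - 3 * C * y"
      using 1 by (simp add: algebra_simps)
    have "3 * C * y \<le> \<delta> * ln y * y" using ly' y1 by (intro mult_right_mono) auto
    then have 3: "(\<Sum>m\<in>nups ((1 + \<delta>) * y) - nups y. lambda2 m) \<ge> y * (\<delta> * ln y)"
      using 2 by (simp add: algebra_simps)
    have "\<delta> / 2 * ln y = (y * (\<delta> * ln y)) / (2 * y)" using y1 by simp
    also have "\<dots> \<le> (\<Sum>m\<in>nups ((1 + \<delta>) * y) - nups y. lambda2 m) / (2 * y)"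
      using 3 y1 by (intro divide_right_mono) auto
    also have "\<dots> = (\<Sum>m\<in>nups ((1 + \<delta>) * y) - nups y. lambda2 m / (2 * y))"
      by (simp add: sum_divide_distrib)
    also have "\<dots> \<le> (\<Sum>m\<in>nups ((1 + \<delta>) * y) - nups y. lambda2 m / real m)"
    proof (intro sum_mono divide_left_mono lambda2_nonneg)
      fix m assume m: "m \<in> nups ((1 + \<delta>) * y) - nups y"
      have "(1 + \<delta>) * y \<le> 2 * y" using \<delta> y1 by (intro mult_right_mono) auto
      then show "real m \<le> 2 * y" using m by auto
      show "0 < 2 * y * real m" using m y1 by auto
    qed
    finally show ?thesis .
  qed
  then show ?thesis using Y1 by blast
qed

section \<open>The Turan-Kubilius inequality\<close>

lemma card_multiples_nups:
  assumes "d \<ge> 1"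
  shows "card {n\<in>nups x. d dvd n} = card (nups (x / real d))"
proof -
  have "bij_betw (\<lambda>m. d * m) (nups (x / real d)) {n\<in>nups x. d dvd n}"
  proof (rule bij_betwI[where g = "\<lambda>n. n div d"])
    show "(*) d \<in> nups (x / real d) \<rightarrow> {n\<in>nups x. d dvd n}"
      using assms by (auto simp: field_simps)
    show "(\<lambda>n. n div d) \<in> {n\<in>nups x. d dvd n} \<rightarrow> nups (x / real d)"
      using assms by (auto simp: field_simps elim!: dvdE)
  qed (use assms in auto)
  then show ?thesis using bij_betw_same_card by metis
qed

definition prime_count :: "nat set \<Rightarrow> nat \<Rightarrow> real" where
  "prime_count P n = real (card {p\<in>P. p dvd n})"

lemma prime_count_altdef: "finite P \<Longrightarrow> prime_count P n = (\<Sum>p\<in>P. if p dvd n then 1 else 0)"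
  unfolding prime_count_def by (simp add: sum.If_cases Int_def)

text \<open>Expansion of the variance. The second moment is bounded by terms \<open>x / d\<close>
  without error; only the first moment, which enters with a negative sign, loses up to 1 for every
  prime.\<close>

theorem turan_kubilius:
  assumes P: "finite P" "\<And>p. p \<in> P \<Longrightarrow> prime p"
  defines "L \<equiv> (\<Sum>p\<in>P. 1 / real p)"
  assumes x: "x \<ge> 1"
  shows "(\<Sum>n\<in>nups x. (prime_count P n - L)\<^sup>2) \<le> x * L + 2 * L * real (card P)"
proof -
  define c where "c = real (card (nups x))"
  have p1: "p \<ge> 1" if "p \<in> P" for p using P(2)[OF that] prime_ge_1_nat by blast
  have L0: "L \<ge> 0" unfolding L_def by (intro sum_nonneg) auto
  have cnt: "(\<Sum>n\<in>nups x. if d dvd n then 1 else (0::real)) = real (card (nups (x / real d)))" if "d \<ge> 1" for d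
    using card_multiples_nups[OF that, of x] by (simp add: sum.If_cases Int_def)
  have s1: "(\<Sum>n\<in>nups x. prime_count P n) \<ge> x * L - real (card P)"
  proof -
    have "(\<Sum>n\<in>nups x. prime_count P n) = (\<Sum>p\<in>P. \<Sum>n\<in>nups x. if p dvd n then 1 else 0)"
      unfolding prime_count_altdef[OF P(1)] by (rule sum.swap)
    also have "\<dots> = (\<Sum>p\<in>P. real (card (nups (x / real p))))"
      by (intro sum.cong refl cnt p1)
    also have "\<dots> \<ge> (\<Sum>p\<in>P. x / real p - 1)" by (intro sum_mono card_nups_ge)
    also have "(\<Sum>p\<in>P. x / real p - 1) = x * L - real (card P)"
      by (simp add: L_def sum_subtractf sum_distrib_left)
    finally show ?thesis .
  qed
  have s2: "(\<Sum>n\<in>nups x. (prime_count P n)\<^sup>2) \<le> x * L + x * L\<^sup>2"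
  proof -
    have "(\<Sum>n\<in>nups x. (prime_count P n)\<^sup>2) =
      (\<Sum>n\<in>nups x. \<Sum>p\<in>P. \<Sum>q\<in>P. if p dvd n \<and> q dvd n then 1 else 0)"
      unfolding prime_count_altdef[OF P(1)] power2_eq_square sum_product
      by (intro sum.cong refl) auto
    also have "\<dots> = (\<Sum>p\<in>P. \<Sum>n\<in>nups x. \<Sum>q\<in>P. if p dvd n \<and> q dvd n then 1 else 0)"
      by (rule sum.swap)
    also have "\<dots> = (\<Sum>p\<in>P. \<Sum>q\<in>P. \<Sum>n\<in>nups x. if p dvd n \<and> q dvd n then 1 else 0)"
      by (rule sum.cong[OF refl], rule sum.swap)
    also have "\<dots> \<le> (\<Sum>p\<in>P. \<Sum>q\<in>P. (if q = p then x / real p else 0) + x / (real p * real q))"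
    proof (intro sum_mono)
      fix p q assume pq: "p \<in> P" "q \<in> P"
      show "(\<Sum>n\<in>nups x. if p dvd n \<and> q dvd n then 1 else 0) \<le> (if q = p then x / real p else 0) + x / (real p * real q)"
      proof (cases "p = q")
        case True
        have "real (card (nups (x / real p))) \<le> x / real p" using x by (intro card_nups_le) auto
        then show ?thesis using True x cnt[OF p1[OF pq(1)]] by (simp add: add_increasing2)
      next
        case False
        then have "coprime p q" using P(2) pq by (simp add: primes_coprime)
        then have "(p dvd n \<and> q dvd n) \<longleftrightarrow> p * q dvd n" for n
          using divides_mult by (auto dest: dvd_mult_left dvd_mult_right)
        then have "(\<Sum>n\<in>nups x. if p dvd n \<and> q dvd n then 1 else (0::real)) = real (card (nups (x / real (p * q))))"
          using cnt[of "p * q"] p1 pq by (simp add: Suc_le_eq)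
        also have "\<dots> \<le> x / real (p * q)" using x by (intro card_nups_le) auto
        finally show ?thesis using False by simp
      qed
    qed
    also have "\<dots> = (\<Sum>p\<in>P. x / real p + (\<Sum>q\<in>P. x / (real p * real q)))"
      by (intro sum.cong refl) (simp add: sum.distrib sum.delta[OF P(1)])
    also have "\<dots> = x * L + (\<Sum>p\<in>P. \<Sum>q\<in>P. x / (real p * real q))"
      by (simp add: sum.distrib L_def sum_distrib_left)
    also have "(\<Sum>p\<in>P. \<Sum>q\<in>P. x / (real p * real q)) = x * L\<^sup>2"
      unfolding L_def power2_eq_square sum_product unfolding sum_distrib_left by simp
    finally show ?thesis .
  qed
  have "(\<Sum>n\<in>nups x. (prime_count P n - L)\<^sup>2) = (\<Sum>n\<in>nups x. (prime_count P n)\<^sup>2) - 2 * L * (\<Sum>n\<in>nups x. prime_count P n) + L\<^sup>2 * c"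
    by (simp add: power2_diff sum.distrib sum_subtractf sum_distrib_left c_def algebra_simps)
  also have "\<dots> \<le> (x * L + x * L\<^sup>2) - 2 * L * (x * L - real (card P)) + L\<^sup>2 * x"
    using s1 s2 L0 x unfolding c_def
    by (intro add_mono diff_mono mult_left_mono card_nups_le) auto
  also have "\<dots> = x * L + 2 * L * real (card P)" by (simp add: power2_eq_square algebra_simps)
  finally show ?thesis .
qed

section \<open>Mean values of completely multiplicative functions\<close>

locale completely_mult =
  fixes f :: "nat \<Rightarrow> complex"
  assumes mult: "\<And>m n. m \<ge> 1 \<Longrightarrow> n \<ge> 1 \<Longrightarrow> f (m * n) = f m * f n"
    and norm_01: "\<And>n. n \<ge> 1 \<Longrightarrow> norm (f n) = 0 \<or> norm (f n) = 1"
begin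

definition S :: "real \<Rightarrow> complex" where "S x = (\<Sum>n\<in>nups x. f n)"

definition A :: "real \<Rightarrow> complex" where "A x = S x / of_real x"

lemma norm_le_1: "n \<ge> 1 \<Longrightarrow> norm (f n) \<le> 1"
  using norm_01[of n] by auto

lemma norm_S_le: "x \<ge> 0 \<Longrightarrow> norm (S x) \<le> x"
proof -
  assume x: "x \<ge> 0"
  have "norm (S x) \<le> (\<Sum>n\<in>nups x. 1)" unfolding S_def by (intro sum_norm_le norm_le_1) auto
  also have "\<dots> \<le> x" using card_nups_le[OF x] by simp
  finally show ?thesis .
qed

lemma norm_A_le: "x \<ge> 0 \<Longrightarrow> norm (A x) \<le> 1"
  using norm_S_le[of x] by (cases "x = 0") (auto simp: A_def norm_divide)

text \<open>\<open>S\<close> changes by at most 1 per integer, and the normalisation changes by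
  \<open>1 / y - 1 / x\<close>; each accounts for one of the two multiples of
  \<open>x - y\<close>.\<close>

lemma A_lipschitz:
  assumes "1 \<le> y" "y \<le> x"
  shows "norm (A x - A y) \<le> (2 * (x - y) + 1) / x"
proof -
  have 1: "norm (S x - S y) \<le> x - y + 1"
  proof -
    have "S x - S y = (\<Sum>n\<in>nups x - nups y. f n)" unfolding S_def
      using nups_mono[OF assms(2)] by (subst sum_diff) auto
    also have "norm \<dots> \<le> (\<Sum>n\<in>nups x - nups y. 1)" by (intro sum_norm_le norm_le_1) auto
    also have "\<dots> = real (card (nups x)) - real (card (nups y))"
      using nups_mono[OF assms(2)] card_mono[OF finite_nups nups_mono[OF assms(2)]]
      by (simp add: card_Diff_subset of_nat_diff)
    also have "\<dots> \<le> x - y + 1" using card_nups_le[of x] card_nups_ge[of y] assms by auto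
    finally show ?thesis .
  qed
  have "A x - A y = (S x - S y) / of_real x - S y * of_real (1 / y - 1 / x)"
    using assms by (simp add: A_def field_simps)
  also have "norm \<dots> \<le> norm (S x - S y) / x + norm (S y) * (1 / y - 1 / x)"
    using assms by (intro order_trans[OF norm_triangle_ineq4] add_mono)
      (auto simp: norm_divide norm_mult abs_if field_simps simp del: of_real_diff of_real_divide)
  also have "\<dots> \<le> (x - y + 1) / x + y * (1 / y - 1 / x)"
    using assms 1 norm_S_le[of y] by (intro add_mono divide_right_mono mult_right_mono) (auto simp: field_simps)
  also have "\<dots> = (2 * (x - y) + 1) / x" using assms by (simp add: field_simps)
  finally show ?thesis .
qed

text \<open>Weighting \<open>f n\<close> by \<open>(ln n)^2\<close>, the divisor sum of
  \<open>lambda2\<close>, produces by complete multiplicativity the average of the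
  \<open>f m * A (x / m)\<close>. Replacing \<open>ln n\<close> by \<open>ln x\<close> is cheap by
  \<open>sum_ln_squared_diff\<close>.\<close>

lemma A_self_averaging:
  assumes x: "x \<ge> 1"
  shows "norm ((\<Sum>m\<in>nups x. of_real (lambda2 m / real m) * f m * A (x / real m)) - A x * of_real ((ln x)\<^sup>2)) \<le> 4 * ln x"
proof -
  have "(\<Sum>m\<in>nups x. of_real (lambda2 m / real m) * f m * A (x / real m)) =
     (\<Sum>m\<in>nups x. \<Sum>k\<in>nups (x / real m). of_real (lambda2 m) * (f m * f k)) / of_real x"
    unfolding sum_divide_distrib
    by (intro sum.cong refl) (use x in \<open>auto simp: A_def S_def sum_distrib_left field_simps sum_divide_distrib\<close>)
  also have "(\<Sum>m\<in>nups x. \<Sum>k\<in>nups (x / real m). of_real (lambda2 m) * (f m * f k)) =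
     (\<Sum>n\<in>nups x. \<Sum>d | d dvd n. of_real (lambda2 d) * (f d * f (n div d)))"
    by (rule sum_divisors_nups[symmetric])
  also have "\<dots> = (\<Sum>n\<in>nups x. f n * of_real ((ln (real n))\<^sup>2))"
  proof (rule sum.cong[OF refl])
    fix n assume "n \<in> nups x"
    then have n: "n > 0" by auto
    have "(\<Sum>d | d dvd n. of_real (lambda2 d) * (f d * f (n div d))) = (\<Sum>d | d dvd n. f n * of_real (lambda2 d))"
    proof (rule sum.cong[OF refl])
      fix d assume "d \<in> {d. d dvd n}"
      then obtain e where e: "n = d * e" by auto
      then have "d \<ge> 1" "e \<ge> 1" using n by auto
      then show "of_real (lambda2 d) * (f d * f (n div d)) = f n * of_real (lambda2 d)"
        using e mult[of d e] by simp
    qed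
    also have "\<dots> = f n * of_real (\<Sum>d | d dvd n. lambda2 d)" by (simp add: sum_distrib_left)
    finally show "(\<Sum>d | d dvd n. of_real (lambda2 d) * (f d * f (n div d))) = f n * of_real ((ln (real n))\<^sup>2)"
      using lambda2_sum[OF n] by simp
  qed
  finally have "(\<Sum>m\<in>nups x. of_real (lambda2 m / real m) * f m * A (x / real m)) =
     (\<Sum>n\<in>nups x. f n * of_real ((ln (real n))\<^sup>2)) / of_real x" .
  moreover have "A x * of_real ((ln x)\<^sup>2) = (\<Sum>n\<in>nups x. f n * of_real ((ln x)\<^sup>2)) / of_real x"
    by (simp add: A_def S_def sum_distrib_right)
  ultimately have "(\<Sum>m\<in>nups x. of_real (lambda2 m / real m) * f m * A (x / real m)) - A x * of_real ((ln x)\<^sup>2) =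
     (\<Sum>n\<in>nups x. f n * of_real ((ln (real n))\<^sup>2 - (ln x)\<^sup>2)) / of_real x"
    by (simp add: diff_divide_distrib[symmetric] sum_subtractf algebra_simps)
  also have "norm \<dots> \<le> (\<Sum>n\<in>nups x. (ln x)\<^sup>2 - (ln (real n))\<^sup>2) / x"
  proof -
    have "norm (\<Sum>n\<in>nups x. f n * of_real ((ln (real n))\<^sup>2 - (ln x)\<^sup>2)) \<le> (\<Sum>n\<in>nups x. (ln x)\<^sup>2 - (ln (real n))\<^sup>2)"
    proof (rule sum_norm_le)
      fix n assume n: "n \<in> nups x"
      then have "(ln (real n))\<^sup>2 \<le> (ln x)\<^sup>2" by (intro power_mono) auto
      then have "norm (of_real ((ln (real n))\<^sup>2 - (ln x)\<^sup>2) :: complex) = (ln x)\<^sup>2 - (ln (real n))\<^sup>2"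
        unfolding norm_of_real by simp
      then show "norm (f n * of_real ((ln (real n))\<^sup>2 - (ln x)\<^sup>2)) \<le> (ln x)\<^sup>2 - (ln (real n))\<^sup>2"
        unfolding norm_mult using n norm_le_1[of n] mult_right_mono[of "norm (f n)" 1 "(ln x)\<^sup>2 - (ln (real n))\<^sup>2"]
        \<open>(ln (real n))\<^sup>2 \<le> (ln x)\<^sup>2\<close> by simp
    qed
    then show ?thesis using x by (simp add: norm_divide divide_right_mono del: of_real_diff)
  qed
  also have "\<dots> \<le> (4 * x * ln x) / x" using x by (intro divide_right_mono sum_ln_squared_diff) auto
  also have "\<dots> = 4 * ln x" using x by simp
  finally show ?thesis .
qed

lemma near_equality:
  assumes y0: "y0 \<ge> 1" and \<beta>: "0 \<le> \<beta>" "\<beta> \<le> 2" "\<And>y. y \<ge> y0 \<Longrightarrow> norm (A y) \<le> \<beta>"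
  shows "\<exists>K>0. \<forall>x\<ge>y0. (\<Sum>m\<in>nups x. lambda2 m / real m * (norm (f m * A (x / real m) - A x))\<^sup>2)
            \<le> (\<beta>\<^sup>2 - (norm (A x))\<^sup>2) * (ln x)\<^sup>2 + K * (1 + ln x)"
proof -
  obtain C where C: "C > 0" "\<And>x. x \<ge> 1 \<Longrightarrow> \<bar>(\<Sum>m\<in>nups x. lambda2 m / real m) - (ln x)\<^sup>2\<bar> \<le> C * (1 + ln x)"
    using sum_lambda2_div_bound by blast
  \<comment> \<open>With \<open>D = C * (1 + L)\<close>: \<open>4 * D\<close> comes from
    \<open>\<beta>\<^sup>2 * W\<close>, \<open>D\<close> from \<open>W * B\<close> and
    \<open>2 * D\<close> from the large \<open>m\<close>, which also give
    \<open>2 * ln y0 * L\<close>; the 8 is twice the 4 of the self-averaging error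
    \<open>4 * L\<close>.\<close>
  define K where "K = 7 * C + 8 + 2 * ln y0"
  have ly0: "ln y0 \<ge> 0" using y0 by simp
  have "(\<Sum>m\<in>nups x. lambda2 m / real m * (norm (f m * A (x / real m) - A x))\<^sup>2)
            \<le> (\<beta>\<^sup>2 - (norm (A x))\<^sup>2) * (ln x)\<^sup>2 + K * (1 + ln x)" if x: "x \<ge> y0" for x
  proof -
    have x1: "x \<ge> 1" using x y0 by simp
    define w where "w m = lambda2 m / real m" for m
    define L where "L = ln x"
    define B where "B = (norm (A x))\<^sup>2"
    define W where "W = (\<Sum>m\<in>nups x. w m)"
    have w0: "w m \<ge> 0" for m by (simp add: w_def lambda2_nonneg)
    have L0: "L \<ge> 0" using x1 by (simp add: L_def)
    have W: "\<bar>W - L\<^sup>2\<bar> \<le> C * (1 + L)" unfolding W_def w_def L_def by (rule C(2)[OF x1])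
    have W': "(\<Sum>m\<in>nups (x / y0). w m) \<ge> (L - ln y0)\<^sup>2 - C * (1 + L)"
    proof -
      have "x / y0 \<ge> 1" using x y0 by simp
      moreover have "ln (x / y0) = L - ln y0" using x1 y0 by (simp add: ln_div L_def)
      moreover have "C * (1 + (L - ln y0)) \<le> C * (1 + L)" using C ly0 by (intro mult_left_mono) auto
      ultimately show ?thesis using C(2)[of "x / y0"] unfolding w_def by simp
    qed
    have B1: "B \<le> 1" "B \<ge> 0" unfolding B_def using norm_A_le[of x] x1 by (auto intro: power_le_one)
    have sub: "nups (x / y0) \<subseteq> nups x" using x1 y0 by (intro nups_mono) (simp add: field_simps)
    have sq1: "(\<Sum>m\<in>nups x. w m * (norm (f m * A (x / real m)))\<^sup>2) \<le> \<beta>\<^sup>2 * W + (W - (\<Sum>m\<in>nups (x / y0). w m))"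
    proof -
      have "(\<Sum>m\<in>nups x. w m * (norm (f m * A (x / real m)))\<^sup>2) =
        (\<Sum>m\<in>nups (x/y0). w m * (norm (f m * A (x / real m)))\<^sup>2) + (\<Sum>m\<in>nups x - nups (x/y0). w m * (norm (f m * A (x / real m)))\<^sup>2)"
        using sub by (subst sum.subset_diff[OF sub]) auto
      also have "\<dots> \<le> (\<Sum>m\<in>nups (x/y0). w m * \<beta>\<^sup>2) + (\<Sum>m\<in>nups x - nups (x/y0). w m * 1)"
      proof (intro add_mono sum_mono mult_left_mono w0)
        fix m assume m: "m \<in> nups (x / y0)"
        then have "norm (A (x / real m)) \<le> \<beta>" using y0 by (intro \<beta>) (auto simp: field_simps)
        then have "norm (f m * A (x / real m)) \<le> 1 * \<beta>" unfolding norm_mult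
          using norm_le_1[of m] m by (intro mult_mono) auto
        then show "(norm (f m * A (x / real m)))\<^sup>2 \<le> \<beta>\<^sup>2" by (intro power_mono) auto
      next
        fix m assume m: "m \<in> nups x - nups (x / y0)"
        have "norm (f m * A (x / real m)) \<le> 1 * 1" unfolding norm_mult
          using norm_le_1[of m] norm_A_le[of "x / real m"] x1 m by (intro mult_mono) auto
        then show "(norm (f m * A (x / real m)))\<^sup>2 \<le> 1" by (intro power_le_one) auto
      qed
      also have "(\<Sum>m\<in>nups (x/y0). w m * \<beta>\<^sup>2) \<le> \<beta>\<^sup>2 * W"
        unfolding W_def sum_distrib_left using sub w0 by (simp add: mult.commute[of _ "\<beta>\<^sup>2"]) (intro sum_mono2, auto)
      also have "(\<Sum>m\<in>nups x - nups (x/y0). w m * 1) = W - (\<Sum>m\<in>nups (x / y0). w m)"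
        using sum_diff[OF finite_nups sub, of w] unfolding W_def by simp
      finally show ?thesis by simp
    qed
    define Z where "Z = (\<Sum>m\<in>nups x. of_real (w m) * f m * A (x / real m))"
    have Z: "norm (Z - A x * of_real (L\<^sup>2)) \<le> 4 * L" unfolding Z_def w_def L_def by (rule A_self_averaging[OF x1])
    have cross: "Re (cnj (A x) * Z) \<ge> B * L\<^sup>2 - 4 * L"
    proof -
      have "cnj (A x) * Z = cnj (A x) * A x * of_real (L\<^sup>2) + cnj (A x) * (Z - A x * of_real (L\<^sup>2))"
        by (simp add: algebra_simps)
      moreover have "cnj (A x) * A x = of_real B" unfolding B_def
        by (subst complex_norm_square) (simp add: mult.commute)
      ultimately have "cnj (A x) * Z = of_real (B * L\<^sup>2) + cnj (A x) * (Z - A x * of_real (L\<^sup>2))" by simp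
      then have "Re (cnj (A x) * Z) = B * L\<^sup>2 + Re (cnj (A x) * (Z - A x * of_real (L\<^sup>2)))"
        by (metis Re_complex_of_real plus_complex.simps(1))
      moreover have "\<bar>Re (cnj (A x) * (Z - A x * of_real (L\<^sup>2)))\<bar> \<le> 1 * (4 * L)"
        by (rule order_trans[OF abs_Re_le_cmod]) (unfold norm_mult complex_mod_cnj, intro mult_mono Z norm_A_le, use x1 in auto)
      ultimately show ?thesis by linarith
    qed
    have "(\<Sum>m\<in>nups x. w m * (norm (f m * A (x / real m) - A x))\<^sup>2) =
       (\<Sum>m\<in>nups x. w m * (norm (f m * A (x / real m)))\<^sup>2 - 2 * Re (cnj (A x) * (of_real (w m) * f m * A (x / real m))) + w m * B)"
    proof (rule sum.cong[OF refl])
      fix m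
      have "(norm (u - v))\<^sup>2 = (norm u)\<^sup>2 - 2 * Re (cnj v * u) + (norm v)\<^sup>2" for u v :: complex
        unfolding cmod_power2 by (simp add: power2_eq_square algebra_simps)
      from this[of "f m * A (x / real m)" "A x"] have "(norm (f m * A (x / real m) - A x))\<^sup>2 =
         (norm (f m * A (x / real m)))\<^sup>2 - 2 * Re (cnj (A x) * (f m * A (x / real m))) + B" unfolding B_def .
      moreover have "Re (cnj (A x) * (of_real (w m) * f m * A (x / real m))) = w m * Re (cnj (A x) * (f m * A (x / real m)))"
        by (simp add: algebra_simps)
      moreover have "w m * e = w m * a - 2 * r + w m * B" if "e = a - 2 * c + B" "r = w m * c" for e a c r
        unfolding that by (simp add: algebra_simps)
      ultimately show "w m * (norm (f m * A (x / real m) - A x))\<^sup>2 =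
          w m * (norm (f m * A (x / real m)))\<^sup>2 - 2 * Re (cnj (A x) * (of_real (w m) * f m * A (x / real m))) + w m * B"
        by blast
    qed
    also have "\<dots> = (\<Sum>m\<in>nups x. w m * (norm (f m * A (x / real m)))\<^sup>2) - 2 * Re (cnj (A x) * Z) + W * B"
      unfolding Z_def W_def sum_distrib_left Re_sum by (simp only: sum.distrib sum_subtractf sum_distrib_left sum_distrib_right)
    also have "\<dots> \<le> (\<beta>\<^sup>2 * W + (W - (\<Sum>m\<in>nups (x / y0). w m))) - 2 * (B * L\<^sup>2 - 4 * L) + W * B"
      using sq1 cross by (intro add_mono diff_mono) auto
    also have "\<dots> \<le> (\<beta>\<^sup>2 - B) * L\<^sup>2 + K * (1 + L)"
    proof -
      have "\<beta>\<^sup>2 \<le> 2\<^sup>2" using \<beta> by (intro power_mono) auto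
      then have b4: "\<beta>\<^sup>2 \<le> 4" by simp
      define D where "D = C * (1 + L)"
      have D0: "D \<ge> 0" using C L0 by (simp add: D_def)
      have "\<beta>\<^sup>2 * W \<le> \<beta>\<^sup>2 * (L\<^sup>2 + D)" using W by (intro mult_left_mono) (auto simp: D_def)
      moreover have "\<beta>\<^sup>2 * D \<le> 4 * D" using b4 D0 by (rule mult_right_mono)
      moreover have "W * B \<le> (L\<^sup>2 + D) * B" using W B1 by (intro mult_right_mono) (auto simp: D_def)
      moreover have "D * B \<le> D * 1" using D0 B1 by (intro mult_left_mono) auto
      moreover have "W - (\<Sum>m\<in>nups (x / y0). w m) \<le> 2 * D + 2 * ln y0 * L"
      proof -
        have "(L - ln y0)\<^sup>2 = L\<^sup>2 - 2 * ln y0 * L + (ln y0)\<^sup>2" by (simp add: power2_diff)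
        moreover have "(ln y0)\<^sup>2 \<ge> 0" by simp
        ultimately show ?thesis using W W' unfolding D_def[symmetric] by linarith
      qed
      moreover have "K * (1 + L) = 7 * D + 8 + 8 * L + 2 * ln y0 + 2 * ln y0 * L"
        unfolding K_def D_def by (simp add: algebra_simps)
      ultimately show ?thesis using ly0 by (simp add: algebra_simps)
    qed
    finally show ?thesis unfolding w_def B_def L_def .
  qed
  moreover have "K > 0" using C ly0 by (simp add: K_def)
  ultimately show ?thesis by blast
qed

text \<open>Weighting by the number of prime divisors of \<open>n\<close> in \<open>P\<close>
  extracts a factor \<open>f p = z\<close>, and this weight is nearly the constant \<open>L\<close>.
  If \<open>A\<close> took nearly one value at \<open>x\<close> and at all \<open>x / p\<close>,
  then \<open>1 - z\<close> times that value would be small; this is how \<open>z \<noteq> 1\<close>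
  will be exploited.\<close>

lemma turan_kubilius_A:
  assumes P: "finite P" "\<And>p. p \<in> P \<Longrightarrow> prime p" "\<And>p. p \<in> P \<Longrightarrow> f p = z"
  defines "L \<equiv> (\<Sum>p\<in>P. 1 / real p)"
  assumes x: "x \<ge> 1" "x \<ge> 2 * real (card P)"
  shows "norm (of_real L * A x - z * (\<Sum>p\<in>P. A (x / real p) / of_nat p)) \<le> sqrt (2 * L)"
proof -
  have L0: "L \<ge> 0" unfolding L_def by (intro sum_nonneg) auto
  have p1: "p \<ge> 1" if "p \<in> P" for p using P(2)[OF that] prime_ge_1_nat by blast
  have 1: "(\<Sum>n\<in>nups x. f n * of_real (prime_count P n)) = z * (\<Sum>p\<in>P. S (x / real p))"
  proof -
    have "(\<Sum>n\<in>nups x. f n * of_real (prime_count P n)) = (\<Sum>n\<in>nups x. \<Sum>p\<in>P. if p dvd n then f n else 0)"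
      unfolding prime_count_altdef[OF P(1)] of_real_sum sum_distrib_left by (intro sum.cong refl) auto
    also have "\<dots> = (\<Sum>p\<in>P. \<Sum>n\<in>nups x. if p dvd n then f n else 0)" by (rule sum.swap)
    also have "\<dots> = (\<Sum>p\<in>P. z * S (x / real p))"
    proof (rule sum.cong[OF refl])
      fix p assume p: "p \<in> P"
      have "(\<Sum>n\<in>nups x. if p dvd n then f n else 0) = (\<Sum>n\<in>{n\<in>nups x. p dvd n}. f n)"
        by (rule sum.mono_neutral_cong_right) auto
      also have "\<dots> = (\<Sum>m\<in>nups (x / real p). f (p * m))"
        by (rule sum.reindex_bij_witness[of _ "\<lambda>m. p * m" "\<lambda>n. n div p"])
           (use p1[OF p] in \<open>auto simp: field_simps elim!: dvdE\<close>)
      also have "\<dots> = (\<Sum>m\<in>nups (x / real p). z * f m)"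
        using mult p1[OF p] P(3)[OF p] by (intro sum.cong refl) auto
      finally show "(\<Sum>n\<in>nups x. if p dvd n then f n else 0) = z * S (x / real p)"
        by (simp add: S_def sum_distrib_left)
    qed
    finally show ?thesis by (simp add: sum_distrib_left)
  qed
  have 2: "norm (\<Sum>n\<in>nups x. f n * of_real (prime_count P n - L)) \<le> x * sqrt (2 * L)"
  proof -
    have "norm (\<Sum>n\<in>nups x. f n * of_real (prime_count P n - L)) \<le> (\<Sum>n\<in>nups x. \<bar>prime_count P n - L\<bar>)"
    proof (rule sum_norm_le)
      fix n assume "n \<in> nups x"
      then show "norm (f n * of_real (prime_count P n - L)) \<le> \<bar>prime_count P n - L\<bar>"
        unfolding norm_mult norm_of_real using norm_le_1[of n] mult_right_mono[of "norm (f n)" 1 "\<bar>prime_count P n - L\<bar>"] by simp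
    qed
    also have "\<dots> \<le> sqrt (real (card (nups x)) * (\<Sum>n\<in>nups x. (prime_count P n - L)\<^sup>2))"
    proof (rule real_le_rsqrt)
      have "(\<Sum>n\<in>nups x. 1 * \<bar>prime_count P n - L\<bar>)\<^sup>2 \<le> (\<Sum>n\<in>nups x. 1\<^sup>2) * (\<Sum>n\<in>nups x. \<bar>prime_count P n - L\<bar>\<^sup>2)"
        by (rule Cauchy_Schwarz_ineq_sum)
      then show "(\<Sum>n\<in>nups x. \<bar>prime_count P n - L\<bar>)\<^sup>2 \<le> real (card (nups x)) * (\<Sum>n\<in>nups x. (prime_count P n - L)\<^sup>2)"
        by simp
    qed
    also have "\<dots> \<le> sqrt (x * (2 * x * L))"
    proof (intro real_sqrt_le_mono mult_mono card_nups_le)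
      have "(\<Sum>n\<in>nups x. (prime_count P n - L)\<^sup>2) \<le> x * L + 2 * L * real (card P)"
        unfolding L_def by (rule turan_kubilius) (use P x in auto)
      also have "2 * L * real (card P) \<le> L * x" using x(2) L0 mult_left_mono[of "2 * real (card P)" x L] by simp
      finally show "(\<Sum>n\<in>nups x. (prime_count P n - L)\<^sup>2) \<le> 2 * x * L" by (simp add: algebra_simps)
    qed (use x in \<open>auto intro!: sum_nonneg\<close>)
    also have "x * (2 * x * L) = x\<^sup>2 * (2 * L)" by (simp add: power2_eq_square)
    also have "sqrt \<dots> = x * sqrt (2 * L)" unfolding real_sqrt_mult[of "x\<^sup>2"] using x by simp
    finally show ?thesis .
  qed
  have "(\<Sum>n\<in>nups x. f n * of_real (prime_count P n - L)) =
      (\<Sum>n\<in>nups x. f n * of_real (prime_count P n)) - of_real L * S x"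
    unfolding S_def by (simp add: algebra_simps sum_subtractf sum_distrib_left)
  moreover have "z * (\<Sum>p\<in>P. S (x / real p)) - of_real L * S x =
      - of_real x * (of_real L * A x - z * (\<Sum>p\<in>P. A (x / real p) / of_nat p))"
  proof -
    have "(\<Sum>p\<in>P. A (x / real p) / of_nat p) = (\<Sum>p\<in>P. S (x / real p)) / of_real x"
      unfolding sum_divide_distrib using x p1 by (intro sum.cong refl) (auto simp: A_def Suc_le_eq)
    then show ?thesis using x by (simp add: A_def field_simps)
  qed
  ultimately have "(\<Sum>n\<in>nups x. f n * of_real (prime_count P n - L)) =
      - of_real x * (of_real L * A x - z * (\<Sum>p\<in>P. A (x / real p) / of_nat p))"
    unfolding 1 by simp
  then have "x * norm (of_real L * A x - z * (\<Sum>p\<in>P. A (x / real p) / of_nat p)) \<le> x * sqrt (2 * L)"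
    using 2 x by (simp add: norm_mult)
  then show ?thesis using x by simp
qed

end

text \<open>One bad index is taken from each of the \<open>J div R\<close> disjoint blocks of length
  \<open>R\<close>.\<close>

lemma card_ge_if_no_run:
  fixes bad :: "nat \<Rightarrow> bool"
  assumes R: "R \<ge> 1" and hit: "\<And>i. i + R \<le> J \<Longrightarrow> \<exists>j\<in>{i..<i+R}. bad j"
  shows "J div R \<le> card {j\<in>{..<J}. bad j}"
proof -
  have "\<exists>j\<in>{i*R..<i*R+R}. bad j" if "i < J div R" for i
  proof (rule hit)
    have "(i + 1) * R \<le> (J div R) * R" using that by (intro mult_right_mono) auto
    also have "\<dots> \<le> J" by simp
    finally show "i * R + R \<le> J" by simp
  qed
  then obtain g where g: "\<And>i. i < J div R \<Longrightarrow> g i \<in> {i*R..<i*R+R} \<and> bad (g i)" by metis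
  have gd: "g i div R = i" if "i < J div R" for i
    using g[OF that] R by (intro div_nat_eqI) (auto simp: mult.commute)
  have "inj_on g {..<J div R}" by (rule inj_on_inverseI[where g = "\<lambda>j. j div R"]) (use gd in auto)
  moreover have "g ` {..<J div R} \<subseteq> {j\<in>{..<J}. bad j}"
  proof clarsimp
    fix i assume i: "i < J div R"
    have "(i + 1) * R \<le> (J div R) * R" using i by (intro mult_right_mono) auto
    also have "\<dots> \<le> J" by simp
    finally show "g i < J \<and> bad (g i)" using g[OF i] by auto
  qed
  ultimately have "card {..<J div R} \<le> card {j\<in>{..<J}. bad j}"
    by (intro card_inj_on_le) auto
  then show ?thesis by simp
qed

lemma finite_separated:
  fixes T :: "'a::metric_space set"
  assumes "finite T"
  shows "\<exists>\<sigma>>0. \<forall>s\<in>T. \<forall>t\<in>T. s \<noteq> t \<longrightarrow> \<sigma> \<le> dist s t"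
proof -
  define D where "D = insert 1 ((\<lambda>(s,t). dist s t) ` {p\<in>T\<times>T. fst p \<noteq> snd p})"
  have "finite {p\<in>T\<times>T. fst p \<noteq> snd p}" by (rule finite_subset[of _ "T \<times> T"]) (use assms in auto)
  then have fin: "finite D" unfolding D_def by simp
  have "Min D > 0" using fin by (subst Min_gr_iff) (auto simp: D_def)
  moreover have "Min D \<le> dist s t" if "s \<in> T" "t \<in> T" "s \<noteq> t" for s t
  proof -
    have "dist s t \<in> D" using that unfolding D_def by (intro insertI2 image_eqI[of _ _ "(s,t)"]) auto
    then show ?thesis using fin by simp
  qed
  ultimately show ?thesis by blast
qed

lemma power_between:
  fixes q :: real
  assumes q: "q > 1" and p: "1 \<le> p" "p \<le> q ^ R" and R: "R \<ge> 1"
  obtains j where "j < R" "q ^ j \<le> p" "p \<le> q ^ Suc j"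
proof -
  define j where "j = (LEAST j. p \<le> q ^ Suc j)"
  have ex: "p \<le> q ^ Suc (R - 1)" using p R by simp
  have 1: "p \<le> q ^ Suc j" unfolding j_def by (rule LeastI[of _ "R-1"]) (rule ex)
  have 2: "j \<le> R - 1" unfolding j_def by (rule Least_le) (rule ex)
  have 3: "q ^ j \<le> p"
  proof (cases j)
    case (Suc i)
    then have "\<not> p \<le> q ^ Suc i" unfolding j_def using not_less_Least[of i "\<lambda>j. p \<le> q ^ Suc j"] by simp
    then show ?thesis using Suc by simp
  qed (use p in simp)
  show ?thesis using that[of j] 1 2 3 R by auto
qed

context completely_mult
begin

text \<open>The lower bound \<open>1 / \<delta>\<close> absorbs the additive 1 in
  \<open>A_lipschitz\<close>; of the 3, two units come from the relative distance and one from this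
  rounding term.\<close>

lemma A_lipschitz_ratio:
  assumes \<delta>: "0 < \<delta>" and u: "1 / \<delta> \<le> u" "u \<ge> 1" and v: "1 / \<delta> \<le> v" "v \<ge> 1"
    and uv: "u \<le> (1 + \<delta>) * v" "v \<le> (1 + \<delta>) * u"
  shows "norm (A u - A v) \<le> 3 * \<delta>"
proof -
  have *: "norm (A u - A v) \<le> 3 * \<delta>"
    if "v \<le> u" "1 / \<delta> \<le> u" "1 \<le> v" "u \<le> (1 + \<delta>) * v" for u v
  proof -
    have "norm (A u - A v) \<le> (2 * (u - v) + 1) / u" using that by (intro A_lipschitz) auto
    also have "\<dots> \<le> (2 * (\<delta> * u) + \<delta> * u) / u"
    proof (intro divide_right_mono add_mono mult_left_mono)
      have "\<delta> * v \<le> \<delta> * u" using that \<delta> by (intro mult_left_mono) auto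
      then show "u - v \<le> \<delta> * u" using that by (simp add: algebra_simps)
      show "1 \<le> \<delta> * u" using that \<delta> by (simp add: field_simps)
    qed (use that in auto)
    also have "\<dots> = 3 * \<delta>" using that by (simp add: field_simps)
    finally show ?thesis .
  qed
  show ?thesis
  proof (cases "v \<le> u")
    case True then show ?thesis using assms by (intro *) auto
  next
    case False
    then have "norm (A v - A u) \<le> 3 * \<delta>" using assms by (intro *) auto
    then show ?thesis by (simp add: norm_minus_commute)
  qed
qed

text \<open>The range from \<open>x powr (1/4)\<close> to \<open>x powr (3/4)\<close> is cut into
  geometric cells. If no \<open>R\<close> consecutive cells all contain a good \<open>m\<close>, a
  proportion of about \<open>1 / R\<close> of the cells is bad, with Selberg weight at least
  \<open>(ln x)^2 / (16 * R)\<close> up to lower order; \<open>near_equality\<close> allows only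
  half of this. The lower end keeps the cells within reach of \<open>sum_lambda2_cell\<close>, the
  upper end keeps \<open>x / m\<close> large.\<close>

lemma exists_good_run:
  assumes \<delta>: "0 < \<delta>" "\<delta> \<le> 1" and \<kappa>: "\<kappa> > 0" and R: "R \<ge> 1"
    and y0: "y0 \<ge> 1" and \<beta>: "0 \<le> \<beta>" "\<beta> \<le> 2" "\<And>y. y \<ge> y0 \<Longrightarrow> norm (A y) \<le> \<beta>"
    and \<gamma>: "0 \<le> \<gamma>" "\<beta>\<^sup>2 - \<gamma>\<^sup>2 \<le> \<kappa>\<^sup>2 / (32 * real R)"
  shows "\<exists>X\<ge>1. \<forall>x\<ge>X. norm (A x) \<ge> \<gamma> \<longrightarrow>
           (\<exists>Y. x powr (1/4) \<le> Y \<and> Y * (1 + \<delta>) ^ R \<le> x powr (3/4) \<and>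
              (\<forall>j<R. \<exists>m\<in>nups (Y * (1 + \<delta>) ^ Suc j) - nups (Y * (1 + \<delta>) ^ j).
                  almost_prime2 m \<and> norm (f m * A (x / real m) - A x) \<le> \<kappa>))"
proof -
  obtain C where C: "C > 0" "\<And>x. x \<ge> 1 \<Longrightarrow> (\<Sum>m\<in>{m\<in>nups x. \<not> almost_prime2 m}. lambda2 m / real m) \<le> C * (1 + ln x)"
    using sum_lambda2_not_almost_prime by blast
  obtain K where K: "K > 0" "\<And>x. x \<ge> y0 \<Longrightarrow> (\<Sum>m\<in>nups x. lambda2 m / real m * (norm (f m * A (x / real m) - A x))\<^sup>2)
            \<le> (\<beta>\<^sup>2 - (norm (A x))\<^sup>2) * (ln x)\<^sup>2 + K * (1 + ln x)"
    using near_equality[OF y0 \<beta>] by blast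
  obtain Yc where Yc: "Yc \<ge> 1" "\<And>y. y \<ge> Yc \<Longrightarrow> (\<Sum>m\<in>nups ((1 + \<delta>) * y) - nups y. lambda2 m / real m) \<ge> \<delta> / 2 * ln y"
    using sum_lambda2_cell[OF \<delta>] by blast
  define C' where "C' = C + K / \<kappa>\<^sup>2 + 1"
  have C'1: "C' \<ge> 1" using C K \<kappa> by (simp add: C'_def)
  \<comment> \<open>The contradiction at the end:
    \<open>L\<^sup>2 / (32 * real R) \<le> C' * (2 * L)\<close> gives
    \<open>L \<le> 64 * real R * C'\<close>. The power \<open>Yc ^ 4\<close> places
    \<open>x powr (1/4)\<close> above \<open>Yc\<close>.\<close>
  define X where "X = max (exp (64 * real R * C' + 1)) (max y0 (Yc ^ 4))"
  have "\<exists>Y. x powr (1/4) \<le> Y \<and> Y * (1 + \<delta>) ^ R \<le> x powr (3/4) \<and>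
              (\<forall>j<R. \<exists>m\<in>nups (Y * (1 + \<delta>) ^ Suc j) - nups (Y * (1 + \<delta>) ^ j).
                  almost_prime2 m \<and> norm (f m * A (x / real m) - A x) \<le> \<kappa>)"
    if x: "x \<ge> X" and Ax: "norm (A x) \<ge> \<gamma>" for x
  proof (rule ccontr)
    assume neg: "\<not> ?thesis"
    have xy0: "x \<ge> y0" "x \<ge> 1" "x \<ge> Yc ^ 4" using x y0 by (auto simp: X_def)
    define L where "L = ln x"
    have L1: "L \<ge> 64 * real R * C' + 1" using x xy0 by (simp add: X_def L_def ln_ge_iff)
    have "64 * real R * C' \<ge> 0" using C'1 by simp
    then have L0: "L \<ge> 1" using L1 by linarith
    define Y0 where "Y0 = x powr (1/4)"
    have Y0c: "Y0 \<ge> Yc"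
    proof -
      have "Yc = (Yc ^ 4) powr (1/4)" using Yc(1) by (simp add: powr_powr flip: powr_numeral)
      also have "\<dots> \<le> Y0" unfolding Y0_def using xy0 Yc(1) by (intro powr_mono2) auto
      finally show ?thesis .
    qed
    have Y0p: "Y0 \<ge> 1" using Y0c Yc by simp
    define q where "q = 1 + \<delta>"
    have q: "q > 1" "q \<le> 2" using \<delta> by (auto simp: q_def)
    have lq: "ln q > 0" "ln q \<le> \<delta>" using \<delta> ln_add_one_self_le_self[of \<delta>] by (auto simp: q_def)
    \<comment> \<open>As many cells as fit into the factor \<open>x powr (1/2)\<close>, that is, at
      least about \<open>L / (2 * \<delta>)\<close>.\<close>
    define J where "J = nat \<lfloor>L / (2 * ln q)\<rfloor>"
    have J1: "real J \<le> L / (2 * ln q)" using L0 lq by (simp add: J_def)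
    have J2: "real J \<ge> L / (2 * \<delta>) - 1"
    proof -
      have "L / (2 * \<delta>) \<le> L / (2 * ln q)" using L0 lq \<delta> by (intro divide_left_mono) auto
      also have "\<dots> - 1 \<le> real J" using L0 lq unfolding J_def by (simp add: linear)
      finally show ?thesis by simp
    qed
    have qJ: "q ^ J \<le> x powr (1/2)"
    proof -
      have "q ^ J = exp (real J * ln q)" using q by (simp add: exp_of_nat_mult)
      also have "real J * ln q \<le> L / 2" using J1 lq by (simp add: field_simps)
      also have "exp (L / 2) = x powr (1/2)" using xy0 by (simp add: powr_def L_def)
      finally show ?thesis by simp
    qed
    define y where "y j = Y0 * q ^ j" for j
    have ymono: "y i \<le> y j" if "i \<le> j" for i j
      unfolding y_def using q Y0p that by (intro mult_left_mono power_increasing) auto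
    have yY: "y j \<ge> Y0" for j using ymono[of 0 j] by (simp add: y_def)
    have ySuc: "y (Suc j) = (1 + \<delta>) * y j" for j by (simp add: y_def q_def)
    have ytop: "y j \<le> x powr (3/4)" if "j \<le> J" for j
    proof -
      have "y j \<le> y J" using that by (rule ymono)
      also have "\<dots> \<le> Y0 * x powr (1/2)" unfolding y_def using qJ Y0p by (intro mult_left_mono) auto
      also have "\<dots> = x powr (3/4)" unfolding Y0_def by (simp flip: powr_add)
      finally show ?thesis .
    qed
    have x34: "x powr (3/4) \<le> x" using xy0 powr_mono[of "3/4" 1 x] by simp
    define cell where "cell j = nups (y (Suc j)) - nups (y j)" for j
    define good where "good m \<longleftrightarrow> almost_prime2 m \<and> norm (f m * A (x / real m) - A x) \<le> \<kappa>" for m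
    define bad where "bad j \<longleftrightarrow> (\<forall>m\<in>cell j. \<not> good m)" for j
    have hit: "\<exists>j\<in>{i..<i+R}. bad j" if "i + R \<le> J" for i
    proof (rule ccontr)
      assume nb: "\<not> ?thesis"
      have yy: "y i * (1 + \<delta>) ^ j = y (i + j)" for j by (simp add: y_def q_def power_add)
      have "x powr (1/4) \<le> y i" using yY[of i] by (simp add: Y0_def)
      moreover have "y i * (1 + \<delta>) ^ R \<le> x powr (3/4)" unfolding yy by (rule ytop[OF that])
      moreover have "\<exists>m\<in>nups (y i * (1 + \<delta>) ^ Suc j) - nups (y i * (1 + \<delta>) ^ j). good m" if "j < R" for j
      proof -
        have "\<not> bad (i + j)" using nb that by auto
        then show ?thesis unfolding bad_def cell_def yy by auto
      qed
      ultimately show False using neg unfolding good_def by blast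
    qed
    define w where "w m = lambda2 m / real m" for m
    have w0: "w m \<ge> 0" for m by (simp add: w_def lambda2_nonneg)
    \<comment> \<open>Markov's inequality in pointwise form: \<open>h\<close> dominates the weight
      at every \<open>m\<close> that fails to be good, for either of the two reasons.\<close>
    define h where "h m = (if almost_prime2 m then 0 else w m) + w m * (norm (f m * A (x / real m) - A x))\<^sup>2 / \<kappa>\<^sup>2" for m
    have h0: "h m \<ge> 0" for m using w0 by (simp add: h_def)
    have hw: "w m \<le> h m" if "\<not> good m" for m
    proof (cases "almost_prime2 m")
      case True
      then have "\<kappa> \<le> norm (f m * A (x / real m) - A x)" using that by (auto simp: good_def)
      then have "\<kappa>\<^sup>2 \<le> (norm (f m * A (x / real m) - A x))\<^sup>2" using \<kappa> by (intro power_mono) auto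
      then have "w m * \<kappa>\<^sup>2 \<le> w m * (norm (f m * A (x / real m) - A x))\<^sup>2" using w0 by (intro mult_left_mono)
      then show ?thesis using True \<kappa> by (simp add: h_def field_simps)
    next
      case False then show ?thesis using w0 by (simp add: h_def)
    qed
    define BJ where "BJ = {j\<in>{..<J}. bad j}"
    have cardB: "real (J div R) \<le> real (card BJ)" using card_ge_if_no_run[OF R hit] by (simp add: BJ_def)
    have disj: "cell i \<inter> cell j = {}" if "i \<noteq> j" for i j
    proof -
      have *: "cell i \<inter> cell j = {}" if "i < j" for i j
        using ymono[of "Suc i" j] that unfolding cell_def by force
      show ?thesis using *[of i j] *[of j i] that by (cases "i < j") auto
    qed
    have cellsub: "cell j \<subseteq> nups x" if "j < J" for j
      using ytop[of "Suc j"] that x34 unfolding cell_def by force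
    have "real (card BJ) * (\<delta> / 8 * L) \<le> (\<Sum>j\<in>BJ. \<Sum>m\<in>cell j. h m)"
    proof -
      have "\<delta> / 8 * L \<le> (\<Sum>m\<in>cell j. h m)" if "j \<in> BJ" for j
      proof -
        have "L / 4 \<le> ln (y j)"
        proof -
          have "L / 4 = ln Y0" using xy0 by (simp add: Y0_def L_def ln_powr)
          also have "\<dots> \<le> ln (y j)" using yY[of j] Y0p by simp
          finally show ?thesis .
        qed
        then have "\<delta> / 8 * L \<le> \<delta> / 2 * ln (y j)" using \<delta> mult_left_mono[of "L/4" "ln (y j)" "\<delta>/2"] by simp
        also have "\<dots> \<le> (\<Sum>m\<in>cell j. w m)" unfolding cell_def ySuc w_def using yY[of j] Y0c by (intro Yc(2)) auto
        also have "\<dots> \<le> (\<Sum>m\<in>cell j. h m)" using that by (intro sum_mono hw) (auto simp: BJ_def bad_def)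
        finally show ?thesis .
      qed
      then have "(\<Sum>j\<in>BJ. \<delta> / 8 * L) \<le> (\<Sum>j\<in>BJ. \<Sum>m\<in>cell j. h m)" by (rule sum_mono)
      then show ?thesis by simp
    qed
    also have "(\<Sum>j\<in>BJ. \<Sum>m\<in>cell j. h m) = (\<Sum>m\<in>(\<Union>j\<in>BJ. cell j). h m)"
      by (subst sum.UNION_disjoint) (use disj in \<open>auto simp: BJ_def cell_def\<close>)
    also have "\<dots> \<le> (\<Sum>m\<in>nups x. h m)"
      by (intro sum_mono2 h0) (use cellsub in \<open>auto simp: BJ_def\<close>)
    also have "\<dots> = (\<Sum>m\<in>{m\<in>nups x. \<not> almost_prime2 m}. w m) +
        (\<Sum>m\<in>nups x. w m * (norm (f m * A (x / real m) - A x))\<^sup>2) / \<kappa>\<^sup>2"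
    proof -
      have "(\<Sum>m\<in>nups x. if almost_prime2 m then 0 else w m) = (\<Sum>m\<in>{m\<in>nups x. \<not> almost_prime2 m}. w m)"
        by (rule sum.mono_neutral_cong_right) auto
      then show ?thesis by (simp add: h_def sum.distrib sum_divide_distrib)
    qed
    also have "\<dots> \<le> C * (1 + L) + ((\<kappa>\<^sup>2 / (32 * real R)) * L\<^sup>2 + K * (1 + L)) / \<kappa>\<^sup>2"
    proof (intro add_mono divide_right_mono)
      show "(\<Sum>m\<in>{m\<in>nups x. \<not> almost_prime2 m}. w m) \<le> C * (1 + L)" unfolding w_def L_def by (rule C(2)) fact
      have "(\<Sum>m\<in>nups x. w m * (norm (f m * A (x / real m) - A x))\<^sup>2) \<le> (\<beta>\<^sup>2 - (norm (A x))\<^sup>2) * L\<^sup>2 + K * (1 + L)"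
        unfolding w_def L_def by (rule K(2)) fact
      also have "(\<beta>\<^sup>2 - (norm (A x))\<^sup>2) * L\<^sup>2 \<le> (\<kappa>\<^sup>2 / (32 * real R)) * L\<^sup>2"
      proof (intro mult_right_mono)
        have "\<gamma>\<^sup>2 \<le> (norm (A x))\<^sup>2" using Ax \<gamma>(1) by (intro power_mono) auto
        then show "\<beta>\<^sup>2 - (norm (A x))\<^sup>2 \<le> \<kappa>\<^sup>2 / (32 * real R)" using \<gamma>(2) by linarith
      qed auto
      finally show "(\<Sum>m\<in>nups x. w m * (norm (f m * A (x / real m) - A x))\<^sup>2) \<le> (\<kappa>\<^sup>2 / (32 * real R)) * L\<^sup>2 + K * (1 + L)" by simp
    qed auto
    also have "\<dots> = L\<^sup>2 / (32 * real R) + (C + K / \<kappa>\<^sup>2) * (1 + L)"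
      using \<kappa> R by (simp add: field_simps)
    finally have up: "real (card BJ) * (\<delta> / 8 * L) \<le> L\<^sup>2 / (32 * real R) + (C + K / \<kappa>\<^sup>2) * (1 + L)" .
    have "L\<^sup>2 / (16 * real R) - \<delta> / 4 * L \<le> real (card BJ) * (\<delta> / 8 * L)"
    proof -
      have R1: "real R \<ge> 1" using R by simp
      have "real J / real R - 1 \<le> real (J div R)"
      proof -
        have "J = (J div R) * R + J mod R" by simp
        then have "real J = real (J div R) * real R + real (J mod R)" by (metis of_nat_add of_nat_mult)
        moreover have "real (J mod R) \<le> real R" using R by (simp add: less_imp_le)
        ultimately show ?thesis using R1 by (simp add: field_simps)
      qed
      then have "(L / (2 * \<delta>) - 1) / real R - 1 \<le> real (card BJ)"
        using divide_right_mono[OF J2, of "real R"] cardB R1 by linarith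
      moreover have "1 / real R \<le> 1" using R1 by simp
      ultimately have "L / (2 * \<delta>) / real R - 2 \<le> real (card BJ)" by (simp add: diff_divide_distrib)
      then have "(L / (2 * \<delta>) / real R - 2) * (\<delta> / 8 * L) \<le> real (card BJ) * (\<delta> / 8 * L)"
        using \<delta> L0 by (intro mult_right_mono) auto
      moreover have "(L / (2 * \<delta>) / real R - 2) * (\<delta> / 8 * L) = L\<^sup>2 / (16 * real R) - \<delta> / 4 * L"
        using \<delta> R1 by (simp add: field_simps power2_eq_square)
      ultimately show ?thesis by simp
    qed
    then have "L\<^sup>2 / (16 * real R) - L\<^sup>2 / (32 * real R) \<le> (C + K / \<kappa>\<^sup>2) * (1 + L) + \<delta> / 4 * L"
      using up by linarith
    also have "\<delta> / 4 * L \<le> 1 * (1 + L)" using \<delta> L0 by (intro mult_mono) auto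
    also have "(C + K / \<kappa>\<^sup>2) * (1 + L) + 1 * (1 + L) = C' * (1 + L)" by (simp add: C'_def algebra_simps)
    also have "\<dots> \<le> C' * (2 * L)" using C'1 L0 by (intro mult_left_mono) auto
    finally have "L\<^sup>2 / (32 * real R) \<le> C' * (2 * L)" using R by (simp add: field_simps)
    then have "L * L \<le> (64 * real R * C') * L" using R by (simp add: field_simps power2_eq_square)
    then have "L \<le> 64 * real R * C'" using L0 by simp
    then show False using L1 by linarith
  qed
  moreover have "X \<ge> 1" using y0 by (simp add: X_def)
  ultimately show ?thesis by blast
qed

end

lemma not_summable_reciprocals:
  assumes "\<not> (\<lambda>p. 1 / real p) summable_on Q"
  shows "\<exists>P. finite P \<and> P \<subseteq> Q \<and> B \<le> (\<Sum>p\<in>P. 1 / real p)"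
proof (rule ccontr)
  assume neg: "\<not> ?thesis"
  have "(\<lambda>p. 1 / real p) summable_on Q"
  proof (rule nonneg_bdd_above_summable_on)
    show "bdd_above (sum (\<lambda>p. 1 / real p) ` {F. F \<subseteq> Q \<and> finite F})"
    proof (rule bdd_aboveI[of _ B])
      fix s assume "s \<in> sum (\<lambda>p. 1 / real p) ` {F. F \<subseteq> Q \<and> finite F}"
      then obtain F where "F \<subseteq> Q" "finite F" "s = (\<Sum>p\<in>F. 1 / real p)" by auto
      then show "s \<le> B" using neg by (meson linear)
    qed
  qed auto
  then show False using assms by simp
qed

text \<open>\<open>\<alpha>\<close> is the upper limit of the modulus, described by its two
  approximation properties; it is positive because \<open>A\<close> does not tend to 0.\<close>

lemma limsup_norm_exists:
  fixes A :: "real \<Rightarrow> complex"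
  assumes b: "\<And>x. x \<ge> 0 \<Longrightarrow> norm (A x) \<le> 1" and n: "\<not> (A \<longlongrightarrow> 0) at_top"
  obtains \<alpha> where "0 < \<alpha>" "\<alpha> \<le> 1"
    "\<And>e. e > 0 \<Longrightarrow> \<exists>y0\<ge>1. \<forall>y\<ge>y0. norm (A y) \<le> \<alpha> + e"
    "\<And>e X. e > 0 \<Longrightarrow> \<exists>x\<ge>X. norm (A x) \<ge> \<alpha> - e"
proof -
  define Q where "Q = {c. \<exists>y0\<ge>1. \<forall>y\<ge>y0. norm (A y) \<le> c}"
  have Q1: "1 \<in> Q" unfolding Q_def using b by (auto intro!: exI[of _ 1])
  have Q0: "c \<ge> 0" if "c \<in> Q" for c
    using that unfolding Q_def by (auto intro: order_trans[OF norm_ge_zero])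
  have bdd: "bdd_below Q" by (rule bdd_belowI[of _ 0]) (rule Q0)
  define \<alpha> where "\<alpha> = Inf Q"
  have a0: "\<alpha> \<ge> 0" unfolding \<alpha>_def using Q1 Q0 by (intro cInf_greatest) auto
  have a1: "\<alpha> \<le> 1" unfolding \<alpha>_def using Q1 bdd by (rule cInf_lower)
  have up: "\<exists>y0\<ge>1. \<forall>y\<ge>y0. norm (A y) \<le> \<alpha> + e" if e: "e > 0" for e
  proof -
    have "\<exists>c\<in>Q. c < \<alpha> + e" using e Q1 unfolding \<alpha>_def by (intro cInf_lessD) auto
    then obtain c where c: "c \<in> Q" "c < \<alpha> + e" by blast
    then obtain y0 where "y0 \<ge> 1" "\<forall>y\<ge>y0. norm (A y) \<le> c" unfolding Q_def by blast
    then show ?thesis using c by (intro exI[of _ y0]) force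
  qed
  have lo: "\<exists>x\<ge>X. norm (A x) \<ge> \<alpha> - e" if e: "e > 0" for e X
  proof (rule ccontr)
    assume "\<not> ?thesis"
    then have "\<forall>x\<ge>max X 1. norm (A x) \<le> \<alpha> - e" by (meson linear max.boundedE)
    then have "\<alpha> - e \<in> Q" unfolding Q_def by (intro CollectI exI[of _ "max X 1"]) auto
    then have "\<alpha> \<le> \<alpha> - e" unfolding \<alpha>_def using bdd by (rule cInf_lower)
    then show False using e by simp
  qed
  have "\<alpha> \<noteq> 0"
  proof
    assume z: "\<alpha> = 0"
    have "(A \<longlongrightarrow> 0) at_top"
    proof (rule tendstoI)
      fix e :: real assume e: "e > 0"
      obtain y0 where "\<forall>y\<ge>y0. norm (A y) \<le> \<alpha> + e/2" using up[of "e/2"] e by auto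
      then show "eventually (\<lambda>x. dist (A x) 0 < e) at_top"
        using e z by (intro eventually_at_top_linorderI[of y0]) (auto simp: dist_norm intro: order_le_less_trans)
    qed
    then show False using n by simp
  qed
  then show ?thesis using that[of \<alpha>] a0 a1 up lo by auto
qed

context completely_mult
begin

lemma finite_values_almost_prime2:
  assumes "finite (f ` {p. prime p})"
  shows "finite (f ` {m. almost_prime2 m})"
proof (rule finite_subset)
  let ?V = "f ` {p. prime p}"
  show "finite (?V \<union> (\<lambda>(u,v). u * v) ` (?V \<times> ?V))" using assms by auto
  show "f ` {m. almost_prime2 m} \<subseteq> ?V \<union> (\<lambda>(u,v). u * v) ` (?V \<times> ?V)"
  proof
    fix t assume "t \<in> f ` {m. almost_prime2 m}"
    then obtain m where m: "almost_prime2 m" "t = f m" by auto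
    show "t \<in> ?V \<union> (\<lambda>(u,v). u * v) ` (?V \<times> ?V)"
    proof (cases "prime m")
      case True then show ?thesis using m by auto
    next
      case False
      then obtain p q where pq: "prime p" "prime q" "m = p * q" using m by (auto simp: almost_prime2_def)
      then have "t = f p * f q" using m mult[of p q] prime_ge_1_nat[OF pq(1)] prime_ge_1_nat[OF pq(2)] by simp
      then show ?thesis using pq by (intro UnI2 image_eqI[of _ _ "(f p, f q)"]) auto
    qed
  qed
qed

text \<open>
  On a run of good cells the mean value is locked to a finite separated set of unit multiples of
  \<open>A x\<close>; it moves too slowly to jump between them, so it is constant over a long multiplicative
  range, which is incompatible with the weighted average over primes with \<open>f p = z\<close>.
\<close>
theorem mean_value_zero:
  assumes fin: "finite (f ` {p. prime p})"
    and z: "z \<noteq> 1" and div: "\<not> (\<lambda>p. 1 / real p) summable_on {p. prime p \<and> f p = z}"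
  shows "(A \<longlongrightarrow> 0) at_top"
proof (rule ccontr)
  assume neg: "\<not> ?thesis"
  obtain \<alpha> where \<alpha>: "0 < \<alpha>" "\<alpha> \<le> 1" "\<And>e. e > 0 \<Longrightarrow> \<exists>y0\<ge>1. \<forall>y\<ge>y0. norm (A y) \<le> \<alpha> + e"
    "\<And>e X. e > 0 \<Longrightarrow> \<exists>x\<ge>X. norm (A x) \<ge> \<alpha> - e"
    using limsup_norm_exists[OF norm_A_le neg] by blast
  define c where "c = norm (1 - z)"
  have c0: "c > 0" using z by (simp add: c_def)
  \<comment> \<open>The bound makes the Turan-Kubilius error \<open>sqrt (2 * \<Lambda>)\<close> at
    most \<open>\<Lambda> * (\<alpha> * c / 8)\<close>.\<close>
  obtain P where P: "finite P" "P \<subseteq> {p. prime p \<and> f p = z}" "128 / (\<alpha> * c)\<^sup>2 \<le> (\<Sum>p\<in>P. 1 / real p)"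
    using not_summable_reciprocals[OF div] by blast
  define \<Lambda> where "\<Lambda> = (\<Sum>p\<in>P. 1 / real p)"
  have L128: "128 / (\<alpha> * c)\<^sup>2 \<le> \<Lambda>" using P by (simp add: \<Lambda>_def)
  have L0: "\<Lambda> > 0" using L128 \<alpha> c0 by (smt (verit) divide_pos_pos zero_less_power mult_pos_pos)
  have Pne: "P \<noteq> {}" using L0 by (auto simp: \<Lambda>_def)
  have Pp: "prime p" "f p = z" "p \<ge> 1" if "p \<in> P" for p using P that prime_ge_1_nat[of p] by auto
  have z1: "norm z \<le> 1" using Pne Pp norm_le_1 by (metis ex_in_conv)
  \<comment> \<open>At a good \<open>m\<close> the value \<open>f m\<close> will have modulus 1, so
    that \<open>A (x / m)\<close> is close to \<open>cnj (f m) * A x\<close>; \<open>T\<close>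
    contains all possible multipliers.\<close>
  define T where "T = cnj ` f ` {m. almost_prime2 m}"
  have "finite T" unfolding T_def by (intro finite_imageI finite_values_almost_prime2 fin)
  from finite_separated[OF this] obtain \<sigma> where \<sigma>: "\<sigma> > 0" "\<forall>s\<in>T. \<forall>t\<in>T. s \<noteq> t \<longrightarrow> \<sigma> \<le> dist s t"
    by blast
  \<comment> \<open>Three demands: \<open>\<delta> < \<alpha> / 2\<close> excludes
    \<open>f m = 0\<close>; \<open>8 * \<delta> \<le> \<alpha> * c / 8\<close> serves the final
    contradiction; \<open>8 * \<delta> < \<sigma> * (\<alpha> / 2)\<close> forbids a change of
    multiplier between adjacent cells, with 17 in place of 16 for strictness.\<close>
  define \<delta> where "\<delta> = min (1/4 * \<alpha>) (min (\<alpha> * c / 64) (\<sigma> * \<alpha> / 17))"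
  have \<delta>: "\<delta> > 0" "\<delta> \<le> 1" "\<delta> < \<alpha> / 2" "8 * \<delta> \<le> \<alpha> * c / 8" "8 * \<delta> < \<sigma> * (\<alpha> / 2)"
  proof -
    show "\<delta> > 0" using \<alpha> c0 \<sigma> by (simp add: \<delta>_def)
    have a: "\<delta> \<le> 1/4 * \<alpha>" "\<delta> \<le> \<alpha> * c / 64" "\<delta> \<le> \<sigma> * \<alpha> / 17" by (simp_all add: \<delta>_def)
    have "\<sigma> * \<alpha> > 0" using \<sigma> \<alpha> by simp
    then show "\<delta> \<le> 1" "\<delta> < \<alpha> / 2" "8 * \<delta> \<le> \<alpha> * c / 8" "8 * \<delta> < \<sigma> * (\<alpha> / 2)" using a \<alpha> by auto
  qed
  define q where "q = 1 + \<delta>"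
  have q: "q > 1" using \<delta> by (simp add: q_def)
  \<comment> \<open>The run of cells has to span the multiplicative range of the primes in
    \<open>P\<close>.\<close>
  define Kp where "Kp = real (Max P)"
  obtain R0 where R0: "Kp < q ^ R0" using real_arch_pow[OF q] by blast
  define R where "R = Suc R0"
  have R: "R \<ge> 1" "Kp \<le> q ^ R"
  proof -
    have "q ^ R0 \<le> q ^ R" using q by (intro power_increasing) (auto simp: R_def)
    then show "Kp \<le> q ^ R" using R0 by simp
  qed (simp add: R_def)
  \<comment> \<open>\<open>(\<alpha> + e)\<^sup>2 - (\<alpha> - e)\<^sup>2 = 4 * e *
    \<alpha>\<close> must not exceed the defect allowed in \<open>exists_good_run\<close>.\<close>
  define e where "e = min (\<alpha> / 2) (\<delta>\<^sup>2 / (128 * real R))"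
  have e: "e > 0" "e \<le> \<alpha> / 2" "4 * e \<le> \<delta>\<^sup>2 / (32 * real R)"
    using \<alpha> \<delta> R by (auto simp: e_def min_def field_simps)
  obtain y0 where y0: "y0 \<ge> 1" "\<And>y. y \<ge> y0 \<Longrightarrow> norm (A y) \<le> \<alpha> + e" using \<alpha>(3)[OF e(1)] by blast
  have "(\<alpha> + e)\<^sup>2 - (\<alpha> - e)\<^sup>2 = 4 * e * \<alpha>" by (simp add: power2_eq_square algebra_simps)
  also have "\<dots> \<le> 4 * e * 1" using \<alpha> e by (intro mult_left_mono) auto
  finally have sq: "(\<alpha> + e)\<^sup>2 - (\<alpha> - e)\<^sup>2 \<le> \<delta>\<^sup>2 / (32 * real R)" using e by linarith
  obtain X where X: "X \<ge> 1" "\<And>x. x \<ge> X \<Longrightarrow> norm (A x) \<ge> \<alpha> - e \<Longrightarrow>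
     (\<exists>Y. x powr (1/4) \<le> Y \<and> Y * (1 + \<delta>) ^ R \<le> x powr (3/4) \<and>
              (\<forall>j<R. \<exists>m\<in>nups (Y * (1 + \<delta>) ^ Suc j) - nups (Y * (1 + \<delta>) ^ j).
                  almost_prime2 m \<and> norm (f m * A (x / real m) - A x) \<le> \<delta>))"
    using exists_good_run[of \<delta> \<delta> R y0 "\<alpha> + e" "\<alpha> - e"] \<delta> R y0 \<alpha> e sq by (auto simp: algebra_simps)
  define X' where "X' = max X (max ((1 / \<delta>) ^ 4) ((2 * real (card P)) ^ 4))"
  obtain x where x: "x \<ge> X'" "norm (A x) \<ge> \<alpha> - e" using \<alpha>(4)[OF e(1)] by blast
  have x1: "x \<ge> 1" "x \<ge> X" "x \<ge> (1 / \<delta>) ^ 4" "x \<ge> (2 * real (card P)) ^ 4" using x X by (auto simp: X'_def)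
  have root4: "t \<le> x powr (1/4)" if "t > 0" "x \<ge> t ^ 4" for t
  proof -
    have "t = (t ^ 4) powr (1/4)" using that(1) by (simp add: powr_powr flip: powr_numeral)
    also have "\<dots> \<le> x powr (1/4)" using that by (intro powr_mono2) auto
    finally show ?thesis .
  qed
  have x14: "1 / \<delta> \<le> x powr (1/4)" using x1 \<delta> by (intro root4) auto
  have x14': "2 * real (card P) \<le> x powr (1/4)" using x1 P Pne by (intro root4) (auto simp: card_gt_0_iff)
  have xq: "x / x powr (3/4) = x powr (1/4)"
  proof -
    have "x powr (1/4) * x powr (3/4) = x" using x1 by (simp flip: powr_add)
    then show ?thesis using x1 by (simp add: field_simps)
  qed
  have x14one: "1 \<le> x powr (1/4)" using x1 by (simp add: ge_one_powr_ge_zero)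
  obtain Y where Y: "x powr (1/4) \<le> Y" "Y * q ^ R \<le> x powr (3/4)"
     "\<And>j. j < R \<Longrightarrow> \<exists>m\<in>nups (Y * q ^ Suc j) - nups (Y * q ^ j). almost_prime2 m \<and> norm (f m * A (x / real m) - A x) \<le> \<delta>"
    using X(2)[OF x1(2) x(2)] unfolding q_def by blast
  have Y1: "Y \<ge> 1" using Y(1) x14one by linarith
  from Y(3) obtain M where M: "\<And>j. j < R \<Longrightarrow> M j \<in> nups (Y * q ^ Suc j) - nups (Y * q ^ j)"
      "\<And>j. j < R \<Longrightarrow> almost_prime2 (M j)" "\<And>j. j < R \<Longrightarrow> norm (f (M j) * A (x / real (M j)) - A x) \<le> \<delta>"
    by metis
  have Ax: "norm (A x) \<ge> \<alpha> / 2" using x(2) e by linarith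
  have ytop: "Y * q ^ j \<le> x powr (3/4)" if "j \<le> R" for j
  proof -
    have "Y * q ^ j \<le> Y * q ^ R" using that q Y1 by (intro mult_left_mono power_increasing) auto
    then show ?thesis using Y(2) by simp
  qed
  have near: "norm (A (x / u) - A (x / v)) \<le> 3 * \<delta>"
    if j: "j < R" and u: "Y * q ^ j \<le> u" "u \<le> Y * q ^ Suc j" and v: "Y * q ^ j \<le> v" "v \<le> Y * q ^ Suc j" for j u v
  proof -
    have yp: "Y * q ^ j \<ge> 1" using mult_mono[of 1 Y 1 "q ^ j"] Y1 q by simp
    have big: "x powr (1/4) \<le> x / t" if "Y * q ^ j \<le> t" "t \<le> Y * q ^ Suc j" for t
    proof -
      have "t \<le> x powr (3/4)" using that ytop[of "Suc j"] j by simp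
      then have "x / x powr (3/4) \<le> x / t" using that yp x1 by (intro divide_left_mono) auto
      then show ?thesis using xq by simp
    qed
    have ratio: "x / s \<le> (1 + \<delta>) * (x / t)" if "Y * q ^ j \<le> s" "Y * q ^ j \<le> t" "t \<le> Y * q ^ Suc j" for s t
    proof -
      have "t \<le> q * (Y * q ^ j)" using that by (simp add: mult_ac)
      also have "\<dots> \<le> q * s" using that q by (intro mult_left_mono) auto
      finally have "t \<le> q * s" .
      then have "x * t \<le> x * (q * s)" using x1 by (intro mult_left_mono) auto
      then show ?thesis using that yp x1 by (simp add: q_def field_simps)
    qed
    show ?thesis
      by (rule A_lipschitz_ratio) (use \<delta> big[OF u] big[OF v] x14 x14one ratio u v in auto)
  qed
  have Min: "Y * q ^ j \<le> real (M j)" "real (M j) \<le> Y * q ^ Suc j" "M j \<ge> 1" if "j < R" for j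
    using M(1)[OF that] by auto
  have nf: "norm (f (M j)) = 1" if "j < R" for j
  proof (rule ccontr)
    assume "norm (f (M j)) \<noteq> 1"
    then have "f (M j) = 0" using norm_01[of "M j"] Min(3)[OF that] by auto
    then have "norm (A x) \<le> \<delta>" using M(3)[OF that] by simp
    then show False using Ax \<delta> by linarith
  qed
  define t where "t j = cnj (f (M j))" for j
  have tT: "t j \<in> T" if "j < R" for j using M(2)[OF that] by (auto simp: t_def T_def)
  have tA: "norm (A (x / real (M j)) - t j * A x) \<le> \<delta>" if j: "j < R" for j
  proof -
    have "t j * f (M j) = 1" using nf[OF j] unfolding t_def
      by (metis complex_norm_square mult.commute of_real_1 power_one)
    then have "A (x / real (M j)) - t j * A x = t j * (f (M j) * A (x / real (M j)) - A x)"
      by (simp add: algebra_simps)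
    then have "norm (A (x / real (M j)) - t j * A x) = norm (f (M j) * A (x / real (M j)) - A x)"
      using nf[OF j] by (simp add: norm_mult t_def)
    then show ?thesis using M(3)[OF j] by simp
  qed
  have tstep: "t j = t (Suc j)" if j: "Suc j < R" for j
  proof (rule ccontr)
    assume ne: "t j \<noteq> t (Suc j)"
    \<comment> \<open>The common endpoint of two adjacent cells links their good points:
      \<open>3 * \<delta>\<close> on either side and \<open>\<delta>\<close> for each multiplier
      make \<open>8 * \<delta>\<close>.\<close>
    let ?u = "Y * q ^ Suc j"
    have yp: "Y * q ^ j \<le> ?u" "?u \<le> Y * q ^ Suc (Suc j)"
      using q Y1 by (auto intro!: mult_left_mono power_increasing simp del: power_Suc)
    have 1: "norm (A (x / real (M j)) - A (x / ?u)) \<le> 3 * \<delta>"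
      using j yp Min[of j] by (intro near[of j]) auto
    have 2: "norm (A (x / ?u) - A (x / real (M (Suc j)))) \<le> 3 * \<delta>"
      using j yp Min[of "Suc j"] by (intro near[of "Suc j"]) auto
    have "norm (t j * A x - t (Suc j) * A x) = norm (- (A (x / real (M j)) - t j * A x) + (A (x / real (M j)) - A (x / ?u))
        + (A (x / ?u) - A (x / real (M (Suc j)))) + (A (x / real (M (Suc j))) - t (Suc j) * A x))" by simp
    also have "\<dots> \<le> \<delta> + 3 * \<delta> + 3 * \<delta> + \<delta>"
      by (intro norm_triangle_mono 1 2) (use tA[of j] tA[of "Suc j"] j in \<open>simp_all add: norm_minus_commute\<close>)
    finally have "norm (t j - t (Suc j)) * norm (A x) \<le> 8 * \<delta>" by (simp add: norm_mult[symmetric] algebra_simps)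
    moreover have "\<sigma> * (\<alpha> / 2) \<le> norm (t j - t (Suc j)) * norm (A x)"
      using \<sigma>(2) tT[of j] tT[of "Suc j"] ne j Ax \<alpha> by (intro mult_mono) (auto simp: dist_norm)
    ultimately show False using \<delta>(5) by linarith
  qed
  have tconst: "t j = t 0" if "j < R" for j using that
  proof (induction j)
    case (Suc j)
    then show ?case using tstep[OF Suc.prems] by simp
  qed simp
  define a where "a = t 0 * A x"
  have na: "norm a = norm (A x)" using nf[of 0] R by (simp add: a_def t_def norm_mult)
  have close: "norm (A (x / Y / p) - a) \<le> 4 * \<delta>" if p: "1 \<le> p" "p \<le> Kp" for p
  proof -
    obtain j where j: "j < R" "q ^ j \<le> p" "p \<le> q ^ Suc j" using power_between[OF q p(1) order_trans[OF p(2) R(2)] R(1)] by blast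
    have "norm (A (x / (Y * p)) - A (x / real (M j))) \<le> 3 * \<delta>"
      by (rule near[OF j(1)]) (use j Y1 Min[OF j(1)] in \<open>auto intro!: mult_left_mono simp del: power_Suc\<close>)
    moreover have "norm (A (x / real (M j)) - a) \<le> \<delta>" using tA[OF j(1)] tconst[OF j(1)] by (simp add: a_def)
    ultimately have "norm ((A (x / (Y * p)) - A (x / real (M j))) + (A (x / real (M j)) - a)) \<le> 3 * \<delta> + \<delta>"
      by (rule norm_triangle_mono)
    then show ?thesis by simp
  qed
  have Kp1: "real p \<le> Kp" if "p \<in> P" for p using that P by (simp add: Kp_def)
  have Kp1': "1 \<le> Kp" using Pne Kp1 Pp by (metis ex_in_conv of_nat_1 of_nat_le_iff order_trans)
  have xY: "x / Y \<ge> x powr (1/4)"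
  proof -
    have "Y \<le> x powr (3/4)" using ytop[of 0] by simp
    then have "x / x powr (3/4) \<le> x / Y" using Y1 x1 by (intro divide_left_mono) auto
    then show ?thesis using xq by simp
  qed
  have tk: "norm (of_real \<Lambda> * A (x / Y) - z * (\<Sum>p\<in>P. A (x / Y / real p) / of_nat p)) \<le> sqrt (2 * \<Lambda>)"
    unfolding \<Lambda>_def by (rule turan_kubilius_A) (use P(1) Pp xY x14 x14' x14one in auto)
  have s1: "norm (of_real \<Lambda> * A (x / Y) - of_real \<Lambda> * a) \<le> \<Lambda> * (4 * \<delta>)"
    using close[of 1] Kp1' L0 by (simp add: right_diff_distrib[symmetric] norm_mult del: right_diff_distrib)
  have s2: "norm (z * (\<Sum>p\<in>P. A (x / Y / real p) / of_nat p) - z * (of_real \<Lambda> * a)) \<le> \<Lambda> * (4 * \<delta>)"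
  proof -
    have "(\<Sum>p\<in>P. A (x / Y / real p) / of_nat p) - of_real \<Lambda> * a = (\<Sum>p\<in>P. (A (x / Y / real p) - a) / of_nat p)"
      by (simp add: \<Lambda>_def diff_divide_distrib sum_subtractf sum_distrib_right)
    also have "norm \<dots> \<le> (\<Sum>p\<in>P. 4 * \<delta> / real p)"
    proof (rule sum_norm_le)
      fix p assume p: "p \<in> P"
      have "norm (A (x / Y / real p) - a) \<le> 4 * \<delta>" using close[of "real p"] Kp1[OF p] Pp(3)[OF p] by simp
      then show "norm ((A (x / Y / real p) - a) / of_nat p) \<le> 4 * \<delta> / real p"
        by (simp add: norm_divide divide_right_mono)
    qed
    also have "\<dots> = \<Lambda> * (4 * \<delta>)" by (simp add: \<Lambda>_def sum_distrib_right)
    finally have "norm z * norm ((\<Sum>p\<in>P. A (x / Y / real p) / of_nat p) - of_real \<Lambda> * a) \<le> 1 * (\<Lambda> * (4 * \<delta>))"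
      using z1 by (intro mult_mono) auto
    then show ?thesis by (simp add: right_diff_distrib norm_mult[symmetric])
  qed
  \<comment> \<open>Up to \<open>4 * \<delta>\<close>, the mean value equals \<open>a\<close> at
    \<open>x / Y\<close> and at all \<open>x / Y / p\<close>. Hence \<open>c * norm a\<close> is at
    most \<open>\<alpha> * c / 4\<close>, whereas it is at least
    \<open>\<alpha> * c / 2\<close>.\<close>
  have "\<Lambda> * (c * norm a) = norm (of_real \<Lambda> * a - z * (of_real \<Lambda> * a))"
  proof -
    have "of_real \<Lambda> * a - z * (of_real \<Lambda> * a) = of_real \<Lambda> * ((1 - z) * a)" by (simp add: algebra_simps)
    then show ?thesis using L0 by (simp add: norm_mult c_def)
  qed
  also have "\<dots> = norm (- (of_real \<Lambda> * A (x / Y) - of_real \<Lambda> * a)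
       + (of_real \<Lambda> * A (x / Y) - z * (\<Sum>p\<in>P. A (x / Y / real p) / of_nat p))
       + (z * (\<Sum>p\<in>P. A (x / Y / real p) / of_nat p) - z * (of_real \<Lambda> * a)))" by (simp add: algebra_simps)
  also have "\<dots> \<le> \<Lambda> * (4 * \<delta>) + sqrt (2 * \<Lambda>) + \<Lambda> * (4 * \<delta>)"
    by (intro norm_triangle_mono tk s2) (use s1 in \<open>simp add: norm_minus_commute\<close>)
  also have "sqrt (2 * \<Lambda>) \<le> \<Lambda> * (\<alpha> * c / 8)"
  proof (rule real_le_lsqrt)
    have "128 \<le> \<Lambda> * (\<alpha> * c)\<^sup>2" using L128 \<alpha> c0 by (simp add: field_simps)
    then have "\<Lambda> * 128 \<le> \<Lambda> * (\<Lambda> * (\<alpha> * c)\<^sup>2)" using L0 by (intro mult_left_mono) auto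
    then show "2 * \<Lambda> \<le> (\<Lambda> * (\<alpha> * c / 8))\<^sup>2" by (simp add: power2_eq_square field_simps)
  qed (use L0 \<alpha> c0 in auto)
  finally have "\<Lambda> * (c * norm a) \<le> \<Lambda> * (8 * \<delta> + \<alpha> * c / 8)" by (simp add: algebra_simps)
  then have "c * norm a \<le> 8 * \<delta> + \<alpha> * c / 8" using L0 by simp
  moreover have "c * (\<alpha> / 2) \<le> c * norm a" using Ax na c0 by (intro mult_left_mono) auto
  moreover have "\<alpha> * c > 0" using \<alpha> c0 by simp
  ultimately show False using \<delta>(4) by (simp add: algebra_simps)
qed

end

section \<open>Sets with convergent reciprocal sum\<close>

abbreviation thin_set :: "nat set \<Rightarrow> bool" where
  "thin_set Q \<equiv> (\<lambda>p. 1 / real p) summable_on Q"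

lemma sparse_subset: "thin_set Q \<Longrightarrow> Q' \<subseteq> Q \<Longrightarrow> thin_set Q'"
  by (rule summable_on_subset_banach)

lemma sparse_finite: "finite Q \<Longrightarrow> thin_set Q"
  by simp

lemma sparse_UN:
  assumes "finite I" "\<And>i. i \<in> I \<Longrightarrow> thin_set (Q i)"
  shows "thin_set (\<Union>i\<in>I. Q i)"
  using assms
proof (induction I rule: finite_induct)
  case (insert i I)
  have "thin_set (Q i \<union> ((\<Union>i\<in>I. Q i) - Q i))"
    using insert by (intro summable_on_Un_disjoint) (auto intro: sparse_subset)
  then show ?case by (simp add: Un_Diff_cancel)
qed simp

lemma sparse_Un: "thin_set P \<Longrightarrow> thin_set Q \<Longrightarrow> thin_set (P \<union> Q)"
  using sparse_UN[of "{True, False}" "\<lambda>b. if b then P else Q"] by (simp add: Un_commute)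

lemma sparse_tail:
  assumes "thin_set B" "e > 0"
  shows "\<exists>F. finite F \<and> F \<subseteq> B \<and> (\<forall>P. finite P \<longrightarrow> P \<subseteq> B - F \<longrightarrow> (\<Sum>p\<in>P. 1 / real p) \<le> e)"
proof -
  obtain s where "((\<lambda>p. 1 / real p) has_sum s) B" using assms by (auto simp: summable_on_def)
  then have "(sum (\<lambda>p. 1 / real p) \<longlongrightarrow> s) (finite_subsets_at_top B)" by (simp add: has_sum_def)
  then have "eventually (\<lambda>F. dist (\<Sum>p\<in>F. 1 / real p) s < e / 2) (finite_subsets_at_top B)"
    using assms(2) tendstoD[of _ s _ "e/2"] by auto
  then obtain F where F: "finite F" "F \<subseteq> B"
      "\<forall>G. finite G \<and> F \<subseteq> G \<and> G \<subseteq> B \<longrightarrow> dist (\<Sum>p\<in>G. 1 / real p) s < e / 2"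
    unfolding eventually_finite_subsets_at_top by metis
  show ?thesis
  proof (intro exI[of _ F] conjI allI impI F(1,2))
    fix P assume P: "finite P" "P \<subseteq> B - F"
    have "(\<Sum>p\<in>F \<union> P. 1 / real p) = (\<Sum>p\<in>F. 1 / real p) + (\<Sum>p\<in>P. 1 / real p)"
      using P F by (intro sum.union_disjoint) auto
    moreover have "dist (\<Sum>p\<in>F \<union> P. 1 / real p) s < e / 2" using P F by auto
    moreover have "dist (\<Sum>p\<in>F. 1 / real p) s < e / 2" using F by auto
    ultimately show "(\<Sum>p\<in>P. 1 / real p) \<le> e" unfolding dist_real_def by linarith
  qed
qed

lemma sparse_count:
  assumes "thin_set B" "e > 0"
  shows "\<exists>K\<ge>0. \<forall>x\<ge>0. real (card (B \<inter> nups x)) \<le> e * x + K"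
proof -
  obtain F where F: "finite F" "F \<subseteq> B" "\<And>P. finite P \<Longrightarrow> P \<subseteq> B - F \<Longrightarrow> (\<Sum>p\<in>P. 1 / real p) \<le> e"
    using sparse_tail[OF assms] by blast
  show ?thesis
  proof (intro exI[of _ "real (card F)"] conjI allI impI)
    fix x :: real assume x: "x \<ge> 0"
    define P where "P = (B - F) \<inter> nups x"
    have "real (card P) = (\<Sum>p\<in>P. 1)" by simp
    also have "\<dots> \<le> (\<Sum>p\<in>P. x * (1 / real p))" by (intro sum_mono) (auto simp: P_def field_simps)
    also have "\<dots> \<le> x * e" using x F(3)[of P] by (subst sum_distrib_left[symmetric]) (auto simp: P_def intro!: mult_left_mono)
    finally have "real (card P) \<le> e * x" by (simp add: mult.commute)
    moreover have "card (B \<inter> nups x) \<le> card (P \<union> F)" using F(1) by (intro card_mono) (auto simp: P_def)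
    moreover have "card (P \<union> F) \<le> card P + card F" by (rule card_Un_le)
    ultimately show "real (card (B \<inter> nups x)) \<le> e * x + real (card F)" by linarith
  qed simp
qed

text \<open>Such a set contributes o(ln x) to Mertens' sum: beyond a finite set the reciprocals add
  up to at most \<open>e\<close>, and \<open>ln p\<close> is bounded by \<open>ln x\<close>.\<close>

lemma sparse_log_sum:
  assumes "thin_set B" "e > 0"
  shows "\<exists>K\<ge>0. \<forall>x\<ge>1. (\<Sum>p\<in>B \<inter> nups x. ln (real p) / real p) \<le> e * ln x + K"
proof -
  obtain F where F: "finite F" "F \<subseteq> B" "\<And>P. finite P \<Longrightarrow> P \<subseteq> B - F \<Longrightarrow> (\<Sum>p\<in>P. 1 / real p) \<le> e"
    using sparse_tail[OF assms] by blast
  define K where "K = (\<Sum>p\<in>F. \<bar>ln (real p) / real p\<bar>)"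
  show ?thesis
  proof (intro exI[of _ K] conjI allI impI)
    fix x :: real assume x: "x \<ge> 1"
    define P where "P = (B - F) \<inter> nups x"
    have "(\<Sum>p\<in>B \<inter> nups x. ln (real p) / real p) \<le> (\<Sum>p\<in>P \<union> (F \<inter> nups x). ln (real p) / real p)"
      using F(1) by (intro sum_mono2) (auto simp: P_def)
    also have "\<dots> = (\<Sum>p\<in>P. ln (real p) / real p) + (\<Sum>p\<in>F \<inter> nups x. ln (real p) / real p)"
      using F by (intro sum.union_disjoint) (auto simp: P_def)
    also have "(\<Sum>p\<in>P. ln (real p) / real p) \<le> (\<Sum>p\<in>P. ln x * (1 / real p))"
      by (intro sum_mono) (auto simp: P_def field_simps)
    also have "\<dots> \<le> ln x * e" using x F(3)[of P] by (subst sum_distrib_left[symmetric]) (auto simp: P_def intro!: mult_left_mono)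
    also have "(\<Sum>p\<in>F \<inter> nups x. ln (real p) / real p) \<le> (\<Sum>p\<in>F \<inter> nups x. \<bar>ln (real p) / real p\<bar>)"
      by (intro sum_mono) simp
    also have "\<dots> \<le> K" unfolding K_def using F(1) by (intro sum_mono2) auto
    finally show "(\<Sum>p\<in>B \<inter> nups x. ln (real p) / real p) \<le> e * ln x + K" by (simp add: mult.commute)
  qed (auto simp: K_def intro: sum_nonneg)
qed

text \<open>Otherwise \<open>sparse_log_sum\<close> would allow the primes only half of the
  \<open>ln x\<close> in Mertens' estimate, and proper prime powers contribute O(1).\<close>

lemma primes_not_sparse: "\<not> thin_set {p. prime p}"
proof
  assume sp: "thin_set {p::nat. prime p}"
  obtain C where C: "C > 0" "\<And>x. (\<Sum>n\<in>{n\<in>nups x. \<not> prime n}. mangoldt n / real n) \<le> C"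
    using sum_mangoldt_nonprime by blast
  obtain D where D: "D > 0" "\<And>x. x \<ge> 1 \<Longrightarrow> \<bar>(\<Sum>n\<in>nups x. mangoldt n / real n) - ln x\<bar> \<le> D"
    using mertens_mangoldt by blast
  obtain K where K: "K \<ge> 0" "\<And>x. x \<ge> 1 \<Longrightarrow> (\<Sum>p\<in>{p. prime p} \<inter> nups x. ln (real p) / real p) \<le> 1/2 * ln x + K"
    using sparse_log_sum[OF sp, of "1/2"] by auto
  define x where "x = exp (2 * (C + D + K) + 2)"
  have x: "x \<ge> 1" "ln x = 2 * (C + D + K) + 2" using C D K by (auto simp: x_def)
  have "(\<Sum>n\<in>nups x. mangoldt n / real n) =
      (\<Sum>n\<in>{n\<in>nups x. \<not> prime n}. mangoldt n / real n) + (\<Sum>n\<in>{p. prime p} \<inter> nups x. mangoldt n / real n)"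
    by (subst sum.union_disjoint[symmetric]) (auto intro!: sum.cong)
  also have "(\<Sum>n\<in>{p. prime p} \<inter> nups x. mangoldt n / real n) = (\<Sum>p\<in>{p. prime p} \<inter> nups x. ln (real p) / real p)"
    by (intro sum.cong refl) auto
  finally have eq: "(\<Sum>n\<in>nups x. mangoldt n / real n) = (\<Sum>n\<in>{n\<in>nups x. \<not> prime n}. mangoldt n / real n) +
      (\<Sum>p\<in>{p. prime p} \<inter> nups x. ln (real p) / real p)" .
  have "a = b + c \<Longrightarrow> b \<le> C \<Longrightarrow> \<bar>a - ln x\<bar> \<le> D \<Longrightarrow> c \<le> 1/2 * ln x + K \<Longrightarrow> False" for a b c
    using x(2) by argo
  from this[OF eq C(2)[of x] _ K(2)[OF x(1)]] D(2)[OF x(1)] show False by blast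
qed

lemma card_residue_class_le:
  fixes N p a :: nat assumes "p \<ge> 1"
  shows "real (card {n\<in>{1..N}. [n = a] (mod p)}) \<le> real N / real p + 1"
proof -
  have "card {n\<in>{1..N}. [n = a] (mod p)} \<le> card {..N div p}"
  proof (rule card_inj_on_le)
    show "inj_on (\<lambda>n. n div p) {n\<in>{1..N}. [n = a] (mod p)}"
    proof (rule inj_onI)
      fix m n assume "m \<in> {n\<in>{1..N}. [n = a] (mod p)}" "n \<in> {n\<in>{1..N}. [n = a] (mod p)}" and d: "m div p = n div p"
      then have "m mod p = n mod p" by (auto simp: cong_def)
      then show "m = n" using d by (metis div_mult_mod_eq)
    qed
  qed (auto intro: div_le_mono)
  then have "real (card {n\<in>{1..N}. [n = a] (mod p)}) \<le> real (N div p) + 1" by simp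
  also have "real (N div p) \<le> real N / real p" by (simp add: of_nat_div_le_of_nat)
  finally show ?thesis by simp
qed

lemma card_linear_multiples_le:
  fixes N p Q r :: nat assumes "p \<ge> 1" "coprime p Q"
  shows "real (card {n\<in>{1..N}. p dvd Q * n + r}) \<le> real N / real p + 1"
proof (cases "{n\<in>{1..N}. p dvd Q * n + r} = {}")
  case False
  then obtain a where a: "p dvd Q * a + r" by blast
  have "{n\<in>{1..N}. p dvd Q * n + r} \<subseteq> {n\<in>{1..N}. [n = a] (mod p)}"
  proof clarsimp
    fix n assume "p dvd Q * n + r"
    then have "[Q * n + r = Q * a + r] (mod p)" using a by (simp add: cong_def dvd_eq_mod_eq_0)
    then have "[Q * n = Q * a] (mod p)" by (simp add: cong_add_rcancel_nat)
    then show "[n = a] (mod p)" using assms by (simp add: cong_mult_lcancel_nat coprime_commute)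
  qed
  then have "card {n\<in>{1..N}. p dvd Q * n + r} \<le> card {n\<in>{1..N}. [n = a] (mod p)}" by (intro card_mono) auto
  then show ?thesis using card_residue_class_le[OF assms(1), of N a] by linarith
next
  case True
  show ?thesis unfolding True by simp
qed

text \<open>A progression inside a given residue class, most of whose terms have no prime factor in
  \<open>B\<close>. Finitely many primes are made harmless by putting them into the modulus; the
  others have so small a reciprocal sum that a union bound suffices.\<close>

lemma sparse_sieve:
  fixes k m :: nat
  assumes B: "thin_set B" "B \<subseteq> {p. prime p}" and k: "k \<ge> 1" "coprime m k"
  obtains Q r N0 where "Q \<ge> 1" "r \<ge> 1" "k dvd Q" "[r = m] (mod k)" "coprime r Q"
    "\<And>N. N \<ge> N0 \<Longrightarrow> real (card {n\<in>{1..N}. \<exists>p\<in>B. p dvd Q * n + r}) \<le> real N / 4"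
proof -
  obtain F where F: "finite F" "F \<subseteq> B" "\<And>P. finite P \<Longrightarrow> P \<subseteq> B - F \<Longrightarrow> (\<Sum>p\<in>P. 1 / real p) \<le> 1/16"
    using sparse_tail[OF B(1), of "1/16"] by auto
  \<comment> \<open>The exceptional primes that do not divide \<open>k\<close>. Those that divide
    \<open>k\<close> are harmless already, since \<open>r\<close> is congruent to \<open>m\<close>,
    which is coprime to \<open>k\<close>.\<close>
  define q where "q = \<Prod>{p\<in>F. \<not> p dvd k}"
  have q: "q \<ge> 1" "coprime k q"
  proof -
    have pr: "prime p" if "p \<in> F" for p using that F B by auto
    have "\<forall>p\<in>{p\<in>F. \<not> p dvd k}. p > 0" using pr prime_gt_0_nat by auto
    then have "q > 0" unfolding q_def by (intro prod_pos) auto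
    then show "q \<ge> 1" by simp
    show "coprime k q" unfolding q_def
      by (intro prod_coprime_right) (use pr in \<open>auto simp: prime_imp_coprime coprime_commute\<close>)
  qed
  define Q where "Q = k * q"
  have Q1: "Q \<ge> 1" using k q by (simp add: Q_def)
  obtain r0 where r0: "[r0 = m] (mod k)" "[r0 = 1] (mod q)"
    using binary_chinese_remainder_nat[OF q(2)] by blast
  define r where "r = r0 + Q"
  have r: "[r = m] (mod k)" "[r = 1] (mod q)" using r0 by (auto simp: r_def Q_def cong_def)
  have r1: "r \<ge> 1" using Q1 by (simp add: r_def)
  have copr: "coprime r Q"
  proof -
    have "coprime r k" using r(1) k(2) cong_imp_coprime[OF cong_sym[OF r(1)]] by simp
    moreover have "coprime r q" using cong_imp_coprime[OF cong_sym[OF r(2)]] by simp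
    ultimately show ?thesis by (simp add: Q_def)
  qed
  have FQ: "p dvd Q" if "p \<in> F" for p
  proof (cases "p dvd k")
    case False
    then have "p dvd q" unfolding q_def using that F(1) by (intro dvd_prodI) auto
    then show ?thesis by (simp add: Q_def)
  qed (simp add: Q_def)
  have notdvd: "\<not> p dvd Q * n + r" if "p \<in> B" "p dvd Q" for p n
  proof
    assume "p dvd Q * n + r"
    then have "p dvd r" using that(2) by (simp add: dvd_add_right_iff)
    then have "p dvd 1" using copr that(2) by (metis coprime_common_divisor)
    then show False using that B by auto
  qed
  \<comment> \<open>The quarter is made up of \<open>1/16\<close> for the reciprocal sum,
    \<open>1/16\<close> for the rounding error of 1 per prime up to \<open>Q * N + r\<close>, and
    \<open>1/8\<close> for \<open>r + K\<close> by the choice of \<open>N0\<close>.\<close>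
  have "1 / (16 * real Q) > 0" using Q1 by simp
  from sparse_count[OF B(1) this] obtain K where
    K: "K \<ge> 0" "\<And>x. x \<ge> 0 \<Longrightarrow> real (card (B \<inter> nups x)) \<le> 1 / (16 * real Q) * x + K" by blast
  define N0 where "N0 = nat \<lceil>8 * (real r + K)\<rceil>"
  show ?thesis
  proof (rule that[OF Q1 r1 _ r(1) copr, of N0])
    show "k dvd Q" by (simp add: Q_def)
    fix N assume N: "N \<ge> N0"
    define x where "x = real (Q * N + r)"
    define P where "P = {p\<in>B. \<not> p dvd Q} \<inter> nups x"
    have Pp: "prime p" "p \<ge> 1" if "p \<in> P" for p using that B by (auto simp: P_def)
    have "{n\<in>{1..N}. \<exists>p\<in>B. p dvd Q * n + r} \<subseteq> (\<Union>p\<in>P. {n\<in>{1..N}. p dvd Q * n + r})"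
    proof clarsimp
      fix n p assume n: "Suc 0 \<le> n" "n \<le> N" and p: "p \<in> B" "p dvd Q * n + r"
      have "p \<le> Q * n + r" using p r1 by (intro dvd_imp_le) auto
      also have "\<dots> \<le> Q * N + r" using n by simp
      finally have "real p \<le> x" unfolding x_def of_nat_le_iff .
      moreover have "p \<ge> 1" using p B prime_ge_1_nat by auto
      ultimately have "p \<in> P" using p notdvd by (auto simp: P_def)
      then show "\<exists>p\<in>P. p dvd Q * n + r" using p by blast
    qed
    then have "card {n\<in>{1..N}. \<exists>p\<in>B. p dvd Q * n + r} \<le> card (\<Union>p\<in>P. {n\<in>{1..N}. p dvd Q * n + r})"
      by (intro card_mono) (auto simp: P_def)
    also have "\<dots> \<le> (\<Sum>p\<in>P. card {n\<in>{1..N}. p dvd Q * n + r})"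
      by (intro card_UN_le) (auto simp: P_def)
    finally have "real (card {n\<in>{1..N}. \<exists>p\<in>B. p dvd Q * n + r}) \<le> real (\<Sum>p\<in>P. card {n\<in>{1..N}. p dvd Q * n + r})"
      unfolding of_nat_le_iff .
    also have "\<dots> \<le> (\<Sum>p\<in>P. real N / real p + 1)" unfolding of_nat_sum
    proof (intro sum_mono card_linear_multiples_le Pp(2))
      fix p assume p: "p \<in> P"
      then have "\<not> p dvd Q" by (simp add: P_def)
      then show "coprime p Q" using Pp(1)[OF p] by (simp add: prime_imp_coprime)
    qed
    also have "\<dots> = real N * (\<Sum>p\<in>P. 1 / real p) + real (card P)"
      by (simp add: sum.distrib sum_distrib_left)
    also have "(\<Sum>p\<in>P. 1 / real p) \<le> 1/16" using FQ by (intro F(3)) (auto simp: P_def)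
    also have "real (card P) \<le> real (card (B \<inter> nups x))" unfolding of_nat_le_iff by (intro card_mono) (auto simp: P_def)
    also have "\<dots> \<le> 1 / (16 * real Q) * x + K" by (rule K) (simp add: x_def)
    also have "1 / (16 * real Q) * x \<le> real N / 16 + real r"
    proof -
      have "1 / (16 * real Q) * x = real N / 16 + real r / (16 * real Q)" using Q1 by (simp add: x_def field_simps)
      moreover have "real r / (16 * real Q) \<le> real r / 1" using Q1 by (intro divide_left_mono) auto
      ultimately show ?thesis by simp
    qed
    finally have "real (card {n\<in>{1..N}. \<exists>p\<in>B. p dvd Q * n + r}) \<le> real N * (1/16) + (real N / 16 + real r + K)"
      by (simp add: mult_left_mono)
    moreover have "8 * (real r + K) \<le> real N" using N unfolding N0_def by linarith
    ultimately show "real (card {n\<in>{1..N}. \<exists>p\<in>B. p dvd Q * n + r}) \<le> real N / 4" by argo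
  qed
qed

lemma mult_eq_1_if_primes:
  fixes g :: "nat \<Rightarrow> 'a::comm_monoid_mult"
  assumes mult: "\<And>m n. m \<ge> 1 \<Longrightarrow> n \<ge> 1 \<Longrightarrow> g (m * n) = g m * g n" and g1: "g 1 = 1"
    and n: "n \<ge> 1" "\<And>p. prime p \<Longrightarrow> p dvd n \<Longrightarrow> g p = 1"
  shows "g n = 1"
  using n
proof (induction n rule: less_induct)
  case (less n)
  show ?case
  proof (cases "n = 1")
    case False
    then obtain p where p: "prime p" "p dvd n" using prime_factor_nat by blast
    then obtain m where m: "n = p * m" by auto
    have "m \<ge> 1" "p > 1" using m less.prems(1) p prime_gt_1_nat by (cases m; auto)+
    then have "m < n" using m by simp
    then have "g m = 1" using less.IH[of m] less.prems m \<open>m \<ge> 1\<close> by auto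
    then show ?thesis using mult[of p m] m less.prems(2)[OF p] \<open>m \<ge> 1\<close> \<open>p > 1\<close> by simp
  qed (use g1 in simp)
qed

section \<open>Dirichlet characters\<close>

definition dirichlet_character :: "nat \<Rightarrow> (nat \<Rightarrow> complex) \<Rightarrow> bool" where
  "dirichlet_character k \<xi> \<longleftrightarrow> (\<forall>m n. \<xi> (m * n) = \<xi> m * \<xi> n) \<and> (\<forall>m n. [m = n] (mod k) \<longrightarrow> \<xi> m = \<xi> n) \<and>
     (\<forall>n. \<xi> n = 0 \<longleftrightarrow> \<not> coprime n k)"

lemma dirichlet_characterD:
  assumes "dirichlet_character k \<xi>"
  shows "\<xi> (m * n) = \<xi> m * \<xi> n" "[m = n] (mod k) \<Longrightarrow> \<xi> m = \<xi> n" "\<xi> n = 0 \<longleftrightarrow> \<not> coprime n k"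
  using assms unfolding dirichlet_character_def by blast+

lemma dirichlet_character_1:
  assumes "dirichlet_character k \<xi>" shows "\<xi> 1 = 1"
proof -
  have "\<xi> 1 * \<xi> 1 = \<xi> 1" using dirichlet_characterD(1)[OF assms, of 1 1] by simp
  moreover have "\<xi> 1 \<noteq> 0" using dirichlet_characterD(3)[OF assms, of 1] by simp
  ultimately show ?thesis by simp
qed

lemma dirichlet_character_power:
  assumes "dirichlet_character k \<xi>" shows "\<xi> (n ^ i) = \<xi> n ^ i"
  by (induction i) (use assms in \<open>auto simp: dirichlet_character_1[simplified] dirichlet_characterD\<close>)

lemma dirichlet_character_root:
  assumes "dirichlet_character k \<xi>" "coprime n k" shows "\<xi> n ^ totient k = 1"
proof -
  have "[n ^ totient k = 1] (mod k)" using assms(2) by (rule euler_theorem)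
  then have "\<xi> (n ^ totient k) = \<xi> 1" by (rule dirichlet_characterD(2)[OF assms(1)])
  then show ?thesis using dirichlet_character_power[OF assms(1)] dirichlet_character_1[OF assms(1)] by simp
qed

lemma norm_dirichlet_character:
  assumes "dirichlet_character k \<xi>" "coprime n k" "k \<ge> 1" shows "norm (\<xi> n) = 1"
proof -
  have "norm (\<xi> n) ^ totient k = 1" using dirichlet_character_root[OF assms(1,2)] by (metis norm_one norm_power)
  moreover have "totient k > 0" using assms(3) by simp
  ultimately show ?thesis using power_eq_1_iff[of "norm (\<xi> n)" "totient k"] by simp
qed

lemma norm_dirichlet_character_le: "dirichlet_character k \<xi> \<Longrightarrow> k \<ge> 1 \<Longrightarrow> norm (\<xi> n) \<le> 1"
  using norm_dirichlet_character[of k \<xi> n] dirichlet_characterD(3)[of k \<xi> n] by (cases "coprime n k") auto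

lemma finite_dirichlet_characters:
  assumes k: "k \<ge> 1" shows "finite {\<xi>. dirichlet_character k \<xi>}"
proof -
  define V where "V = insert 0 {z::complex. z ^ totient k = 1}"
  have "totient k \<ge> 1" using k by (simp add: Suc_le_eq)
  then have fV: "finite V" unfolding V_def using finite_roots_unity by simp
  have "inj_on (\<lambda>\<xi>. restrict \<xi> {..<k}) {\<xi>. dirichlet_character k \<xi>}"
  proof (rule inj_onI, rule ext)
    fix \<xi> \<psi> n assume a: "\<xi> \<in> {\<xi>. dirichlet_character k \<xi>}" "\<psi> \<in> {\<xi>. dirichlet_character k \<xi>}"
      and eq: "restrict \<xi> {..<k} = restrict \<psi> {..<k}"
    have "n mod k < k" using k by simp
    then have "\<xi> (n mod k) = \<psi> (n mod k)" using fun_cong[OF eq, of "n mod k"] by simp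
    moreover have "[n = n mod k] (mod k)" by simp
    ultimately show "\<xi> n = \<psi> n" using a dirichlet_characterD(2) by (metis mem_Collect_eq)
  qed
  moreover have "(\<lambda>\<xi>. restrict \<xi> {..<k}) ` {\<xi>. dirichlet_character k \<xi>} \<subseteq> PiE {..<k} (\<lambda>_. V)"
    unfolding V_def using dirichlet_character_root dirichlet_characterD(3) by (auto simp: PiE_def)
  ultimately show ?thesis using fV by (meson finite_PiE finite_imageD finite_lessThan finite_subset)
qed

text \<open>A character of a subgroup of the units modulo \<open>k\<close>, where \<open>H\<close>
  is the set of all natural numbers in the residue classes of the subgroup. For
  \<open>k \<ge> 1\<close> closure under inverses follows from Euler's theorem.\<close>

definition partial_character :: "nat \<Rightarrow> nat set \<Rightarrow> (nat \<Rightarrow> complex) \<Rightarrow> bool" where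
  "partial_character k H \<psi> \<longleftrightarrow> H \<subseteq> {n. coprime n k} \<and> 1 \<in> H \<and> \<psi> 1 = 1 \<and>
     (\<forall>m\<in>H. \<forall>n\<in>H. m * n \<in> H \<and> \<psi> (m * n) = \<psi> m * \<psi> n) \<and>
     (\<forall>m\<in>H. \<forall>n. [m = n] (mod k) \<longrightarrow> n \<in> H \<and> \<psi> n = \<psi> m)"

lemma partial_characterD:
  assumes "partial_character k H \<psi>"
  shows "n \<in> H \<Longrightarrow> coprime n k" "1 \<in> H" "\<psi> 1 = 1" "m \<in> H \<Longrightarrow> n \<in> H \<Longrightarrow> m * n \<in> H"
    "m \<in> H \<Longrightarrow> n \<in> H \<Longrightarrow> \<psi> (m * n) = \<psi> m * \<psi> n" "m \<in> H \<Longrightarrow> [m = n] (mod k) \<Longrightarrow> n \<in> H"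
    "m \<in> H \<Longrightarrow> [m = n] (mod k) \<Longrightarrow> \<psi> n = \<psi> m"
  using assms unfolding partial_character_def by blast+

lemma partial_character_power:
  assumes "partial_character k H \<psi>" "m \<in> H"
  shows "m ^ i \<in> H" "\<psi> (m ^ i) = \<psi> m ^ i"
proof -
  have "m ^ i \<in> H \<and> \<psi> (m ^ i) = \<psi> m ^ i"
  proof (induction i)
    case 0
    show ?case using partial_characterD(2,3)[OF assms(1)] by simp
  next
    case (Suc i)
    then show ?case
      using partial_characterD(4)[OF assms(1) assms(2), of "m ^ i"] partial_characterD(5)[OF assms(1) assms(2), of "m ^ i"] by simp
  qed
  then show "m ^ i \<in> H" "\<psi> (m ^ i) = \<psi> m ^ i" by auto
qed

text \<open>Extension to the subgroup generated by \<open>H\<close> and \<open>a\<close>: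
  \<open>d\<close> is the order of \<open>a\<close> modulo \<open>H\<close>, and any
  \<open>d\<close>-th root of \<open>\<psi> (a ^ d)\<close> is a consistent value at
  \<open>a\<close>.\<close>

lemma partial_character_extend:
  assumes pc: "partial_character k H \<psi>" and k: "k \<ge> 1" and a: "coprime a k"
    and d: "d = (LEAST d. d \<ge> 1 \<and> a ^ d \<in> H)" and \<zeta>: "\<zeta> ^ d = \<psi> (a ^ d)"
  obtains H' \<psi>' where "partial_character k H' \<psi>'" "H \<subseteq> H'" "\<And>n. n \<in> H \<Longrightarrow> \<psi>' n = \<psi> n" "a \<in> H'" "\<psi>' a = \<zeta>"
proof -
  note pcD = partial_characterD[OF pc]
  have "[1 = a ^ totient k] (mod k)" using euler_theorem[OF a] by (rule cong_sym)
  from pcD(6)[OF pcD(2) this] have "a ^ totient k \<in> H" .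
  moreover have "totient k \<ge> 1" using k by (simp add: Suc_le_eq)
  ultimately have dd: "d \<ge> 1" "a ^ d \<in> H" unfolding d by (metis (mono_tags, lifting) LeastI)+
  have dmin: "d \<le> e" if "e \<ge> 1" "a ^ e \<in> H" for e unfolding d using that by (intro Least_le) auto
  \<comment> \<open>Division inside \<open>H\<close>, with \<open>y ^ (totient k - 1)\<close> as an
    inverse of \<open>y\<close>.\<close>
  have quot: "x \<in> H" if "y \<in> H" "z \<in> H" "[x * y = z] (mod k)" for x y z
  proof -
    have c: "coprime y k" by (rule pcD(1)[OF that(1)])
    have "[z * y ^ (totient k - 1) = x * y * y ^ (totient k - 1)] (mod k)"
      using cong_sym[OF that(3)] by (intro cong_mult) auto
    moreover have "x * y * y ^ (totient k - 1) = x * y ^ totient k"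
      using \<open>totient k \<ge> 1\<close> by (cases "totient k") auto
    moreover have "[x * y ^ totient k = x * 1] (mod k)" using euler_theorem[OF c] by (intro cong_mult) auto
    ultimately have "[z * y ^ (totient k - 1) = x] (mod k)" by (metis cong_trans mult.right_neutral)
    moreover have "z * y ^ (totient k - 1) \<in> H" by (rule pcD(4)[OF that(2) partial_character_power(1)[OF pc that(1)]])
    ultimately show ?thesis using pcD(6) by metis
  qed
  have pow: "\<psi> (a ^ e) = \<zeta> ^ e" if e: "a ^ e \<in> H" for e
  proof -
    define s where "s = e mod d"
    have es: "e = d * (e div d) + s" by (simp add: s_def)
    have p: "(a ^ d) ^ (e div d) \<in> H" by (rule partial_character_power(1)[OF pc dd(2)])
    have "a ^ e = a ^ s * (a ^ d) ^ (e div d)" using es by (metis power_add power_mult mult.commute)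
    then have "a ^ s \<in> H" using quot[OF p e, of "a ^ s"] by simp
    moreover have "s < d" using dd by (simp add: s_def)
    ultimately have "s = 0" using dmin[of s] by (cases "s = 0") auto
    then have e': "e = d * (e div d)" using es by simp
    have "\<psi> (a ^ e) = \<psi> ((a ^ d) ^ (e div d))" using e' by (metis power_mult)
    also have "\<dots> = (\<zeta> ^ d) ^ (e div d)" using partial_character_power(2)[OF pc dd(2)] \<zeta> by simp
    also have "\<dots> = \<zeta> ^ e" using e' by (metis power_mult)
    finally show ?thesis .
  qed
  have wd: "\<psi> h * \<zeta> ^ i = \<psi> h' * \<zeta> ^ j" if h: "h \<in> H" "h' \<in> H" "[h * a ^ i = h' * a ^ j] (mod k)" for h h' i j
  proof -
    have *: "\<psi> h * \<zeta> ^ i = \<psi> h' * \<zeta> ^ j" if h: "h \<in> H" "h' \<in> H" "[h * a ^ i = h' * a ^ j] (mod k)" and ij: "i \<le> j" for h h' i j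
    proof -
      have "h' * a ^ j = h' * a ^ (j - i) * a ^ i" using ij by (simp add: mult.assoc flip: power_add)
      from h(3)[unfolded this] have "[h * a ^ i = h' * a ^ (j - i) * a ^ i] (mod k)" .
      then have c: "[h = h' * a ^ (j - i)] (mod k)" using a by (simp add: cong_mult_rcancel_nat)
      then have "[a ^ (j - i) * h' = h] (mod k)" by (simp add: cong_sym mult.commute)
      from quot[OF h(2) h(1) this] have aH: "a ^ (j - i) \<in> H" .
      then have "\<psi> h = \<psi> h' * \<zeta> ^ (j - i)" using pcD(7)[OF h(1) c] pcD(5)[OF h(2) aH] pow[OF aH] by simp
      then show ?thesis using ij by (simp add: mult.assoc flip: power_add)
    qed
    show ?thesis
    proof (cases "i \<le> j")
      case True then show ?thesis using * h by blast
    next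
      case False then show ?thesis using *[OF h(2,1) cong_sym[OF h(3)]] by simp
    qed
  qed
  define H' where "H' = {n. \<exists>h\<in>H. \<exists>i. [n = h * a ^ i] (mod k)}"
  \<comment> \<open>An arbitrary representation is chosen; \<open>wd\<close> makes the value
    independent of it.\<close>
  define rep where "rep n = (SOME x. fst x \<in> H \<and> [n = fst x * a ^ snd x] (mod k))" for n
  define \<psi>' where "\<psi>' n = \<psi> (fst (rep n)) * \<zeta> ^ snd (rep n)" for n
  have val: "\<psi>' n = \<psi> h * \<zeta> ^ i" if "h \<in> H" "[n = h * a ^ i] (mod k)" for n h i
  proof -
    have "fst (rep n) \<in> H \<and> [n = fst (rep n) * a ^ snd (rep n)] (mod k)"
      unfolding rep_def by (rule someI[of _ "(h, i)"]) (use that in simp)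
    then have "fst (rep n) \<in> H" "[fst (rep n) * a ^ snd (rep n) = h * a ^ i] (mod k)"
      using that(2) by (auto intro: cong_trans cong_sym)
    then show ?thesis unfolding \<psi>'_def using wd[OF _ that(1)] by blast
  qed
  have sub: "\<psi>' n = \<psi> n" "n \<in> H'" if "n \<in> H" for n
  proof -
    have "[n = n * a ^ 0] (mod k)" by simp
    then show "\<psi>' n = \<psi> n" "n \<in> H'"
      using val[OF that, of n 0] that unfolding H'_def by (simp, blast)
  qed
  have va: "\<psi>' a = \<zeta>" "a \<in> H'"
  proof -
    have "[a = 1 * a ^ 1] (mod k)" by simp
    then show "\<psi>' a = \<zeta>" "a \<in> H'" using val[OF pcD(2), of a 1] pcD(2,3) unfolding H'_def by (simp, blast)
  qed
  have "partial_character k H' \<psi>'"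
    unfolding partial_character_def
  proof (intro conjI ballI allI impI)
    show "H' \<subseteq> {n. coprime n k}"
    proof
      fix n assume "n \<in> H'"
      then obtain h i where h: "h \<in> H" "[n = h * a ^ i] (mod k)" unfolding H'_def by blast
      then have "coprime (h * a ^ i) k" using pcD(1) a by simp
      then show "n \<in> {n. coprime n k}" using cong_imp_coprime[OF cong_sym[OF h(2)]] by simp
    qed
    show "1 \<in> H'" "\<psi>' 1 = 1" using sub[OF pcD(2)] pcD(3) by auto
    fix m assume m: "m \<in> H'"
    then obtain h i where h: "h \<in> H" "[m = h * a ^ i] (mod k)" unfolding H'_def by blast
    { fix n assume "n \<in> H'"
      then obtain h' i' where h': "h' \<in> H" "[n = h' * a ^ i'] (mod k)" unfolding H'_def by blast
      have "[m * n = (h * a ^ i) * (h' * a ^ i')] (mod k)" using h h' by (intro cong_mult)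
      then have c: "[m * n = (h * h') * a ^ (i + i')] (mod k)" by (simp add: power_add mult_ac)
      then show "m * n \<in> H'" unfolding H'_def using pcD(4)[OF h(1) h'(1)] by blast
      show "\<psi>' (m * n) = \<psi>' m * \<psi>' n"
        using val[OF _ c] val[OF h] val[OF h'] pcD(4)[OF h(1) h'(1)] pcD(5)[OF h(1) h'(1)] by (simp add: power_add) }
    { fix n assume "[m = n] (mod k)"
      then have c: "[n = h * a ^ i] (mod k)" using h by (meson cong_sym cong_trans)
      then show "n \<in> H'" unfolding H'_def using h by blast
      show "\<psi>' n = \<psi>' m" using val[OF h(1) c] val[OF h] by simp }
  qed
  then show ?thesis using that[of H' \<psi>'] sub va by auto
qed

lemma partial_character_nonzero:
  assumes "partial_character k H \<psi>" "m \<in> H"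
  shows "\<psi> m \<noteq> 0"
proof
  assume z: "\<psi> m = 0"
  have c: "[1 = m ^ totient k] (mod k)" using euler_theorem[OF partial_characterD(1)[OF assms]] by (rule cong_sym)
  have "\<psi> m ^ totient k = 1"
    using partial_characterD(7)[OF assms(1) partial_characterD(2)[OF assms(1)] c]
      partial_character_power(2)[OF assms] partial_characterD(3)[OF assms(1)] by simp
  then have "totient k = 0" using z by (cases "totient k") auto
  \<comment> \<open>The modulus 0 is not excluded by \<open>partial_character\<close>; there
    coprimality forces \<open>m = 1\<close>.\<close>
  then have "[1 = m ^ 0] (mod k)" "k = 0" using c by auto
  then have "m ^ totient k = 1" using c by simp
  have "coprime m 0" using partial_characterD(1)[OF assms] \<open>k = 0\<close> by simp
  then have "m = 1" by simp
  then show False using z partial_characterD(3)[OF assms(1)] by simp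
qed

lemma complex_nth_root_exists:
  assumes "d \<ge> 1" "w \<noteq> 0" shows "\<exists>\<zeta>::complex. \<zeta> ^ d = w"
proof -
  have "card {z::complex. z ^ d = w} > 0" using card_nth_roots[of w d] assms by simp
  then have "{z::complex. z ^ d = w} \<noteq> {}" by (metis card.empty less_irrefl)
  then show ?thesis by blast
qed

lemma complex_nontrivial_root_of_unity:
  assumes "d \<ge> 2" shows "\<exists>\<zeta>::complex. \<zeta> ^ d = 1 \<and> \<zeta> \<noteq> 1"
proof (rule ccontr)
  assume "\<not> ?thesis"
  then have "{z::complex. z ^ d = 1} \<subseteq> {1}" by blast
  then have "card {z::complex. z ^ d = 1} \<le> card {1::complex}" by (intro card_mono) auto
  then show False using card_complex_roots_unity[of d] assms by simp
qed

text \<open>The start is the trivial character on the residue class of 1. Modulo this class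
  \<open>n\<close> has an order \<open>d \<ge> 2\<close>, so an extension may take a nontrivial root
  of unity at \<open>n\<close>; a maximal further extension is defined on all units.\<close>

theorem dirichlet_character_separates:
  assumes k: "k \<ge> 1" and n: "coprime n k" "\<not> [n = 1] (mod k)"
  shows "\<exists>\<xi>. dirichlet_character k \<xi> \<and> \<xi> n \<noteq> 1"
proof -
  define ok where "ok x \<longleftrightarrow> partial_character k (fst x) (snd x) \<and> n \<in> fst x \<and> snd x n \<noteq> 1" for x :: "nat set \<times> (nat \<Rightarrow> complex)"
  define H0 where "H0 = {m. [m = 1] (mod k)}"
  have pc0: "partial_character k H0 (\<lambda>_. 1)"
    unfolding partial_character_def
  proof (intro conjI ballI allI impI)
    show "H0 \<subseteq> {n. coprime n k}"
    proof
      fix m assume "m \<in> H0"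
      then have "[1 = m] (mod k)" by (simp add: H0_def cong_sym)
      then show "m \<in> {n. coprime n k}" using cong_imp_coprime[of 1 m k] by simp
    qed
    show "m * m' \<in> H0" if "m \<in> H0" "m' \<in> H0" for m m'
      using that cong_mult[of m 1 k m' 1] by (simp add: H0_def)
    show "m' \<in> H0" if "m \<in> H0" "[m = m'] (mod k)" for m m'
      using that unfolding H0_def by (auto intro: cong_trans cong_sym)
  qed (auto simp: H0_def)
  define d where "d = (LEAST d. d \<ge> 1 \<and> n ^ d \<in> H0)"
  have "n ^ totient k \<in> H0" using euler_theorem[OF n(1)] by (simp add: H0_def)
  moreover have "totient k \<ge> 1" using k by (simp add: Suc_le_eq)
  ultimately have d1: "d \<ge> 1" "n ^ d \<in> H0" unfolding d_def by (metis (mono_tags, lifting) LeastI)+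
  have "d \<noteq> 1" using d1 n(2) by (auto simp: H0_def)
  then have "d \<ge> 2" using d1 by linarith
  then obtain \<zeta> :: complex where \<zeta>: "\<zeta> ^ d = 1" "\<zeta> \<noteq> 1" using complex_nontrivial_root_of_unity by blast
  have "\<exists>x. ok x"
  proof (rule partial_character_extend[OF pc0 k n(1) d_def \<zeta>(1)])
    fix H' \<psi>' assume "partial_character k H' \<psi>'" "n \<in> H'" "\<psi>' n = \<zeta>"
    then have "ok (H', \<psi>')" using \<zeta>(2) by (simp add: ok_def)
    then show ?thesis by blast
  qed
  then obtain x0 where "ok x0" by blast
  moreover have "\<forall>y. ok y \<longrightarrow> card (fst y \<inter> {..<k}) \<le> k"
    using card_mono[of "{..<k}"] by auto
  \<comment> \<open>Maximality is measured by the number of residues in \<open>{..<k}\<close>, which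
    is at most \<open>k\<close>.\<close>
  ultimately have "\<exists>x. ok x \<and> (\<forall>y. ok y \<longrightarrow> card (fst y \<inter> {..<k}) \<le> card (fst x \<inter> {..<k}))"
    using ex_has_greatest_nat[of ok x0 "\<lambda>y. card (fst y \<inter> {..<k})" "Suc k"] by (simp add: less_Suc_eq_le)
  then obtain x where x: "ok x" "\<forall>y. ok y \<longrightarrow> card (fst y \<inter> {..<k}) \<le> card (fst x \<inter> {..<k})" by blast
  define H where "H = fst x"
  define \<psi> where "\<psi> = snd x"
  have H: "ok (H, \<psi>)" using x(1) by (simp add: H_def \<psi>_def)
  have mx: "card (fst y \<inter> {..<k}) \<le> card (H \<inter> {..<k})" if "ok y" for y
    using x(2) that unfolding H_def by blast
  have pc: "partial_character k H \<psi>" and nH: "n \<in> H" "\<psi> n \<noteq> 1" using H by (auto simp: ok_def)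
  have full: "a \<in> H" if a: "coprime a k" for a
  proof (rule ccontr)
    assume aH: "a \<notin> H"
    define e where "e = (LEAST d. d \<ge> 1 \<and> a ^ d \<in> H)"
    have "[1 = a ^ totient k] (mod k)" using euler_theorem[OF a] by (rule cong_sym)
    from partial_characterD(6)[OF pc partial_characterD(2)[OF pc] this] have "a ^ totient k \<in> H" .
    with \<open>totient k \<ge> 1\<close> have e1: "e \<ge> 1" "a ^ e \<in> H" unfolding e_def by (metis (mono_tags, lifting) LeastI)+
    obtain \<zeta> where \<zeta>: "\<zeta> ^ e = \<psi> (a ^ e)"
      using complex_nth_root_exists[OF e1(1) partial_character_nonzero[OF pc e1(2)]] by blast
    show False
    proof (rule partial_character_extend[OF pc k a e_def \<zeta>])
      fix H' \<psi>' assume h: "partial_character k H' \<psi>'" "H \<subseteq> H'" "\<And>n. n \<in> H \<Longrightarrow> \<psi>' n = \<psi> n" "a \<in> H'"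
      have "ok (H', \<psi>')" using h nH by (auto simp: ok_def)
      then have "card (H' \<inter> {..<k}) \<le> card (H \<inter> {..<k})" using mx by force
      moreover have "H \<inter> {..<k} \<subset> H' \<inter> {..<k}"
      proof
        show "H \<inter> {..<k} \<noteq> H' \<inter> {..<k}"
        proof
          assume eq: "H \<inter> {..<k} = H' \<inter> {..<k}"
          have "[a = a mod k] (mod k)" by simp
          then have "a mod k \<in> H'" by (rule partial_characterD(6)[OF h(1) h(4)])
          moreover have "a mod k < k" using k by simp
          ultimately have "a mod k \<in> H" using eq by auto
          then have "a \<in> H" by (rule partial_characterD(6)[OF pc]) simp
          then show False using aH by simp
        qed
      qed (use h in auto)
      then have "card (H \<inter> {..<k}) < card (H' \<inter> {..<k})" by (intro psubset_card_mono) auto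
      ultimately show False by simp
    qed
  qed
  define \<xi> where "\<xi> m = (if coprime m k then \<psi> m else 0)" for m
  have "dirichlet_character k \<xi>"
    unfolding dirichlet_character_def
  proof (intro conjI allI impI)
    fix m m' show "\<xi> (m * m') = \<xi> m * \<xi> m'"
      using partial_characterD(5)[OF pc full full, of m m'] by (auto simp: \<xi>_def)
  next
    fix m m' assume c: "[m = m'] (mod k)"
    then have "coprime m k \<longleftrightarrow> coprime m' k" using cong_imp_coprime cong_sym by metis
    then show "\<xi> m = \<xi> m'" using partial_characterD(7)[OF pc full c] by (simp add: \<xi>_def)
  next
    fix m show "\<xi> m = 0 \<longleftrightarrow> \<not> coprime m k"
      using partial_character_nonzero[OF pc full] by (auto simp: \<xi>_def)
  qed
  moreover have "\<xi> n \<noteq> 1" using nH n by (simp add: \<xi>_def)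
  ultimately show ?thesis by blast
qed

lemma dirichlet_character_mult:
  "dirichlet_character k \<xi> \<Longrightarrow> dirichlet_character k \<psi> \<Longrightarrow> dirichlet_character k (\<lambda>n. \<xi> n * \<psi> n)"
  unfolding dirichlet_character_def by (auto simp: mult_ac)

lemma dirichlet_character_cnj:
  "dirichlet_character k \<xi> \<Longrightarrow> dirichlet_character k (\<lambda>n. cnj (\<xi> n))"
  unfolding dirichlet_character_def by auto

lemma dirichlet_character_principal: "dirichlet_character k (\<lambda>n. if coprime n k then 1 else 0)"
  unfolding dirichlet_character_def using cong_imp_coprime cong_sym by (auto split: if_splits) blast+

text \<open>Multiplication by a character \<open>\<psi>\<close> with
  \<open>\<psi> n \<noteq> 1\<close> permutes the characters and multiplies the sum by
  \<open>\<psi> n\<close>.\<close>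

lemma sum_dirichlet_characters_zero:
  assumes k: "k \<ge> 1" and n: "\<not> [n = 1] (mod k)"
  shows "(\<Sum>\<xi>\<in>{\<xi>. dirichlet_character k \<xi>}. \<xi> n) = 0"
proof (cases "coprime n k")
  case False
  then show ?thesis using dirichlet_characterD(3) by (intro sum.neutral) auto
next
  case True
  then obtain \<psi> where \<psi>: "dirichlet_character k \<psi>" "\<psi> n \<noteq> 1" using dirichlet_character_separates[OF k _ n] by blast
  have un: "cnj (\<psi> m) * \<psi> m * z = z" if "\<not> coprime m k \<Longrightarrow> z = 0" for m z
  proof (cases "coprime m k")
    case True
    then have "\<psi> m * cnj (\<psi> m) = 1" using norm_dirichlet_character[OF \<psi>(1) True k] by (metis complex_norm_square of_real_1 power_one)
    then show ?thesis by (simp add: mult.commute)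
  qed (use that in simp)
  have "(\<Sum>\<xi>\<in>{\<xi>. dirichlet_character k \<xi>}. \<xi> n) = (\<Sum>\<xi>\<in>{\<xi>. dirichlet_character k \<xi>}. \<psi> n * \<xi> n)"
  proof (rule sum.reindex_bij_witness[of _ "\<lambda>\<xi> m. \<psi> m * \<xi> m" "\<lambda>\<xi> m. cnj (\<psi> m) * \<xi> m"])
    fix \<xi> assume x: "\<xi> \<in> {\<xi>. dirichlet_character k \<xi>}"
    then have z: "\<not> coprime m k \<Longrightarrow> \<xi> m = 0" for m using dirichlet_characterD(3) by blast
    show "(\<lambda>m. \<psi> m * (cnj (\<psi> m) * \<xi> m)) = \<xi>" "(\<lambda>m. cnj (\<psi> m) * (\<psi> m * \<xi> m)) = \<xi>"
      using un[OF z] by (auto simp: mult_ac)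
    show "(\<lambda>m. cnj (\<psi> m) * \<xi> m) \<in> {\<xi>. dirichlet_character k \<xi>}"
      "(\<lambda>m. \<psi> m * \<xi> m) \<in> {\<xi>. dirichlet_character k \<xi>}"
      using x \<psi>(1) dirichlet_character_mult dirichlet_character_cnj by auto
    show "\<psi> n * (cnj (\<psi> n) * \<xi> n) = \<xi> n" using un[OF z, of n] by (simp add: mult_ac)
  qed
  then have "(\<Sum>\<xi>\<in>{\<xi>. dirichlet_character k \<xi>}. \<xi> n) = \<psi> n * (\<Sum>\<xi>\<in>{\<xi>. dirichlet_character k \<xi>}. \<xi> n)"
    unfolding sum_distrib_left .
  note eq = this[symmetric]
  have "(\<psi> n - 1) * (\<Sum>\<xi>\<in>{\<xi>. dirichlet_character k \<xi>}. \<xi> n) = 0"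
    unfolding left_diff_distrib eq by simp
  then show ?thesis using \<psi>(2) by simp
qed

lemma dirichlet_character_orthogonality:
  assumes k: "k \<ge> 1" and r: "coprime r k"
  obtains r' where "\<And>n. (\<Sum>\<xi>\<in>{\<xi>. dirichlet_character k \<xi>}. \<xi> r' * \<xi> n) =
     (if [n = r] (mod k) then of_nat (card {\<xi>. dirichlet_character k \<xi>}) else 0)"
proof -
  \<comment> \<open>An inverse of \<open>r\<close> modulo \<open>k\<close>, by Euler's
    theorem.\<close>
  define r' where "r' = r ^ (totient k - 1)"
  have t: "totient k \<ge> 1" using k by (simp add: Suc_le_eq)
  have e: "r' * r = r ^ totient k" unfolding r'_def using t by (cases "totient k") auto
  have rr: "[r' * r = 1] (mod k)" unfolding e by (rule euler_theorem[OF r])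
  have cr': "coprime r' k" using r by (simp add: r'_def)
  have iff: "[r' * n = 1] (mod k) \<longleftrightarrow> [n = r] (mod k)" for n
  proof -
    have "[r' * n = 1] (mod k) \<longleftrightarrow> [r' * n = r' * r] (mod k)" using rr by (meson cong_sym cong_trans)
    also have "\<dots> \<longleftrightarrow> [n = r] (mod k)" using cr' by (simp add: cong_mult_lcancel_nat)
    finally show ?thesis .
  qed
  have "(\<Sum>\<xi>\<in>{\<xi>. dirichlet_character k \<xi>}. \<xi> r' * \<xi> n) =
     (if [n = r] (mod k) then of_nat (card {\<xi>. dirichlet_character k \<xi>}) else 0)" for n
  proof -
    have eq: "(\<Sum>\<xi>\<in>{\<xi>. dirichlet_character k \<xi>}. \<xi> r' * \<xi> n) = (\<Sum>\<xi>\<in>{\<xi>. dirichlet_character k \<xi>}. \<xi> (r' * n))"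
      by (intro sum.cong refl) (simp add: dirichlet_characterD(1))
    show ?thesis
    proof (cases "[n = r] (mod k)")
      case True
      then have "[r' * n = 1] (mod k)" using iff by simp
      then have "(\<Sum>\<xi>\<in>{\<xi>. dirichlet_character k \<xi>}. \<xi> (r' * n)) = (\<Sum>\<xi>\<in>{\<xi>. dirichlet_character k \<xi>}. 1)"
        using dirichlet_characterD(2) dirichlet_character_1 by (intro sum.cong refl) (metis mem_Collect_eq)
      then show ?thesis using True eq by simp
    next
      case False
      then show ?thesis using eq iff sum_dirichlet_characters_zero[OF k, of "r' * n"] by simp
    qed
  qed
  then show ?thesis using that by blast
qed

section \<open>The value at 1 of the L-series of a nonprincipal character\<close>

lemma abel_summation_bound:
  fixes c :: "nat \<Rightarrow> complex" and g :: "nat \<Rightarrow> real"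
  assumes K: "\<And>b. norm (\<Sum>n=a..b. c n) \<le> K" and g: "\<And>n. n \<ge> a \<Longrightarrow> g (Suc n) \<le> g n" "\<And>n. n \<ge> a \<Longrightarrow> g n \<ge> 0"
  shows "norm (\<Sum>n=a..b. c n * of_real (g n)) \<le> K * g a"
proof (cases "a \<le> b")
  case False
  have "K \<ge> 0" using K[of a] norm_ge_zero order_trans by blast
  then show ?thesis using False g(2)[of a] by simp
next
  case True
  define C where "C n = (\<Sum>i=a..n. c i)" for n
  have id: "(\<Sum>n=a..b. c n * of_real (g n)) = (\<Sum>n=a..<b. C n * of_real (g n - g (Suc n))) + C b * of_real (g b)"
    using True
  proof (induction b rule: nat_induct_at_least)
    case (Suc b)
    have "C (Suc b) = C b + c (Suc b)" using Suc.hyps by (simp add: C_def)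
    then show ?case using Suc by (simp add: algebra_simps)
  qed (simp add: C_def)
  have "norm (\<Sum>n=a..b. c n * of_real (g n)) \<le> (\<Sum>n=a..<b. K * (g n - g (Suc n))) + K * g b"
    unfolding id
  proof (intro norm_triangle_mono sum_norm_le)
    fix n assume "n \<in> {a..<b}"
    then have "g n - g (Suc n) \<ge> 0" using g(1)[of n] by simp
    then show "norm (C n * of_real (g n - g (Suc n))) \<le> K * (g n - g (Suc n))"
      unfolding norm_mult norm_of_real using K[of n] by (simp add: C_def mult_right_mono)
  next
    show "norm (C b * of_real (g b)) \<le> K * g b"
      unfolding norm_mult norm_of_real using K[of b] g(2)[OF True] by (simp add: C_def mult_right_mono)
  qed
  also have "(\<Sum>n=a..<b. K * (g n - g (Suc n))) = K * (g a - g b)"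
    using sum_Suc_diff'[OF True, of g] by (simp add: sum_distrib_left[symmetric] sum_subtractf)
  finally show ?thesis by (simp add: algebra_simps)
qed

locale nonprincipal_character =
  fixes k :: nat and \<xi> :: "nat \<Rightarrow> complex" and n0 :: nat
  assumes k1: "k \<ge> 1" and char: "dirichlet_character k \<xi>" and n0: "coprime n0 k" "\<xi> n0 \<noteq> 1"
begin

lemma norm_le_1: "norm (\<xi> n) \<le> 1"
  by (rule norm_dirichlet_character_le[OF char k1])

text \<open>Multiplication by \<open>n0\<close> permutes the residues modulo \<open>k\<close> and
  multiplies the sum by \<open>\<xi> n0\<close>, which is not 1.\<close>

lemma sum_period: "(\<Sum>n<k. \<xi> n) = 0"
proof -
  have inj: "inj_on (\<lambda>n. n0 * n mod k) {..<k}"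
  proof (rule inj_onI)
    fix m n assume a: "m \<in> {..<k}" "n \<in> {..<k}" "n0 * m mod k = n0 * n mod k"
    then have "[n0 * m = n0 * n] (mod k)" by (simp add: cong_def)
    then have "[m = n] (mod k)" using n0(1) by (simp add: cong_mult_lcancel_nat)
    then show "m = n" using a by (simp add: cong_def)
  qed
  have im: "(\<lambda>n. n0 * n mod k) ` {..<k} = {..<k}"
    by (rule endo_inj_surj[OF _ _ inj]) (use k1 in auto)
  have "(\<Sum>n<k. \<xi> n) = (\<Sum>n\<in>(\<lambda>n. n0 * n mod k) ` {..<k}. \<xi> n)" using im by simp
  also have "\<dots> = (\<Sum>n<k. \<xi> (n0 * n mod k))" by (simp add: sum.reindex[OF inj])
  also have "\<dots> = (\<Sum>n<k. \<xi> n0 * \<xi> n)"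
  proof (intro sum.cong refl)
    fix n have "[n0 * n mod k = n0 * n] (mod k)" by simp
    then show "\<xi> (n0 * n mod k) = \<xi> n0 * \<xi> n" using dirichlet_characterD(1,2)[OF char] by metis
  qed
  finally have "(\<Sum>n<k. \<xi> n) = \<xi> n0 * (\<Sum>n<k. \<xi> n)" unfolding sum_distrib_left .
  note eq = this[symmetric]
  have "(\<xi> n0 - 1) * (\<Sum>n<k. \<xi> n) = 0" unfolding left_diff_distrib eq by simp
  then show ?thesis using n0(2) by simp
qed

lemma sum_initial_bound: "norm (\<Sum>n<j. \<xi> n) \<le> real k"
proof (induction j rule: less_induct)
  case (less j)
  show ?case
  proof (cases "j < k")
    case True
    have "norm (\<Sum>n<j. \<xi> n) \<le> (\<Sum>n<j. 1)" by (intro sum_norm_le norm_le_1)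
    then show ?thesis using True by simp
  next
    case False
    then have j: "j = (j - k) + k" by simp
    have "(\<Sum>n<j. \<xi> n) = (\<Sum>n<k. \<xi> n) + (\<Sum>n=k..<j. \<xi> n)"
      using False by (metis lessThan_atLeast0 not_le sum.atLeastLessThan_concat zero_le)
    also have "(\<Sum>n=k..<j. \<xi> n) = (\<Sum>n<j-k. \<xi> n)"
    proof (rule sum.reindex_bij_witness[of _ "\<lambda>n. n + k" "\<lambda>n. n - k"])
      fix n assume "n \<in> {k..<j}"
      then have "[n - k = n] (mod k)" by (simp add: cong_def) (metis le_add_diff_inverse2 mod_add_self2)
      then show "\<xi> (n - k) = \<xi> n" by (rule dirichlet_characterD(2)[OF char])
    qed auto
    finally show ?thesis using sum_period less.IH[of "j - k"] k1 False by simp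
  qed
qed

lemma sum_interval_bound: "norm (\<Sum>n=a..b. \<xi> n) \<le> 2 * real k"
proof (cases "a \<le> b")
  case True
  have "(\<Sum>n<a. \<xi> n) + (\<Sum>n=a..<Suc b. \<xi> n) = (\<Sum>n<Suc b. \<xi> n)"
    using True by (metis le_Suc_eq lessThan_atLeast0 sum.atLeastLessThan_concat zero_le)
  then have "(\<Sum>n=a..b. \<xi> n) = (\<Sum>n<Suc b. \<xi> n) - (\<Sum>n<a. \<xi> n)"
    by (simp add: atLeastLessThanSuc_atLeastAtMost algebra_simps)
  also have "norm \<dots> \<le> real k + real k"
    by (intro order_trans[OF norm_triangle_ineq4] add_mono sum_initial_bound)
  finally show ?thesis by simp
qed simp

lemma abel_bound:
  assumes "\<And>n. n \<ge> a \<Longrightarrow> g (Suc n) \<le> g n" "\<And>n. n \<ge> a \<Longrightarrow> g n \<ge> 0"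
  shows "norm (\<Sum>n=a..b. \<xi> n * of_real (g n)) \<le> 2 * real k * g a"
  by (rule abel_summation_bound[OF sum_interval_bound]) (use assms in auto)

lemma L_exists: "\<exists>L. \<forall>x>0. norm ((\<Sum>n\<in>nups x. \<xi> n / of_nat n) - L) \<le> 2 * real k / x"
proof -
  define P where "P N = (\<Sum>n=1..N. \<xi> n / of_nat n)" for N
  have diff: "norm (P N - P M) \<le> 2 * real k / (real M + 1)" if "M \<le> N" for M N
  proof -
    have "P N - P M = (\<Sum>n=Suc M..N. \<xi> n * of_real (1 / real n))"
    proof -
      have "(\<Sum>n\<in>{1..M} \<union> {Suc M..N}. \<xi> n / of_nat n) = P M + (\<Sum>n=Suc M..N. \<xi> n / of_nat n)"
        unfolding P_def by (rule sum.union_disjoint) auto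
      moreover have "{1..M} \<union> {Suc M..N} = {1..N}" using that by auto
      ultimately show ?thesis by (simp add: P_def)
    qed
    also have "norm \<dots> \<le> 2 * real k * (1 / real (Suc M))"
      by (rule abel_bound) (auto simp: field_simps)
    finally show ?thesis by (simp add: add.commute)
  qed
  have "Cauchy P"
  proof (rule metric_CauchyI)
    fix e :: real assume e: "e > 0"
    obtain M0 :: nat where M0: "real M0 > 2 * real k / e" using reals_Archimedean2 by blast
    have small: "2 * real k / (real M + 1) < e" if "M \<ge> M0" for M
    proof -
      have "real M + 1 > 2 * real k / e" using M0 that by linarith
      then show ?thesis using e by (simp add: field_simps)
    qed
    have "dist (P m) (P n) < e" if "m \<ge> M0" "n \<ge> M0" for m n
    proof (cases "m \<le> n")
      case True
      then show ?thesis using diff[of m n] small[of m] that by (simp add: dist_norm norm_minus_commute)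
    next
      case False
      then show ?thesis using diff[of n m] small[of n] that by (simp add: dist_norm)
    qed
    then show "\<exists>M. \<forall>m\<ge>M. \<forall>n\<ge>M. dist (P m) (P n) < e" by blast
  qed
  then obtain L where L: "P \<longlonglongrightarrow> L" using Cauchy_convergent convergent_def by blast
  have PL: "norm (P M - L) \<le> 2 * real k / (real M + 1)" for M
  proof (rule tendsto_upperbound)
    show "(\<lambda>N. norm (P M - P N)) \<longlonglongrightarrow> norm (P M - L)" by (intro tendsto_intros L)
    show "\<forall>\<^sub>F N in sequentially. norm (P M - P N) \<le> 2 * real k / (real M + 1)"
    proof (rule eventually_sequentiallyI)
      fix N assume "M \<le> N"
      then show "norm (P M - P N) \<le> 2 * real k / (real M + 1)"
        using diff[of M N] norm_minus_commute[of "P M" "P N"] by simp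
    qed
  qed simp
  have "norm ((\<Sum>n\<in>nups x. \<xi> n / of_nat n) - L) \<le> 2 * real k / x" if x: "x > 0" for x
  proof -
    have "norm ((\<Sum>n\<in>nups x. \<xi> n / of_nat n) - L) \<le> 2 * real k / (real (nat \<lfloor>x\<rfloor>) + 1)"
      using PL[of "nat \<lfloor>x\<rfloor>"] by (simp add: P_def nups_altdef)
    also have "\<dots> \<le> 2 * real k / x" using x by (intro divide_left_mono mult_pos_pos) linarith+
    finally show ?thesis .
  qed
  then show ?thesis by blast
qed

text \<open>The value at 1 of the Dirichlet L-series. The bound determines it, since the right-hand
  side tends to 0 as \<open>x\<close> grows.\<close>

definition L where "L = (SOME L. \<forall>x>0. norm ((\<Sum>n\<in>nups x. \<xi> n / of_nat n) - L) \<le> 2 * real k / x)"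

lemma L_bound: "x > 0 \<Longrightarrow> norm ((\<Sum>n\<in>nups x. \<xi> n / of_nat n) - L) \<le> 2 * real k / x"
  using someI_ex[OF L_exists] unfolding L_def by blast

definition M where "M x = (\<Sum>n\<in>nups x. \<xi> n * of_real (mangoldt n / real n))"

lemma ln_over_antimono: "n \<ge> 3 \<Longrightarrow> ln (real (Suc n)) / real (Suc n) \<le> ln (real n) / real n"
proof -
  assume n: "n \<ge> 3"
  have "ln (real n + 1) - ln (real n) < 1 / real n" using ln_diff_le_inverse[of "real n"] n by simp
  moreover have "ln (real n) \<ge> 1"
  proof -
    have "exp 1 \<le> (3::real)" by (rule exp_le)
    then have "ln (exp 1) \<le> ln (real n)" using n by (subst ln_le_cancel_iff) auto
    then show ?thesis by simp
  qed
  ultimately have "real n * (ln (real n + 1) - ln (real n)) \<le> ln (real n)" using n by (simp add: field_simps)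
  then show ?thesis using n by (simp add: field_simps)
qed

text \<open>The sum of the \<open>\<xi> n * ln n / n\<close> is bounded by Abel summation. With
  \<open>ln\<close> written as the divisor sum of \<open>mangoldt\<close>, it is \<open>M x\<close>
  with every term multiplied by a partial sum of the L-series, which is \<open>L\<close> up to O(d /
  x); Chebyshev's bound controls the total error.\<close>

lemma L_times_M_bounded: "\<exists>K. \<forall>x\<ge>1. norm (L * M x) \<le> K"
proof -
  obtain C where C: "C > 0" "\<And>x. x \<ge> 0 \<Longrightarrow> psi x \<le> C * x" using chebyshev_psi by blast
  have "norm (L * M x) \<le> (1 + 2 * real k * (ln 3 / 3)) + 2 * real k * C" if x: "x \<ge> 1" for x
  proof -
    define T where "T = (\<Sum>n\<in>nups x. \<xi> n * of_real (ln (real n) / real n))"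
    define N where "N = nat \<lfloor>x\<rfloor>"
    have T_bound: "norm T \<le> 1 + 2 * real k * (ln 3 / 3)"
    proof -
      \<comment> \<open>Along the integers \<open>ln n / n\<close> decreases only from 3 on.\<close>
      have "nups x = ({1..N} \<inter> {1,2}) \<union> {3..N}" unfolding nups_altdef N_def[symmetric] by auto
      then have "T = (\<Sum>n\<in>{1..N} \<inter> {1,2}. \<xi> n * of_real (ln (real n) / real n)) + (\<Sum>n=3..N. \<xi> n * of_real (ln (real n) / real n))"
        unfolding T_def by (simp only:) (rule sum.union_disjoint, auto)
      also have "norm \<dots> \<le> (\<Sum>n\<in>{1,2::nat}. ln (real n) / real n) + 2 * real k * (ln (real 3) / real 3)"
      proof (intro norm_triangle_mono abel_bound)
        have "norm (\<Sum>n\<in>{1..N} \<inter> {1,2}. \<xi> n * of_real (ln (real n) / real n)) \<le> (\<Sum>n\<in>{1..N} \<inter> {1,2}. ln (real n) / real n)"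
        proof (rule sum_norm_le)
          fix n assume n: "n \<in> {1..N} \<inter> {1,2}"
          then have nn: "ln (real n) / real n \<ge> 0" by auto
          then show "norm (\<xi> n * of_real (ln (real n) / real n)) \<le> ln (real n) / real n"
            unfolding norm_mult norm_of_real abs_of_nonneg[OF nn]
            using mult_right_mono[OF norm_le_1[of n], of "ln (real n) / real n"] by simp
        qed
        also have "\<dots> \<le> (\<Sum>n\<in>{1,2::nat}. ln (real n) / real n)" by (intro sum_mono2) auto
        finally show "norm (\<Sum>n\<in>{1..N} \<inter> {1,2}. \<xi> n * of_real (ln (real n) / real n)) \<le> (\<Sum>n\<in>{1,2::nat}. ln (real n) / real n)" .
      qed (use ln_over_antimono in auto)
      also have "(\<Sum>n\<in>{1,2::nat}. ln (real n) / real n) \<le> 1" using ln2_le_25_over_36 by simp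
      finally show ?thesis by simp
    qed
    have "T = (\<Sum>n\<in>nups x. \<Sum>d | d dvd n. \<xi> d * \<xi> (n div d) * of_real (mangoldt d / (real d * real (n div d))))"
      unfolding T_def
    proof (rule sum.cong[OF refl])
      fix n assume "n \<in> nups x"
      then have n: "n > 0" by auto
      have "ln (real n) = (\<Sum>d | d dvd n. mangoldt d)" using mangoldt_sum[of n, where ?'a = real] n by simp
      then have "\<xi> n * of_real (ln (real n) / real n) = (\<Sum>d | d dvd n. \<xi> n * of_real (mangoldt d / real n))"
        by (simp add: sum_divide_distrib sum_distrib_left)
      also have "\<dots> = (\<Sum>d | d dvd n. \<xi> d * \<xi> (n div d) * of_real (mangoldt d / (real d * real (n div d))))"
      proof (rule sum.cong[OF refl])
        fix d assume "d \<in> {d. d dvd n}"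
        then have dn: "n = d * (n div d)" by simp
        have "\<xi> n = \<xi> d * \<xi> (n div d)" using dn dirichlet_characterD(1)[OF char] by metis
        moreover have "real n = real d * real (n div d)" using dn by (metis of_nat_mult)
        ultimately show "\<xi> n * of_real (mangoldt d / real n) = \<xi> d * \<xi> (n div d) * of_real (mangoldt d / (real d * real (n div d)))"
          by simp
      qed
      finally show "\<xi> n * of_real (ln (real n) / real n) = \<dots>" .
    qed
    also have "\<dots> = (\<Sum>d\<in>nups x. \<Sum>m\<in>nups (x / real d). \<xi> d * \<xi> m * of_real (mangoldt d / (real d * real m)))"
      by (rule sum_divisors_nups)
    also have "\<dots> = (\<Sum>d\<in>nups x. \<xi> d * of_real (mangoldt d / real d) * (\<Sum>m\<in>nups (x / real d). \<xi> m / of_nat m))"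
      by (rule sum.cong[OF refl]) (simp add: sum_distrib_left sum_divide_distrib mult_ac)
    finally have T: "T = \<dots>" .
    have "norm (L * M x - T) \<le> (\<Sum>d\<in>nups x. mangoldt d * (2 * real k / x))"
    proof -
      have "L * M x - T = (\<Sum>d\<in>nups x. \<xi> d * of_real (mangoldt d / real d) * (L - (\<Sum>m\<in>nups (x / real d). \<xi> m / of_nat m)))"
        unfolding T M_def by (simp add: sum_distrib_left sum_subtractf algebra_simps)
      also have "norm \<dots> \<le> (\<Sum>d\<in>nups x. mangoldt d * (2 * real k / x))"
      proof (rule sum_norm_le)
        fix d assume d: "d \<in> nups x"
        have "norm (\<xi> d * of_real (mangoldt d / real d) * (L - (\<Sum>m\<in>nups (x / real d). \<xi> m / of_nat m)))
           \<le> 1 * (mangoldt d / real d) * (2 * real k / (x / real d))"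
          unfolding norm_mult norm_of_real using d x L_bound[of "x / real d"]
          by (intro mult_mono norm_le_1) (auto simp: mangoldt_nonneg norm_minus_commute)
        also have "\<dots> = mangoldt d * (2 * real k / x)" using d x by (simp add: field_simps)
        finally show "norm (\<xi> d * of_real (mangoldt d / real d) * (L - (\<Sum>m\<in>nups (x / real d). \<xi> m / of_nat m)))
           \<le> mangoldt d * (2 * real k / x)" .
      qed
      finally show ?thesis .
    qed
    also have "\<dots> = psi x * (2 * real k / x)" by (simp only: psi_def sum_distrib_right)
    also have "\<dots> \<le> (C * x) * (2 * real k / x)" using C(2)[of x] x by (intro mult_right_mono) auto
    also have "\<dots> = 2 * real k * C" using x by simp
    finally have d: "norm (L * M x - T) \<le> 2 * real k * C" .
    have "norm (L * M x) = norm (T + (L * M x - T))" by simp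
    also have "\<dots> \<le> (1 + 2 * real k * (ln 3 / 3)) + 2 * real k * C" by (intro norm_triangle_mono T_bound d)
    finally show ?thesis .
  qed
  then show ?thesis by blast
qed

text \<open>Moebius inversion weighted by \<open>ln (x / d)\<close> yields
  \<open>mangoldt n\<close>, and an additional \<open>ln x\<close> at \<open>n = 1\<close>. The
  inner sums are partial sums of a series with sum 0, hence O(d / x), and the
  \<open>ln (x / d)\<close> add up to O(x).\<close>

lemma M_if_L_zero:
  assumes "L = 0" shows "\<exists>K. \<forall>x\<ge>1. norm (M x + of_real (ln x)) \<le> K"
proof -
  have "norm (M x + of_real (ln x)) \<le> 8 * real k" if x: "x \<ge> 1" for x
  proof -
    have "M x + of_real (ln x) = (\<Sum>n\<in>nups x. \<xi> n * of_real ((mangoldt n + (if n = 1 then ln x else 0)) / real n))"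
    proof -
      have "(\<Sum>n\<in>nups x. \<xi> n * of_real ((if n = 1 then ln x else 0) / real n)) = (\<Sum>n\<in>nups x. if n = 1 then of_real (ln x) else 0)"
        using dirichlet_character_1[OF char] by (intro sum.cong refl) auto
      also have "\<dots> = of_real (ln x)" using x by (subst sum.delta) auto
      finally show ?thesis unfolding M_def by (simp add: add_divide_distrib distrib_left sum.distrib)
    qed
    also have "\<dots> = (\<Sum>n\<in>nups x. \<Sum>d | d dvd n. \<xi> d * \<xi> (n div d) * of_real (moebius_mu d * ln (x / real d) / (real d * real (n div d))))"
    proof (rule sum.cong[OF refl])
      fix n assume "n \<in> nups x"
      then have n: "n > 0" by auto
      have "(\<Sum>d | d dvd n. moebius_mu d * ln (x / real d)) = (\<Sum>d | d dvd n. moebius_mu d * ln x - moebius_mu d * ln (real d))"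
        using n x by (intro sum.cong refl) (auto simp: ln_div algebra_simps dest: dvd_pos_nat)
      also have "\<dots> = (\<Sum>d | d dvd n. moebius_mu d) * ln x + mangoldt n"
        using moebius_ln_sum[OF n] by (simp add: sum_subtractf sum_distrib_right)
      finally have "mangoldt n + (if n = 1 then ln x else 0) = (\<Sum>d | d dvd n. moebius_mu d * ln (x / real d))"
        using moebius_sum[OF n] by simp
      then have "\<xi> n * of_real ((mangoldt n + (if n = 1 then ln x else 0)) / real n) =
         (\<Sum>d | d dvd n. \<xi> n * of_real (moebius_mu d * ln (x / real d) / real n))"
        by (simp only: sum_divide_distrib of_real_sum sum_distrib_left)
      also have "\<dots> = (\<Sum>d | d dvd n. \<xi> d * \<xi> (n div d) * of_real (moebius_mu d * ln (x / real d) / (real d * real (n div d))))"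
      proof (rule sum.cong[OF refl])
        fix d assume "d \<in> {d. d dvd n}"
        then have dn: "n = d * (n div d)" by simp
        have "\<xi> n = \<xi> d * \<xi> (n div d)" using dn dirichlet_characterD(1)[OF char] by metis
        moreover have "real n = real d * real (n div d)" using dn by (metis of_nat_mult)
        ultimately show "\<xi> n * of_real (moebius_mu d * ln (x / real d) / real n) =
            \<xi> d * \<xi> (n div d) * of_real (moebius_mu d * ln (x / real d) / (real d * real (n div d)))"
          by simp
      qed
      finally show "\<xi> n * of_real ((mangoldt n + (if n = 1 then ln x else 0)) / real n) = \<dots>" .
    qed
    also have "\<dots> = (\<Sum>d\<in>nups x. \<Sum>m\<in>nups (x / real d). \<xi> d * \<xi> m * of_real (moebius_mu d * ln (x / real d) / (real d * real m)))"
      by (rule sum_divisors_nups)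
    also have "\<dots> = (\<Sum>d\<in>nups x. \<xi> d * of_real (moebius_mu d * ln (x / real d) / real d) * (\<Sum>m\<in>nups (x / real d). \<xi> m / of_nat m))"
      by (rule sum.cong[OF refl]) (simp add: sum_distrib_left sum_divide_distrib mult_ac)
    also have "norm \<dots> \<le> (\<Sum>d\<in>nups x. ln (x / real d) * (2 * real k / x))"
    proof (rule sum_norm_le)
      fix d assume d: "d \<in> nups x"
      then have l: "ln (x / real d) \<ge> 0" by (auto simp: field_simps)
      have "\<bar>moebius_mu d * ln (x / real d) / real d\<bar> \<le> ln (x / real d) / real d"
        using mult_right_mono[OF abs_moebius_le[of d], of "ln (x / real d) / real d"] l by (simp add: abs_mult)
      then have "norm (\<xi> d * of_real (moebius_mu d * ln (x / real d) / real d) * (\<Sum>m\<in>nups (x / real d). \<xi> m / of_nat m))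
         \<le> 1 * (ln (x / real d) / real d) * (2 * real k / (x / real d))"
        unfolding norm_mult norm_of_real using d x L_bound[of "x / real d"] assms l
        by (intro mult_mono norm_le_1) auto
      also have "\<dots> = ln (x / real d) * (2 * real k / x)" using d x by (simp add: field_simps)
      finally show "norm (\<xi> d * of_real (moebius_mu d * ln (x / real d) / real d) * (\<Sum>m\<in>nups (x / real d). \<xi> m / of_nat m))
         \<le> ln (x / real d) * (2 * real k / x)" .
    qed
    also have "\<dots> = (real (card (nups x)) * ln x - logsum x) * (2 * real k / x)"
    proof -
      have "(\<Sum>d\<in>nups x. ln (x / real d)) = (\<Sum>d\<in>nups x. ln x - ln (real d))"
        using x by (intro sum.cong refl) (auto simp: ln_div)
      then show ?thesis unfolding sum_distrib_right[symmetric] logsum_def by (simp add: sum_subtractf)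
    qed
    also have "\<dots> \<le> (4 * x) * (2 * real k / x)"
    proof (intro mult_right_mono)
      have "real (card (nups x)) * ln x \<le> x * ln x" using card_nups_le[of x] x by (intro mult_right_mono) auto
      moreover have "\<bar>logsum x - (x * ln x - x)\<bar> \<le> ln x + 1" by (rule logsum_bound[OF x])
      moreover have "ln x \<le> x - 1" using x by (intro ln_le_minus_one) auto
      ultimately show "real (card (nups x)) * ln x - logsum x \<le> 4 * x" using x by argo
    qed (use x in auto)
    also have "\<dots> = 8 * real k" using x by simp
    finally show ?thesis .
  qed
  then show ?thesis by blast
qed

end

section \<open>Nonvanishing for real characters\<close>

text \<open>Both sums factor over the primes into geometric sums with ratio 0, 1 or -1; at a square
  all exponents are even, and then every factor is at least 1.\<close>

lemma real_character_divisor_sum: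
  fixes \<rho> :: "nat \<Rightarrow> real"
  assumes mult: "\<And>m n. \<rho> (m * n) = \<rho> m * \<rho> n" and v: "\<And>n. \<rho> n \<in> {0, 1, -1}" and one: "\<rho> 1 = 1"
  shows "n \<ge> 1 \<Longrightarrow> (\<Sum>d | d dvd n. \<rho> d) \<ge> 0" and "n \<ge> 1 \<Longrightarrow> (\<Sum>d | d dvd n\<^sup>2. \<rho> d) \<ge> 1"
proof -
  have pw: "\<rho> (p ^ i) = \<rho> p ^ i" for p i by (induction i) (use mult one in auto)
  have fac: "(\<Sum>d | d dvd p ^ e * m. \<rho> d) = (\<Sum>i\<le>e. \<rho> p ^ i) * (\<Sum>d | d dvd m. \<rho> d)"
    if "prime p" "\<not> p dvd m" "m > 0" for p e m
    unfolding sum_divisors_prime_power_mult[OF that] by (simp add: mult pw sum_product)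
  have geo: "(\<Sum>i\<le>e. t ^ i) \<ge> 0 \<and> (even e \<longrightarrow> (\<Sum>i\<le>e. t ^ i) \<ge> 1)" if "t \<in> {0, 1, -1}" for t :: real and e
  proof -
    have "(\<Sum>i\<le>e. (-1::real) ^ i) = (if even e then 1 else 0)" by (induction e) auto
    moreover have "(\<Sum>i\<le>e. (0::real) ^ i) = 1" by (induction e) auto
    ultimately show ?thesis using that by auto
  qed
  have main: "(\<Sum>d | d dvd n. \<rho> d) \<ge> 0 \<and> (\<Sum>d | d dvd n\<^sup>2. \<rho> d) \<ge> 1" if "n \<ge> 1" for n
    using that
  proof (induction n rule: less_induct)
    case (less n)
    show ?case
    proof (cases "n = 1")
      case True then show ?thesis using one by simp
    next
      case False
      then obtain p where p: "prime p" "p dvd n" using prime_factor_nat by blast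
      have "n > 0" using less.prems by simp
      then obtain e m where em: "e \<ge> 1" "\<not> p dvd m" "m > 0" "n = p ^ e * m"
        using prime_power_split[OF _ p] by blast
      have "p ^ e > 1" using em(1) prime_gt_1_nat[OF p(1)] by (intro one_less_power) auto
      then have "m < n" using em by simp
      then have IH: "(\<Sum>d | d dvd m. \<rho> d) \<ge> 0" "(\<Sum>d | d dvd m\<^sup>2. \<rho> d) \<ge> 1" using less.IH[of m] em by auto
      have 1: "(\<Sum>d | d dvd n. \<rho> d) \<ge> 0" unfolding em(4) fac[OF p(1) em(2,3)] using geo[OF v] IH by simp
      have n2: "n\<^sup>2 = p ^ (2 * e) * m\<^sup>2" unfolding em(4) by (simp add: power_mult_distrib power_mult mult.commute)
      have "\<not> p dvd m\<^sup>2" using em p by (simp add: prime_dvd_power_iff)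
      moreover have "m\<^sup>2 > 0" using em by simp
      ultimately have "(\<Sum>d | d dvd n\<^sup>2. \<rho> d) = (\<Sum>i\<le>2 * e. \<rho> p ^ i) * (\<Sum>d | d dvd m\<^sup>2. \<rho> d)"
        unfolding n2 by (intro fac p(1))
      moreover have "1 * 1 \<le> (\<Sum>i\<le>2 * e. \<rho> p ^ i) * (\<Sum>d | d dvd m\<^sup>2. \<rho> d)"
        using geo[OF v[of p], of "2 * e"] IH by (intro mult_mono) auto
      ultimately show ?thesis using 1 by simp
    qed
  qed
  then show "n \<ge> 1 \<Longrightarrow> (\<Sum>d | d dvd n. \<rho> d) \<ge> 0" and "n \<ge> 1 \<Longrightarrow> (\<Sum>d | d dvd n\<^sup>2. \<rho> d) \<ge> 1" by auto
qed

text \<open>With \<open>G n\<close> the geometric sum, \<open>t ^ n / G n\<close> drops by exactly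
  \<open>t ^ n / (G n * G (Suc n))\<close> at each step, and this must not exceed
  \<open>1 / (n * (n + 1))\<close>. Pairing opposite terms of \<open>G m\<close>, the AM-GM
  inequality bounds it below by \<open>m\<close> times the power of \<open>t\<close> with exponent
  \<open>(m - 1) / 2\<close>, which is enough.\<close>

lemma lambert_coefficient_antimono:
  fixes t :: real
  assumes t: "0 < t" "t < 1" and n: "n \<ge> 1"
  defines "b \<equiv> \<lambda>n. 1 / (real n * (1 - t)) - t ^ n / (1 - t ^ n)"
  shows "b (Suc n) \<le> b n"
proof -
  define s where "s = sqrt t"
  have s: "0 < s" "s < 1" "t = s\<^sup>2" using t by (auto simp: s_def)
  have ti: "t ^ j = (s ^ j)\<^sup>2" for j unfolding s(3) by (metis power_mult mult.commute)
  define G where "G n = (\<Sum>i<n. t ^ i)" for n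
  have tn: "t ^ m < 1" if "m \<ge> 1" for m using that t by (simp add: power_less_one_iff)
  have G: "1 - t ^ m = (1 - t) * G m" for m unfolding G_def by (rule one_diff_power_eq)
  have Glow: "real m * s ^ (m - 1) \<le> G m" for m
  proof -
    have "2 * G m = (\<Sum>i<m. t ^ i + t ^ (m - 1 - i))"
    proof -
      have "G m = (\<Sum>i<m. t ^ (m - 1 - i))" unfolding G_def using sum.nat_diff_reindex[of "\<lambda>i. t ^ i" m] by simp
      then show ?thesis by (simp add: sum.distrib G_def)
    qed
    also have "\<dots> \<ge> (\<Sum>i<m. 2 * s ^ (m - 1))"
    proof (rule sum_mono)
      fix i assume "i \<in> {..<m}"
      then have e: "s ^ i * s ^ (m - 1 - i) = s ^ (m - 1)" by (simp flip: power_add)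
      have "0 \<le> (s ^ i - s ^ (m - 1 - i))\<^sup>2" by simp
      also have "\<dots> = t ^ i + t ^ (m - 1 - i) - 2 * (s ^ i * s ^ (m - 1 - i))"
        unfolding ti by (simp add: power2_diff)
      finally show "2 * s ^ (m - 1) \<le> t ^ i + t ^ (m - 1 - i)" unfolding e by simp
    qed
    finally show ?thesis by simp
  qed
  have Gp: "G m > 0" if "m \<ge> 1" for m using G[of m] tn[OF that] t by (metis diff_gt_0_iff_gt zero_less_mult_pos)
  have prod: "real n * real (Suc n) * t ^ n \<le> G n * G (Suc n)"
  proof -
    have "t ^ n = s ^ (2 * n)" unfolding s(3) by (simp add: power_mult)
    also have "\<dots> \<le> s ^ (n - 1 + n)" using s by (intro power_decreasing) auto
    finally have "real n * real (Suc n) * t ^ n \<le> real n * real (Suc n) * (s ^ (n - 1) * s ^ n)"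
      by (intro mult_left_mono) (auto simp: power_add)
    also have "\<dots> = (real n * s ^ (n - 1)) * (real (Suc n) * s ^ (Suc n - 1))" by (simp add: mult_ac)
    also have "\<dots> \<le> G n * G (Suc n)" using s Gp[OF n] by (intro mult_mono Glow) auto
    finally show ?thesis .
  qed
  have "t ^ n / G n - t ^ Suc n / G (Suc n) = t ^ n / (G n * G (Suc n))"
  proof -
    have "G (Suc n) - t * G n = 1"
    proof -
      have "G (Suc n) = 1 + t * G n" unfolding G_def by (subst sum.lessThan_Suc_shift) (simp add: sum_distrib_left)
      then show ?thesis by simp
    qed
    moreover have "G n \<noteq> 0" "G (Suc n) \<noteq> 0" using Gp[OF n] Gp[of "Suc n"] by auto
    then have "t ^ n / G n - t ^ Suc n / G (Suc n) = t ^ n * (G (Suc n) - t * G n) / (G n * G (Suc n))"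
      by (simp add: field_simps)
    ultimately show ?thesis by simp
  qed
  also have "\<dots> \<le> 1 / (real n * real (Suc n))"
  proof -
    have "t ^ n * (real n * real (Suc n)) \<le> 1 * (G n * G (Suc n))" using prod by (simp only: mult_ac mult_1)
    then show ?thesis using Gp[OF n] Gp[of "Suc n"] n by (simp add: divide_simps mult_ac)
  qed
  also have "\<dots> = 1 / real n - 1 / real (Suc n)" using n by (simp add: field_simps)
  finally have main: "1 / real (Suc n) - t ^ Suc n / G (Suc n) \<le> 1 / real n - t ^ n / G n" by linarith
  have b: "b m = (1 / real m - t ^ m / G m) / (1 - t)" for m
    unfolding b_def G using t by (simp add: diff_divide_distrib mult.commute)
  show ?thesis unfolding b using main t by (intro divide_right_mono) auto
qed

lemma lambert_coefficient_nonneg: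
  fixes t :: real
  assumes t: "0 < t" "t < 1" and n: "n \<ge> 1"
  shows "1 / (real n * (1 - t)) - t ^ n / (1 - t ^ n) \<ge> 0"
proof -
  have "1 - t ^ n > 0" using t n by (simp add: power_less_one_iff)
  have "real n * t ^ n \<le> (\<Sum>i<n. t ^ i)"
  proof -
    have "(\<Sum>i<n. t ^ n) \<le> (\<Sum>i<n. t ^ i)" using t by (intro sum_mono power_decreasing) auto
    then show ?thesis by simp
  qed
  then have "(real n * t ^ n) * (1 - t) \<le> (\<Sum>i<n. t ^ i) * (1 - t)" using t by (intro mult_right_mono) auto
  also have "\<dots> = 1 - t ^ n" by (simp add: one_diff_power_eq mult.commute)
  finally have "t ^ n * (real n * (1 - t)) \<le> 1 * (1 - t ^ n)" by (simp add: mult_ac)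
  then have "t ^ n / (1 - t ^ n) \<le> 1 / (real n * (1 - t))"
    using \<open>1 - t ^ n > 0\<close> t n by (simp add: divide_simps mult_ac)
  then show ?thesis by simp
qed

context nonprincipal_character
begin

text \<open>
  If \<open>L\<close> vanished, the Lambert series with coefficients \<open>\<xi> n\<close> would stay bounded as \<open>t\<close> tends to 1,
  because subtracting the multiple \<open>1 / (n * (1 - t))\<close> leaves monotone weights; but its power series
  coefficients are nonnegative and at least 1 at squares.
\<close>
lemma L_nonzero_if_real:
  assumes v: "\<And>n. \<xi> n \<in> {0, 1, -1}"
  shows "L \<noteq> 0"
proof
  assume L0: "L = 0"
  define \<rho> where "\<rho> n = Re (\<xi> n)" for n
  have \<xi>\<rho>: "\<xi> n = of_real (\<rho> n)" for n using v[of n] by (auto simp: \<rho>_def)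
  have \<rho>v: "\<rho> n \<in> {0, 1, -1}" for n using v[of n] by (auto simp: \<rho>_def)
  have \<rho>m: "\<rho> (m * n) = \<rho> m * \<rho> n" for m n
    using dirichlet_characterD(1)[OF char, of m n] unfolding \<xi>\<rho> by (metis of_real_eq_iff of_real_mult)
  have \<rho>1: "\<rho> 1 = 1" using dirichlet_character_1[OF char] unfolding \<xi>\<rho> by simp
  define r where "r n = (\<Sum>d | d dvd n. \<rho> d)" for n
  have r0: "r n \<ge> 0" "r (n\<^sup>2) \<ge> 1" if "n \<ge> 1" for n
    unfolding r_def using real_character_divisor_sum[OF \<rho>m \<rho>v \<rho>1] that by auto
  have bound: "(\<Sum>i=1..I. t ^ (i\<^sup>2)) \<le> 2 * real k" if t: "0 < t" "t < 1" for t :: real and I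
  proof -
    define b where "b n = 1 / (real n * (1 - t)) - t ^ n / (1 - t ^ n)" for n
    \<comment> \<open>The Lambert series is truncated to pairs with \<open>n * m \<le> N\<close>.
      The first \<open>2 * real k\<close> is Abel's bound with \<open>b 1 = 1\<close>; the other two
      terms, from the L-series cut at \<open>N\<close> and from the tails of the geometric series,
      vanish as \<open>N\<close> grows with \<open>t\<close> fixed.\<close>
    have fin: "(\<Sum>i=1..I. t ^ (i\<^sup>2)) \<le> 2 * real k + (2 * real k / real N) / (1 - t) + real N * t ^ N / (1 - t)"
      if N: "N \<ge> I\<^sup>2" "N \<ge> 1" for N
    proof -
      have tn: "t ^ m < 1" if "m \<ge> 1" for m using that t by (simp add: power_less_one_iff)
      have A: "\<bar>\<Sum>n=1..N. \<rho> n * b n\<bar> \<le> 2 * real k"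
      proof -
        have "norm (\<Sum>n=1..N. \<xi> n * of_real (b n)) \<le> 2 * real k * b 1"
          unfolding b_def by (rule abel_bound) (use t lambert_coefficient_antimono lambert_coefficient_nonneg in auto)
        moreover have "b 1 = 1" using t by (simp add: b_def diff_divide_distrib[symmetric])
        moreover have "(\<Sum>n=1..N. \<xi> n * of_real (b n)) = of_real (\<Sum>n=1..N. \<rho> n * b n)" unfolding \<xi>\<rho> by simp
        ultimately show ?thesis by (simp only: norm_of_real)
      qed
      have B: "\<bar>\<Sum>n=1..N. \<rho> n / real n\<bar> \<le> 2 * real k / real N"
      proof -
        have "norm ((\<Sum>n\<in>nups (real N). \<xi> n / of_nat n) - L) \<le> 2 * real k / real N" using N by (intro L_bound) auto
        moreover have "(\<Sum>n\<in>nups (real N). \<xi> n / of_nat n) = of_real (\<Sum>n=1..N. \<rho> n / real n)"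
          unfolding \<xi>\<rho> nups_of_nat by simp
        ultimately show ?thesis unfolding L0 by (simp only: norm_of_real diff_zero)
      qed
      have C: "(\<Sum>n=1..N. \<rho> n * (t ^ n / (1 - t ^ n))) = (\<Sum>n=1..N. \<rho> n / real n) / (1 - t) - (\<Sum>n=1..N. \<rho> n * b n)"
        unfolding sum_divide_distrib sum_subtractf[symmetric] b_def by (intro sum.cong refl) (simp add: algebra_simps)
      have D: "\<bar>(\<Sum>n=1..N. \<rho> n / real n) / (1 - t)\<bar> \<le> (2 * real k / real N) / (1 - t)"
        using divide_right_mono[OF B, of "1 - t"] t by (simp add: abs_divide)
      have E: "t ^ n / (1 - t ^ n) - (\<Sum>m\<in>nups (real N / real n). t ^ (n * m)) \<in> {0..t ^ N / (1 - t)}" if n: "n \<in> {1..N}" for n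
      proof -
        define q where "q = t ^ n"
        have q: "0 < q" "q < 1" using t n tn by (auto simp: q_def)
        define J where "J = N div n"
        have J: "nat \<lfloor>real N / real n\<rfloor> = J" unfolding J_def by (simp add: floor_divide_of_nat_eq)
        have "(\<Sum>m\<in>nups (real N / real n). t ^ (n * m)) = (\<Sum>m=1..J. q ^ m)"
          unfolding nups_altdef J q_def by (simp add: power_mult)
        also have "\<dots> = q * (\<Sum>m<J. q ^ m)"
          unfolding sum_distrib_left by (rule sum.reindex_bij_witness[of _ Suc "\<lambda>m. m - 1"]) (auto simp: power_Suc[symmetric] simp del: power_Suc)
        also have "(\<Sum>m<J. q ^ m) = (1 - q ^ J) / (1 - q)" using q one_diff_power_eq[of q J] by (simp add: field_simps)
        finally have eq: "q / (1 - q) - (\<Sum>m\<in>nups (real N / real n). t ^ (n * m)) = q ^ Suc J / (1 - q)"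
          using q by (simp add: field_simps)
        have "q ^ Suc J = t ^ (n * Suc J)" by (simp only: q_def power_mult)
        also have "\<dots> \<le> t ^ N"
        proof (rule power_decreasing)
          have "N = n * J + N mod n" by (simp add: J_def)
          moreover have "N mod n < n" using n by simp
          ultimately show "N \<le> n * Suc J" by simp
        qed (use t in auto)
        finally have "q ^ Suc J / (1 - q) \<le> t ^ N / (1 - q)" using q by (intro divide_right_mono) auto
        also have "\<dots> \<le> t ^ N / (1 - t)"
        proof -
          have "q \<le> t" unfolding q_def using t n power_decreasing[of 1 n t] by simp
          then show ?thesis using t q by (intro divide_left_mono mult_pos_pos) auto
        qed
        finally show ?thesis using eq q unfolding q_def[symmetric] by simp
      qed
      have F: "\<bar>(\<Sum>n=1..N. \<rho> n * (t ^ n / (1 - t ^ n))) - (\<Sum>n=1..N. \<rho> n * (\<Sum>m\<in>nups (real N / real n). t ^ (n * m)))\<bar> \<le> real N * t ^ N / (1 - t)"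
      proof -
        have "(\<Sum>n=1..N. \<rho> n * (t ^ n / (1 - t ^ n))) - (\<Sum>n=1..N. \<rho> n * (\<Sum>m\<in>nups (real N / real n). t ^ (n * m)))
           = (\<Sum>n=1..N. \<rho> n * (t ^ n / (1 - t ^ n) - (\<Sum>m\<in>nups (real N / real n). t ^ (n * m))))"
          by (simp add: sum_subtractf right_diff_distrib)
        also have "\<bar>\<dots>\<bar> \<le> (\<Sum>n=1..N. t ^ N / (1 - t))"
        proof (rule order_trans[OF sum_abs sum_mono])
          fix n assume "n \<in> {1..N}"
          moreover have "\<bar>\<rho> n\<bar> \<le> 1" using \<rho>v[of n] by auto
          ultimately have "\<bar>\<rho> n\<bar> * \<bar>t ^ n / (1 - t ^ n) - (\<Sum>m\<in>nups (real N / real n). t ^ (n * m))\<bar> \<le> 1 * (t ^ N / (1 - t))"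
            using E[of n] by (intro mult_mono) auto
          then show "\<bar>\<rho> n * (t ^ n / (1 - t ^ n) - (\<Sum>m\<in>nups (real N / real n). t ^ (n * m)))\<bar> \<le> t ^ N / (1 - t)"
            by (simp add: abs_mult)
        qed
        finally show ?thesis by simp
      qed
      have G: "(\<Sum>n=1..N. \<rho> n * (\<Sum>m\<in>nups (real N / real n). t ^ (n * m))) = (\<Sum>j=1..N. r j * t ^ j)"
      proof -
        have "(\<Sum>n\<in>nups (real N). \<Sum>m\<in>nups (real N / real n). \<rho> n * t ^ (n * m)) = (\<Sum>j\<in>nups (real N). \<Sum>d | d dvd j. \<rho> d * t ^ (d * (j div d)))"
          by (rule sum_divisors_nups[symmetric])
        also have "\<dots> = (\<Sum>j\<in>nups (real N). r j * t ^ j)"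
          unfolding r_def sum_distrib_right by (intro sum.cong refl) auto
        finally show ?thesis unfolding nups_of_nat sum_distrib_left .
      qed
      have "(\<Sum>i=1..I. t ^ (i\<^sup>2)) \<le> (\<Sum>i=1..I. r (i\<^sup>2) * t ^ (i\<^sup>2))"
        using r0(2) t by (intro sum_mono) (auto simp: mult_le_cancel_right1)
      also have "\<dots> = (\<Sum>j\<in>(\<lambda>i. i\<^sup>2) ` {1..I}. r j * t ^ j)"
        by (subst sum.reindex) (auto intro!: inj_onI)
      also have "\<dots> \<le> (\<Sum>j=1..N. r j * t ^ j)"
      proof (rule sum_mono2)
        show "(\<lambda>i. i\<^sup>2) ` {1..I} \<subseteq> {1..N}"
        proof
          fix j assume "j \<in> (\<lambda>i. i\<^sup>2) ` {1..I}"
          then obtain i where i: "j = i\<^sup>2" "1 \<le> i" "i \<le> I" by auto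
          have "i\<^sup>2 \<le> I\<^sup>2" using i by (intro power_mono) auto
          then have "i\<^sup>2 \<le> N" using N by linarith
          then show "j \<in> {1..N}" using i by auto
        qed
      qed (use r0(1) t in auto)
      finally have "(\<Sum>i=1..I. t ^ (i\<^sup>2)) \<le> (\<Sum>n=1..N. \<rho> n * (\<Sum>m\<in>nups (real N / real n). t ^ (n * m)))" using G by simp
      then show ?thesis using F C D A by linarith
    qed
    have lim1: "(\<lambda>N. (2 * real k / real N) / (1 - t)) \<longlonglongrightarrow> 0 / (1 - t)"
      by (intro tendsto_divide tendsto_const) (use t in \<open>auto intro: lim_const_over_n\<close>)
    have lim2: "(\<lambda>N. real N * t ^ N / (1 - t)) \<longlonglongrightarrow> 0 / (1 - t)"
      by (intro tendsto_divide tendsto_const) (use t in \<open>auto intro!: powser_times_n_limit_0\<close>)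
    have "(\<lambda>N. 2 * real k + (2 * real k / real N) / (1 - t) + real N * t ^ N / (1 - t)) \<longlonglongrightarrow> 2 * real k + 0 / (1 - t) + 0 / (1 - t)"
      by (intro tendsto_add tendsto_const lim1 lim2)
    then have "(\<lambda>N. 2 * real k + (2 * real k / real N) / (1 - t) + real N * t ^ N / (1 - t)) \<longlonglongrightarrow> 2 * real k" by simp
    then show ?thesis
      by (rule tendsto_lowerbound) (use fin in \<open>auto intro!: eventually_sequentiallyI[of "max 1 (I\<^sup>2)"]\<close>)
  qed
  \<comment> \<open>As \<open>t\<close> tends to 1, the sum tends to the number \<open>I\<close> of
    its terms, which just exceeds the uniform bound \<open>2 * k\<close>.\<close>
  define I where "I = 2 * k + 1"
  have "((\<lambda>t::real. \<Sum>i=1..I. t ^ (i\<^sup>2)) \<longlongrightarrow> (\<Sum>i=1..I. 1 ^ (i\<^sup>2))) (at_left 1)"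
    by (intro tendsto_intros)
  then have "(\<Sum>i=1..I. (1::real) ^ (i\<^sup>2)) \<le> 2 * real k"
  proof (rule tendsto_upperbound)
    have "eventually (\<lambda>t::real. t \<in> {0<..<1}) (at_left 1)" by (rule eventually_at_left_real) simp
    then show "\<forall>\<^sub>F t in at_left 1. (\<Sum>i=1..I. t ^ (i\<^sup>2)) \<le> 2 * real k"
      by eventually_elim (use bound in auto)
  qed simp
  then show False by (simp add: I_def)
qed

end

section \<open>Characters that are constant on almost every prime\<close>

lemma not_le_log_growth:
  assumes "\<And>e. e > 0 \<Longrightarrow> \<exists>K. \<forall>x\<ge>1. a * ln x \<le> e * ln x + K"
  shows "a \<le> (0::real)"
proof (rule ccontr)
  assume "\<not> a \<le> 0"
  then have a: "a > 0" by simp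
  obtain K where K: "\<And>x. x \<ge> 1 \<Longrightarrow> a * ln x \<le> a / 2 * ln x + K" using assms[of "a / 2"] a by auto
  define x where "x = exp (2 * \<bar>K\<bar> / a + 1)"
  have x: "x \<ge> 1" "ln x = 2 * \<bar>K\<bar> / a + 1" using a by (auto simp: x_def)
  have "a * ln x = 2 * \<bar>K\<bar> + a" using x a by (simp add: field_simps)
  moreover have "a / 2 * ln x = \<bar>K\<bar> + a / 2" using x a by (simp add: field_simps)
  ultimately show False using K[OF x(1)] a by linarith
qed

context nonprincipal_character
begin

text \<open>If all values were \<open>c\<close>, Mertens' estimate would give
  \<open>c * ln x + O(1)\<close>; the exceptional primes change this by o(ln x) and the proper prime
  powers by O(1).\<close>

lemma M_growth:
  assumes thin: "thin_set {p. prime p \<and> \<xi> p \<noteq> c}" and e: "e > 0"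
  shows "\<exists>K. \<forall>x\<ge>1. norm (M x - c * of_real (ln x)) \<le> e * ln x + K"
proof -
  define b where "b = 1 + norm c"
  have b: "b > 0" by (simp add: b_def add_pos_nonneg)
  obtain C where C: "C > 0" "\<And>x. (\<Sum>n\<in>{n\<in>nups x. \<not> prime n}. mangoldt n / real n) \<le> C"
    using sum_mangoldt_nonprime by blast
  obtain D where D: "D > 0" "\<And>x. x \<ge> 1 \<Longrightarrow> \<bar>(\<Sum>n\<in>nups x. mangoldt n / real n) - ln x\<bar> \<le> D"
    using mertens_mangoldt by blast
  define B where "B = {p. prime p \<and> \<xi> p \<noteq> c}"
  have "e / b > 0" using e b by simp
  then obtain K where K: "K \<ge> 0" "\<And>x. x \<ge> 1 \<Longrightarrow> (\<Sum>p\<in>B \<inter> nups x. ln (real p) / real p) \<le> e / b * ln x + K"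
    using sparse_log_sum[OF thin] unfolding B_def by blast
  have "norm (M x - c * of_real (ln x)) \<le> e * ln x + (b * C + b * K + norm c * D)" if x: "x \<ge> 1" for x
  proof -
    define w where "w n = (mangoldt n / real n :: real)" for n
    have w0: "w n \<ge> 0" for n by (simp add: w_def mangoldt_nonneg)
    have "norm (\<Sum>n\<in>nups x. (\<xi> n - c) * of_real (w n)) \<le> (\<Sum>n\<in>nups x. (if prime n then 0 else b * w n) + (if n \<in> B then b * w n else 0))"
    proof (rule sum_norm_le)
      fix n assume "n \<in> nups x"
      have "norm (\<xi> n - c) \<le> b" unfolding b_def
        by (rule order_trans[OF norm_triangle_ineq4]) (simp add: norm_le_1)
      then have "norm (\<xi> n - c) * w n \<le> b * w n" using w0 by (rule mult_right_mono)
      then show "norm ((\<xi> n - c) * of_real (w n)) \<le> (if prime n then 0 else b * w n) + (if n \<in> B then b * w n else 0)"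
        using w0[of n] b unfolding norm_mult by (auto simp: B_def)
    qed
    also have "\<dots> = b * (\<Sum>n\<in>{n\<in>nups x. \<not> prime n}. w n) + b * (\<Sum>n\<in>B \<inter> nups x. w n)"
    proof -
      have "(\<Sum>n\<in>nups x. if prime n then 0 else b * w n) = (\<Sum>n\<in>{n\<in>nups x. \<not> prime n}. b * w n)"
        by (rule sum.mono_neutral_cong_right) auto
      moreover have "(\<Sum>n\<in>nups x. if n \<in> B then b * w n else 0) = (\<Sum>n\<in>B \<inter> nups x. b * w n)"
        by (rule sum.mono_neutral_cong_right) auto
      ultimately show ?thesis by (simp only: sum.distrib sum_distrib_left)
    qed
    also have "\<dots> \<le> b * C + b * (e / b * ln x + K)"
    proof (intro add_mono mult_left_mono)
      show "(\<Sum>n\<in>{n\<in>nups x. \<not> prime n}. w n) \<le> C" unfolding w_def by (rule C(2))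
      have "(\<Sum>n\<in>B \<inter> nups x. w n) = (\<Sum>p\<in>B \<inter> nups x. ln (real p) / real p)"
        by (intro sum.cong refl) (auto simp: w_def B_def)
      then show "(\<Sum>n\<in>B \<inter> nups x. w n) \<le> e / b * ln x + K" using K(2)[OF x] by simp
    qed (use b in auto)
    also have "\<dots> = e * ln x + (b * C + b * K)" using b by (simp add: field_simps)
    finally have 1: "norm (\<Sum>n\<in>nups x. (\<xi> n - c) * of_real (w n)) \<le> e * ln x + (b * C + b * K)" .
    have 2: "norm (c * of_real ((\<Sum>n\<in>nups x. w n) - ln x)) \<le> norm c * D"
      unfolding norm_mult norm_of_real w_def by (intro mult_left_mono D(2) x) auto
    have "M x - c * of_real (ln x) = (\<Sum>n\<in>nups x. (\<xi> n - c) * of_real (w n)) + c * of_real ((\<Sum>n\<in>nups x. w n) - ln x)"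
    proof -
      have "M x = (\<Sum>n\<in>nups x. \<xi> n * of_real (w n))" by (simp add: M_def w_def)
      moreover have "(\<Sum>n\<in>nups x. (\<xi> n - c) * of_real (w n)) = (\<Sum>n\<in>nups x. \<xi> n * of_real (w n)) - c * of_real (\<Sum>n\<in>nups x. w n)"
        by (simp add: left_diff_distrib sum_subtractf sum_distrib_left)
      ultimately show ?thesis by (simp add: right_diff_distrib del: of_real_sum)
    qed
    then show ?thesis using norm_triangle_mono[OF 1 2] by simp
  qed
  then show ?thesis by blast
qed

text \<open>\<open>M x\<close> grows like \<open>c * ln x\<close> by \<open>M_growth\<close>; on the
  other hand it is bounded if \<open>L \<noteq> 0\<close>, and it is \<open>- ln x + O(1)\<close> if
  \<open>L = 0\<close>.\<close>

lemma thin_value_is_minus_1: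
  assumes thin: "thin_set {p. prime p \<and> \<xi> p \<noteq> c}" and c0: "c \<noteq> 0"
  shows "L = 0 \<and> c = -1"
proof -
  have L: "L = 0"
  proof (rule ccontr)
    assume L: "L \<noteq> 0"
    obtain K where K: "\<And>x. x \<ge> 1 \<Longrightarrow> norm (L * M x) \<le> K" using L_times_M_bounded by blast
    have "norm c \<le> 0"
    proof (rule not_le_log_growth)
      fix e :: real assume "e > 0"
      then obtain K' where K': "\<And>x. x \<ge> 1 \<Longrightarrow> norm (M x - c * of_real (ln x)) \<le> e * ln x + K'"
        using M_growth[OF thin] by blast
      have "norm c * ln x \<le> e * ln x + (K' + K / norm L)" if x: "x \<ge> 1" for x
      proof -
        have "norm c * ln x = norm (c * of_real (ln x))" using x by (simp add: norm_mult)
        also have "\<dots> \<le> norm (M x) + norm (M x - c * of_real (ln x))" by (metis norm_triangle_sub norm_minus_commute)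
        also have "norm (M x) \<le> K / norm L" using K[OF x] L by (simp add: norm_mult field_simps)
        also have "norm (M x - c * of_real (ln x)) \<le> e * ln x + K'" by (rule K'[OF x])
        finally show ?thesis by simp
      qed
      then show "\<exists>K. \<forall>x\<ge>1. norm c * ln x \<le> e * ln x + K" by blast
    qed
    then show False using c0 by simp
  qed
  obtain K where K: "\<And>x. x \<ge> 1 \<Longrightarrow> norm (M x + of_real (ln x)) \<le> K" using M_if_L_zero[OF L] by blast
  have "norm (c + 1) \<le> 0"
  proof (rule not_le_log_growth)
    fix e :: real assume "e > 0"
    then obtain K' where K': "\<And>x. x \<ge> 1 \<Longrightarrow> norm (M x - c * of_real (ln x)) \<le> e * ln x + K'"
      using M_growth[OF thin] by blast
    have "norm (c + 1) * ln x \<le> e * ln x + (K' + K)" if x: "x \<ge> 1" for x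
    proof -
      have "norm (c + 1) * ln x = norm ((c + 1) * of_real (ln x))" using x by (simp add: norm_mult)
      also have "(c + 1) * of_real (ln x) = (M x + of_real (ln x)) - (M x - c * of_real (ln x))" by (simp add: algebra_simps)
      also have "norm \<dots> \<le> K + (e * ln x + K')"
        by (rule order_trans[OF norm_triangle_ineq4 add_mono]) (use K K' x in auto)
      finally show ?thesis by simp
    qed
    then show "\<exists>K. \<forall>x\<ge>1. norm (c + 1) * ln x \<le> e * ln x + K" by blast
  qed
  then have "c = -1" by (simp add: eq_neg_iff_add_eq_0)
  then show ?thesis using L by simp
qed

end

text \<open>The sieve finds a number congruent to \<open>m\<close> modulo \<open>k\<close> all of
  whose prime factors satisfy \<open>\<xi> p = 1\<close>; it takes the place of a prime in the
  residue class.\<close>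

lemma character_trivial_if_thin:
  assumes k: "k \<ge> 1" and char: "dirichlet_character k \<xi>" and thin: "thin_set {p. prime p \<and> \<xi> p \<noteq> 1}"
    and m: "coprime m k"
  shows "\<xi> m = 1"
proof -
  have thin': "thin_set {p. prime p \<and> \<xi> p \<noteq> 1}" by (rule thin)
  obtain Q r N0 where Q: "Q \<ge> 1" "r \<ge> 1" "k dvd Q" "[r = m] (mod k)" "coprime r Q"
    "\<And>N. N \<ge> N0 \<Longrightarrow> real (card {n\<in>{1..N}. \<exists>p\<in>{p. prime p \<and> \<xi> p \<noteq> 1}. p dvd Q * n + r}) \<le> real N / 4"
    by (rule sparse_sieve[OF thin' _ k m]) auto
  define N where "N = Suc N0"
  have "{n\<in>{1..N}. \<exists>p\<in>{p. prime p \<and> \<xi> p \<noteq> 1}. p dvd Q * n + r} \<noteq> {1..N}"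
  proof
    assume "{n\<in>{1..N}. \<exists>p\<in>{p. prime p \<and> \<xi> p \<noteq> 1}. p dvd Q * n + r} = {1..N}"
    then have "real (card {1..N}) \<le> real N / 4" using Q(6)[of N] by (simp add: N_def)
    then show False by (simp add: N_def)
  qed
  then obtain n where n: "\<And>p. prime p \<Longrightarrow> p dvd Q * n + r \<Longrightarrow> \<xi> p = 1" by blast
  have "\<xi> (Q * n + r) = 1"
  proof (rule mult_eq_1_if_primes)
    show "\<xi> 1 = 1" by (rule dirichlet_character_1[OF char])
  qed (use n Q(2) dirichlet_characterD(1)[OF char] in auto)
  moreover have "[Q * n + r = m] (mod k)"
  proof -
    have "[Q * n + r = r] (mod k)" using Q(3) by (auto simp: cong_def mult.assoc elim!: dvdE)
    then show ?thesis using Q(4) cong_trans by blast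
  qed
  ultimately show ?thesis using dirichlet_characterD(2)[OF char] by metis
qed

text \<open>If \<open>c \<noteq> 1\<close>, the character is not principal, and so
  \<open>c = -1\<close> and \<open>L = 0\<close>. Then its square is 1 at almost every prime, hence
  principal by \<open>character_trivial_if_thin\<close>; so the character is real, and
  \<open>L \<noteq> 0\<close>.\<close>

theorem character_thin_value:
  assumes k: "k \<ge> 1" and char: "dirichlet_character k \<xi>" and thin: "thin_set {p. prime p \<and> \<xi> p \<noteq> c}"
  shows "c = 1"
proof (rule ccontr)
  assume c1: "c \<noteq> 1"
  have fin: "finite {p. p dvd k}" using k by simp
  have "\<exists>p. prime p \<and> \<xi> p = c \<and> \<not> p dvd k"
  proof (rule ccontr)
    assume "\<not> ?thesis"
    then have "{p. prime p} \<subseteq> {p. prime p \<and> \<xi> p \<noteq> c} \<union> {p. p dvd k}" by blast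
    then show False using sparse_subset[OF sparse_Un[OF thin sparse_finite[OF fin]]] primes_not_sparse by blast
  qed
  then obtain p where p: "prime p" "\<xi> p = c" "\<not> p dvd k" by blast
  then have cop: "coprime p k" by (simp add: prime_imp_coprime)
  interpret nonprincipal_character k \<xi> p by unfold_locales (use k char cop p c1 in auto)
  have c0: "c \<noteq> 0" using dirichlet_characterD(3)[OF char] cop p by auto
  have Lc: "L = 0" "c = -1" using thin_value_is_minus_1[OF thin c0] by auto
  have sq: "\<xi> m * \<xi> m = 1" if "coprime m k" for m
  proof (rule character_trivial_if_thin[OF k dirichlet_character_mult[OF char char] _ that])
    show "thin_set {p. prime p \<and> \<xi> p * \<xi> p \<noteq> 1}"
      by (rule sparse_subset[OF thin]) (auto simp: Lc)
  qed
  have "\<xi> n \<in> {0, 1, -1}" for n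
  proof (cases "coprime n k")
    case True
    then have "(\<xi> n)\<^sup>2 = 1" using sq by (simp add: power2_eq_square)
    then show ?thesis by (simp add: power2_eq_1_iff)
  qed (use dirichlet_characterD(3)[OF char] in auto)
  then show False using L_nonzero_if_real Lc by blast
qed

section \<open>Mean values over residue classes\<close>

text \<open>The primes with \<open>f p \<noteq> 1\<close> split into finitely many classes according
  to the value of \<open>f\<close>, so one of these classes has a divergent reciprocal sum.\<close>

lemma (in completely_mult) mean_value_zero_nat:
  assumes "finite (f ` {p. prime p})" and "\<not> thin_set {p. prime p \<and> f p \<noteq> 1}"
  shows "(\<lambda>N. (\<Sum>n=1..N. f n) / of_nat N) \<longlonglongrightarrow> 0"
proof -
  have "\<exists>z\<in>f ` {p. prime p} - {1}. \<not> thin_set {p. prime p \<and> f p = z}"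
  proof (rule ccontr)
    assume "\<not> ?thesis"
    then have "thin_set (\<Union>z\<in>f ` {p. prime p} - {1}. {p. prime p \<and> f p = z})"
      using assms(1) by (intro sparse_UN) auto
    moreover have "{p. prime p \<and> f p \<noteq> 1} \<subseteq> (\<Union>z\<in>f ` {p. prime p} - {1}. {p. prime p \<and> f p = z})" by auto
    ultimately show False using assms(2) sparse_subset by blast
  qed
  then obtain z where z: "z \<noteq> 1" "\<not> thin_set {p. prime p \<and> f p = z}" by blast
  have "(A \<longlongrightarrow> 0) at_top" by (rule mean_value_zero[OF assms(1) z])
  then have "(\<lambda>N. A (real N)) \<longlonglongrightarrow> 0" by (rule filterlim_compose) (rule filterlim_real_sequentially)
  then show ?thesis by (simp add: A_def S_def nups_of_nat)
qed

text \<open>Residue classes are detected by Dirichlet characters, so only character twists of \<open>f\<close> matter.\<close>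
theorem residue_class_mean_zero:
  fixes f :: "nat \<Rightarrow> complex"
  assumes mult: "\<And>m n. m \<ge> 1 \<Longrightarrow> n \<ge> 1 \<Longrightarrow> f (m * n) = f m * f n"
    and norm1: "\<And>n. n \<ge> 1 \<Longrightarrow> norm (f n) = 1"
    and fin: "finite (f ` {p. prime p})"
    and twist: "\<And>k \<xi>. k \<ge> 1 \<Longrightarrow> dirichlet_character k \<xi> \<Longrightarrow> \<not> thin_set {p. prime p \<and> f p * \<xi> p \<noteq> 1}"
    and k: "k \<ge> 1"
  shows "(\<lambda>N. (\<Sum>n\<in>{n\<in>{1..N}. [n = r] (mod k)}. f n) / of_nat N) \<longlonglongrightarrow> 0"
proof -
  have cop: "(\<lambda>N. (\<Sum>n\<in>{n\<in>{1..N}. [n = r] (mod k)}. f n) / of_nat N) \<longlonglongrightarrow> 0"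
    if k: "k \<ge> 1" and r: "coprime r k" for k r :: nat
  proof -
    define X where "X = {\<xi>. dirichlet_character k \<xi>}"
    have fX: "finite X" unfolding X_def by (rule finite_dirichlet_characters[OF k])
    have cX: "card X > 0" using dirichlet_character_principal[of k] fX by (auto simp: X_def card_gt_0_iff)
    obtain r' where r': "\<And>n. (\<Sum>\<xi>\<in>X. \<xi> r' * \<xi> n) = (if [n = r] (mod k) then of_nat (card X) else 0)"
      using dirichlet_character_orthogonality[OF k r] unfolding X_def by blast
    have tw: "(\<lambda>N. (\<Sum>n=1..N. f n * \<xi> n) / of_nat N) \<longlonglongrightarrow> 0" if x: "\<xi> \<in> X" for \<xi>
    proof -
      have ch: "dirichlet_character k \<xi>" using x by (simp add: X_def)
      interpret cm: completely_mult "\<lambda>n. f n * \<xi> n"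
      proof
        show "norm (f n * \<xi> n) = 0 \<or> norm (f n * \<xi> n) = 1" if "n \<ge> 1" for n
          using norm1[OF that] norm_dirichlet_character[OF ch _ k] dirichlet_characterD(3)[OF ch]
          by (cases "coprime n k") (auto simp: norm_mult)
      qed (use mult dirichlet_characterD(1)[OF ch] in \<open>simp add: mult_ac\<close>)
      show ?thesis
      proof (rule cm.mean_value_zero_nat)
        have "finite (range \<xi>)"
        proof -
          have "range \<xi> \<subseteq> \<xi> ` {..<k}"
          proof clarify
            fix n
            have "[n = n mod k] (mod k)" by simp
            then have "\<xi> n = \<xi> (n mod k)" by (rule dirichlet_characterD(2)[OF ch])
            then show "\<xi> n \<in> \<xi> ` {..<k}" using k by auto
          qed
          then show ?thesis by (rule finite_subset) simp
        qed
        then have "finite ((\<lambda>(u,v). u * v) ` (f ` {p. prime p} \<times> range \<xi>))" using fin by simp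
        then show "finite ((\<lambda>n. f n * \<xi> n) ` {p. prime p})"
          by (rule finite_subset[rotated]) auto
        show "\<not> thin_set {p. prime p \<and> f p * \<xi> p \<noteq> 1}" by (rule twist[OF k ch])
      qed
    qed
    have "(\<Sum>n\<in>{n\<in>{1..N}. [n = r] (mod k)}. f n) / of_nat N = (\<Sum>\<xi>\<in>X. \<xi> r' * ((\<Sum>n=1..N. f n * \<xi> n) / of_nat N)) / of_nat (card X)" for N
    proof -
      have "(\<Sum>\<xi>\<in>X. \<xi> r' * (\<Sum>n=1..N. f n * \<xi> n)) = (\<Sum>n=1..N. f n * (\<Sum>\<xi>\<in>X. \<xi> r' * \<xi> n))"
        unfolding sum_distrib_left by (subst sum.swap) (simp add: mult_ac)
      also have "\<dots> = (\<Sum>n=1..N. if [n = r] (mod k) then f n * of_nat (card X) else 0)"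
        unfolding r' by (intro sum.cong refl) auto
      also have "\<dots> = (\<Sum>n\<in>{n\<in>{1..N}. [n = r] (mod k)}. f n * of_nat (card X))"
        by (rule sum.mono_neutral_cong_right) auto
      finally have e: "(\<Sum>\<xi>\<in>X. \<xi> r' * (\<Sum>n=1..N. f n * \<xi> n)) = (\<Sum>n\<in>{n\<in>{1..N}. [n = r] (mod k)}. f n) * of_nat (card X)"
        by (simp add: sum_distrib_right)
      show ?thesis unfolding times_divide_eq_right sum_divide_distrib[symmetric] e using cX by simp
    qed
    moreover have "(\<lambda>N. (\<Sum>\<xi>\<in>X. \<xi> r' * ((\<Sum>n=1..N. f n * \<xi> n) / of_nat N)) / of_nat (card X)) \<longlonglongrightarrow> (\<Sum>\<xi>\<in>X. \<xi> r' * 0) / of_nat (card X)"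
      by (intro tendsto_divide tendsto_sum tendsto_mult tendsto_const tw) (use cX in auto)
    ultimately show ?thesis by simp
  qed
  \<comment> \<open>Reduction to a coprime class: the greatest common divisor \<open>g\<close> of
    residue and modulus divides every \<open>n\<close> in the class and is pulled out of
    \<open>f\<close>.\<close>
  define r1 where "r1 = r + k"
  define g where "g = gcd r1 k"
  have g: "g \<ge> 1" using k by (simp add: g_def Suc_le_eq)
  obtain r2 where r2: "r1 = g * r2" unfolding g_def by (metis dvdE gcd_dvd1)
  obtain k2 where k2: "k = g * k2" unfolding g_def by (metis dvdE gcd_dvd2)
  have k21: "k2 \<ge> 1" using k k2 by (cases k2) auto
  have cop2: "coprime r2 k2"
  proof -
    have "g * gcd r2 k2 = g * 1" using r2 k2 by (metis g_def gcd_mult_distrib_nat mult.right_neutral)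
    then have "gcd r2 k2 = 1" using g mult_cancel1[of g "gcd r2 k2" 1] by linarith
    then show ?thesis by (simp only: coprime_iff_gcd_eq_1)
  qed
  have eq: "(\<Sum>n\<in>{n\<in>{1..N}. [n = r] (mod k)}. f n) = f g * (\<Sum>m\<in>{m\<in>{1..N div g}. [m = r2] (mod k2)}. f m)" for N
  proof -
    have "(\<Sum>n\<in>{n\<in>{1..N}. [n = r] (mod k)}. f n) = (\<Sum>m\<in>{m\<in>{1..N div g}. [m = r2] (mod k2)}. f (g * m))"
    proof (rule sum.reindex_bij_witness[of _ "\<lambda>m. g * m" "\<lambda>n. n div g"])
      fix n assume n: "n \<in> {n\<in>{1..N}. [n = r] (mod k)}"
      then have c: "[n = r1] (mod k)" by (simp add: r1_def cong_def)
      then have "[n = r1] (mod g)" using k2 by (metis cong_modulus_mult_nat)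
      then have "g dvd n" using r2 by (simp add: cong_def mod_eq_0_iff_dvd)
      then obtain m where m: "n = g * m" by auto
      show "g * (n div g) = n" using m g by simp
      then show "f (g * (n div g)) = f n" by simp
      have "[g * m = g * r2] (mod g * k2)" using c m r2 k2 by simp
      then have "[m = r2] (mod k2)" using g by (simp add: cong_def mult_mod_right[symmetric])
      moreover have "m \<le> N div g" using n m g by (simp add: less_eq_div_iff_mult_less_eq mult.commute)
      ultimately show "n div g \<in> {m\<in>{1..N div g}. [m = r2] (mod k2)}" using n m g by (cases m) auto
    next
      fix m assume m: "m \<in> {m\<in>{1..N div g}. [m = r2] (mod k2)}"
      then have "[g * m = g * r2] (mod g * k2)" by (simp add: cong_def mult_mod_right[symmetric])
      then have "[g * m = r1] (mod k)" unfolding r2 k2 .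
      moreover have "[r1 = r] (mod k)" by (simp add: r1_def cong_def)
      ultimately have "[g * m = r] (mod k)" by (rule cong_trans)
      moreover have "g * m \<le> N" using m g by (simp add: less_eq_div_iff_mult_less_eq mult.commute)
      ultimately show "g * m \<in> {n\<in>{1..N}. [n = r] (mod k)}" using m g by auto
      show "g * m div g = m" using g by simp
    qed
    also have "\<dots> = (\<Sum>m\<in>{m\<in>{1..N div g}. [m = r2] (mod k2)}. f g * f m)"
      using mult g by (intro sum.cong refl) auto
    finally show ?thesis by (simp add: sum_distrib_left)
  qed
  define a where "a N = (\<Sum>m\<in>{m\<in>{1..N}. [m = r2] (mod k2)}. f m) / of_nat N" for N
  have a: "a \<longlonglongrightarrow> 0" unfolding a_def by (rule cop[OF k21 cop2])
  have "(\<lambda>N. a (N div g)) \<longlonglongrightarrow> 0"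
  proof (rule filterlim_compose[OF a])
    show "filterlim (\<lambda>N. N div g) at_top at_top"
      unfolding filterlim_at_top
    proof
      fix Z :: nat
      show "\<forall>\<^sub>F N in sequentially. Z \<le> N div g"
        by (rule eventually_sequentiallyI[of "Z * g"]) (use g in \<open>simp add: less_eq_div_iff_mult_less_eq\<close>)
    qed
  qed
  then have an: "(\<lambda>N. norm (a (N div g))) \<longlonglongrightarrow> 0" by (rule tendsto_norm_zero)
  show ?thesis
  proof (rule Lim_null_comparison[OF _ an], rule eventually_sequentiallyI[of 1])
    fix N :: nat assume N: "1 \<le> N"
    have "norm ((\<Sum>n\<in>{n\<in>{1..N}. [n = r] (mod k)}. f n) / of_nat N) = norm (\<Sum>m\<in>{m\<in>{1..N div g}. [m = r2] (mod k2)}. f m) / real N"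
      unfolding eq using norm1[OF g] by (simp add: norm_mult norm_divide)
    also have "\<dots> \<le> norm (a (N div g))"
    proof (cases "N div g = 0")
      case True then show ?thesis by simp
    next
      case False
      have "N div g \<le> N" by simp
      then have "real (N div g) \<le> real N" by (simp only: of_nat_le_iff)
      then show ?thesis unfolding a_def norm_divide norm_of_nat using False N by (intro divide_left_mono mult_pos_pos) auto
    qed
    finally show "norm ((\<Sum>n\<in>{n\<in>{1..N}. [n = r] (mod k)}. f n) / of_nat N) \<le> norm (a (N div g))" .
  qed
qed

section \<open>Exponentials of additive functions\<close>

lemma e_char_cis: "e_char t = cis (2 * pi * t)"
  by (simp add: e_char_def cis_conv_exp mult_ac)

lemma norm_e_char [simp]: "norm (e_char t) = 1"
  by (simp add: e_char_cis)

lemma e_char_0 [simp]: "e_char 0 = 1"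
  by (simp add: e_char_cis)

lemma e_char_add: "e_char (s + t) = e_char s * e_char t"
  by (simp add: e_char_cis cis_mult distrib_left)

lemma e_char_minus: "e_char (- t) = cnj (e_char t)"
  by (simp add: e_char_cis cis_cnj)

lemma e_char_of_nat_mult: "e_char (real n * t) = e_char t ^ n"
  by (induction n) (auto simp: e_char_add distrib_right)

lemma e_char_eq_1_iff: "e_char t = 1 \<longleftrightarrow> t \<in> \<int>"
proof
  assume "e_char t = 1"
  then obtain n :: int where "2 * pi * t = of_int (2 * n) * pi"
    unfolding e_char_def by (auto simp: exp_eq_1)
  then have "t = of_int n" by simp
  then show "t \<in> \<int>" by simp
next
  assume "t \<in> \<int>"
  then obtain n :: int where "t = of_int n" by (elim Ints_cases)
  then show "e_char t = 1" unfolding e_char_def by (auto simp: exp_eq_1)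
qed

lemma e_char_int [simp]: "e_char (of_int n) = 1"
  by (simp add: e_char_eq_1_iff)

text \<open>All residues are included, coprime to \<open>k\<close> or not, because the periodic part
  of \<open>F\<close> leads to averages over every class.\<close>

definition residue_mean_zero :: "(nat \<Rightarrow> int) \<Rightarrow> real \<Rightarrow> bool" where
  "residue_mean_zero a \<theta> \<longleftrightarrow> (\<forall>k\<ge>1. \<forall>r. (\<lambda>N. (\<Sum>n\<in>{n\<in>{1..N}. [n = r] (mod k)}. e_char (of_int (a n) * \<theta>)) / of_nat N) \<longlonglongrightarrow> 0)"

lemma e_char_additive:
  assumes "completely_additive a" "m \<ge> 1" "n \<ge> 1"
  shows "e_char (of_int (a (m * n)) * \<theta>) = e_char (of_int (a m) * \<theta>) * e_char (of_int (a n) * \<theta>)"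
  using assms unfolding completely_additive_def by (simp add: distrib_right e_char_add)

lemma residue_mean_zero_criterion:
  assumes add: "completely_additive a" and fg: "finitely_generated a"
    and twist: "\<And>k \<xi>. k \<ge> 1 \<Longrightarrow> dirichlet_character k \<xi> \<Longrightarrow> \<not> thin_set {p. prime p \<and> e_char (of_int (a p) * \<theta>) * \<xi> p \<noteq> 1}"
  shows "residue_mean_zero a \<theta>"
  unfolding residue_mean_zero_def
proof (intro allI impI)
  fix k r :: nat assume k: "k \<ge> 1"
  have fin: "finite ((\<lambda>n. e_char (of_int (a n) * \<theta>)) ` {p. prime p})"
  proof -
    have "(\<lambda>n. e_char (of_int (a n) * \<theta>)) ` {p. prime p} = (\<lambda>v. e_char (of_int v * \<theta>)) ` (a ` {p. prime p})"
      by (simp add: image_image)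
    then show ?thesis using fg by (simp add: finitely_generated_def)
  qed
  show "(\<lambda>N. (\<Sum>n\<in>{n\<in>{1..N}. [n = r] (mod k)}. e_char (of_int (a n) * \<theta>)) / of_nat N) \<longlonglongrightarrow> 0"
    by (rule residue_class_mean_zero[where f = "\<lambda>n. e_char (of_int (a n) * \<theta>)"])
       (use e_char_additive[OF add] fin twist k in auto)
qed

text \<open>Otherwise the sieve gives a progression in which three quarters of the terms have only
  prime factors with \<open>a p = 0\<close>, hence exponential 1; the means along it would have
  modulus at least \<open>3/4 - 1/4\<close>.\<close>

lemma not_thin_nonzero_if_aperiodic:
  assumes add: "completely_additive a" and ap: "aperiodic (\<lambda>n. e_char (of_int (a n) * (1/2)))"
  shows "\<not> thin_set {p. prime p \<and> a p \<noteq> 0}"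
proof
  assume thin: "thin_set {p. prime p \<and> a p \<noteq> 0}"
  let ?f = "\<lambda>n. e_char (of_int (a n) * (1/2))"
  obtain Q r N0 where Q: "Q \<ge> 1" "r \<ge> 1" "1 dvd Q" "[r = 1] (mod 1)" "coprime r Q"
    "\<And>N. N \<ge> N0 \<Longrightarrow> real (card {n\<in>{1..N}. \<exists>p\<in>{p. prime p \<and> a p \<noteq> 0}. p dvd Q * n + r}) \<le> real N / 4"
    by (rule sparse_sieve[OF thin, of 1 1]) auto
  have a1: "a 1 = 0" using add[unfolded completely_additive_def, rule_format, of 1 1] by simp
  define E where "E N = {n\<in>{1..N}. \<exists>p\<in>{p. prime p \<and> a p \<noteq> 0}. p dvd Q * n + r}" for N
  have one: "?f (Q * n + r) = 1" if "n \<in> {1..N} - E N" for n N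
  proof (rule mult_eq_1_if_primes[where g = ?f])
    fix p assume "prime p" "p dvd Q * n + r"
    then have "a p = 0" using that unfolding E_def by blast
    then show "?f p = 1" by simp
  next
    show "?f (m * n) = ?f m * ?f n" if "m \<ge> 1" "n \<ge> 1" for m n
      by (rule e_char_additive[OF add that])
  qed (use Q a1 in auto)
  have low: "real N / 2 \<le> norm (\<Sum>n=1..N. ?f (Q * n + r))" if N: "N \<ge> N0" for N
  proof -
    have sub: "E N \<subseteq> {1..N}" by (auto simp: E_def)
    have card: "real (card (E N)) \<le> real N / 4" unfolding E_def by (rule Q(6)[OF N])
    have "(\<Sum>n=1..N. ?f (Q * n + r)) = (\<Sum>n\<in>{1..N} - E N. ?f (Q * n + r)) + (\<Sum>n\<in>E N. ?f (Q * n + r))"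
      using sub by (intro sum.subset_diff) auto
    also have "(\<Sum>n\<in>{1..N} - E N. ?f (Q * n + r)) = (\<Sum>n\<in>{1..N} - E N. 1)" by (intro sum.cong refl one)
    also have "\<dots> = of_nat (N - card (E N))" using sub by (simp add: card_Diff_subset finite_subset[OF sub])
    finally have eq: "(\<Sum>n=1..N. ?f (Q * n + r)) = of_nat (N - card (E N)) + (\<Sum>n\<in>E N. ?f (Q * n + r))" .
    have "norm (\<Sum>n\<in>E N. ?f (Q * n + r)) \<le> (\<Sum>n\<in>E N. 1)" by (intro sum_norm_le) simp
    then have e2: "norm (\<Sum>n\<in>E N. ?f (Q * n + r)) \<le> real (card (E N))" by simp
    have "norm (of_nat (N - card (E N)) :: complex) \<le> norm (\<Sum>n=1..N. ?f (Q * n + r)) + norm (\<Sum>n\<in>E N. ?f (Q * n + r))"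
      unfolding eq by (metis add_diff_cancel_right' norm_triangle_ineq4)
    then have "real (N - card (E N)) \<le> norm (\<Sum>n=1..N. ?f (Q * n + r)) + real (card (E N))" using e2 by simp
    moreover have "real (N - card (E N)) = real N - real (card (E N))"
      using card_mono[OF _ sub] by (simp add: of_nat_diff)
    ultimately show ?thesis using card by linarith
  qed
  have "(\<lambda>N. (1 / of_nat N) * (\<Sum>n = 1..N. ?f (Q * n + r))) \<longlonglongrightarrow> 0"
    using ap Q unfolding aperiodic_def by blast
  from tendstoD[OF this, of "1/2"] have "eventually (\<lambda>N. norm ((1 / of_nat N) * (\<Sum>n = 1..N. ?f (Q * n + r))) < 1/2) sequentially"
    by (simp add: dist_norm)
  then have "eventually (\<lambda>N. norm ((1 / of_nat N) * (\<Sum>n = 1..N. ?f (Q * n + r))) < 1/2 \<and> N \<ge> N0 \<and> N \<ge> 1) sequentially"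
    by (intro eventually_conj eventually_ge_at_top)
  then obtain N where N: "norm ((1 / of_nat N) * (\<Sum>n = 1..N. ?f (Q * n + r))) < 1/2" "N \<ge> N0" "N \<ge> 1"
    unfolding eventually_sequentially by blast
  have "norm ((1 / of_nat N) * (\<Sum>n = 1..N. ?f (Q * n + r))) = norm (\<Sum>n = 1..N. ?f (Q * n + r)) / real N"
    by (simp add: norm_mult norm_divide)
  moreover have "1/2 \<le> norm (\<Sum>n = 1..N. ?f (Q * n + r)) / real N"
    using low[OF N(2)] N(3) by (simp add: field_simps)
  ultimately show False using N(1) by argo
qed

text \<open>Raising to the power \<open>totient k\<close> removes the character.\<close>

lemma e_char_dirichlet_product:
  assumes "dirichlet_character k \<xi>" "k \<ge> 1" "e_char t * \<xi> p = 1"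
  shows "t * real (totient k) \<in> \<int>"
proof -
  have "\<xi> p \<noteq> 0" using assms(3) by auto
  then have "coprime p k" using dirichlet_characterD(3)[OF assms(1)] by blast
  have "(e_char t * \<xi> p) ^ totient k = 1" using assms(3) by simp
  then have "e_char t ^ totient k = 1"
    using dirichlet_character_root[OF assms(1) \<open>coprime p k\<close>] by (simp add: power_mult_distrib)
  then have "e_char (real (totient k) * t) = 1" by (simp add: e_char_of_nat_mult)
  then show ?thesis by (simp add: e_char_eq_1_iff mult.commute)
qed

text \<open>The nonzero values of a character are roots of unity of bounded order, so for irrational
  \<open>\<theta>\<close> a twisted value can be 1 only at primes with \<open>a p = 0\<close>; by
  aperiodicity at \<open>1/2\<close> the remaining primes are not thin.\<close>

lemma residue_mean_zero_irrational:
  assumes add: "completely_additive a" and fg: "finitely_generated a"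
    and ap: "aperiodic (\<lambda>n. e_char (of_int (a n) * (1/2)))" and \<theta>: "\<theta> \<notin> \<rat>"
  shows "residue_mean_zero a \<theta>"
proof (rule residue_mean_zero_criterion[OF add fg])
  fix k \<xi> assume k: "k \<ge> 1" and ch: "dirichlet_character k \<xi>"
  have "{p. prime p \<and> a p \<noteq> 0} \<subseteq> {p. prime p \<and> e_char (of_int (a p) * \<theta>) * \<xi> p \<noteq> 1}"
  proof (intro subsetI CollectI conjI notI; elim CollectE conjE)
    fix p assume p: "a p \<noteq> 0" "e_char (of_int (a p) * \<theta>) * \<xi> p = 1"
    have "of_int (a p) * \<theta> * real (totient k) \<in> \<int>" by (rule e_char_dirichlet_product[OF ch k p(2)])
    then obtain z :: int where z: "of_int (a p) * \<theta> * real (totient k) = of_int z" by (elim Ints_cases)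
    have "totient k > 0" using k by simp
    then have "\<theta> = of_int z / (of_int (a p) * of_nat (totient k))" using p(1) z by (simp add: field_simps)
    then have "\<theta> \<in> \<rat>" by simp
    then show False using \<theta> by simp
  qed auto
  then show "\<not> thin_set {p. prime p \<and> e_char (of_int (a p) * \<theta>) * \<xi> p \<noteq> 1}"
    using not_thin_nonzero_if_aperiodic[OF add ap] sparse_subset by blast
qed

lemma residue_mean_zero_aperiodic:
  assumes "aperiodic (\<lambda>n. e_char (of_int (a n) * \<theta>))"
  shows "residue_mean_zero a \<theta>"
  unfolding residue_mean_zero_def
proof (intro allI impI)
  fix k r :: nat assume k: "k \<ge> 1"
  let ?f = "\<lambda>n. e_char (of_int (a n) * \<theta>)"
  \<comment> \<open>\<open>aperiodic\<close> asks for an offset of at least 1 and sums from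
    \<open>n = 1\<close>. Hence \<open>s\<close> is the least positive element of the class, and its
    own term is split off.\<close>
  define s where "s = (if r mod k = 0 then k else r mod k)"
  have s: "s \<ge> 1" "s \<le> k" "[s = r] (mod k)" using k by (auto simp: s_def cong_def Suc_le_eq)
  define b where "b J = (1 / of_nat J) * (\<Sum>n=1..J. ?f (k * n + s))" for J
  have b: "b \<longlonglongrightarrow> 0" using assms k s unfolding aperiodic_def b_def by blast
  define J where "J N = (N - s) div k" for N
  have Jlim: "filterlim J at_top at_top"
    unfolding filterlim_at_top
  proof
    fix Z :: nat
    show "\<forall>\<^sub>F N in sequentially. Z \<le> J N"
      by (rule eventually_sequentiallyI[of "Z * k + s"]) (use k in \<open>auto simp: J_def less_eq_div_iff_mult_less_eq\<close>)
  qed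
  have lim: "(\<lambda>N. 1 / real N + norm (b (J N))) \<longlonglongrightarrow> 0"
    using tendsto_add[OF lim_const_over_n[of 1] tendsto_norm_zero[OF filterlim_compose[OF b Jlim]]] by simp
  show "(\<lambda>N. (\<Sum>n\<in>{n\<in>{1..N}. [n = r] (mod k)}. ?f n) / of_nat N) \<longlonglongrightarrow> 0"
  proof (rule Lim_null_comparison[OF _ lim], rule eventually_sequentiallyI[of "s + 1"])
    fix N assume N: "s + 1 \<le> N"
    have set: "{n\<in>{1..N}. [n = r] (mod k)} = insert s ((\<lambda>j. k * j + s) ` {1..J N})"
    proof (intro equalityI subsetI)
      fix n assume "n \<in> {n\<in>{1..N}. [n = r] (mod k)}"
      then have n: "1 \<le> n" "n \<le> N" "[n = s] (mod k)" using s(3) by (auto simp: cong_def)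
      have sn: "s \<le> n"
      proof (rule ccontr)
        assume "\<not> s \<le> n"
        then have "n < s" by simp
        then have "n mod k = n" using s by simp
        moreover have "s mod k = (if s = k then 0 else s)" using s by auto
        ultimately show False using n \<open>n < s\<close> by (auto simp: cong_def split: if_splits)
      qed
      have "k dvd n - s" using n(3) sn by (simp add: cong_altdef_nat)
      then obtain j where "n - s = k * j" by auto
      then have j: "n = k * j + s" using sn by simp
      show "n \<in> insert s ((\<lambda>j. k * j + s) ` {1..J N})"
      proof (cases "j = 0")
        case False
        have "j * k \<le> N - s" using j n by (simp add: mult.commute)
        then have "j \<le> J N" using k unfolding J_def by (simp add: less_eq_div_iff_mult_less_eq)
        then show ?thesis using False j by auto
      qed (use j in simp)
    next
      fix n assume "n \<in> insert s ((\<lambda>j. k * j + s) ` {1..J N})"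
      then obtain j where j: "n = k * j + s" "j \<le> J N"
        by (elim insertE imageE) (use that[of 0] that in auto)
      have "j * k \<le> N - s" using j k unfolding J_def by (simp add: less_eq_div_iff_mult_less_eq)
      then have "n \<le> N" using j N by (simp add: mult.commute)
      moreover have "[n = s] (mod k)" by (simp add: j cong_def)
      ultimately show "n \<in> {n\<in>{1..N}. [n = r] (mod k)}" using j s cong_trans by auto
    qed
    have inj: "inj_on (\<lambda>j. k * j + s) {1..J N}" using k by (auto intro!: inj_onI)
    have "s \<notin> (\<lambda>j. k * j + s) ` {1..J N}" using k by auto
    then have "(\<Sum>n\<in>{n\<in>{1..N}. [n = r] (mod k)}. ?f n) = ?f s + (\<Sum>n=1..J N. ?f (k * n + s))"
    proof -
      have "(\<Sum>n\<in>(\<lambda>j. k * j + s) ` {1..J N}. ?f n) = (\<Sum>n=1..J N. ?f (k * n + s))"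
        unfolding sum.reindex[OF inj] by simp
      then show ?thesis unfolding set using \<open>s \<notin> (\<lambda>j. k * j + s) ` {1..J N}\<close> by simp
    qed
    also have "(\<Sum>n=1..J N. ?f (k * n + s)) = of_nat (J N) * b (J N)" by (cases "J N = 0") (auto simp: b_def)
    finally have "norm (\<Sum>n\<in>{n\<in>{1..N}. [n = r] (mod k)}. ?f n) \<le> 1 + real (J N) * norm (b (J N))"
      using norm_triangle_ineq[of "?f s" "of_nat (J N) * b (J N)"] by (simp add: norm_mult)
    also have "real (J N) \<le> real N"
    proof -
      have "J N \<le> N - s" unfolding J_def by (rule div_le_dividend)
      then show ?thesis by simp
    qed
    finally have "norm (\<Sum>n\<in>{n\<in>{1..N}. [n = r] (mod k)}. ?f n) \<le> 1 + real N * norm (b (J N))"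
      by (simp add: mult_right_mono)
    then show "norm ((\<Sum>n\<in>{n\<in>{1..N}. [n = r] (mod k)}. ?f n) / of_nat N) \<le> 1 / real N + norm (b (J N))"
      using N by (simp add: norm_divide field_simps)
  qed
qed

lemma residue_mean_zero_frac:
  "residue_mean_zero a (frac \<theta>) \<longleftrightarrow> residue_mean_zero a \<theta>"
proof -
  have "e_char (of_int (a n) * \<theta>) = e_char (of_int (a n) * frac \<theta>)" for n
  proof -
    have "of_int (a n) * \<theta> = of_int (a n) * frac \<theta> + of_int (a n * \<lfloor>\<theta>\<rfloor>)" by (simp add: frac_def algebra_simps)
    then show ?thesis by (simp only: e_char_add e_char_int mult_1_right)
  qed
  then show ?thesis by (simp add: residue_mean_zero_def)
qed

text \<open>As \<open>a\<close> has integer values, only the fractional part of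
  \<open>\<theta>\<close> matters; this brings rational \<open>\<theta>\<close> into the range of
  the hypothesis.\<close>

theorem residue_mean_zero_all:
  assumes add: "completely_additive a" and fg: "finitely_generated a"
    and ap: "\<forall>\<alpha>\<in>{0<..<1} \<inter> \<rat>. aperiodic (\<lambda>n. e_char (of_int (a n) * \<alpha>))" and \<theta>: "\<theta> \<notin> \<int>"
  shows "residue_mean_zero a \<theta>"
proof (cases "\<theta> \<in> \<rat>")
  case True
  then have "frac \<theta> \<in> \<rat>" by (simp add: frac_def)
  moreover have "frac \<theta> > 0" using \<theta> by simp
  moreover have "frac \<theta> < 1" by (rule frac_lt_1)
  ultimately have "residue_mean_zero a (frac \<theta>)" using ap by (intro residue_mean_zero_aperiodic) auto
  then show ?thesis by (simp add: residue_mean_zero_frac)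
next
  case False
  have "(1/2::real) \<in> {0<..<1} \<inter> \<rat>" by simp
  then have "aperiodic (\<lambda>n. e_char (of_int (a n) * (1/2)))" using ap by blast
  then show ?thesis using False by (rule residue_mean_zero_irrational[OF add fg])
qed

lemma completely_additive_Omega_in: "completely_additive (\<lambda>n. int (Omega_in P n))"
  unfolding completely_additive_def Omega_in_def
  by (auto simp: prime_factorization_mult)

lemma Omega_in_prime: "prime p \<Longrightarrow> Omega_in P p = (if p \<in> P then 1 else 0)"
  by (simp add: Omega_in_def prime_factorization_prime)

lemma finitely_generated_Omega_in: "finitely_generated (\<lambda>n. int (Omega_in P n))"
  unfolding finitely_generated_def
  by (rule finite_subset[of _ "{0,1}"]) (auto simp: Omega_in_prime split: if_splits)

text \<open>If the criterion failed, a character would take the value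
  \<open>e_char (- \<theta>)\<close> at almost every prime; by \<open>character_thin_value\<close>
  this value would be 1 and \<open>\<theta>\<close> an integer.\<close>

theorem residue_mean_zero_Omega_in:
  assumes P: "contains_almost_every_prime P" and \<theta>: "\<theta> \<notin> \<int>"
  shows "residue_mean_zero (\<lambda>n. int (Omega_in P n)) \<theta>"
proof (rule residue_mean_zero_criterion[OF completely_additive_Omega_in finitely_generated_Omega_in])
  fix k \<xi> assume k: "k \<ge> 1" and ch: "dirichlet_character k \<xi>"
  show "\<not> thin_set {p. prime p \<and> e_char (of_int (int (Omega_in P p)) * \<theta>) * \<xi> p \<noteq> 1}"
  proof
    assume thin: "thin_set {p. prime p \<and> e_char (of_int (int (Omega_in P p)) * \<theta>) * \<xi> p \<noteq> 1}"
    have inv: "e_char \<theta> * z = 1 \<Longrightarrow> z = e_char (- \<theta>)" for z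
      by (metis add.right_inverse e_char_0 e_char_add mult.left_commute mult_1_right)
    have "thin_set {p. prime p \<and> \<xi> p \<noteq> e_char (- \<theta>)}"
    proof (rule sparse_subset[OF sparse_Un[OF thin P[unfolded contains_almost_every_prime_def]]], rule subsetI)
      fix p assume p: "p \<in> {p. prime p \<and> \<xi> p \<noteq> e_char (- \<theta>)}"
      show "p \<in> {p. prime p \<and> e_char (of_int (int (Omega_in P p)) * \<theta>) * \<xi> p \<noteq> 1} \<union> {p. prime p \<and> p \<notin> P}"
        using p inv[of "\<xi> p"] by (auto simp: Omega_in_prime)
    qed
    then have "e_char (- \<theta>) = 1" by (rule character_thin_value[OF k ch])
    then show False using \<theta> by (simp add: e_char_eq_1_iff)
  qed
qed

lemma Omega_eq_Omega_in: "Omega = Omega_in {p. prime p}"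
proof
  fix n :: nat
  have "filter_mset (\<lambda>p. p \<in> {p. prime p}) (prime_factorization n) = prime_factorization n"
    unfolding filter_mset_eq_conv by auto
  then show "Omega n = Omega_in {p. prime p} n" by (simp add: Omega_def Omega_in_def)
qed

lemma borel_measurable_cnj [measurable (raw)]:
  assumes "f \<in> borel_measurable M"
  shows "(\<lambda>x. cnj (f x)) \<in> borel_measurable M"
  by (rule borel_measurable_continuous_on[OF _ assms]) (intro continuous_intros)

section \<open>Measure preserving actions of the integers\<close>

text \<open>Composition is required only on \<open>space M\<close>, as the maps are arbitrary
  elsewhere. No axiom fixes \<open>\<tau> 0\<close>; where it occurs, invariance of the measure
  takes care of it.\<close>

locale mp_action = prob_space M for M :: "'a measure" +
  fixes \<tau> :: "int \<Rightarrow> 'a \<Rightarrow> 'a"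
  assumes meas [measurable]: "\<And>k. \<tau> k \<in> M \<rightarrow>\<^sub>M M"
    and preserves: "\<And>k. distr M M (\<tau> k) = M"
    and act: "\<And>j k x. x \<in> space M \<Longrightarrow> \<tau> (j + k) x = \<tau> j (\<tau> k x)"
begin

lemma integral_shift:
  fixes h :: "'a \<Rightarrow> 'b::{banach, second_countable_topology}"
  assumes [measurable]: "h \<in> borel_measurable M"
  shows "(LINT x|M. h (\<tau> k x)) = (LINT x|M. h x)"
  using integral_distr[OF meas assms, of k] by (simp add: preserves)

lemma AE_shift: "AE x in M. Q x \<Longrightarrow> AE x in M. Q (\<tau> k x)"
proof -
  assume "AE x in M. Q x"
  then have "AE x in distr M M (\<tau> k). Q x" unfolding preserves .
  then show ?thesis by (rule AE_distrD[OF meas])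
qed

end

lemma (in prob_space) integrable_bounded:
  fixes h :: "'a \<Rightarrow> 'b::{banach, second_countable_topology}"
  assumes "h \<in> borel_measurable M" "\<And>x. norm (h x) \<le> C"
  shows "integrable M h"
  using assms by (intro integrable_const_bound[where B = C]) auto

lemma (in prob_space) integral_norm_le_bound:
  fixes h :: "'a \<Rightarrow> 'b::{banach, second_countable_topology}"
  assumes "h \<in> borel_measurable M" "\<And>x. norm (h x) \<le> C"
  shows "norm (LINT x|M. h x) \<le> C"
proof -
  have i: "integrable M (\<lambda>x. norm (h x))" using integrable_bounded[OF assms] by (rule integrable_norm)
  have "norm (LINT x|M. h x) \<le> (LINT x|M. norm (h x))" by (rule integral_norm_bound)
  also have "\<dots> \<le> (LINT x|M. C)" by (intro integral_mono i) (use assms in auto)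
  also have "\<dots> = C" by (simp add: prob_space)
  finally show ?thesis .
qed

text \<open>The case distinction in \<open>int_iterate\<close> is confined to moving a single step
  across 0; additivity of the exponents follows by induction in both directions.\<close>

lemma interpret_mp_action:
  assumes "prob_space M" and T: "invertible_measure_preserving M T"
  shows "mp_action M (int_iterate M T)"
proof -
  interpret prob_space M by fact
  define T' where "T' = inv_into (space M) T"
  have Tm [measurable]: "T \<in> M \<rightarrow>\<^sub>M M" and Td: "distr M M T = M" and Tb: "bij_betw T (space M) (space M)"
    and T'm [measurable]: "T' \<in> M \<rightarrow>\<^sub>M M" using T by (auto simp: invertible_measure_preserving_def T'_def)
  have sp: "T x \<in> space M" "T' x \<in> space M" if "x \<in> space M" for x
    using that measurable_space[OF Tm] measurable_space[OF T'm] by auto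
  have inv1: "T' (T x) = x" if "x \<in> space M" for x unfolding T'_def using Tb that by (rule bij_betw_inv_into_left)
  have inv2: "T (T' x) = x" if "x \<in> space M" for x unfolding T'_def using Tb that by (rule bij_betw_inv_into_right)
  have T'd: "distr M M T' = M"
  proof -
    have "distr M M T' = distr (distr M M T) M T'" by (simp add: Td)
    also have "\<dots> = distr M M (T' \<circ> T)" by (rule distr_distr) auto
    also have "\<dots> = distr M M (\<lambda>x. x)" by (rule distr_cong) (auto simp: inv1)
    also have "\<dots> = M" by (rule distr_id)
    finally show ?thesis .
  qed
  have pm: "S ^^ n \<in> M \<rightarrow>\<^sub>M M \<and> distr M M (S ^^ n) = M" if S: "S \<in> M \<rightarrow>\<^sub>M M" "distr M M S = M" for S n
  proof (induction n)
    case 0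
    have "distr M M (\<lambda>x. x) = M" by (rule distr_id)
    then show ?case by (simp add: id_def)
  next
    case (Suc n)
    have "distr M M (S ^^ Suc n) = distr (distr M M (S ^^ n)) M S"
      using Suc S by (subst distr_distr) (auto simp: comp_def)
    then show ?case using Suc S by (auto simp: comp_def)
  qed
  let ?\<tau> = "int_iterate M T"
  have step: "?\<tau> (j + 1) x = ?\<tau> j (T x)" if x: "x \<in> space M" for j x
  proof (cases "j \<ge> 0")
    case True
    then have "nat (j + 1) = Suc (nat j)" by simp
    then show ?thesis using True by (simp add: int_iterate_def funpow_swap1)
  next
    case False
    define m where "m = nat (- j - 1)"
    have m: "nat (- j) = Suc m" using False by (simp add: m_def)
    have "?\<tau> j (T x) = (T' ^^ Suc m) (T x)" using False m by (simp add: int_iterate_def T'_def)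
    also have "\<dots> = (T' ^^ m) x" using inv1[OF x] by (simp add: funpow_swap1)
    also have "\<dots> = ?\<tau> (j + 1) x"
    proof (cases "j = -1")
      case True then show ?thesis by (simp add: int_iterate_def m_def)
    next
      case False
      then have "\<not> j + 1 \<ge> 0" "nat (- (j + 1)) = m" using \<open>\<not> j \<ge> 0\<close> by (auto simp: m_def)
      then show ?thesis by (simp add: int_iterate_def T'_def)
    qed
    finally show ?thesis by simp
  qed
  have step': "?\<tau> (j - 1) x = ?\<tau> j (T' x)" if x: "x \<in> space M" for j x
    using step[OF sp(2)[OF x], of "j - 1"] inv2[OF x] by simp
  have pos: "?\<tau> (j + int n) x = ?\<tau> j (?\<tau> (int n) x)" if "x \<in> space M" for j n x
    using that
  proof (induction n arbitrary: x)
    case 0 then show ?case by (simp add: int_iterate_def)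
  next
    case (Suc n)
    have "?\<tau> (j + int (Suc n)) x = ?\<tau> (j + int n) (T x)" using step[OF Suc.prems, of "j + int n"] by (simp add: add_ac)
    also have "\<dots> = ?\<tau> j (?\<tau> (int n) (T x))" using Suc.IH sp Suc.prems by blast
    also have "?\<tau> (int n) (T x) = ?\<tau> (int (Suc n)) x" using step[OF Suc.prems, of "int n"] by (simp add: add_ac)
    finally show ?case .
  qed
  have neg: "?\<tau> (j - int n) x = ?\<tau> j (?\<tau> (- int n) x)" if "x \<in> space M" for j n x
    using that
  proof (induction n arbitrary: x)
    case 0 then show ?case by (simp add: int_iterate_def)
  next
    case (Suc n)
    have "?\<tau> (j - int (Suc n)) x = ?\<tau> (j - int n) (T' x)" using step'[OF Suc.prems, of "j - int n"] by (simp add: algebra_simps)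
    also have "\<dots> = ?\<tau> j (?\<tau> (- int n) (T' x))" using Suc.IH sp Suc.prems by blast
    also have "?\<tau> (- int n) (T' x) = ?\<tau> (- int n - 1) x" using step'[OF Suc.prems, of "- int n"] by simp
    also have "- int n - 1 = - int (Suc n)" by simp
    finally show ?case .
  qed
  show ?thesis
  proof
    fix k show "?\<tau> k \<in> M \<rightarrow>\<^sub>M M" "distr M M (?\<tau> k) = M"
      using pm[OF Tm Td] pm[OF T'm T'd] by (auto simp: int_iterate_def T'_def)
  next
    fix j k x assume "x \<in> space M"
    then show "?\<tau> (j + k) x = ?\<tau> j (?\<tau> k x)"
      using pos[of x j "nat k"] neg[of x j "nat (- k)"] by (cases "k \<ge> 0") auto
  qed
qed

section \<open>Correlations and the spectral measure\<close>

lemma norm_sum_squared: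
  fixes z :: "'i \<Rightarrow> complex"
  shows "of_real ((norm (\<Sum>i\<in>I. z i))\<^sup>2) = (\<Sum>i\<in>I. \<Sum>j\<in>I. z i * cnj (z j))"
  by (simp only: complex_norm_square cnj_sum sum_product)

context mp_action
begin

definition corr :: "('a \<Rightarrow> complex) \<Rightarrow> int \<Rightarrow> complex" where
  "corr g k = (LINT x|M. g (\<tau> k x) * cnj (g x))"

text \<open>Stationarity: the correlation depends on the two times only through their
  difference.\<close>

lemma corr_shift:
  assumes [measurable]: "g \<in> borel_measurable M"
  shows "(LINT x|M. g (\<tau> j x) * cnj (g (\<tau> l x))) = corr g (j - l)"
proof -
  have "corr g (j - l) = (LINT x|M. g (\<tau> (j - l) (\<tau> l x)) * cnj (g (\<tau> l x)))"
    unfolding corr_def by (rule integral_shift[symmetric, of "\<lambda>x. g (\<tau> (j - l) x) * cnj (g x)"]) simp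
  also have "\<dots> = (LINT x|M. g (\<tau> j x) * cnj (g (\<tau> l x)))"
    by (intro Bochner_Integration.integral_cong refl) (simp add: act[symmetric])
  finally show ?thesis by simp
qed

lemma L2_norm_combination:
  assumes g [measurable]: "g \<in> borel_measurable M" and C: "\<And>x. norm (g x) \<le> C"
  shows "of_real (LINT x|M. (norm (\<Sum>i\<in>I. c i * g (\<tau> (b i) x)))\<^sup>2) = (\<Sum>i\<in>I. \<Sum>j\<in>I. c i * cnj (c j) * corr g (b i - b j))"
proof -
  have int: "integrable M (\<lambda>x. g (\<tau> j x) * cnj (g (\<tau> l x)))" for j l
  proof (rule integrable_bounded[where C = "C * C"])
    fix x show "norm (g (\<tau> j x) * cnj (g (\<tau> l x))) \<le> C * C"
      unfolding norm_mult complex_mod_cnj using C order_trans[OF norm_ge_zero C] by (intro mult_mono) auto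
  qed measurable
  have "of_real (LINT x|M. (norm (\<Sum>i\<in>I. c i * g (\<tau> (b i) x)))\<^sup>2) = (LINT x|M. of_real ((norm (\<Sum>i\<in>I. c i * g (\<tau> (b i) x)))\<^sup>2) :: complex)"
    by (simp only: integral_complex_of_real)
  also have "\<dots> = (LINT x|M. (\<Sum>i\<in>I. \<Sum>j\<in>I. (c i * cnj (c j)) * (g (\<tau> (b i) x) * cnj (g (\<tau> (b j) x)))))"
    unfolding norm_sum_squared by (simp add: mult_ac)
  also have "\<dots> = (\<Sum>i\<in>I. \<Sum>j\<in>I. (c i * cnj (c j)) * (LINT x|M. g (\<tau> (b i) x) * cnj (g (\<tau> (b j) x))))"
    by (simp only: Bochner_Integration.integral_sum Bochner_Integration.integrable_sum Bochner_Integration.integrable_mult_right int Bochner_Integration.integral_mult_right_zero)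
  finally show ?thesis by (simp add: corr_shift)
qed

end

lemma integral_e_char_unit_interval:
  "(LINT t|lborel. indicator {0..1} t *\<^sub>R e_char (of_int k * t)) = (if k = 0 then 1 else 0)"
proof (cases "k = 0")
  case True
  have "(LINT t|lborel. indicator {0..1::real} t *\<^sub>R (1::complex)) = 1" by simp
  then show ?thesis using True by simp
next
  case False
  define w where "w = 2 * of_real pi * \<i> * of_int k"
  have w: "w \<noteq> 0" using False by (simp add: w_def)
  have e: "e_char (of_int k * t) = exp (w * of_real t)" for t by (simp add: e_char_def w_def mult_ac)
  have "(LINT t|lborel. indicator {0..1} t *\<^sub>R exp (w * of_real t)) = exp (w * of_real 1) / w - exp (w * of_real 0) / w"
  proof (rule integral_FTC_Icc)
    fix x :: real
    have "((\<lambda>z. exp (w * z) / w) has_field_derivative exp (w * of_real x)) (at (of_real x))"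
      using w by (auto intro!: derivative_eq_intros)
    then show "((\<lambda>x. exp (w * of_real x) / w) has_vector_derivative exp (w * of_real x)) (at x within {0..1})"
      by (rule has_vector_derivative_real_field)
  qed (auto intro!: continuous_intros)
  also have "exp (w * of_real 1) = 1"
  proof -
    have "exp (w * of_real 1) = e_char (of_int k)" by (simp add: e_char_def w_def mult_ac)
    then show ?thesis by simp
  qed
  finally show ?thesis using False by (simp add: e)
qed

lemma continuous_e_char [continuous_intros]: "continuous_on S f \<Longrightarrow> continuous_on S (\<lambda>x. e_char (f x))"
  unfolding e_char_def by (intro continuous_intros)

lemma measurable_e_char [measurable]: "e_char \<in> borel_measurable borel"
  by (intro borel_measurable_continuous_onI continuous_intros)

text \<open>For large \<open>N\<close> there are \<open>N - \<bar>k\<bar>\<close> pairs with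
  difference \<open>k\<close>; these are the Fejer weights.\<close>

lemma count_differences_limit:
  fixes k :: int
  shows "(\<lambda>N. (\<Sum>j<N. \<Sum>l<N. if int j - int l = k then 1 else 0) / real N) \<longlonglongrightarrow> 1"
proof -
  define c where "c N = (\<Sum>j<N. \<Sum>l<N. if int j - int l = k then 1 else (0::real))" for N
  have inner: "(\<Sum>l<N. if int j - int l = k then 1 else (0::real)) = (if int j - k \<in> {0..<int N} then 1 else 0)" for j N
  proof (cases "int j - k \<in> {0..<int N}")
    case True
    have "(\<Sum>l<N. if int j - int l = k then 1 else (0::real)) = (\<Sum>l<N. if l = nat (int j - k) then 1 else 0)"
      by (intro sum.cong refl) (use True in auto)
    then show ?thesis using True by (simp add: nat_less_iff)
  next
    case False
    then have "(\<Sum>l<N. if int j - int l = k then 1 else (0::real)) = 0" by (intro sum.neutral) auto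
    then show ?thesis using False by simp
  qed
  have up: "c N \<le> real N" for N
  proof -
    have "c N \<le> (\<Sum>j<N. 1)" unfolding c_def inner by (intro sum_mono) auto
    then show ?thesis by simp
  qed
  have low: "real N - real (nat \<bar>k\<bar>) \<le> c N" for N
  proof -
    have "real N - c N = (\<Sum>j<N. if int j - k \<in> {0..<int N} then 0 else 1)"
    proof -
      have "real N = (\<Sum>j<N. 1)" by simp
      then show ?thesis unfolding c_def inner by (simp only: sum_subtractf[symmetric]) (intro sum.cong refl, auto)
    qed
    also have "\<dots> = real (card {j\<in>{..<N}. int j - k \<notin> {0..<int N}})"
      by (simp add: sum.If_cases Int_def Collect_neg_eq[symmetric])
    also have "card {j\<in>{..<N}. int j - k \<notin> {0..<int N}} \<le> card ({..<nat k} \<union> {N - nat (- k)..<N})"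
      by (intro card_mono) auto
    also have "\<dots> \<le> nat k + nat (- k)" by (rule order_trans[OF card_Un_le]) simp
    also have "\<dots> = nat \<bar>k\<bar>" by (cases "k \<ge> 0") auto
    finally show ?thesis by simp
  qed
  have "(\<lambda>N. c N / real N) \<longlonglongrightarrow> 1"
  proof (rule tendsto_sandwich)
    show "\<forall>\<^sub>F N in sequentially. 1 - real (nat \<bar>k\<bar>) / real N \<le> c N / real N"
    proof (rule eventually_sequentiallyI[of 1])
      fix N :: nat assume "1 \<le> N"
      then show "1 - real (nat \<bar>k\<bar>) / real N \<le> c N / real N"
        using divide_right_mono[OF low[of N], of "real N"] by (simp add: diff_divide_distrib)
    qed
    show "\<forall>\<^sub>F N in sequentially. c N / real N \<le> 1"
      by (rule eventually_sequentiallyI[of 1]) (use up in \<open>simp add: divide_le_eq\<close>)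
    have "(\<lambda>N. 1 - real (nat \<bar>k\<bar>) / real N) \<longlonglongrightarrow> 1 - 0"
      by (intro tendsto_diff tendsto_const lim_const_over_n)
    then show "(\<lambda>N. 1 - real (nat \<bar>k\<bar>) / real N) \<longlonglongrightarrow> 1" by simp
  qed simp
  then show ?thesis unfolding c_def .
qed

context mp_action
begin

text \<open>Herglotz's theorem by the Fejer method. The densities \<open>P N\<close> on the unit
  interval are nonnegative, being normalised squared norms, and their Fourier coefficients are the
  correlations times Fejer weights; a weak limit along a subsequence has the desired
  coefficients.\<close>

lemma spectral_measure_aux:
  assumes g [measurable]: "g \<in> borel_measurable M" and C: "\<And>x. norm (g x) \<le> C"
    and c0: "(LINT x|M. (norm (g x))\<^sup>2) > 0"
  shows "\<exists>\<mu>. real_distribution \<mu> \<and> (\<forall>k. corr g k = of_real (LINT x|M. (norm (g x))\<^sup>2) * (LINT t|\<mu>. e_char (of_int k * t)))"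
proof -
  define c where "c = (LINT x|M. (norm (g x))\<^sup>2)"
  have c: "c > 0" using c0 by (simp add: c_def)
  have corr0: "corr g 0 = of_real c"
  proof -
    have "corr g 0 = (LINT x|M. g (\<tau> 0 x) * cnj (g (\<tau> 0 x)))" using corr_shift[OF g, of 0 0] by simp
    also have "\<dots> = (LINT x|M. g x * cnj (g x))" by (rule integral_shift[of "\<lambda>x. g x * cnj (g x)"]) simp
    also have "\<dots> = (LINT x|M. of_real ((norm (g x))\<^sup>2))" by (simp only: complex_norm_square)
    finally show ?thesis by (simp only: c_def integral_complex_of_real)
  qed
  define P where "P N t = (LINT x|M. (norm (\<Sum>j<N. e_char (- (real j * t)) * g (\<tau> (int j) x)))\<^sup>2) / (real N * c)" for N t
  have P0: "P N t \<ge> 0" for N t unfolding P_def using c by simp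
  have Pc: "of_real (P N t) = (\<Sum>j<N. \<Sum>l<N. corr g (int j - int l) * e_char (of_int (int l - int j) * t)) / of_real (real N * c)" for N t
  proof -
    have eq: "e_char (- (real j * t)) * cnj (e_char (- (real l * t))) * corr g (int j - int l) =
       corr g (int j - int l) * e_char (of_int (int l - int j) * t)" for j l
    proof -
      have "of_int (int l - int j) * t = - (real j * t) + real l * t" by (simp add: algebra_simps)
      then have "e_char (of_int (int l - int j) * t) = e_char (- (real j * t)) * e_char (real l * t)" by (simp only: e_char_add)
      moreover have "cnj (e_char (- (real l * t))) = e_char (real l * t)" by (simp add: e_char_minus)
      ultimately show ?thesis by (simp only: mult_ac)
    qed
    show ?thesis unfolding P_def of_real_divide L2_norm_combination[OF g C] eq ..
  qed
  have Pcont: "continuous_on S (P N)" for S N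
  proof -
    have "P N = (\<lambda>t. Re ((\<Sum>j<N. \<Sum>l<N. corr g (int j - int l) * e_char (of_int (int l - int j) * t)) / of_real (real N * c)))"
      by (rule ext) (metis Pc Re_complex_of_real)
    moreover have "continuous_on S \<dots>" unfolding divide_inverse by (intro continuous_intros)
    ultimately show ?thesis by simp
  qed
  have Pm [measurable]: "P N \<in> borel_measurable borel" for N
    by (intro borel_measurable_continuous_onI Pcont)
  have moment: "(LINT t|lborel. indicator {0..1} t *\<^sub>R (of_real (P N t) * e_char (of_int k * t))) =
      corr g k / of_real c * of_real ((\<Sum>j<N. \<Sum>l<N. if int j - int l = k then 1 else 0) / real N)" for N k
  proof -
    have int: "integrable lborel (\<lambda>t. indicator {0..1} t *\<^sub>R e_char (of_int (m::int) * t))" for m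
      by (rule borel_integrable_compact) (auto intro!: continuous_intros)
    have "(LINT t|lborel. indicator {0..1} t *\<^sub>R (of_real (P N t) * e_char (of_int k * t))) =
       (LINT t|lborel. (\<Sum>j<N. \<Sum>l<N. (corr g (int j - int l) / of_real (real N * c)) * (indicator {0..1} t *\<^sub>R e_char (of_int (k - (int j - int l)) * t))))"
    proof (intro Bochner_Integration.integral_cong refl)
      fix t
      have ee: "e_char (of_int (int l - int j) * t) * e_char (of_int k * t) = e_char (of_int (k - (int j - int l)) * t)" for j l
      proof -
        have "of_int (int l - int j) * t + of_int k * t = of_int (k - (int j - int l)) * t" by (simp add: algebra_simps)
        then show ?thesis by (metis e_char_add)
      qed
      have "of_real (P N t) * e_char (of_int k * t) = (\<Sum>j<N. \<Sum>l<N. (corr g (int j - int l) / of_real (real N * c)) * e_char (of_int (k - (int j - int l)) * t))"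
        unfolding Pc ee[symmetric] sum_divide_distrib sum_distrib_right by (intro sum.cong refl) simp
      then show "indicator {0..1} t *\<^sub>R (of_real (P N t) * e_char (of_int k * t)) =
        (\<Sum>j<N. \<Sum>l<N. (corr g (int j - int l) / of_real (real N * c)) * (indicator {0..1} t *\<^sub>R e_char (of_int (k - (int j - int l)) * t)))"
        by (simp only: scaleR_sum_right mult_scaleR_right)
    qed
    also have "\<dots> = (\<Sum>j<N. \<Sum>l<N. (corr g (int j - int l) / of_real (real N * c)) * (LINT t|lborel. indicator {0..1} t *\<^sub>R e_char (of_int (k - (int j - int l)) * t)))"
      by (simp only: Bochner_Integration.integral_sum Bochner_Integration.integrable_sum Bochner_Integration.integrable_mult_right int Bochner_Integration.integral_mult_right_zero)
    also have "\<dots> = (\<Sum>j<N. \<Sum>l<N. (corr g k / of_real c) * of_real ((if int j - int l = k then 1 else 0) / real N))"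
      unfolding integral_e_char_unit_interval by (intro sum.cong refl) auto
    also have "\<dots> = corr g k / of_real c * of_real ((\<Sum>j<N. \<Sum>l<N. if int j - int l = k then 1 else 0) / real N)"
      by (simp only: sum_distrib_left[symmetric] of_real_sum[symmetric] sum_divide_distrib[symmetric])
    finally show ?thesis .
  qed
  \<comment> \<open>The index is shifted because \<open>P 0\<close> is 0 and not a probability
    density.\<close>
  define \<nu> where "\<nu> n = density lborel (\<lambda>t. ennreal (indicator {0..1} t * P (Suc n) t))" for n
  have total: "(LINT t|lborel. indicator {0..1} t * P (Suc n) t) = 1" for n
  proof -
    have "(\<Sum>j<Suc n. \<Sum>l<Suc n. if int j - int l = 0 then 1 else (0::real)) = (\<Sum>j<Suc n. 1)"
      by (intro sum.cong refl) (simp add: sum.delta')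
    then have cnt: "(\<Sum>j<Suc n. \<Sum>l<Suc n. if int j - int l = 0 then 1 else (0::real)) / real (Suc n) = 1"
      by (simp only: sum_constant card_lessThan) simp
    have "(LINT t|lborel. indicator {0..1} t *\<^sub>R (of_real (P (Suc n) t) :: complex)) = 1"
      using moment[of "Suc n" 0, unfolded cnt] c corr0 by simp
    moreover have "(LINT t|lborel. indicator {0..1} t *\<^sub>R (of_real (P (Suc n) t) :: complex)) =
       of_real (LINT t|lborel. indicator {0..1} t * P (Suc n) t)"
      by (simp only: scaleR_conv_of_real of_real_mult[symmetric] integral_complex_of_real)
    ultimately show ?thesis by (metis of_real_eq_1_iff)
  qed
  have Pint: "integrable lborel (\<lambda>t. indicator {0..1} t * P (Suc n) t)" for n
    using borel_integrable_compact[OF compact_Icc Pcont, of 0 1 "Suc n"] by simp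
  have nn: "(\<integral>\<^sup>+ t. ennreal (indicator {0..1} t * P (Suc n) t) \<partial>lborel) = 1" for n
    using nn_integral_eq_integral[OF Pint] P0 total by (simp add: indicator_def)
  have prob: "prob_space (\<nu> n)" for n
    by (rule prob_spaceI) (simp add: \<nu>_def emeasure_density nn)
  have rd: "real_distribution (\<nu> n)" for n
    using prob by (simp add: real_distribution_def real_distribution_axioms_def \<nu>_def)
  \<comment> \<open>All the mass lies in the unit interval; the half-open interval from -1 to 2
    contains it.\<close>
  have "tight \<nu>"
    unfolding tight_def
  proof (intro conjI allI impI rd, rule exI[of _ "-1"], rule exI[of _ 2], intro conjI allI)
    fix e :: real and n :: nat assume e: "e > 0"
    have "emeasure (\<nu> n) {-1<..2} = (\<integral>\<^sup>+ t. ennreal (indicator {0..1} t * P (Suc n) t) * indicator {-1<..2} t \<partial>lborel)"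
      by (simp add: \<nu>_def emeasure_density)
    also have "\<dots> = (\<integral>\<^sup>+ t. ennreal (indicator {0..1} t * P (Suc n) t) \<partial>lborel)"
      by (intro nn_integral_cong) (auto split: split_indicator)
    finally have "measure (\<nu> n) {-1<..2} = 1" using nn by (simp add: measure_def)
    then show "1 - e < measure (\<nu> n) {-1<..2}" using e by simp
  qed simp
  from tight_imp_convergent_subsubsequence[OF this, of "\<lambda>n. n"]
  obtain r \<mu> where r: "strict_mono r" "real_distribution \<mu>" "weak_conv_m (\<nu> \<circ> r) \<mu>"
    by (auto simp: strict_mono_def comp_def)
  have "corr g k = of_real c * (LINT t|\<mu>. e_char (of_int k * t))" for k
  proof -
    have "(\<lambda>n. (LINT t|(\<nu> \<circ> r) n. e_char (of_int k * t))) \<longlonglongrightarrow> (LINT t|\<mu>. e_char (of_int k * t))"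
    proof (rule weak_conv_imp_integral_bdd_continuous_conv[OF _ r(2,3), where B = 1])
      show "isCont (\<lambda>t. e_char (of_int k * t)) x" for x
        using continuous_e_char[of UNIV "\<lambda>t. of_int k * t"] by (simp add: continuous_on_eq_continuous_at continuous_intros)
    qed (use rd in auto)
    moreover have "(LINT t|(\<nu> \<circ> r) n. e_char (of_int k * t)) = corr g k / of_real c *
        of_real ((\<Sum>j<Suc (r n). \<Sum>l<Suc (r n). if int j - int l = k then 1 else 0) / real (Suc (r n)))" for n
    proof -
      have "(LINT t|(\<nu> \<circ> r) n. e_char (of_int k * t)) = (LINT t|lborel. (indicator {0..1} t * P (Suc (r n)) t) *\<^sub>R e_char (of_int k * t))"
        unfolding \<nu>_def comp_def by (rule integral_density) (use P0 in \<open>auto simp: indicator_def\<close>)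
      also have "\<dots> = (LINT t|lborel. indicator {0..1} t *\<^sub>R (of_real (P (Suc (r n)) t) * e_char (of_int k * t)))"
        by (simp only: scaleR_conv_of_real of_real_mult mult.assoc)
      finally show ?thesis unfolding moment .
    qed
    moreover have "(\<lambda>n. corr g k / of_real c * of_real ((\<Sum>j<Suc (r n). \<Sum>l<Suc (r n). if int j - int l = k then 1 else 0) / real (Suc (r n))))
        \<longlonglongrightarrow> corr g k / of_real c * of_real 1"
    proof (intro tendsto_mult tendsto_const tendsto_of_real)
      have "filterlim (\<lambda>n. Suc (r n)) sequentially sequentially"
        by (rule filterlim_compose[OF filterlim_Suc filterlim_subseq[OF r(1)]])
      from filterlim_compose[OF count_differences_limit this]
      show "(\<lambda>n. (\<Sum>j<Suc (r n). \<Sum>l<Suc (r n). if int j - int l = k then 1 else 0) / real (Suc (r n))) \<longlonglongrightarrow> 1" .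
    qed
    ultimately have "(LINT t|\<mu>. e_char (of_int k * t)) = corr g k / of_real c * of_real 1"
      using LIMSEQ_unique by (simp only:) blast
    then show ?thesis using c by simp
  qed
  then show ?thesis using r(2) unfolding c_def by blast
qed

end

section \<open>Mean square convergence and the mean ergodic theorem\<close>

lemma (in prob_space) L2_integrable:
  fixes h :: "'a \<Rightarrow> complex"
  assumes [measurable]: "h \<in> borel_measurable M" and "\<And>x. norm (h x) \<le> C"
  shows "integrable M (\<lambda>x. (norm (h x))\<^sup>2)"
proof (rule integrable_bounded[where C = "C\<^sup>2"])
  fix x show "norm ((norm (h x))\<^sup>2) \<le> C\<^sup>2" using assms(2)[of x] by (simp add: power_mono)
qed measurable

lemma norm_add_squared_le: "(norm (a + b :: complex))\<^sup>2 \<le> 2 * (norm a)\<^sup>2 + 2 * (norm b)\<^sup>2"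
proof -
  have "(norm (a + b))\<^sup>2 \<le> (norm a + norm b)\<^sup>2" by (intro power_mono norm_triangle_ineq) auto
  also have "\<dots> \<le> 2 * (norm a)\<^sup>2 + 2 * (norm b)\<^sup>2"
    using sum_squares_ge_zero[of "norm a - norm b" 0] by (simp add: power2_eq_square algebra_simps)
  finally show ?thesis .
qed

text \<open>Distances are kept squared throughout; the factor 2 is the price for the triangle
  inequality in this form.\<close>

lemma (in prob_space) L2_triangle:
  fixes u v w :: "'a \<Rightarrow> complex"
  assumes [measurable]: "u \<in> borel_measurable M" "v \<in> borel_measurable M" "w \<in> borel_measurable M"
    and b: "\<And>x. norm (u x) \<le> B" "\<And>x. norm (v x) \<le> B" "\<And>x. norm (w x) \<le> B"
  shows "(LINT x|M. (norm (u x - w x))\<^sup>2) \<le> 2 * (LINT x|M. (norm (u x - v x))\<^sup>2) + 2 * (LINT x|M. (norm (v x - w x))\<^sup>2)"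
proof -
  have bd: "norm (f x - h x) \<le> B + B" if "\<And>x. norm (f x) \<le> B" "\<And>x. norm (h x) \<le> B" for f h :: "'a \<Rightarrow> complex" and x
    by (rule order_trans[OF norm_triangle_ineq4 add_mono]) (use that in auto)
  have i: "integrable M (\<lambda>x. (norm (u x - w x))\<^sup>2)" "integrable M (\<lambda>x. (norm (u x - v x))\<^sup>2)" "integrable M (\<lambda>x. (norm (v x - w x))\<^sup>2)"
    using bd[OF b(1,3)] bd[OF b(1,2)] bd[OF b(2,3)] by (auto intro!: L2_integrable)
  have "(LINT x|M. (norm (u x - w x))\<^sup>2) \<le> (LINT x|M. 2 * (norm (u x - v x))\<^sup>2 + 2 * (norm (v x - w x))\<^sup>2)"
  proof (intro integral_mono i Bochner_Integration.integrable_add integrable_mult_right)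
    fix x show "(norm (u x - w x))\<^sup>2 \<le> 2 * (norm (u x - v x))\<^sup>2 + 2 * (norm (v x - w x))\<^sup>2"
      using norm_add_squared_le[of "u x - v x" "v x - w x"] by simp
  qed
  then show ?thesis using i by simp
qed

text \<open>Riesz-Fischer, with a limit that keeps the bound \<open>C\<close> at every point: a
  rapidly converging subsequence converges almost everywhere, and its limit is set to 0 wherever it
  exceeds \<open>C\<close>.\<close>

lemma (in prob_space) bounded_L2_complete:
  fixes h :: "nat \<Rightarrow> 'a \<Rightarrow> complex"
  assumes h [measurable]: "\<And>n. h n \<in> borel_measurable M" and C: "\<And>n x. norm (h n x) \<le> C"
    and cauchy: "\<And>e. e > 0 \<Longrightarrow> \<exists>N. \<forall>m\<ge>N. \<forall>n\<ge>N. (LINT x|M. (norm (h m x - h n x))\<^sup>2) \<le> e"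
  shows "\<exists>f. f \<in> borel_measurable M \<and> (\<forall>x. norm (f x) \<le> C) \<and> (\<lambda>n. LINT x|M. (norm (h n x - f x))\<^sup>2) \<longlonglongrightarrow> 0"
proof -
  have C0: "C \<ge> 0" using C[of 0 undefined] norm_ge_zero order_trans by blast
  have "\<exists>N. \<forall>m\<ge>N. \<forall>n\<ge>N. (LINT x|M. (norm (h m x - h n x))\<^sup>2) \<le> (1/4) ^ j" for j
    by (rule cauchy) simp
  then obtain R where R: "\<And>j m n. m \<ge> R j \<Longrightarrow> n \<ge> R j \<Longrightarrow> (LINT x|M. (norm (h m x - h n x))\<^sup>2) \<le> (1/4) ^ j" by metis
  \<comment> \<open>Cumulative sums, so that \<open>r j\<close> is at least \<open>R i\<close> for
    all \<open>i \<le> j\<close>.\<close>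
  define r where "r j = (\<Sum>i\<le>j. R i)" for j
  have rR: "R j \<le> r j" "R j \<le> r (Suc j)" for j
  proof -
    show "R j \<le> r j" unfolding r_def by (rule member_le_sum) auto
    show "R j \<le> r (Suc j)" unfolding r_def by (rule member_le_sum) auto
  qed
  define u where "u j x = norm (h (r (Suc j)) x - h (r j) x)" for j x
  have um [measurable]: "u j \<in> borel_measurable M" for j unfolding u_def by measurable
  have u0: "u j x \<ge> 0" "u j x \<le> C + C" for j x
    unfolding u_def by (simp, rule order_trans[OF norm_triangle_ineq4 add_mono[OF C C]])
  have ui: "integrable M (u j)" for j by (rule integrable_bounded[where C = "C + C"]) (use u0 in auto)
  have uI: "(LINT x|M. u j x) \<le> (1/2) ^ j" for j
  proof -
    have i2: "integrable M (\<lambda>x. (u j x)\<^sup>2)"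
    proof (rule integrable_bounded[where C = "(C + C)\<^sup>2"])
      fix x
      have "(u j x)\<^sup>2 \<le> (C + C)\<^sup>2" by (rule power_mono[OF u0(2) u0(1)])
      then show "norm ((u j x)\<^sup>2) \<le> (C + C)\<^sup>2" by simp
    qed measurable
    \<comment> \<open>The mean square of \<open>u j\<close> is at most \<open>(1/4) ^ j\<close>; the
      weighted AM-GM inequality turns this into a mean of at most \<open>(1/2) ^ j\<close>, which is
      summable.\<close>
    have "(LINT x|M. u j x) \<le> (LINT x|M. (1/2) ^ j / 2 + 2 ^ j / 2 * (u j x)\<^sup>2)"
    proof (intro integral_mono ui Bochner_Integration.integrable_add integrable_mult_right i2)
      fix x
      have "0 \<le> (2 ^ j * u j x - 1)\<^sup>2 * ((1/2) ^ j / 2)" by simp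
      also have "\<dots> = (1/2) ^ j / 2 + 2 ^ j / 2 * (u j x)\<^sup>2 - u j x"
        by (simp add: power2_eq_square field_simps power_one_over)
      finally show "u j x \<le> (1/2) ^ j / 2 + 2 ^ j / 2 * (u j x)\<^sup>2" by simp
    qed simp
    also have "\<dots> = (1/2) ^ j / 2 + 2 ^ j / 2 * (LINT x|M. (u j x)\<^sup>2)" using i2 by (simp add: prob_space)
    also have "\<dots> \<le> (1/2) ^ j / 2 + 2 ^ j / 2 * (1/4) ^ j"
      unfolding u_def by (intro add_left_mono mult_left_mono R rR) auto
    also have "2 ^ j / 2 * (1/4) ^ j = (1/2::real) ^ j / 2"
      by (simp add: power_mult_distrib[symmetric])
    finally show ?thesis by simp
  qed
  have "AE x in M. (\<Sum>j. ennreal (u j x)) \<noteq> \<infinity>"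
  proof (rule nn_integral_PInf_AE)
    have "(\<integral>\<^sup>+x. (\<Sum>j. ennreal (u j x)) \<partial>M) = (\<Sum>j. \<integral>\<^sup>+x. ennreal (u j x) \<partial>M)"
      by (rule nn_integral_suminf) measurable
    also have "\<dots> = (\<Sum>j. ennreal (LINT x|M. u j x))" using ui u0 by (simp add: nn_integral_eq_integral)
    also have "\<dots> \<le> (\<Sum>j. ennreal ((1/2) ^ j))" by (intro suminf_le summableI ennreal_leI uI)
    also have "\<dots> = ennreal (\<Sum>j. (1/2) ^ j)" by (rule suminf_ennreal2) auto
    also have "\<dots> < \<infinity>" by simp
    finally show "(\<integral>\<^sup>+x. (\<Sum>j. ennreal (u j x)) \<partial>M) \<noteq> \<infinity>" by simp
  qed measurable
  then have conv: "AE x in M. convergent (\<lambda>j. h (r j) x)"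
  proof eventually_elim
    fix x assume "(\<Sum>j. ennreal (u j x)) \<noteq> \<infinity>"
    then have "summable (\<lambda>j. u j x)" using u0 by (intro summable_suminf_not_top) auto
    then have "summable (\<lambda>j. h (r (Suc j)) x - h (r j) x)" unfolding u_def by (rule summable_norm_cancel)
    then obtain s where s: "(\<lambda>n. \<Sum>j<n. h (r (Suc j)) x - h (r j) x) \<longlonglongrightarrow> s" by (auto simp: summable_def sums_def)
    have "(\<lambda>n. (\<Sum>j<n. h (r (Suc j)) x - h (r j) x) + h (r 0) x) \<longlonglongrightarrow> s + h (r 0) x" by (intro tendsto_add s tendsto_const)
    from this[unfolded sum_lessThan_telescope[of "\<lambda>j. h (r j) x"]]
    have "(\<lambda>n. h (r n) x) \<longlonglongrightarrow> s + h (r 0) x" by simp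
    then show "convergent (\<lambda>j. h (r j) x)" by (auto simp: convergent_def)
  qed
  define l where "l x = lim (\<lambda>j. h (r j) x)" for x
  define f where "f x = (if norm (l x) \<le> C then l x else 0)" for x
  have [measurable]: "l \<in> borel_measurable M" unfolding l_def by measurable
  have fm [measurable]: "f \<in> borel_measurable M" unfolding f_def by measurable
  have fC: "norm (f x) \<le> C" for x using C0 by (simp add: f_def)
  have lim: "AE x in M. (\<lambda>j. h (r j) x) \<longlonglongrightarrow> f x"
    using conv
  proof eventually_elim
    fix x assume "convergent (\<lambda>j. h (r j) x)"
    then have L: "(\<lambda>j. h (r j) x) \<longlonglongrightarrow> l x" unfolding l_def by (simp add: convergent_LIMSEQ_iff)
    have "norm (l x) \<le> C"
      by (rule tendsto_upperbound[OF tendsto_norm[OF L]]) (use C in auto)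
    then show "(\<lambda>j. h (r j) x) \<longlonglongrightarrow> f x" using L by (simp add: f_def)
  qed
  have sub: "(\<lambda>j. LINT x|M. (norm (h (r j) x - f x))\<^sup>2) \<longlonglongrightarrow> (LINT x|M. 0)"
  proof (rule integral_dominated_convergence[where w = "\<lambda>_. (C + C)\<^sup>2"])
    show "AE x in M. (\<lambda>j. (norm (h (r j) x - f x))\<^sup>2) \<longlonglongrightarrow> 0"
      using lim
    proof eventually_elim
      fix x assume "(\<lambda>j. h (r j) x) \<longlonglongrightarrow> f x"
      then have "(\<lambda>j. (norm (h (r j) x - f x))\<^sup>2) \<longlonglongrightarrow> (norm (f x - f x))\<^sup>2" by (intro tendsto_intros)
      then show "(\<lambda>j. (norm (h (r j) x - f x))\<^sup>2) \<longlonglongrightarrow> 0" by simp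
    qed
    show "AE x in M. norm ((norm (h (r j) x - f x))\<^sup>2) \<le> (C + C)\<^sup>2" for j
    proof (rule AE_I2)
      fix x have "norm (h (r j) x - f x) \<le> C + C" by (rule order_trans[OF norm_triangle_ineq4 add_mono]) (use C fC in auto)
      then have "(norm (h (r j) x - f x))\<^sup>2 \<le> (C + C)\<^sup>2" by (rule power_mono) simp
      then show "norm ((norm (h (r j) x - f x))\<^sup>2) \<le> (C + C)\<^sup>2" by simp
    qed
  qed auto
  have "(\<lambda>n. LINT x|M. (norm (h n x - f x))\<^sup>2) \<longlonglongrightarrow> 0"
  proof (rule tendstoI)
    fix e :: real assume e: "e > 0"
    obtain j0 where j0: "(1/4::real) ^ j0 < e / 4" using real_arch_pow_inv[of "e/4" "1/4"] e by auto
    have "eventually (\<lambda>j. \<bar>LINT x|M. (norm (h (r j) x - f x))\<^sup>2\<bar> < e / 4) sequentially"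
      using tendstoD[OF sub, of "e/4"] e by (simp add: dist_real_def)
    then have "eventually (\<lambda>j. \<bar>LINT x|M. (norm (h (r j) x - f x))\<^sup>2\<bar> < e / 4 \<and> j \<ge> j0) sequentially"
      by (intro eventually_conj eventually_ge_at_top)
    then obtain j where j: "\<bar>LINT x|M. (norm (h (r j) x - f x))\<^sup>2\<bar> < e / 4" "j \<ge> j0"
      unfolding eventually_sequentially by blast
    have rj: "R j0 \<le> r j" using j(2) unfolding r_def by (intro member_le_sum) auto
    show "\<forall>\<^sub>F n in sequentially. dist (LINT x|M. (norm (h n x - f x))\<^sup>2) 0 < e"
    proof (rule eventually_sequentiallyI[of "R j0"])
      fix n assume n: "R j0 \<le> n"
      have "(LINT x|M. (norm (h n x - f x))\<^sup>2) \<le> 2 * (LINT x|M. (norm (h n x - h (r j) x))\<^sup>2) + 2 * (LINT x|M. (norm (h (r j) x - f x))\<^sup>2)"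
        by (rule L2_triangle[where B = C]) (use C fC in auto)
      moreover have "(LINT x|M. (norm (h n x - h (r j) x))\<^sup>2) \<le> (1/4) ^ j0" by (rule R[OF n rj])
      ultimately have "(LINT x|M. (norm (h n x - f x))\<^sup>2) < e" using j(1) j0 by argo
      moreover have "(LINT x|M. (norm (h n x - f x))\<^sup>2) \<ge> 0" by simp
      ultimately show "dist (LINT x|M. (norm (h n x - f x))\<^sup>2) 0 < e" by (simp add: dist_real_def)
    qed
  qed
  then show ?thesis using fm fC by blast
qed

lemma geometric_average_limit:
  fixes z :: complex assumes "norm z = 1"
  shows "(\<lambda>N. (\<Sum>n=1..N. z ^ n) / of_nat N) \<longlonglongrightarrow> (if z = 1 then 1 else 0)"
proof (cases "z = 1")
  case True
  have "\<forall>\<^sub>F N in sequentially. (\<Sum>n=1..N. z ^ n) / of_nat N = 1"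
    by (rule eventually_sequentiallyI[of 1]) (use True in auto)
  then show ?thesis using True by (simp add: tendsto_eventually)
next
  case False
  have b: "norm ((\<Sum>n=1..N. z ^ n) / of_nat N) \<le> (2 / norm (z - 1)) / real N" for N
  proof -
    have "(z - 1) * (\<Sum>n=1..N. z ^ n) = z ^ Suc N - z" by (induction N) (auto simp: algebra_simps)
    then have "norm (z - 1) * norm (\<Sum>n=1..N. z ^ n) = norm (z ^ Suc N - z)" by (metis norm_mult)
    also have "\<dots> \<le> norm (z ^ Suc N) + norm z" by (rule norm_triangle_ineq4)
    also have "\<dots> = 2" unfolding norm_power assms by simp
    finally have "norm (\<Sum>n=1..N. z ^ n) \<le> 2 / norm (z - 1)" using False by (simp add: field_simps)
    then show ?thesis unfolding norm_divide norm_of_nat by (intro divide_right_mono) auto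
  qed
  have "(\<lambda>N. (\<Sum>n=1..N. z ^ n) / of_nat N) \<longlonglongrightarrow> 0"
    by (rule Lim_null_comparison[OF always_eventually[OF allI[OF b]]]) (rule lim_const_over_n)
  then show ?thesis using False by simp
qed

context mp_action
begin

text \<open>The form in which the spectral theorem is applied: mean squares of combinations of
  shifts of \<open>g\<close> become mean squares of trigonometric polynomials. The measure lives on
  the line and not on the circle, so invariance corresponds to the set of integers instead of a
  single point.\<close>

theorem spectral_measure:
  assumes g [measurable]: "g \<in> borel_measurable M" and C: "\<And>x. norm (g x) \<le> C"
  defines "c0 \<equiv> LINT x|M. (norm (g x))\<^sup>2"
  shows "\<exists>\<mu>. real_distribution \<mu> \<and> (\<forall>(I :: nat set) c b.
      (LINT x|M. (norm (\<Sum>i\<in>I. c i * g (\<tau> (b i) x)))\<^sup>2) = c0 * (LINT t|\<mu>. (norm (\<Sum>i\<in>I. c i * e_char (of_int (b i) * t)))\<^sup>2))"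
proof -
  have "c0 \<ge> 0" unfolding c0_def by simp
  have "\<exists>\<mu>. real_distribution \<mu> \<and> (\<forall>k. corr g k = of_real c0 * (LINT t|\<mu>. e_char (of_int k * t)))"
  proof (cases "c0 > 0")
    case True
    then show ?thesis using spectral_measure_aux[OF g C] unfolding c0_def by blast
  next
    case False
    then have "c0 = 0" using \<open>c0 \<ge> 0\<close> by simp
    then have "AE x in M. (norm (g x))\<^sup>2 = 0"
      using integral_nonneg_eq_0_iff_AE[OF L2_integrable[OF g C]] unfolding c0_def by simp
    then have ae: "AE x in M. g x = 0" by simp
    have "corr g k = 0" for k unfolding corr_def
      by (rule integral_eq_zero_AE) (use ae in eventually_elim, simp)
    \<comment> \<open>If \<open>g\<close> vanishes almost everywhere, any probability measure will
      do.\<close>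
    moreover have "real_distribution (return borel (0::real))"
      by (simp add: real_distribution_def real_distribution_axioms_def prob_space_return)
    ultimately show ?thesis using \<open>c0 = 0\<close> by auto
  qed
  then obtain \<mu> where \<mu>: "real_distribution \<mu>" "\<And>k. corr g k = of_real c0 * (LINT t|\<mu>. e_char (of_int k * t))" by blast
  interpret \<mu>: real_distribution \<mu> by fact
  have int: "integrable \<mu> (\<lambda>t. e_char (of_int k * t))" for k
    by (rule \<mu>.integrable_bounded[where C = 1]) auto
  have "(LINT x|M. (norm (\<Sum>i\<in>I. c i * g (\<tau> (b i) x)))\<^sup>2) = c0 * (LINT t|\<mu>. (norm (\<Sum>i\<in>I. c i * e_char (of_int (b i) * t)))\<^sup>2)"
    for I :: "nat set" and c b
  proof -
    have "of_real (LINT t|\<mu>. (norm (\<Sum>i\<in>I. c i * e_char (of_int (b i) * t)))\<^sup>2) =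
       (LINT t|\<mu>. of_real ((norm (\<Sum>i\<in>I. c i * e_char (of_int (b i) * t)))\<^sup>2) :: complex)"
      by (simp only: integral_complex_of_real)
    also have "\<dots> = (LINT t|\<mu>. (\<Sum>i\<in>I. \<Sum>j\<in>I. (c i * cnj (c j)) * e_char (of_int (b i - b j) * t)))"
    proof (rule Bochner_Integration.integral_cong[OF refl])
      fix t
      have "e_char (of_int (b i) * t) * cnj (e_char (of_int (b j) * t)) = e_char (of_int (b i - b j) * t)" for i j
        by (simp add: e_char_minus[symmetric] e_char_add[symmetric] algebra_simps)
      then have eq: "(c i * e_char (of_int (b i) * t)) * cnj (c j * e_char (of_int (b j) * t)) = (c i * cnj (c j)) * e_char (of_int (b i - b j) * t)" for i j
        by (metis (no_types, opaque_lifting) complex_cnj_mult mult.assoc mult.left_commute)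
      show "of_real ((norm (\<Sum>i\<in>I. c i * e_char (of_int (b i) * t)))\<^sup>2) = (\<Sum>i\<in>I. \<Sum>j\<in>I. (c i * cnj (c j)) * e_char (of_int (b i - b j) * t))"
        unfolding norm_sum_squared eq ..
    qed
    also have "\<dots> = (\<Sum>i\<in>I. \<Sum>j\<in>I. (c i * cnj (c j)) * (LINT t|\<mu>. e_char (of_int (b i - b j) * t)))"
      by (simp only: Bochner_Integration.integral_sum Bochner_Integration.integrable_sum Bochner_Integration.integrable_mult_right int Bochner_Integration.integral_mult_right_zero)
    finally have 1: "of_real (LINT t|\<mu>. (norm (\<Sum>i\<in>I. c i * e_char (of_int (b i) * t)))\<^sup>2) = \<dots>" .
    have "of_real (LINT x|M. (norm (\<Sum>i\<in>I. c i * g (\<tau> (b i) x)))\<^sup>2) =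
       of_real c0 * (\<Sum>i\<in>I. \<Sum>j\<in>I. (c i * cnj (c j)) * (LINT t|\<mu>. e_char (of_int (b i - b j) * t)))"
      unfolding L2_norm_combination[OF g C] \<mu>(2) sum_distrib_left by (intro sum.cong refl) (simp only: mult_ac)
    then have "of_real (LINT x|M. (norm (\<Sum>i\<in>I. c i * g (\<tau> (b i) x)))\<^sup>2) =
       (of_real (c0 * (LINT t|\<mu>. (norm (\<Sum>i\<in>I. c i * e_char (of_int (b i) * t)))\<^sup>2)) :: complex)"
      unfolding 1[symmetric] by simp
    then show ?thesis by (simp only: of_real_eq_iff)
  qed
  then show ?thesis using \<mu>(1) by blast
qed

definition erg_avg :: "('a \<Rightarrow> complex) \<Rightarrow> nat \<Rightarrow> nat \<Rightarrow> 'a \<Rightarrow> complex" where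
  "erg_avg g d N x = (\<Sum>n=1..N. g (\<tau> (int (d * n)) x)) / of_nat N"

lemma erg_avg_measurable [measurable]:
  assumes [measurable]: "g \<in> borel_measurable M"
  shows "erg_avg g d N \<in> borel_measurable M"
  unfolding erg_avg_def by measurable

lemma norm_average_le:
  fixes z :: "nat \<Rightarrow> complex"
  assumes "\<And>n. norm (z n) \<le> C" "I \<subseteq> {1..N}" shows "norm ((\<Sum>n\<in>I. z n) / of_nat N) \<le> C"
proof (cases "N = 0")
  case True
  have "C \<ge> 0" using assms(1)[of 0] norm_ge_zero order_trans by blast
  then show ?thesis using True by simp
next
  case False
  have C: "C \<ge> 0" using assms(1)[of 0] norm_ge_zero order_trans by blast
  have "norm (\<Sum>n\<in>I. z n) \<le> (\<Sum>n\<in>I. C)" by (intro sum_norm_le assms)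
  also have "\<dots> \<le> (\<Sum>n\<in>{1..N}. C)" using assms(2) C by (intro sum_mono2) auto
  finally have "norm (\<Sum>n\<in>I. z n) \<le> real N * C" by simp
  then show ?thesis using False by (simp add: norm_divide divide_le_eq mult.commute)
qed

lemma norm_erg_avg_le: "(\<And>x. norm (g x) \<le> C) \<Longrightarrow> norm (erg_avg g d N x) \<le> C"
  unfolding erg_avg_def by (rule norm_average_le) auto

definition char_avg :: "nat \<Rightarrow> nat \<Rightarrow> real \<Rightarrow> complex" where
  "char_avg d N t = (\<Sum>n=1..N. e_char (of_int (int (d * n)) * t)) / of_nat N"

lemma char_avg_measurable [measurable]: "char_avg d N \<in> borel_measurable borel"
  unfolding char_avg_def by measurable

lemma norm_char_avg_le: "norm (char_avg d N t) \<le> 1"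
  unfolding char_avg_def by (rule norm_average_le) auto

lemma char_avg_limit: "(\<lambda>N. char_avg d N t) \<longlonglongrightarrow> (if real d * t \<in> \<int> then 1 else 0)"
proof -
  have "e_char (of_int (int (d * n)) * t) = e_char (real d * t) ^ n" for n
    by (simp add: e_char_of_nat_mult[symmetric] mult_ac)
  then show ?thesis unfolding char_avg_def using geometric_average_limit[of "e_char (real d * t)"] by (simp add: e_char_eq_1_iff)
qed

text \<open>Under the spectral measure the averages become \<open>char_avg\<close>, which converges
  boundedly to the indicator of those \<open>t\<close> for which \<open>d * t\<close> is an
  integer.\<close>

lemma erg_avg_cauchy:
  assumes g [measurable]: "g \<in> borel_measurable M" and C: "\<And>x. norm (g x) \<le> C" and e: "e > 0"
  shows "\<exists>N0. \<forall>m\<ge>N0. \<forall>n\<ge>N0. (LINT x|M. (norm (erg_avg g d m x - erg_avg g d n x))\<^sup>2) \<le> e"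
proof -
  define c0 where "c0 = (LINT x|M. (norm (g x))\<^sup>2)"
  have c0: "c0 \<ge> 0" by (simp add: c0_def)
  obtain \<mu> where \<mu>: "real_distribution \<mu>" "\<forall>(I :: nat set) c b.
      (LINT x|M. (norm (\<Sum>i\<in>I. c i * g (\<tau> (b i) x)))\<^sup>2) = c0 * (LINT t|\<mu>. (norm (\<Sum>i\<in>I. c i * e_char (of_int (b i) * t)))\<^sup>2)"
    using spectral_measure[OF g C] unfolding c0_def by blast
  have spec: "(LINT x|M. (norm (\<Sum>i\<in>I. c i * g (\<tau> (b i) x)))\<^sup>2) = c0 * (LINT t|\<mu>. (norm (\<Sum>i\<in>I. c i * e_char (of_int (b i) * t)))\<^sup>2)"
    for I :: "nat set" and c b using \<mu>(2) by blast
  interpret \<mu>: real_distribution \<mu> by fact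
  \<comment> \<open>Two averages of different lengths are written over one index set, so that
    \<open>spec\<close> applies to their difference.\<close>
  have coeff: "(\<Sum>i\<in>{1..max m n}. ((if i \<le> m then 1 / of_nat m else 0) - (if i \<le> n then 1 / of_nat n else 0)) * z i) =
      (\<Sum>i=1..m. z i) / of_nat m - (\<Sum>i=1..n. z i) / of_nat n" for m n and z :: "nat \<Rightarrow> complex"
  proof -
    have "(\<Sum>i\<in>{1..max m n}. (if i \<le> k then 1 / of_nat k else 0) * z i) = (\<Sum>i=1..k. z i) / of_nat k" if "k \<le> max m n" for k
    proof -
      have "(\<Sum>i\<in>{1..max m n}. (if i \<le> k then 1 / of_nat k else 0) * z i) = (\<Sum>i\<in>{1..k}. 1 / of_nat k * z i)"
        by (rule sum.mono_neutral_cong_right) (use that in auto)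
      then show ?thesis by (simp add: sum_divide_distrib)
    qed
    from this[of m] this[of n] show ?thesis by (simp add: left_diff_distrib sum_subtractf)
  qed
  have eq: "(LINT x|M. (norm (erg_avg g d m x - erg_avg g d n x))\<^sup>2) = c0 * (LINT t|\<mu>. (norm (char_avg d m t - char_avg d n t))\<^sup>2)" for m n
    using spec[of "\<lambda>i. (if i \<le> m then 1 / of_nat m else 0) - (if i \<le> n then 1 / of_nat n else 0)" "\<lambda>i. int (d * i)" "{1..max m n}"]
    unfolding coeff erg_avg_def char_avg_def .
  define D where "D t = (if real d * t \<in> \<int> then 1 else (0::complex))" for t
  have Zb [measurable]: "(\<int> :: real set) \<in> sets borel" by (intro borel_closed closed_Ints)
  have Dm [measurable]: "D \<in> borel_measurable borel" unfolding D_def by measurable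
  have Db: "norm (D t) \<le> 1" for t by (simp add: D_def)
  have "(\<lambda>N. LINT t|\<mu>. (norm (char_avg d N t - D t))\<^sup>2) \<longlonglongrightarrow> (LINT t|\<mu>. 0)"
  proof (rule integral_dominated_convergence[where w = "\<lambda>_. 4"])
    show "AE t in \<mu>. (\<lambda>N. (norm (char_avg d N t - D t))\<^sup>2) \<longlonglongrightarrow> 0"
    proof (rule AE_I2)
      fix t
      have "(\<lambda>N. (norm (char_avg d N t - D t))\<^sup>2) \<longlonglongrightarrow> (norm (D t - D t))\<^sup>2"
        unfolding D_def by (intro tendsto_intros char_avg_limit)
      then show "(\<lambda>N. (norm (char_avg d N t - D t))\<^sup>2) \<longlonglongrightarrow> 0" by simp
    qed
    show "AE t in \<mu>. norm ((norm (char_avg d N t - D t))\<^sup>2) \<le> 4" for N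
    proof (rule AE_I2)
      fix t
      have "norm (char_avg d N t - D t) \<le> 1 + 1" by (rule order_trans[OF norm_triangle_ineq4 add_mono[OF norm_char_avg_le Db]])
      then have "(norm (char_avg d N t - D t))\<^sup>2 \<le> (1 + 1)\<^sup>2" by (intro power_mono) auto
      then show "norm ((norm (char_avg d N t - D t))\<^sup>2) \<le> 4" by simp
    qed
  qed auto
  then have lim: "(\<lambda>N. LINT t|\<mu>. (norm (char_avg d N t - D t))\<^sup>2) \<longlonglongrightarrow> 0" by simp
  define e' where "e' = e / (4 * (c0 + 1))"
  have e': "e' > 0" using e c0 by (simp add: e'_def)
  from tendstoD[OF lim e'] obtain N0 where N0': "\<forall>N\<ge>N0. dist (LINT t|\<mu>. (norm (char_avg d N t - D t))\<^sup>2) 0 < e'"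
    unfolding eventually_sequentially by blast
  have N0: "(LINT t|\<mu>. (norm (char_avg d N t - D t))\<^sup>2) < e'" if "N \<ge> N0" for N
    using N0'[rule_format, OF that] unfolding dist_real_def by linarith
  have "(LINT x|M. (norm (erg_avg g d m x - erg_avg g d n x))\<^sup>2) \<le> e" if "m \<ge> N0" "n \<ge> N0" for m n
  proof -
    have "(LINT t|\<mu>. (norm (char_avg d m t - char_avg d n t))\<^sup>2) \<le>
       2 * (LINT t|\<mu>. (norm (char_avg d m t - D t))\<^sup>2) + 2 * (LINT t|\<mu>. (norm (D t - char_avg d n t))\<^sup>2)"
      by (rule \<mu>.L2_triangle[where B = 1]) (use norm_char_avg_le Db in auto)
    also have "\<dots> \<le> 2 * e' + 2 * e'"
      using N0[OF that(1)] N0[OF that(2)] by (simp add: norm_minus_commute)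
    finally have "c0 * (LINT t|\<mu>. (norm (char_avg d m t - char_avg d n t))\<^sup>2) \<le> (c0 + 1) * (4 * e')"
      using c0 e' by (intro mult_mono) auto
    also have "\<dots> = e"
    proof -
      have "q * (4 * (e / (4 * q))) = e" if "q > 0" for q :: real using that by simp
      from this[of "c0 + 1"] show ?thesis unfolding e'_def using c0 by linarith
    qed
    finally show ?thesis unfolding eq .
  qed
  then show ?thesis by blast
qed

end

context mp_action
begin

text \<open>Cauchy-Schwarz on a probability space, obtained from the nonnegative variance of the
  modulus of \<open>u\<close>.\<close>

lemma integral_L2_small:
  fixes u v :: "'a \<Rightarrow> complex"
  assumes [measurable]: "u \<in> borel_measurable M" "v \<in> borel_measurable M"
    and B: "\<And>x. norm (u x) \<le> B" "\<And>x. norm (v x) \<le> B'"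
  shows "(norm (LINT x|M. u x * v x))\<^sup>2 \<le> B'\<^sup>2 * (LINT x|M. (norm (u x))\<^sup>2)"
proof -
  have B0: "B' \<ge> 0" using B(2)[of undefined] norm_ge_zero order_trans by blast
  have Bu: "B \<ge> 0" using B(1)[of undefined] norm_ge_zero order_trans by blast
  have iu: "integrable M (\<lambda>x. norm (u x))" by (rule integrable_bounded[where C = B]) (use B in auto)
  have iu2: "integrable M (\<lambda>x. (norm (u x))\<^sup>2)" by (rule L2_integrable[where C = B]) (use B in auto)
  define I where "I = (LINT x|M. norm (u x))"
  have I0: "I \<ge> 0" unfolding I_def by simp
  have "norm (LINT x|M. u x * v x) \<le> (LINT x|M. norm (u x * v x))" by (rule integral_norm_bound)
  also have "\<dots> \<le> (LINT x|M. B' * norm (u x))"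
  proof (intro integral_mono integrable_mult_right iu)
    show "integrable M (\<lambda>x. norm (u x * v x))"
    proof (rule integrable_bounded[where C = "B * B'"])
      fix x show "norm (norm (u x * v x)) \<le> B * B'" using B Bu by (simp add: norm_mult mult_mono)
    qed measurable
    fix x show "norm (u x * v x) \<le> B' * norm (u x)" unfolding norm_mult
      using mult_right_mono[OF B(2)[of x], of "norm (u x)"] by (simp add: mult.commute)
  qed
  finally have 1: "norm (LINT x|M. u x * v x) \<le> B' * I" by (simp add: I_def)
  have "0 \<le> (LINT x|M. (norm (u x) - I)\<^sup>2)" by simp
  also have "\<dots> = (LINT x|M. (norm (u x))\<^sup>2 - 2 * I * norm (u x) + I\<^sup>2)"
    by (intro Bochner_Integration.integral_cong refl) (simp add: power2_diff)
  also have "\<dots> = (LINT x|M. (norm (u x))\<^sup>2) - 2 * I * I + I\<^sup>2"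
    using iu iu2 by (simp add: I_def prob_space)
  finally have 2: "I\<^sup>2 \<le> (LINT x|M. (norm (u x))\<^sup>2)" by (simp add: power2_eq_square)
  have "(norm (LINT x|M. u x * v x))\<^sup>2 \<le> (B' * I)\<^sup>2" using 1 by (rule power_mono) simp
  also have "\<dots> \<le> B'\<^sup>2 * (LINT x|M. (norm (u x))\<^sup>2)" unfolding power_mult_distrib using 2 by (intro mult_left_mono) auto
  finally show ?thesis .
qed

lemma L2_limit_integral:
  fixes u :: "nat \<Rightarrow> 'a \<Rightarrow> complex"
  assumes [measurable]: "\<And>n. u n \<in> borel_measurable M" "f \<in> borel_measurable M" "v \<in> borel_measurable M"
    and B: "\<And>n x. norm (u n x) \<le> B" "\<And>x. norm (f x) \<le> B" "\<And>x. norm (v x) \<le> B'"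
    and lim: "(\<lambda>n. LINT x|M. (norm (u n x - f x))\<^sup>2) \<longlonglongrightarrow> 0"
  shows "(\<lambda>n. LINT x|M. u n x * v x) \<longlonglongrightarrow> (LINT x|M. f x * v x)"
proof -
  have B0: "B \<ge> 0" "B' \<ge> 0" using B(2)[of undefined] B(3)[of undefined] norm_ge_zero order_trans by blast+
  have i: "integrable M (\<lambda>x. w x * v x)" if [measurable]: "w \<in> borel_measurable M" and "\<And>x. norm (w x) \<le> B" for w
  proof (rule integrable_bounded[where C = "B * B'"])
    fix x show "norm (w x * v x) \<le> B * B'" unfolding norm_mult using that(2) B(3) B0 by (intro mult_mono) auto
  qed measurable
  have le: "(norm ((LINT x|M. u n x * v x) - (LINT x|M. f x * v x)))\<^sup>2 \<le> B'\<^sup>2 * (LINT x|M. (norm (u n x - f x))\<^sup>2)" for n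
  proof -
    have "(LINT x|M. u n x * v x) - (LINT x|M. f x * v x) = (LINT x|M. (u n x - f x) * v x)"
      unfolding left_diff_distrib by (rule Bochner_Integration.integral_diff[symmetric]) (use i B in auto)
    moreover have "(norm (LINT x|M. (u n x - f x) * v x))\<^sup>2 \<le> B'\<^sup>2 * (LINT x|M. (norm (u n x - f x))\<^sup>2)"
    proof (rule integral_L2_small[where B = "B + B"])
      show "norm (u n x - f x) \<le> B + B" for x by (rule order_trans[OF norm_triangle_ineq4 add_mono[OF B(1) B(2)]])
    qed (use B in auto)
    ultimately show ?thesis by simp
  qed
  have "(\<lambda>n. B'\<^sup>2 * (LINT x|M. (norm (u n x - f x))\<^sup>2)) \<longlonglongrightarrow> B'\<^sup>2 * 0" by (intro tendsto_mult tendsto_const lim)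
  then have "(\<lambda>n. B'\<^sup>2 * (LINT x|M. (norm (u n x - f x))\<^sup>2)) \<longlonglongrightarrow> 0" by simp
  then have "(\<lambda>n. (norm ((LINT x|M. u n x * v x) - (LINT x|M. f x * v x)))\<^sup>2) \<longlonglongrightarrow> 0"
    by (rule Lim_null_comparison[rotated]) (use le in \<open>auto intro!: always_eventually\<close>)
  then have "(\<lambda>n. sqrt ((norm ((LINT x|M. u n x * v x) - (LINT x|M. f x * v x)))\<^sup>2)) \<longlonglongrightarrow> sqrt 0" by (rule tendsto_real_sqrt)
  then have "(\<lambda>n. norm ((LINT x|M. u n x * v x) - (LINT x|M. f x * v x))) \<longlonglongrightarrow> 0" by simp
  then show ?thesis using Lim_null tendsto_norm_zero_iff by blast
qed

lemma AE_invariant_multiple: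
  assumes HI: "AE x in M. H (\<tau> (int d) x) = H x"
  shows "AE x in M. H (\<tau> (int (d * n)) x) = H x"
  proof (induction n)
    case 0
    \<comment> \<open>By \<open>act\<close>, \<open>\<tau> 0\<close> fixes the point
      \<open>\<tau> (int d) x\<close>, and \<open>H\<close> does not distinguish \<open>x\<close>
      from that point.\<close>
    have "AE x in M. H (\<tau> 0 x) = H x"
    proof -
      have "AE x in M. H (\<tau> 0 (\<tau> (int d) x)) = H (\<tau> 0 x)"
      proof -
        have "AE x in M. H (\<tau> (int d) (\<tau> 0 x)) = H (\<tau> 0 x)" by (rule AE_shift[OF HI])
        then show ?thesis using AE_space by eventually_elim (simp add: act[symmetric])
      qed
      with HI AE_space show ?thesis
        by eventually_elim (metis act add_0)
    qed
    then show ?case by simp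
  next
    case (Suc n)
    have "AE x in M. H (\<tau> (int d) (\<tau> (int (d * n)) x)) = H (\<tau> (int (d * n)) x)" by (rule AE_shift[OF HI])
    with Suc AE_space show ?case
    proof eventually_elim
      fix x assume a: "x \<in> space M" "H (\<tau> (int d) (\<tau> (int (d * n)) x)) = H (\<tau> (int (d * n)) x)" "H (\<tau> (int (d * n)) x) = H x"
      have "\<tau> (int (d * Suc n)) x = \<tau> (int d) (\<tau> (int (d * n)) x)" using act[OF a(1), of "int d" "int (d * n)"] by (simp add: algebra_simps)
      then show "H (\<tau> (int (d * Suc n)) x) = H x" using a by simp
    qed
  qed

text \<open>Von Neumann's theorem for bounded functions, with the limit identified as the projection
  to the invariant functions. Invariance comes from telescoping, the projection property from the
  fact that all terms of the average have the same inner product with an invariant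
  \<open>H\<close>.\<close>

theorem mean_ergodic:
  assumes g [measurable]: "g \<in> borel_measurable M" and C: "\<And>x. norm (g x) \<le> C"
  shows "\<exists>h. h \<in> borel_measurable M \<and> (\<forall>x. norm (h x) \<le> C) \<and>
     (\<lambda>N. LINT x|M. (norm (erg_avg g d N x - h x))\<^sup>2) \<longlonglongrightarrow> 0 \<and>
     (AE x in M. h (\<tau> (int d) x) = h x) \<and>
     (\<forall>H B. H \<in> borel_measurable M \<longrightarrow> (\<forall>x. norm (H x) \<le> B) \<longrightarrow> (AE x in M. H (\<tau> (int d) x) = H x) \<longrightarrow>
        (LINT x|M. h x * cnj (H x)) = (LINT x|M. g x * cnj (H x)))"
proof -
  obtain h where h [measurable]: "h \<in> borel_measurable M" and hC: "\<And>x. norm (h x) \<le> C" and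
    lim: "(\<lambda>N. LINT x|M. (norm (erg_avg g d N x - h x))\<^sup>2) \<longlonglongrightarrow> 0"
    using bounded_L2_complete[of "erg_avg g d" C] norm_erg_avg_le[of g C] C erg_avg_cauchy[OF g C] erg_avg_measurable[OF g] by blast
  have aC: "norm (erg_avg g d N x) \<le> C" for N x by (rule norm_erg_avg_le[OF C])
  have C0: "C \<ge> 0" using C[of undefined] norm_ge_zero order_trans by blast
  have inv: "AE x in M. h (\<tau> (int d) x) = h x"
  proof -
    have shift: "(LINT x|M. (norm (h (\<tau> (int d) x) - erg_avg g d N (\<tau> (int d) x)))\<^sup>2) = (LINT x|M. (norm (erg_avg g d N x - h x))\<^sup>2)" for N
      by (subst integral_shift[of "\<lambda>x. (norm (h x - erg_avg g d N x))\<^sup>2"]) (auto simp: norm_minus_commute)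
    have tele: "(LINT x|M. (norm (erg_avg g d N (\<tau> (int d) x) - erg_avg g d N x))\<^sup>2) \<le> (2 * C)\<^sup>2 / real N" for N
    proof (cases "N = 0")
      case False
      have "norm (erg_avg g d N (\<tau> (int d) x) - erg_avg g d N x) \<le> 2 * C / real N" if x: "x \<in> space M" for x
      proof -
        have "(\<Sum>n=1..N. g (\<tau> (int (d * n)) (\<tau> (int d) x))) = (\<Sum>n=1..N. g (\<tau> (int (d * Suc n)) x))"
          using x by (intro sum.cong refl) (simp add: act[symmetric] algebra_simps)
        then have "(\<Sum>n=1..N. g (\<tau> (int (d * n)) (\<tau> (int d) x))) - (\<Sum>n=1..N. g (\<tau> (int (d * n)) x)) =
           (\<Sum>n=1..N. g (\<tau> (int (d * Suc n)) x) - g (\<tau> (int (d * n)) x))" by (simp only: sum_subtractf)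
        also have "\<dots> = g (\<tau> (int (d * Suc N)) x) - g (\<tau> (int (d * 1)) x)" using False by (intro sum_Suc_diff) auto
        finally have "erg_avg g d N (\<tau> (int d) x) - erg_avg g d N x = (g (\<tau> (int (d * Suc N)) x) - g (\<tau> (int (d * 1)) x)) / of_nat N"
          unfolding erg_avg_def by (simp only: diff_divide_distrib[symmetric])
        then have "norm (erg_avg g d N (\<tau> (int d) x) - erg_avg g d N x) = norm (g (\<tau> (int (d * Suc N)) x) - g (\<tau> (int (d * 1)) x)) / real N"
          by (simp only: norm_divide norm_of_nat)
        also have "\<dots> \<le> (C + C) / real N"
          by (intro divide_right_mono order_trans[OF norm_triangle_ineq4 add_mono[OF C C]]) auto
        finally show ?thesis by simp
      qed
      then have "(norm (erg_avg g d N (\<tau> (int d) x) - erg_avg g d N x))\<^sup>2 \<le> (2 * C / real N)\<^sup>2" if "x \<in> space M" for x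
        using that by (intro power_mono) auto
      then have "(LINT x|M. (norm (erg_avg g d N (\<tau> (int d) x) - erg_avg g d N x))\<^sup>2) \<le> (LINT x|M. (2 * C / real N)\<^sup>2)"
        by (intro integral_mono') auto
      also have "\<dots> = (2 * C)\<^sup>2 / (real N * real N)" by (simp add: prob_space power2_eq_square)
      also have "\<dots> \<le> (2 * C)\<^sup>2 / (real N * 1)" using False by (intro divide_left_mono mult_left_mono) auto
      finally show ?thesis by simp
    qed (simp add: erg_avg_def)
    \<comment> \<open>Two triangle inequalities give \<open>2 * s + 2 * (2 * b + 2 * s)\<close>,
      with \<open>s\<close> the distance of \<open>h\<close> to the average, which is the same after
      a shift, and \<open>b\<close> the telescoped boundary term; hence the constants 6 and
      4.\<close>
    define E where "E = (LINT x|M. (norm (h (\<tau> (int d) x) - h x))\<^sup>2)"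
    have "E \<le> 6 * (LINT x|M. (norm (erg_avg g d N x - h x))\<^sup>2) + 4 * ((2 * C)\<^sup>2 / real N)" for N
    proof -
      have "E \<le> 2 * (LINT x|M. (norm (h (\<tau> (int d) x) - erg_avg g d N (\<tau> (int d) x)))\<^sup>2) + 2 * (LINT x|M. (norm (erg_avg g d N (\<tau> (int d) x) - h x))\<^sup>2)"
        unfolding E_def by (rule L2_triangle[where B = C]) (use hC aC in auto)
      moreover have "(LINT x|M. (norm (erg_avg g d N (\<tau> (int d) x) - h x))\<^sup>2) \<le>
         2 * (LINT x|M. (norm (erg_avg g d N (\<tau> (int d) x) - erg_avg g d N x))\<^sup>2) + 2 * (LINT x|M. (norm (erg_avg g d N x - h x))\<^sup>2)"
        by (rule L2_triangle[where B = C]) (use hC aC in auto)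
      ultimately show ?thesis using tele[of N] unfolding shift by argo
    qed
    moreover have "(\<lambda>N. 6 * (LINT x|M. (norm (erg_avg g d N x - h x))\<^sup>2) + 4 * ((2 * C)\<^sup>2 / real N)) \<longlonglongrightarrow> 6 * 0 + 4 * 0"
      by (intro tendsto_add tendsto_mult tendsto_const lim lim_const_over_n)
    ultimately have "E \<le> 6 * 0 + 4 * 0" by (intro tendsto_lowerbound) auto
    moreover have "E \<ge> 0" unfolding E_def by simp
    ultimately have E0: "E = 0" by simp
    have int: "integrable M (\<lambda>x. (norm (h (\<tau> (int d) x) - h x))\<^sup>2)"
      by (rule L2_integrable[where C = "C + C"]) (measurable, rule order_trans[OF norm_triangle_ineq4 add_mono[OF hC hC]])
    have "AE x in M. (norm (h (\<tau> (int d) x) - h x))\<^sup>2 = 0"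
      using E0 integral_nonneg_eq_0_iff_AE[OF int] unfolding E_def by simp
    then show ?thesis by eventually_elim simp
  qed
  have orth: "(LINT x|M. h x * cnj (H x)) = (LINT x|M. g x * cnj (H x))"
    if H [measurable]: "H \<in> borel_measurable M" and B: "\<And>x. norm (H x) \<le> B" and HI: "AE x in M. H (\<tau> (int d) x) = H x" for H B
  proof -
    have HIn: "AE x in M. H (\<tau> (int (d * n)) x) = H x" for n by (rule AE_invariant_multiple[OF HI])
    have B0: "B \<ge> 0" using B[of undefined] norm_ge_zero order_trans by blast
    have int: "integrable M (\<lambda>x. g (\<tau> k x) * cnj (H x))" for k
    proof (rule integrable_bounded[where C = "C * B"])
      fix x show "norm (g (\<tau> k x) * cnj (H x)) \<le> C * B" unfolding norm_mult complex_mod_cnj using C B C0 by (intro mult_mono) auto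
    qed measurable
    have tm: "(LINT x|M. g (\<tau> (int (d * n)) x) * cnj (H x)) = (LINT x|M. g x * cnj (H x))" for n
    proof -
      have "(LINT x|M. g (\<tau> (int (d * n)) x) * cnj (H x)) = (LINT x|M. g (\<tau> (int (d * n)) x) * cnj (H (\<tau> (int (d * n)) x)))"
        by (rule integral_cong_AE) (use HIn[of n] in \<open>auto\<close>)
      also have "\<dots> = (LINT x|M. g x * cnj (H x))" by (rule integral_shift[of "\<lambda>x. g x * cnj (H x)"]) simp
      finally show ?thesis .
    qed
    have lim1: "(\<lambda>N. LINT x|M. erg_avg g d N x * cnj (H x)) \<longlonglongrightarrow> (LINT x|M. h x * cnj (H x))"
      by (rule L2_limit_integral[where B = C and B' = B]) (use aC hC B lim in auto)
    have ev: "\<forall>\<^sub>F N in sequentially. (LINT x|M. erg_avg g d N x * cnj (H x)) = (LINT x|M. g x * cnj (H x))"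
    proof (rule eventually_sequentiallyI[of 1])
      fix N :: nat assume N: "1 \<le> N"
      have "(LINT x|M. erg_avg g d N x * cnj (H x)) = (LINT x|M. (\<Sum>n=1..N. g (\<tau> (int (d * n)) x) * cnj (H x)) / of_nat N)"
        by (intro Bochner_Integration.integral_cong refl) (simp add: erg_avg_def sum_distrib_right)
      also have "\<dots> = (\<Sum>n=1..N. LINT x|M. g (\<tau> (int (d * n)) x) * cnj (H x)) / of_nat N"
        by (simp add: Bochner_Integration.integral_sum int)
      also have "\<dots> = (LINT x|M. g x * cnj (H x))" unfolding tm using N by simp
      finally show "(LINT x|M. erg_avg g d N x * cnj (H x)) = (LINT x|M. g x * cnj (H x))" .
    qed
    show ?thesis by (rule LIMSEQ_unique[OF lim1 tendsto_eventually[OF ev]])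
  qed
  show ?thesis using h hC lim inv orth by blast
qed

text \<open>\<open>ergodic\<close> speaks of strictly invariant sets, whereas \<open>u\<close> is
  invariant only almost everywhere. The set of points along whose orbit \<open>u\<close> is
  eventually at most \<open>c\<close> is strictly invariant and agrees with the sublevel set of
  \<open>u\<close> up to a null set, so every sublevel set has probability 0 or 1.\<close>

lemma ergodic_real_constant:
  fixes u :: "'a \<Rightarrow> real"
  assumes erg: "ergodic M (\<tau> 1)" and u [measurable]: "u \<in> borel_measurable M" and B: "\<And>x. \<bar>u x\<bar> \<le> B"
    and inv: "AE x in M. u (\<tau> 1 x) = u x"
  shows "AE x in M. u x = (LINT x|M. u x)"
proof -
  have ui: "integrable M u" by (rule integrable_bounded[where C = B]) (use B in auto)
  have invn: "AE x in M. \<forall>n. u (\<tau> (1 + int n) x) = u x"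
    unfolding AE_all_countable
  proof
    fix n show "AE x in M. u (\<tau> (1 + int n) x) = u x"
    proof (induction n)
      case (Suc n)
      have "AE x in M. u (\<tau> (1 + int n) (\<tau> 1 x)) = u (\<tau> 1 x)" by (rule AE_shift[OF Suc])
      with inv AE_space show ?case
      proof eventually_elim
        fix x assume "u (\<tau> 1 x) = u x" "x \<in> space M" "u (\<tau> (1 + int n) (\<tau> 1 x)) = u (\<tau> 1 x)"
        then show "u (\<tau> (1 + int (Suc n)) x) = u x" using act[of x "1 + int n" 1] by (simp add: add_ac)
      qed
    qed (use inv in simp)
  qed
  have zero_one: "(AE x in M. u x \<le> c) \<or> (AE x in M. u x > c)" for c
  proof -
    define A where "A = {x\<in>space M. \<exists>m. \<forall>n\<ge>m. u (\<tau> (1 + int n) x) \<le> c}"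
    have A [measurable]: "A \<in> sets M" unfolding A_def by measurable
    have "\<tau> 1 -` A \<inter> space M = A"
    proof (intro equalityI subsetI)
      fix x assume "x \<in> \<tau> 1 -` A \<inter> space M"
      then obtain m where x: "x \<in> space M" and m: "\<forall>n\<ge>m. u (\<tau> (1 + int n) (\<tau> 1 x)) \<le> c" by (auto simp: A_def)
      have "u (\<tau> (1 + int n) x) \<le> c" if n: "n \<ge> Suc m" for n
      proof -
        obtain k where k: "n = Suc k" using n by (cases n) auto
        then show ?thesis using m[rule_format, of k] n act[OF x, of "1 + int k" 1] by (simp add: add_ac)
      qed
      then show "x \<in> A" using x unfolding A_def by blast
    next
      fix x assume "x \<in> A"
      then obtain m where x: "x \<in> space M" and m: "\<forall>n\<ge>m. u (\<tau> (1 + int n) x) \<le> c" by (auto simp: A_def)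
      have "u (\<tau> (1 + int n) (\<tau> 1 x)) \<le> c" if n: "n \<ge> m" for n
        using m[rule_format, of "Suc n"] n act[OF x, of "1 + int n" 1] by (simp add: add_ac)
      then show "x \<in> \<tau> 1 -` A \<inter> space M" using x measurable_space[OF meas x, of 1] unfolding A_def by blast
    qed
    then have "prob A = 0 \<or> prob A = 1" using erg A unfolding ergodic_def by blast
    then have zo: "prob A = 0 \<or> prob A = 1" .
    have AE: "AE x in M. x \<in> A \<longleftrightarrow> u x \<le> c" using invn AE_space
      by eventually_elim (auto simp: A_def)
    from zo show ?thesis
    proof
      assume "prob A = 0"
      then have "AE x in M. x \<notin> A" using A by (simp add: prob_eq_0)
      with AE have "AE x in M. u x > c" by eventually_elim auto
      then show ?thesis ..
    next
      assume "prob A = 1"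
      then have "AE x in M. x \<in> A" using A by (simp add: prob_eq_1)
      with AE have "AE x in M. u x \<le> c" by eventually_elim auto
      then show ?thesis ..
    qed
  qed
  define m where "m = (LINT x|M. u x)"
  have up: "AE x in M. u x \<le> m + 1 / real (Suc n)" for n
  proof (rule ccontr)
    assume "\<not> ?thesis"
    then have "AE x in M. u x > m + 1 / real (Suc n)" using zero_one by blast
    then have ae: "AE x in M. m + 1 / real (Suc n) \<le> u x" by (rule AE_mp) (intro AE_I2 impI less_imp_le)
    have "(LINT x|M. m + 1 / real (Suc n)) \<le> (LINT x|M. u x)"
      by (rule integral_mono_AE[OF _ ui ae]) simp
    then show False by (simp add: prob_space m_def[symmetric])
  qed
  have lo: "AE x in M. u x > m - 1 / real (Suc n)" for n
  proof (rule ccontr)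
    assume "\<not> ?thesis"
    then have ae: "AE x in M. u x \<le> m - 1 / real (Suc n)" using zero_one by blast
    have "(LINT x|M. u x) \<le> (LINT x|M. m - 1 / real (Suc n))" by (rule integral_mono_AE[OF ui _ ae]) simp
    then show False by (simp add: prob_space m_def[symmetric])
  qed
  have "AE x in M. \<forall>n. u x \<le> m + 1 / real (Suc n)" "AE x in M. \<forall>n. u x > m - 1 / real (Suc n)"
    using up lo by (simp_all add: AE_all_countable del: of_nat_Suc)
  then show ?thesis
  proof eventually_elim
    fix x assume a: "\<forall>n. u x \<le> m + 1 / real (Suc n)" "\<forall>n. u x > m - 1 / real (Suc n)"
    have l: "(\<lambda>n. 1 / real (Suc n)) \<longlonglongrightarrow> 0" by (rule LIMSEQ_Suc[OF lim_const_over_n])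
    have lp: "(\<lambda>n. m + 1 / real (Suc n)) \<longlonglongrightarrow> m + 0" by (intro tendsto_add tendsto_const l)
    have lm: "(\<lambda>n. m - 1 / real (Suc n)) \<longlonglongrightarrow> m - 0" by (intro tendsto_diff tendsto_const l)
    have "u x \<le> m + 0" by (rule LIMSEQ_le_const[OF lp]) (rule exI, rule allI, rule impI, rule a(1)[rule_format])
    moreover have "m - 0 \<le> u x"
      by (rule LIMSEQ_le_const2[OF lm]) (rule exI, rule allI, rule impI, rule less_imp_le, rule a(2)[rule_format])
    ultimately show "u x = (LINT x|M. u x)" by (simp add: m_def)
  qed
qed

lemma ergodic_constant:
  fixes h :: "'a \<Rightarrow> complex"
  assumes erg: "ergodic M (\<tau> 1)" and h [measurable]: "h \<in> borel_measurable M" and B: "\<And>x. norm (h x) \<le> B"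
    and inv: "AE x in M. h (\<tau> 1 x) = h x"
  shows "AE x in M. h x = (LINT x|M. h x)"
proof -
  have i: "integrable M h" by (rule integrable_bounded[OF h B])
  have "AE x in M. Re (h x) = (LINT x|M. Re (h x))"
    by (rule ergodic_real_constant[OF erg, where B = B])
       (use B inv in \<open>auto intro: order_trans[OF abs_Re_le_cmod]\<close>)
  moreover have "AE x in M. Im (h x) = (LINT x|M. Im (h x))"
    by (rule ergodic_real_constant[OF erg, where B = B])
       (use B inv in \<open>auto intro: order_trans[OF abs_Im_le_cmod]\<close>)
  ultimately show ?thesis
    by eventually_elim (simp add: complex_eq_iff i)
qed

end

section \<open>Averages over residue classes\<close>

text \<open>Only an upper bound is counted; the lower bound follows because the \<open>k\<close>
  classes together have \<open>N\<close> elements.\<close>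

lemma residue_class_density:
  assumes k: "k \<ge> 1"
  shows "(\<lambda>N. real (card {n\<in>{1..N}. [n = r] (mod k)}) / real N) \<longlonglongrightarrow> 1 / real k"
proof -
  define c where "c s N = real (card {n\<in>{1..N}. [n = s] (mod k)})" for s N
  have up: "c s N \<le> real N / real k + 1" for s N unfolding c_def by (rule card_residue_class_le[OF k])
  have total: "(\<Sum>s<k. c s N) = real N" for N
  proof -
    have "{1..N} = (\<Union>s\<in>{..<k}. {n\<in>{1..N}. [n = s] (mod k)})" using k by (auto simp: cong_def)
    then have "card {1..N} = (\<Sum>s<k. card {n\<in>{1..N}. [n = s] (mod k)})"
      by (subst card_UN_disjoint[symmetric]) (auto simp: cong_def)
    then show ?thesis unfolding c_def by (simp only: of_nat_sum[symmetric]) simp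
  qed
  have cr: "c r N = c (r mod k) N" for N by (simp add: c_def cong_def)
  have low: "real N / real k - real k \<le> c r N" for N
  proof -
    have rk: "r mod k \<in> {..<k}" using k by simp
    have "real N = c (r mod k) N + (\<Sum>s\<in>{..<k} - {r mod k}. c s N)"
      using total[of N] sum.remove[OF _ rk, of "\<lambda>s. c s N"] by simp
    also have "(\<Sum>s\<in>{..<k} - {r mod k}. c s N) \<le> (\<Sum>s\<in>{..<k} - {r mod k}. real N / real k + 1)" by (intro sum_mono up)
    also have "\<dots> = (real k - 1) * (real N / real k + 1)" using rk k by (simp add: of_nat_diff)
    also have "\<dots> = real N - real N / real k + real k - 1" using k by (simp add: field_simps)
    finally show ?thesis using cr by simp
  qed
  have "(\<lambda>N. c r N / real N) \<longlonglongrightarrow> 1 / real k"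
  proof (rule tendsto_sandwich)
    show "\<forall>\<^sub>F N in sequentially. 1 / real k - real k / real N \<le> c r N / real N"
    proof (rule eventually_sequentiallyI[of 1])
      fix N :: nat assume "1 \<le> N"
      then show "1 / real k - real k / real N \<le> c r N / real N"
        using divide_right_mono[OF low[of N], of "real N"] by (simp add: diff_divide_distrib)
    qed
    show "\<forall>\<^sub>F N in sequentially. c r N / real N \<le> 1 / real k + 1 / real N"
    proof (rule eventually_sequentiallyI[of 1])
      fix N :: nat assume "1 \<le> N"
      then show "c r N / real N \<le> 1 / real k + 1 / real N"
        using divide_right_mono[OF up[of r N], of "real N"] by (simp add: add_divide_distrib)
    qed
    have "(\<lambda>N. 1 / real k - real k / real N) \<longlonglongrightarrow> 1 / real k - 0" by (intro tendsto_diff tendsto_const lim_const_over_n)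
    then show "(\<lambda>N. 1 / real k - real k / real N) \<longlonglongrightarrow> 1 / real k" by simp
    have "(\<lambda>N. 1 / real k + 1 / real N) \<longlonglongrightarrow> 1 / real k + 0" by (intro tendsto_add tendsto_const lim_const_over_n)
    then show "(\<lambda>N. 1 / real k + 1 / real N) \<longlonglongrightarrow> 1 / real k" by simp
  qed
  then show ?thesis unfolding c_def .
qed

context mp_action
begin

text \<open>The divisor is \<open>N\<close> and not the size of the class, so that the averages over
  all classes add up to the full average; the limit then carries a factor
  \<open>1 / k\<close>.\<close>

definition res_avg :: "(nat \<Rightarrow> int) \<Rightarrow> nat \<Rightarrow> nat \<Rightarrow> ('a \<Rightarrow> complex) \<Rightarrow> nat \<Rightarrow> 'a \<Rightarrow> complex" where
  "res_avg a k r g N x = (\<Sum>n\<in>{n\<in>{1..N}. [n = r] (mod k)}. g (\<tau> (a n) x)) / of_nat N"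

lemma res_avg_measurable [measurable]:
  assumes [measurable]: "g \<in> borel_measurable M"
  shows "res_avg a k r g N \<in> borel_measurable M"
  unfolding res_avg_def by measurable

lemma norm_res_avg_le: "(\<And>x. norm (g x) \<le> C) \<Longrightarrow> norm (res_avg a k r g N x) \<le> C"
  unfolding res_avg_def by (rule norm_average_le) auto

text \<open>
  Ergodicity says that the spectral measure of a mean-zero function does not charge the integers, and
  off the integers the exponential averages tend to 0.
\<close>
lemma res_avg_mean_zero:
  assumes erg: "ergodic M (\<tau> 1)" and a: "\<And>\<theta>. \<theta> \<notin> \<int> \<Longrightarrow> residue_mean_zero a \<theta>" and k: "k \<ge> 1"
    and g [measurable]: "g \<in> borel_measurable M" and C: "\<And>x. norm (g x) \<le> C" and g0: "(LINT x|M. g x) = 0"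
  shows "(\<lambda>N. LINT x|M. (norm (res_avg a k r g N x))\<^sup>2) \<longlonglongrightarrow> 0"
proof -
  define c0 where "c0 = (LINT x|M. (norm (g x))\<^sup>2)"
  obtain \<mu> where \<mu>: "real_distribution \<mu>" "\<forall>(I :: nat set) c b.
      (LINT x|M. (norm (\<Sum>i\<in>I. c i * g (\<tau> (b i) x)))\<^sup>2) = c0 * (LINT t|\<mu>. (norm (\<Sum>i\<in>I. c i * e_char (of_int (b i) * t)))\<^sup>2)"
    using spectral_measure[OF g C] unfolding c0_def by blast
  interpret \<mu>: real_distribution \<mu> by fact
  have avg: "(LINT x|M. (norm ((\<Sum>i\<in>I. g (\<tau> (b i) x)) / of_nat N))\<^sup>2) = c0 * (LINT t|\<mu>. (norm ((\<Sum>i\<in>I. e_char (of_int (b i) * t)) / of_nat N))\<^sup>2)"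
    for I :: "nat set" and b and N :: nat
  proof -
    have "(LINT x|M. (norm (\<Sum>i\<in>I. (1 / of_nat N) * g (\<tau> (b i) x)))\<^sup>2) = c0 * (LINT t|\<mu>. (norm (\<Sum>i\<in>I. (1 / of_nat N) * e_char (of_int (b i) * t)))\<^sup>2)"
      by (rule \<mu>(2)[rule_format])
    then show ?thesis by (simp only: sum_divide_distrib times_divide_eq_left mult_1)
  qed
  have Zb [measurable]: "(\<int> :: real set) \<in> sets borel" by (intro borel_closed closed_Ints)
  \<comment> \<open>The ergodic averages of \<open>g\<close> are evaluated twice: by ergodicity they
    tend to the mean 0, and under the spectral measure they tend to the indicator of the
    integers.\<close>
  have zero: "c0 * measure \<mu> \<int> = 0"
  proof -
    obtain h where h [measurable]: "h \<in> borel_measurable M" and hC: "\<forall>x. norm (h x) \<le> C" and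
      lim: "(\<lambda>N. LINT x|M. (norm (erg_avg g 1 N x - h x))\<^sup>2) \<longlonglongrightarrow> 0" and
      inv: "AE x in M. h (\<tau> (int 1) x) = h x" and
      orth: "\<forall>H B. H \<in> borel_measurable M \<longrightarrow> (\<forall>x. norm (H x) \<le> B) \<longrightarrow> (AE x in M. H (\<tau> (int 1) x) = H x) \<longrightarrow>
        (LINT x|M. h x * cnj (H x)) = (LINT x|M. g x * cnj (H x))"
      using mean_ergodic[OF g C, of 1] by blast
    have "(LINT x|M. h x * cnj 1) = (LINT x|M. g x * cnj 1)"
      using orth[rule_format, of "\<lambda>_. 1" 1] by simp
    then have h0: "(LINT x|M. h x) = 0" using g0 by simp
    have "AE x in M. h x = (LINT x|M. h x)"
      by (rule ergodic_constant[OF erg h]) (use hC inv in auto)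
    then have hz: "AE x in M. h x = 0" unfolding h0 .
    have "(LINT x|M. (norm (erg_avg g 1 N x - h x))\<^sup>2) = c0 * (LINT t|\<mu>. (norm (char_avg 1 N t))\<^sup>2)" for N
    proof -
      have "(LINT x|M. (norm (erg_avg g 1 N x - h x))\<^sup>2) = (LINT x|M. (norm (erg_avg g 1 N x))\<^sup>2)"
        by (rule integral_cong_AE) (use hz in auto)
      then show ?thesis unfolding erg_avg_def char_avg_def avg .
    qed
    then have l1: "(\<lambda>N. c0 * (LINT t|\<mu>. (norm (char_avg 1 N t))\<^sup>2)) \<longlonglongrightarrow> 0" using lim by simp
    have "(\<lambda>N. LINT t|\<mu>. (norm (char_avg 1 N t))\<^sup>2) \<longlonglongrightarrow> (LINT t|\<mu>. indicator \<int> t)"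
    proof (rule integral_dominated_convergence[where w = "\<lambda>_. 1"])
      show "AE t in \<mu>. (\<lambda>N. (norm (char_avg 1 N t))\<^sup>2) \<longlonglongrightarrow> indicator \<int> t"
      proof (rule AE_I2)
        fix t
        have "(\<lambda>N. (norm (char_avg 1 N t))\<^sup>2) \<longlonglongrightarrow> (norm (if real 1 * t \<in> \<int> then 1 else 0 :: complex))\<^sup>2"
          by (intro tendsto_intros char_avg_limit)
        moreover have "(norm (if real 1 * t \<in> \<int> then 1 else 0 :: complex))\<^sup>2 = (indicator \<int> t :: real)" by (simp add: indicator_def)
        ultimately show "(\<lambda>N. (norm (char_avg 1 N t))\<^sup>2) \<longlonglongrightarrow> indicator \<int> t" by (simp only:)
      qed
      show "AE t in \<mu>. norm ((norm (char_avg 1 N t))\<^sup>2) \<le> 1" for N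
        by (rule AE_I2) (use norm_char_avg_le in \<open>auto intro: power_le_one\<close>)
    qed auto
    then have "(\<lambda>N. LINT t|\<mu>. (norm (char_avg 1 N t))\<^sup>2) \<longlonglongrightarrow> measure \<mu> \<int>" by simp
    then have "(\<lambda>N. c0 * (LINT t|\<mu>. (norm (char_avg 1 N t))\<^sup>2)) \<longlonglongrightarrow> c0 * measure \<mu> \<int>" by (intro tendsto_mult tendsto_const)
    then show ?thesis by (rule LIMSEQ_unique[OF _ l1])
  qed
  define W where "W N t = (\<Sum>n\<in>{n\<in>{1..N}. [n = r] (mod k)}. e_char (of_int (a n) * t)) / of_nat N" for N t
  have Wm [measurable]: "W N \<in> borel_measurable borel" for N unfolding W_def by measurable
  have eq: "(LINT x|M. (norm (res_avg a k r g N x))\<^sup>2) = c0 * (LINT t|\<mu>. (norm (W N t))\<^sup>2)" for N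
    unfolding res_avg_def W_def avg ..
  show ?thesis
  proof (cases "c0 = 0")
    case True then show ?thesis unfolding eq by simp
  next
    case False
    then have "measure \<mu> \<int> = 0" using zero by simp
    then have ae: "AE t in \<mu>. t \<notin> \<int>" by (subst \<mu>.prob_eq_0[symmetric]) auto
    have "(\<lambda>N. LINT t|\<mu>. (norm (W N t))\<^sup>2) \<longlonglongrightarrow> (LINT t|\<mu>. 0)"
    proof (rule integral_dominated_convergence[where w = "\<lambda>_. 1"])
      show "AE t in \<mu>. (\<lambda>N. (norm (W N t))\<^sup>2) \<longlonglongrightarrow> 0"
        using ae
      proof eventually_elim
        fix t :: real assume "t \<notin> \<int>"
        then have "(\<lambda>N. W N t) \<longlonglongrightarrow> 0" using a k unfolding residue_mean_zero_def W_def by blast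
        then have "(\<lambda>N. (norm (W N t))\<^sup>2) \<longlonglongrightarrow> (norm (0::complex))\<^sup>2" by (intro tendsto_intros)
        then show "(\<lambda>N. (norm (W N t))\<^sup>2) \<longlonglongrightarrow> 0" by simp
      qed
      have "norm (W N t) \<le> 1" for N t unfolding W_def by (rule norm_average_le) auto
      then show "AE t in \<mu>. norm ((norm (W N t))\<^sup>2) \<le> 1" for N
        by (intro AE_I2) (auto intro: power_le_one)
    qed auto
    then have "(\<lambda>N. c0 * (LINT t|\<mu>. (norm (W N t))\<^sup>2)) \<longlonglongrightarrow> c0 * 0" by (intro tendsto_mult tendsto_const) simp
    then show ?thesis unfolding eq by simp
  qed
qed

theorem res_avg_limit:
  assumes erg: "ergodic M (\<tau> 1)" and a: "\<And>\<theta>. \<theta> \<notin> \<int> \<Longrightarrow> residue_mean_zero a \<theta>" and k: "k \<ge> 1"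
    and g [measurable]: "g \<in> borel_measurable M" and C: "\<And>x. norm (g x) \<le> C"
  shows "(\<lambda>N. LINT x|M. (norm (res_avg a k r g N x - (LINT y|M. g y) / of_nat k))\<^sup>2) \<longlonglongrightarrow> 0"
proof -
  define m where "m = (LINT y|M. g y)"
  define g' where "g' x = g x - m" for x
  have [measurable]: "g' \<in> borel_measurable M" unfolding g'_def by measurable
  have C0: "C \<ge> 0" using C[of undefined] norm_ge_zero order_trans by blast
  have mC: "norm m \<le> C" unfolding m_def by (rule integral_norm_le_bound[OF g C])
  have g'C: "norm (g' x) \<le> C + C" for x unfolding g'_def by (rule order_trans[OF norm_triangle_ineq4 add_mono[OF C mC]])
  have g'0: "(LINT x|M. g' x) = 0"
    unfolding g'_def using integrable_bounded[OF g C] by (simp add: prob_space m_def)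
  define c where "c N = real (card {n\<in>{1..N}. [n = r] (mod k)}) / real N" for N
  have split: "res_avg a k r g N x - m / of_nat k = res_avg a k r g' N x + of_real (c N - 1 / real k) * m" for N x
  proof -
    have "res_avg a k r g' N x = res_avg a k r g N x - of_real (c N) * m"
      unfolding res_avg_def g'_def c_def by (simp add: sum_subtractf diff_divide_distrib)
    then show ?thesis by (simp add: algebra_simps)
  qed
  have le: "(LINT x|M. (norm (res_avg a k r g N x - m / of_nat k))\<^sup>2) \<le>
      2 * (LINT x|M. (norm (res_avg a k r g' N x))\<^sup>2) + 2 * (norm (of_real (c N - 1 / real k) * m))\<^sup>2" for N
  proof -
    have i: "integrable M (\<lambda>x. (norm (res_avg a k r g' N x))\<^sup>2)"
      by (rule L2_integrable) (measurable, rule norm_res_avg_le[OF g'C])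
    have "(LINT x|M. (norm (res_avg a k r g N x - m / of_nat k))\<^sup>2) \<le>
       (LINT x|M. 2 * (norm (res_avg a k r g' N x))\<^sup>2 + 2 * (norm (of_real (c N - 1 / real k) * m))\<^sup>2)"
      unfolding split
    proof (intro integral_mono' Bochner_Integration.integrable_add integrable_mult_right i)
      fix x show "(norm (res_avg a k r g' N x + of_real (c N - 1 / real k) * m))\<^sup>2 \<le>
         2 * (norm (res_avg a k r g' N x))\<^sup>2 + 2 * (norm (of_real (c N - 1 / real k) * m))\<^sup>2"
        by (rule norm_add_squared_le)
    qed auto
    then show ?thesis using i by (simp add: prob_space)
  qed
  have "(\<lambda>N. 2 * (LINT x|M. (norm (res_avg a k r g' N x))\<^sup>2) + 2 * (norm (of_real (c N - 1 / real k) * m))\<^sup>2) \<longlonglongrightarrow>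
     2 * 0 + 2 * (norm (of_real (1 / real k - 1 / real k) * m))\<^sup>2"
    unfolding c_def
    by (intro tendsto_intros residue_class_density[OF k] res_avg_mean_zero[OF erg a k _ g'C g'0]) measurable
  then have lim: "(\<lambda>N. 2 * (LINT x|M. (norm (res_avg a k r g' N x))\<^sup>2) + 2 * (norm (of_real (c N - 1 / real k) * m))\<^sup>2) \<longlonglongrightarrow> 0" by simp
  show ?thesis unfolding m_def[symmetric]
    by (rule Lim_null_comparison[OF _ lim]) (use le in \<open>auto intro!: always_eventually\<close>)
qed

text \<open>\<open>F0\<close> is the projection of \<open>F\<close> for the step \<open>D\<close>.
  Functions invariant under the step \<open>d\<close> are invariant under its multiple
  \<open>D\<close>, so \<open>F - F0\<close> is orthogonal to the limit of its own ergodic averages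
  along \<open>d\<close>; the averaged correlations converge to that inner product.\<close>

lemma corr_average_zero:
  assumes F [measurable]: "F \<in> borel_measurable M" and C: "\<And>x. norm (F x) \<le> C"
    and F0 [measurable]: "F0 \<in> borel_measurable M" and C0: "\<And>x. norm (F0 x) \<le> C"
    and D: "d dvd D"
    and orth: "\<forall>H B. H \<in> borel_measurable M \<longrightarrow> (\<forall>x. norm (H x) \<le> B) \<longrightarrow> (AE x in M. H (\<tau> (int D) x) = H x) \<longrightarrow>
        (LINT x|M. F0 x * cnj (H x)) = (LINT x|M. F x * cnj (H x))"
  shows "(\<lambda>N. (\<Sum>n=1..N. corr (\<lambda>x. F x - F0 x) (int (d * n))) / of_nat N) \<longlonglongrightarrow> 0"
proof -
  define g where "g x = F x - F0 x" for x
  have g [measurable]: "g \<in> borel_measurable M" unfolding g_def by measurable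
  have gC: "norm (g x) \<le> C + C" for x unfolding g_def by (rule order_trans[OF norm_triangle_ineq4 add_mono[OF C C0]])
  have Cnn: "C \<ge> 0" using C[of undefined] norm_ge_zero order_trans by blast
  obtain h where h [measurable]: "h \<in> borel_measurable M" and hC: "\<forall>x. norm (h x) \<le> C + C" and
      lim: "(\<lambda>N. LINT x|M. (norm (erg_avg g d N x - h x))\<^sup>2) \<longlonglongrightarrow> 0" and
      inv: "AE x in M. h (\<tau> (int d) x) = h x"
    using mean_ergodic[OF g gC, of d] by blast
  obtain e where e: "D = d * e" using D by auto
  have invD: "AE x in M. h (\<tau> (int D) x) = h x" unfolding e by (rule AE_invariant_multiple[OF inv])
  have i: "integrable M (\<lambda>x. w x * cnj (h x))" if [measurable]: "w \<in> borel_measurable M" and "\<And>x. norm (w x) \<le> B" for w B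
  proof (rule integrable_bounded[where C = "B * (C + C)"])
    have "B \<ge> 0" using that(2)[of undefined] norm_ge_zero order_trans by blast
    then show "norm (w x * cnj (h x)) \<le> B * (C + C)" for x unfolding norm_mult complex_mod_cnj using that(2) hC by (intro mult_mono) auto
  qed measurable
  have "(LINT x|M. F0 x * cnj (h x)) = (LINT x|M. F x * cnj (h x))" using orth h hC invD by blast
  then have "(LINT x|M. g x * cnj (h x)) = 0"
    unfolding g_def left_diff_distrib using Bochner_Integration.integral_diff[OF i[OF F C] i[OF F0 C0]] by simp
  moreover have "(LINT x|M. h x * cnj (g x)) = (LINT x|M. cnj (g x * cnj (h x)))"
    by (simp only: complex_cnj_mult complex_cnj_cnj mult.commute)
  ultimately have hg: "(LINT x|M. h x * cnj (g x)) = 0" by (simp only: Bochner_Integration.integral_cnj complex_cnj_zero)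
  have "(\<lambda>N. LINT x|M. erg_avg g d N x * cnj (g x)) \<longlonglongrightarrow> (LINT x|M. h x * cnj (g x))"
    by (rule L2_limit_integral[where B = "C + C" and B' = "C + C"]) (use norm_erg_avg_le[OF gC] hC gC lim in auto)
  moreover have "(LINT x|M. erg_avg g d N x * cnj (g x)) = (\<Sum>n=1..N. corr g (int (d * n))) / of_nat N" for N
  proof -
    have int: "integrable M (\<lambda>x. g (\<tau> j x) * cnj (g x))" for j
    proof (rule integrable_bounded[where C = "(C + C) * (C + C)"])
      show "norm (g (\<tau> j x) * cnj (g x)) \<le> (C + C) * (C + C)" for x
        unfolding norm_mult complex_mod_cnj using gC Cnn by (intro mult_mono) auto
    qed measurable
    have "(LINT x|M. erg_avg g d N x * cnj (g x)) = (LINT x|M. (\<Sum>n=1..N. g (\<tau> (int (d * n)) x) * cnj (g x)) / of_nat N)"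
      by (intro Bochner_Integration.integral_cong refl) (simp add: erg_avg_def sum_distrib_right)
    also have "\<dots> = (\<Sum>n=1..N. LINT x|M. g (\<tau> (int (d * n)) x) * cnj (g x)) / of_nat N"
      by (simp add: Bochner_Integration.integral_sum int)
    finally show ?thesis by (simp add: corr_def)
  qed
  ultimately show ?thesis using hg unfolding g_def[symmetric] by simp
qed

lemma corr_minus:
  assumes [measurable]: "g \<in> borel_measurable M"
  shows "corr g (- k) = cnj (corr g k)"
proof -
  have "corr g (- k) = (LINT x|M. g (\<tau> 0 x) * cnj (g (\<tau> k x)))" using corr_shift[OF assms, of 0 k] by simp
  moreover have "corr g k = (LINT x|M. g (\<tau> k x) * cnj (g (\<tau> 0 x)))" using corr_shift[OF assms, of k 0] by simp
  moreover have "(LINT x|M. g (\<tau> 0 x) * cnj (g (\<tau> k x))) = (LINT x|M. cnj (g (\<tau> k x) * cnj (g (\<tau> 0 x))))"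
    by (simp only: complex_cnj_mult complex_cnj_cnj mult.commute)
  ultimately show ?thesis by (simp only: Bochner_Integration.integral_cnj)
qed

end

section \<open>Katai's orthogonality criterion\<close>

lemma sum_multiples:
  fixes z :: "nat \<Rightarrow> complex"
  assumes p: "p \<ge> 1"
  shows "(\<Sum>n\<in>{n\<in>{1..N}. p dvd n}. z n) = (\<Sum>m\<in>{m\<in>{1..N}. p * m \<le> N}. z (p * m))"
  by (rule sum.reindex_bij_witness[of _ "\<lambda>m. p * m" "\<lambda>n. n div p"])
     (use p in \<open>auto elim!: dvdE intro: order_trans[rotated] simp: Suc_le_eq\<close>)

text \<open>The constant \<open>L\<close> is replaced by the number of prime divisors in
  \<open>P\<close>, at the cost of the Turan-Kubilius variance. The sum is then grouped by the
  cofactor \<open>m\<close> in \<open>n = p * m\<close>, and Cauchy-Schwarz over \<open>m\<close>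
  leaves only the moduli of the sums over \<open>p\<close>.\<close>

lemma katai_pointwise:
  fixes z :: "nat \<Rightarrow> complex"
  assumes P: "finite P" "\<And>p. p \<in> P \<Longrightarrow> prime p" and N: "2 * card P \<le> N" "N \<ge> 1" and B: "\<And>n. norm (z n) \<le> B"
  defines "L \<equiv> \<Sum>p\<in>P. 1 / real p"
  shows "L\<^sup>2 * (norm (\<Sum>n=1..N. z n))\<^sup>2 \<le>
    4 * B\<^sup>2 * L * (real N)\<^sup>2 + 2 * real N * (\<Sum>m=1..N. (norm (\<Sum>p\<in>{p\<in>P. p * m \<le> N}. z (p * m)))\<^sup>2)"
proof -
  define \<omega> where "\<omega> n = prime_count P n" for n
  define S where "S m = (\<Sum>p\<in>{p\<in>P. p * m \<le> N}. z (p * m))" for m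
  have L0: "L \<ge> 0" unfolding L_def by (intro sum_nonneg) auto
  have p1: "p \<ge> 1" if "p \<in> P" for p using P(2)[OF that] prime_gt_0_nat[of p] by simp
  have s1: "(\<Sum>n=1..N. of_real (\<omega> n) * z n) = (\<Sum>m=1..N. S m)"
  proof -
    have "(\<Sum>n=1..N. of_real (\<omega> n) * z n) = (\<Sum>n=1..N. \<Sum>p\<in>P. if p dvd n then z n else 0)"
      unfolding \<omega>_def prime_count_altdef[OF P(1)] of_real_sum sum_distrib_right
      by (intro sum.cong refl) auto
    also have "\<dots> = (\<Sum>p\<in>P. \<Sum>n=1..N. if p dvd n then z n else 0)" by (rule sum.swap)
    also have "\<dots> = (\<Sum>p\<in>P. \<Sum>m\<in>{m\<in>{1..N}. p * m \<le> N}. z (p * m))"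
      unfolding sum.inter_filter[OF finite_atLeastAtMost, symmetric]
      by (rule sum.cong[OF refl]) (rule sum_multiples[OF p1])
    also have "\<dots> = (\<Sum>p\<in>P. \<Sum>m=1..N. if p * m \<le> N then z (p * m) else 0)"
      by (simp only: sum.inter_filter[OF finite_atLeastAtMost])
    also have "\<dots> = (\<Sum>m=1..N. \<Sum>p\<in>P. if p * m \<le> N then z (p * m) else 0)" by (rule sum.swap)
    also have "\<dots> = (\<Sum>m=1..N. S m)" unfolding S_def by (simp only: sum.inter_filter[OF P(1)])
    finally show ?thesis .
  qed
  have "(norm (\<Sum>n=1..N. of_real (L - \<omega> n) * z n))\<^sup>2 \<le> (\<Sum>n=1..N. (\<omega> n - L)\<^sup>2) * (\<Sum>n=1..N. B\<^sup>2)"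
  proof -
    have "norm (\<Sum>n=1..N. of_real (L - \<omega> n) * z n) \<le> (\<Sum>n=1..N. \<bar>L - \<omega> n\<bar> * norm (z n))"
      by (rule order_trans[OF norm_sum]) (simp only: norm_mult norm_of_real order_refl)
    then have "(norm (\<Sum>n=1..N. of_real (L - \<omega> n) * z n))\<^sup>2 \<le> (\<Sum>n=1..N. \<bar>L - \<omega> n\<bar> * norm (z n))\<^sup>2"
      by (intro power_mono) auto
    also have "\<dots> \<le> (\<Sum>n=1..N. (\<bar>L - \<omega> n\<bar>)\<^sup>2) * (\<Sum>n=1..N. (norm (z n))\<^sup>2)" by (rule Cauchy_Schwarz_ineq_sum)
    also have "\<dots> = (\<Sum>n=1..N. (\<omega> n - L)\<^sup>2) * (\<Sum>n=1..N. (norm (z n))\<^sup>2)" by (simp add: power2_commute)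
    also have "\<dots> \<le> (\<Sum>n=1..N. (\<omega> n - L)\<^sup>2) * (\<Sum>n=1..N. B\<^sup>2)"
      by (intro mult_left_mono sum_mono power_mono B sum_nonneg) auto
    finally show ?thesis .
  qed
  also have "\<dots> \<le> (2 * real N * L) * (real N * B\<^sup>2)"
  proof -
    have "(\<Sum>n=1..N. (\<omega> n - L)\<^sup>2) \<le> real N * L + 2 * L * real (card P)"
      using turan_kubilius[of P "real N"] P N unfolding \<omega>_def nups_of_nat L_def by simp
    also have "\<dots> \<le> real N * L + L * real N"
    proof -
      have "real (2 * card P) \<le> real N" using N(1) by (simp only: of_nat_le_iff)
      then have "L * (2 * real (card P)) \<le> L * real N" by (intro mult_left_mono L0) simp
      then show ?thesis by simp
    qed
    also have "\<dots> = 2 * real N * L" by (simp only: mult.commute mult_2 distrib_right)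
    finally have "(\<Sum>n=1..N. (\<omega> n - L)\<^sup>2) \<le> 2 * real N * L" .
    moreover have "(\<Sum>n=1..N. B\<^sup>2) = real N * B\<^sup>2" by simp
    ultimately show ?thesis by (intro mult_mono) (auto intro!: L0 mult_nonneg_nonneg)
  qed
  finally have e1: "(norm (\<Sum>n=1..N. of_real (L - \<omega> n) * z n))\<^sup>2 \<le> (2 * real N * L) * (real N * B\<^sup>2)" .
  have e2: "(norm (\<Sum>m=1..N. S m))\<^sup>2 \<le> (\<Sum>m=1..N. (norm (S m))\<^sup>2) * real N"
  proof -
    have "(norm (\<Sum>m=1..N. S m))\<^sup>2 \<le> (\<Sum>m=1..N. norm (S m))\<^sup>2" by (intro power_mono norm_sum) auto
    also have "\<dots> \<le> (\<Sum>m=1..N. (norm (S m))\<^sup>2) * real (card {1..N})" by (rule sum_squared_le_sum_of_squares)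
    finally show ?thesis by simp
  qed
  have "of_real L * (\<Sum>n=1..N. z n) = (\<Sum>n=1..N. of_real (L - \<omega> n) * z n) + (\<Sum>m=1..N. S m)"
    unfolding s1[symmetric] sum_distrib_left sum.distrib[symmetric] by (rule sum.cong[OF refl]) (simp add: algebra_simps)
  then have "L\<^sup>2 * (norm (\<Sum>n=1..N. z n))\<^sup>2 = (norm ((\<Sum>n=1..N. of_real (L - \<omega> n) * z n) + (\<Sum>m=1..N. S m)))\<^sup>2"
    by (metis norm_mult norm_of_real power2_abs power_mult_distrib)
  also have "\<dots> \<le> 2 * (norm (\<Sum>n=1..N. of_real (L - \<omega> n) * z n))\<^sup>2 + 2 * (norm (\<Sum>m=1..N. S m))\<^sup>2"
    by (rule norm_add_squared_le)
  also have "\<dots> \<le> 2 * ((2 * real N * L) * (real N * B\<^sup>2)) + 2 * ((\<Sum>m=1..N. (norm (S m))\<^sup>2) * real N)"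
    using e1 e2 by argo
  also have "\<dots> = 4 * B\<^sup>2 * L * (real N)\<^sup>2 + 2 * real N * (\<Sum>m=1..N. (norm (S m))\<^sup>2)"
    by (simp add: power2_eq_square)
  finally show ?thesis unfolding S_def .
qed

lemma filterlim_div_nat: "p \<ge> 1 \<Longrightarrow> filterlim (\<lambda>N :: nat. N div p) at_top at_top"
  unfolding filterlim_at_top
proof
  fix Z assume p: "p \<ge> 1"
  show "\<forall>\<^sub>F N in sequentially. Z \<le> N div p"
    by (rule eventually_sequentiallyI[of "Z * p"]) (use p in \<open>simp add: less_eq_div_iff_mult_less_eq\<close>)
qed

context mp_action
begin

text \<open>Only the larger of the two numbers restricts \<open>m\<close>, so that the sum is an
  ergodic sum of length \<open>N div p\<close>; the case of \<open>p < q\<close> follows by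
  conjugation.\<close>

lemma katai_offdiagonal:
  assumes g [measurable]: "g \<in> borel_measurable M" and p: "1 \<le> p" "1 \<le> q" "q \<noteq> p"
    and corr0: "\<And>p' q'. p' \<in> {p, q} \<Longrightarrow> q' \<in> {p, q} \<Longrightarrow> q' < p' \<Longrightarrow> (\<lambda>N. (\<Sum>n=1..N. corr g (int ((p' - q') * n))) / of_nat N) \<longlonglongrightarrow> 0"
  shows "(\<lambda>N. (\<Sum>m\<in>{m\<in>{1..N}. p * m \<le> N \<and> q * m \<le> N}. corr g (int (p * m) - int (q * m))) / of_nat N) \<longlonglongrightarrow> 0"
proof -
  have main: "(\<lambda>N. (\<Sum>m\<in>{m\<in>{1..N}. p' * m \<le> N \<and> q' * m \<le> N}. corr g (int (p' * m) - int (q' * m))) / of_nat N) \<longlonglongrightarrow> 0"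
    if q: "p' \<in> {p, q}" "q' \<in> {p, q}" "q' < p'" for p' q'
  proof -
    have p1: "p' \<ge> 1" using q p by auto
    define A where "A K = (\<Sum>n=1..K. corr g (int ((p' - q') * n)))" for K
    have set: "{m\<in>{1..N}. p' * m \<le> N \<and> q' * m \<le> N} = {1..N div p'}" for N
    proof (intro equalityI subsetI)
      fix m assume "m \<in> {1..N div p'}"
      then have m: "1 \<le> m" "p' * m \<le> N" using p1 by (auto simp: less_eq_div_iff_mult_less_eq mult.commute)
      have "q' * m \<le> N" by (rule order_trans[OF mult_right_mono m(2)]) (use q in auto)
      moreover have "1 * m \<le> N" by (rule order_trans[OF mult_right_mono m(2)]) (use p1 in auto)
      ultimately show "m \<in> {m\<in>{1..N}. p' * m \<le> N \<and> q' * m \<le> N}" using m by auto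
    qed (use p1 in \<open>auto simp: less_eq_div_iff_mult_less_eq mult.commute\<close>)
    have eq: "(\<Sum>m\<in>{m\<in>{1..N}. p' * m \<le> N \<and> q' * m \<le> N}. corr g (int (p' * m) - int (q' * m))) = A (N div p')" for N
      unfolding set A_def by (rule sum.cong[OF refl]) (use q in \<open>simp add: of_nat_diff algebra_simps\<close>)
    have "(\<lambda>N. A (N div p') / of_nat (N div p')) \<longlonglongrightarrow> 0"
      using filterlim_compose[OF corr0[OF q] filterlim_div_nat[OF p1]] unfolding A_def .
    then have lim: "(\<lambda>N. norm (A (N div p') / of_nat (N div p'))) \<longlonglongrightarrow> 0" by (rule tendsto_norm_zero)
    have "norm (A (N div p') / of_nat N) \<le> norm (A (N div p') / of_nat (N div p'))" for N
    proof (cases "N div p' = 0")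
      case True then show ?thesis by (simp add: A_def)
    next
      case False
      then have "0 < N div p'" "N div p' \<le> N" "0 < N" by (simp, simp, cases "N = 0", auto)
      then show ?thesis unfolding norm_divide norm_of_nat by (intro divide_left_mono mult_pos_pos) auto
    qed
    then show ?thesis unfolding eq by (intro Lim_null_comparison[OF _ lim]) (auto intro!: always_eventually)
  qed
  show ?thesis
  proof (cases "q < p")
    case True then show ?thesis by (intro main) auto
  next
    case False
    then have "p < q" using p by simp
    then have "(\<lambda>N. (\<Sum>m\<in>{m\<in>{1..N}. q * m \<le> N \<and> p * m \<le> N}. corr g (int (q * m) - int (p * m))) / of_nat N) \<longlonglongrightarrow> 0"
      by (intro main) auto
    then have "(\<lambda>N. cnj ((\<Sum>m\<in>{m\<in>{1..N}. q * m \<le> N \<and> p * m \<le> N}. corr g (int (q * m) - int (p * m))) / of_nat N)) \<longlonglongrightarrow> cnj 0"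
      by (rule tendsto_cnj)
    moreover have "cnj ((\<Sum>m\<in>{m\<in>{1..N}. q * m \<le> N \<and> p * m \<le> N}. corr g (int (q * m) - int (p * m))) / of_nat N) =
      (\<Sum>m\<in>{m\<in>{1..N}. p * m \<le> N \<and> q * m \<le> N}. corr g (int (p * m) - int (q * m))) / of_nat N" for N
    proof -
      have "corr g (int (p * m) - int (q * m)) = cnj (corr g (int (q * m) - int (p * m)))" for m
        using corr_minus[OF g, of "int (q * m) - int (p * m)"] by (simp only: minus_diff_eq)
      then show ?thesis by (simp only: complex_cnj_divide cnj_sum complex_cnj_of_nat conj_commute)
    qed
    ultimately show ?thesis by (simp only: complex_cnj_zero)
  qed
qed

lemma norm_corr_le:
  assumes "g \<in> borel_measurable M" "\<And>x. norm (g x) \<le> B"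
  shows "norm (corr g k) \<le> B\<^sup>2"
  unfolding corr_def
proof (rule integral_norm_le_bound)
  note [measurable] = assms(1)
  show "(\<lambda>x. g (\<tau> k x) * cnj (g x)) \<in> borel_measurable M" by measurable
  have "B \<ge> 0" using assms(2)[of undefined] norm_ge_zero order_trans by blast
  then show "norm (g (\<tau> k x) * cnj (g x)) \<le> B\<^sup>2" for x
    unfolding norm_mult complex_mod_cnj power2_eq_square using assms(2) by (intro mult_mono) auto
qed

text \<open>By \<open>wP\<close> the unimodular weight at \<open>p * m\<close> is the same for all
  \<open>p\<close> in \<open>P\<close> and drops out of the modulus of the sum over
  \<open>p\<close>. What remains are correlations of \<open>g\<close>: after division by
  \<open>N\<close> the diagonal contributes at most \<open>B\<^sup>2 * L\<close>, and the rest tends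
  to 0.\<close>

theorem katai_average:
  fixes w :: "nat \<Rightarrow> 'a \<Rightarrow> complex"
  assumes g [measurable]: "g \<in> borel_measurable M" and B: "\<And>x. norm (g x) \<le> B"
    and P: "finite P" "\<And>p. p \<in> P \<Longrightarrow> prime p"
    and w [measurable]: "\<And>n. w n \<in> borel_measurable M" and w1: "\<And>n x. norm (w n x) = 1"
    and wP: "\<And>p q m x. p \<in> P \<Longrightarrow> q \<in> P \<Longrightarrow> m \<ge> 1 \<Longrightarrow> w (p * m) x = w (q * m) x"
    and corr0: "\<And>p q. p \<in> P \<Longrightarrow> q \<in> P \<Longrightarrow> q < p \<Longrightarrow> (\<lambda>N. (\<Sum>n=1..N. corr g (int ((p - q) * n))) / of_nat N) \<longlonglongrightarrow> 0"
  defines "L \<equiv> \<Sum>p\<in>P. 1 / real p"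
  assumes L: "L > 0"
  shows "\<forall>\<^sub>F N in sequentially. (LINT x|M. (norm ((\<Sum>n=1..N. g (\<tau> (int n) x) * w n x) / of_nat N))\<^sup>2) \<le> (6 * B\<^sup>2 + 1) / L"
proof -
  define z where "z x n = g (\<tau> (int n) x) * w n x" for x n
  have zm [measurable]: "(\<lambda>x. z x n) \<in> borel_measurable M" for n unfolding z_def by measurable
  have zB: "norm (z x n) \<le> B" for x n unfolding z_def norm_mult w1 using B by simp
  have p1: "p \<ge> 1" if "p \<in> P" for p using P(2)[OF that] prime_gt_0_nat[of p] by simp
  define T where "T p q N = (\<Sum>m\<in>{m\<in>{1..N}. p * m \<le> N \<and> q * m \<le> N}. corr g (int (p * m) - int (q * m))) / of_nat N" for p q N
  define off where "off N = (\<Sum>p\<in>P. \<Sum>q\<in>P - {p}. Re (T p q N))" for N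
  have "(\<lambda>N. off N) \<longlonglongrightarrow> (\<Sum>p\<in>P. \<Sum>q\<in>P - {p}. Re 0)"
    unfolding off_def T_def
    by (intro tendsto_sum tendsto_Re katai_offdiagonal g p1 corr0) auto
  then have off: "off \<longlonglongrightarrow> 0" by simp
  define V where "V N m x = (norm (\<Sum>p\<in>{p\<in>P. p * m \<le> N}. z x (p * m)))\<^sup>2" for N m x
  have Vi: "integrable M (V N m)" for N m unfolding V_def
  proof (rule L2_integrable[where C = "real (card {p\<in>P. p * m \<le> N}) * B"])
    show "norm (\<Sum>p\<in>{p\<in>P. p * m \<le> N}. z x (p * m)) \<le> real (card {p\<in>P. p * m \<le> N}) * B" for x
      by (rule sum_norm_bound) (rule zB)
  qed measurable
  have VI: "(LINT x|M. V N m x) = Re (\<Sum>p\<in>{p\<in>P. p * m \<le> N}. \<Sum>q\<in>{q\<in>P. q * m \<le> N}. corr g (int (p * m) - int (q * m)))"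
    if m: "m \<ge> 1" for N m
  proof -
    have "V N m x = (norm (\<Sum>p\<in>{p\<in>P. p * m \<le> N}. 1 * g (\<tau> (int (p * m)) x)))\<^sup>2" for x
    proof (cases "{p\<in>P. p * m \<le> N} = {}")
      case True then show ?thesis unfolding V_def by (simp only: sum.empty)
    next
      case False
      then obtain p0 where p0: "p0 \<in> P" by blast
      have "(\<Sum>p\<in>{p\<in>P. p * m \<le> N}. z x (p * m)) = (\<Sum>p\<in>{p\<in>P. p * m \<le> N}. 1 * g (\<tau> (int (p * m)) x)) * w (p0 * m) x"
        unfolding sum_distrib_right z_def
        by (rule sum.cong[OF refl]) (use wP[OF _ p0 m] in \<open>simp del: of_nat_mult\<close>)
      then show ?thesis unfolding V_def by (simp only: norm_mult w1 mult_1_right)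
    qed
    then have "complex_of_real (LINT x|M. V N m x) =
       (\<Sum>p\<in>{p\<in>P. p * m \<le> N}. \<Sum>q\<in>{q\<in>P. q * m \<le> N}. 1 * cnj 1 * corr g (int (p * m) - int (q * m)))"
      by (simp only: L2_norm_combination[OF g B, where I = "{p\<in>P. p * m \<le> N}" and c = "\<lambda>_. 1" and b = "\<lambda>p. int (p * m)"])
    then have "Re (complex_of_real (LINT x|M. V N m x)) =
       Re (\<Sum>p\<in>{p\<in>P. p * m \<le> N}. \<Sum>q\<in>{q\<in>P. q * m \<le> N}. corr g (int (p * m) - int (q * m)))"
      by (simp only: complex_cnj_one mult_1)
    then show ?thesis by (simp only: Re_complex_of_real)
  qed
  have Vsum: "(\<Sum>m=1..N. LINT x|M. V N m x) / real N = (\<Sum>p\<in>P. \<Sum>q\<in>P. Re (T p q N))" for N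
  proof -
    have "(\<Sum>m=1..N. LINT x|M. V N m x) = Re (\<Sum>m=1..N. \<Sum>p\<in>{p\<in>P. p * m \<le> N}. \<Sum>q\<in>{q\<in>P. q * m \<le> N}. corr g (int (p * m) - int (q * m)))"
      unfolding Re_sum[of _ "{1..N}"] by (rule sum.cong[OF refl], rule VI) auto
    also have "(\<Sum>m=1..N. \<Sum>p\<in>{p\<in>P. p * m \<le> N}. \<Sum>q\<in>{q\<in>P. q * m \<le> N}. corr g (int (p * m) - int (q * m))) =
      (\<Sum>m=1..N. \<Sum>p\<in>P. \<Sum>q\<in>P. if p * m \<le> N \<and> q * m \<le> N then corr g (int (p * m) - int (q * m)) else 0)"
      unfolding sum.inter_filter[OF P(1)]
      by (rule sum.cong[OF refl], rule sum.cong[OF refl]) simp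
    also have "\<dots> = (\<Sum>p\<in>P. \<Sum>m=1..N. \<Sum>q\<in>P. if p * m \<le> N \<and> q * m \<le> N then corr g (int (p * m) - int (q * m)) else 0)" by (rule sum.swap)
    also have "\<dots> = (\<Sum>p\<in>P. \<Sum>q\<in>P. \<Sum>m=1..N. if p * m \<le> N \<and> q * m \<le> N then corr g (int (p * m) - int (q * m)) else 0)"
      by (rule sum.cong[OF refl], rule sum.swap)
    also have "\<dots> = (\<Sum>p\<in>P. \<Sum>q\<in>P. of_nat N * T p q N)"
    proof (rule sum.cong[OF refl], rule sum.cong[OF refl])
      fix p q
      show "(\<Sum>m=1..N. if p * m \<le> N \<and> q * m \<le> N then corr g (int (p * m) - int (q * m)) else 0) = of_nat N * T p q N"
        unfolding T_def sum.inter_filter[OF finite_atLeastAtMost] by simp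
    qed
    also have "Re \<dots> = real N * (\<Sum>p\<in>P. \<Sum>q\<in>P. Re (T p q N))"
      by (simp add: sum_distrib_left)
    finally show ?thesis by (cases "N = 0") (simp_all add: T_def)
  qed
  have diag: "Re (T p p N) \<le> B\<^sup>2 * (1 / real p)" if p: "p \<in> P" for p N
  proof (cases "N = 0")
    case False
    have set: "{m\<in>{1..N}. p * m \<le> N \<and> p * m \<le> N} \<subseteq> {1..N div p}"
      using p1[OF p] by (auto simp: less_eq_div_iff_mult_less_eq mult.commute)
    have "norm (\<Sum>m\<in>{m\<in>{1..N}. p * m \<le> N \<and> p * m \<le> N}. corr g (int (p * m) - int (p * m))) \<le> real (card {m\<in>{1..N}. p * m \<le> N \<and> p * m \<le> N}) * B\<^sup>2"
      by (rule sum_norm_bound) (rule norm_corr_le[OF g B])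
    also have "\<dots> \<le> real (card {1..N div p}) * B\<^sup>2"
      using card_mono[OF _ set] by (intro mult_right_mono) auto
    also have "\<dots> \<le> real N / real p * B\<^sup>2" by (intro mult_right_mono) (auto simp: of_nat_div_le_of_nat)
    finally have "norm (T p p N) \<le> (real N / real p * B\<^sup>2) / real N"
      unfolding T_def norm_divide norm_of_nat by (intro divide_right_mono) auto
    also have "\<dots> = B\<^sup>2 * (1 / real p)" using False by simp
    finally show ?thesis using complex_Re_le_cmod[of "T p p N"] by linarith
  qed (simp add: T_def)
  have "\<forall>\<^sub>F N in sequentially. off N < L / 2" using off L by (intro order_tendstoD(2)) auto
  moreover have "\<forall>\<^sub>F N in sequentially. 2 * card P + 1 \<le> N" by (rule eventually_ge_at_top)
  ultimately show ?thesis
  proof eventually_elim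
    fix N assume o: "off N < L / 2" and N: "2 * card P + 1 \<le> N"
    then have N1: "N \<ge> 1" "real N > 0" by auto
    define J where "J = (LINT x|M. (norm (\<Sum>n=1..N. z x n))\<^sup>2)"
    have Ji: "integrable M (\<lambda>x. (norm (\<Sum>n=1..N. z x n))\<^sup>2)"
    proof (rule L2_integrable[where C = "real (card {1..N}) * B"])
      show "norm (\<Sum>n=1..N. z x n) \<le> real (card {1..N}) * B" for x by (rule sum_norm_bound) (rule zB)
    qed measurable
    have "L\<^sup>2 * J = (LINT x|M. L\<^sup>2 * (norm (\<Sum>n=1..N. z x n))\<^sup>2)" unfolding J_def by simp
    also have "\<dots> \<le> (LINT x|M. 4 * B\<^sup>2 * L * (real N)\<^sup>2 + 2 * real N * (\<Sum>m=1..N. V N m x))"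
    proof (rule integral_mono)
      show "integrable M (\<lambda>x. L\<^sup>2 * (norm (\<Sum>n=1..N. z x n))\<^sup>2)" by (intro integrable_mult_right Ji)
      show "integrable M (\<lambda>x. 4 * B\<^sup>2 * L * (real N)\<^sup>2 + 2 * real N * (\<Sum>m=1..N. V N m x))"
        by (intro Bochner_Integration.integrable_add integrable_mult_right Bochner_Integration.integrable_sum Vi) simp
      show "L\<^sup>2 * (norm (\<Sum>n=1..N. z x n))\<^sup>2 \<le> 4 * B\<^sup>2 * L * (real N)\<^sup>2 + 2 * real N * (\<Sum>m=1..N. V N m x)" for x
        unfolding V_def L_def by (rule katai_pointwise[OF P _ N1(1) zB]) (use N in auto)
    qed
    also have "\<dots> = 4 * B\<^sup>2 * L * (real N)\<^sup>2 + 2 * real N * (\<Sum>m=1..N. LINT x|M. V N m x)"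
      by (subst Bochner_Integration.integral_add)
         (auto simp: Vi prob_space Bochner_Integration.integral_sum intro!: integrable_mult_right Bochner_Integration.integrable_sum)
    also have "\<dots> = (4 * B\<^sup>2 * L + 2 * (\<Sum>p\<in>P. \<Sum>q\<in>P. Re (T p q N))) * (real N)\<^sup>2"
      unfolding Vsum[symmetric] using N1 by (simp add: power2_eq_square field_simps)
    \<comment> \<open>Of the 6, the variance accounts for 4 and the diagonal for 2; the final
      \<open>L\<close> is twice the bound \<open>L / 2\<close> on the off-diagonal terms.\<close>
    also have "\<dots> \<le> (6 * B\<^sup>2 * L + L) * (real N)\<^sup>2"
    proof (rule mult_right_mono)
      have s: "(\<Sum>p\<in>P. \<Sum>q\<in>P. Re (T p q N)) = (\<Sum>p\<in>P. Re (T p p N)) + off N"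
        unfolding off_def sum.distrib[symmetric] using P(1) by (intro sum.cong[OF refl] sum.remove)
      have "(\<Sum>p\<in>P. Re (T p p N)) \<le> (\<Sum>p\<in>P. B\<^sup>2 * (1 / real p))" by (rule sum_mono, rule diag)
      also have "\<dots> = B\<^sup>2 * L" unfolding L_def by (simp only: sum_distrib_left)
      finally have "(\<Sum>p\<in>P. \<Sum>q\<in>P. Re (T p q N)) \<le> B\<^sup>2 * L + off N" unfolding s by simp
      then show "4 * B\<^sup>2 * L + 2 * (\<Sum>p\<in>P. \<Sum>q\<in>P. Re (T p q N)) \<le> 6 * B\<^sup>2 * L + L" using o by argo
    qed simp
    finally have "L * (L * J) \<le> L * ((6 * B\<^sup>2 + 1) * (real N)\<^sup>2)" by (simp add: power2_eq_square algebra_simps)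
    then have "L * J \<le> (6 * B\<^sup>2 + 1) * (real N)\<^sup>2" using L by simp
    then have "J / (real N)\<^sup>2 \<le> (6 * B\<^sup>2 + 1) / L" using L N1 by (simp add: field_simps)
    moreover have "(LINT x|M. (norm ((\<Sum>n=1..N. g (\<tau> (int n) x) * w n x) / of_nat N))\<^sup>2) = J / (real N)\<^sup>2"
      unfolding J_def z_def by (simp add: norm_divide power_divide)
    ultimately show "(LINT x|M. (norm ((\<Sum>n=1..N. g (\<tau> (int n) x) * w n x) / of_nat N))\<^sup>2) \<le> (6 * B\<^sup>2 + 1) / L" by simp
  qed
qed

end

section \<open>Joint averages of two actions\<close>

context mp_action
begin

definition joint :: "(int \<Rightarrow> 'a \<Rightarrow> 'a) \<Rightarrow> (nat \<Rightarrow> int) \<Rightarrow> ('a \<Rightarrow> complex) \<Rightarrow> ('a \<Rightarrow> complex) \<Rightarrow> nat \<Rightarrow> 'a \<Rightarrow> complex" where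
  "joint \<sigma> a f g N x = (\<Sum>n=1..N. f (\<tau> (int n) x) * g (\<sigma> (a n) x)) / of_nat N"

lemma joint_measurable:
  assumes "mp_action M \<sigma>" and [measurable]: "f \<in> borel_measurable M" "g \<in> borel_measurable M"
  shows "joint \<sigma> a f g N \<in> borel_measurable M"
proof -
  interpret S: mp_action M \<sigma> by fact
  show ?thesis unfolding joint_def by measurable
qed

lemma norm_joint_le:
  assumes "\<And>x. norm (f x) \<le> C" "\<And>x. norm (g x) \<le> B"
  shows "norm (joint \<sigma> a f g N x) \<le> C * B"
  unfolding joint_def
proof (rule norm_average_le)
  have "C \<ge> 0" using assms(1)[of undefined] norm_ge_zero order_trans by blast
  then show "norm (f (\<tau> (int n) x) * g (\<sigma> (a n) x)) \<le> C * B" for n unfolding norm_mult using assms by (intro mult_mono) auto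
qed auto

lemma AE_periodic:
  assumes inv: "AE x in M. h (\<tau> (int D) x) = h x"
  shows "AE x in M. \<forall>n. h (\<tau> (int n) x) = h (\<tau> (int (n mod D)) x)"
  unfolding AE_all_countable
proof
  fix n
  have "AE x in M. h (\<tau> (int (D * (n div D))) (\<tau> (int (n mod D)) x)) = h (\<tau> (int (n mod D)) x)"
    by (rule AE_shift[OF AE_invariant_multiple[OF inv]])
  with AE_space show "AE x in M. h (\<tau> (int n) x) = h (\<tau> (int (n mod D)) x)"
  proof eventually_elim
    fix x assume x: "x \<in> space M" "h (\<tau> (int (D * (n div D))) (\<tau> (int (n mod D)) x)) = h (\<tau> (int (n mod D)) x)"
    have "int (D * (n div D)) + int (n mod D) = int n" by (simp only: of_nat_add[symmetric] mult_div_mod_eq)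
    then show "h (\<tau> (int n) x) = h (\<tau> (int (n mod D)) x)" using x act[OF x(1), of "int (D * (n div D))" "int (n mod D)"] by simp
  qed
qed

text \<open>The mean over a full period is invariant under a single step and therefore constant,
  although \<open>h\<close> itself need not be.\<close>

lemma AE_period_mean:
  fixes h :: "'a \<Rightarrow> complex"
  assumes erg: "ergodic M (\<tau> 1)" and D: "D \<ge> 1"
    and h [measurable]: "h \<in> borel_measurable M" and C: "\<And>x. norm (h x) \<le> C"
    and inv: "AE x in M. h (\<tau> (int D) x) = h x"
  shows "AE x in M. (\<Sum>r<D. h (\<tau> (int r) x)) / of_nat D = (LINT y|M. h y)"
proof -
  define H where "H x = (\<Sum>r<D. h (\<tau> (int r) x)) / of_nat D" for x
  have Hm [measurable]: "H \<in> borel_measurable M" unfolding H_def by measurable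
  have Hsum: "norm (\<Sum>r<D. h (\<tau> (int r) x)) \<le> real (card {..<D}) * C" for x by (rule sum_norm_bound) (rule C)
  have HC: "norm (H x) \<le> C" for x
    using divide_right_mono[OF Hsum[of x], of "real D"] D by (simp add: H_def norm_divide)
  have "AE x in M. H (\<tau> 1 x) = H x"
    using AE_periodic[OF inv] AE_space
  proof eventually_elim
    fix x assume x: "\<forall>n. h (\<tau> (int n) x) = h (\<tau> (int (n mod D)) x)" "x \<in> space M"
    have s: "h (\<tau> (int r) (\<tau> 1 x)) = h (\<tau> (int (Suc r)) x)" for r using act[OF x(2), of "int r" 1] by (simp add: add.commute)
    have "(\<Sum>r<D. h (\<tau> (int (Suc r)) x)) + h (\<tau> (int 0) x) = (\<Sum>r<Suc D. h (\<tau> (int r) x))"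
      by (simp only: sum.lessThan_Suc_shift add.commute)
    also have "\<dots> = (\<Sum>r<D. h (\<tau> (int r) x)) + h (\<tau> (int D) x)" by (rule sum.lessThan_Suc)
    also have "h (\<tau> (int D) x) = h (\<tau> (int 0) x)" using x(1)[rule_format, of D] by simp
    finally show "H (\<tau> 1 x) = H x" unfolding H_def s by simp
  qed
  then have "AE x in M. H x = (LINT y|M. H y)" by (rule ergodic_constant[OF erg Hm HC])
  moreover have "(LINT y|M. H y) = (LINT y|M. h y)"
  proof -
    have i: "integrable M (\<lambda>x. h (\<tau> (int r) x))" for r by (rule integrable_bounded[where C = C]) (auto simp: C)
    show ?thesis unfolding H_def using D by (simp add: Bochner_Integration.integral_sum i integral_shift[OF h])
  qed
  ultimately show ?thesis unfolding H_def by (simp only:)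
qed

text \<open>Along almost every orbit \<open>h\<close> depends only on \<open>n mod D\<close>, so the
  joint average is a combination of \<open>D\<close> averages of \<open>g\<close> over residue
  classes, each tending to \<open>m / D\<close>; by \<open>AE_period_mean\<close> the coefficients
  have the integral of \<open>h\<close> as their mean.\<close>

lemma joint_limit_periodic:
  assumes S: "mp_action M \<sigma>" and erg: "ergodic M (\<tau> 1)" "ergodic M (\<sigma> 1)"
    and a: "\<And>\<theta>. \<theta> \<notin> \<int> \<Longrightarrow> residue_mean_zero a \<theta>" and D: "D \<ge> 1"
    and h [measurable]: "h \<in> borel_measurable M" and C: "\<And>x. norm (h x) \<le> C"
    and inv: "AE x in M. h (\<tau> (int D) x) = h x"
    and g [measurable]: "g \<in> borel_measurable M" and B: "\<And>x. norm (g x) \<le> B"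
  shows "(\<lambda>N. LINT x|M. (norm (joint \<sigma> a h g N x - (LINT y|M. h y) * (LINT y|M. g y)))\<^sup>2) \<longlonglongrightarrow> 0"
proof -
  interpret S: mp_action M \<sigma> by fact
  define m where "m = (LINT y|M. g y)"
  define R where "R r N x = S.res_avg a D r g N x - m / of_nat D" for r N x
  have [measurable]: "R r N \<in> borel_measurable M" for r N unfolding R_def by measurable
  have C0: "C \<ge> 0" using C[of undefined] norm_ge_zero order_trans by blast
  have mB: "norm m \<le> B" unfolding m_def by (rule integral_norm_le_bound[OF g B])
  have RB: "norm (R r N x) \<le> B + B" for r N x unfolding R_def
  proof (rule order_trans[OF norm_triangle_ineq4 add_mono[OF S.norm_res_avg_le[OF B]]])
    have "norm m / real D \<le> norm m / 1" using D by (intro divide_left_mono) auto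
    then show "norm (m / of_nat D) \<le> B" using mB by (simp add: norm_divide)
  qed
  have split: "AE x in M. \<forall>N. joint \<sigma> a h g N x - (LINT y|M. h y) * m = (\<Sum>r<D. h (\<tau> (int r) x) * R r N x)"
    using AE_periodic[OF inv] AE_period_mean[OF erg(1) D h C inv]
  proof eventually_elim
    fix x assume per: "\<forall>n. h (\<tau> (int n) x) = h (\<tau> (int (n mod D)) x)" and mean: "(\<Sum>r<D. h (\<tau> (int r) x)) / of_nat D = (LINT y|M. h y)"
    show "\<forall>N. joint \<sigma> a h g N x - (LINT y|M. h y) * m = (\<Sum>r<D. h (\<tau> (int r) x) * R r N x)"
    proof
      fix N
      have "(\<Sum>n=1..N. h (\<tau> (int n) x) * g (\<sigma> (a n) x)) = (\<Sum>r<D. \<Sum>n\<in>{n\<in>{1..N}. n mod D = r}. h (\<tau> (int n) x) * g (\<sigma> (a n) x))"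
        by (rule sum.group[symmetric]) (use D in auto)
      also have "\<dots> = (\<Sum>r<D. h (\<tau> (int r) x) * (\<Sum>n\<in>{n\<in>{1..N}. [n = r] (mod D)}. g (\<sigma> (a n) x)))"
      proof (rule sum.cong[OF refl])
        fix r assume r: "r \<in> {..<D}"
        then have set: "{n\<in>{1..N}. n mod D = r} = {n\<in>{1..N}. [n = r] (mod D)}" by (auto simp: cong_def)
        have "(\<Sum>n\<in>{n\<in>{1..N}. n mod D = r}. h (\<tau> (int n) x) * g (\<sigma> (a n) x)) = (\<Sum>n\<in>{n\<in>{1..N}. n mod D = r}. h (\<tau> (int r) x) * g (\<sigma> (a n) x))"
        proof (rule sum.cong[OF refl])
          fix n assume "n \<in> {n\<in>{1..N}. n mod D = r}"
          then have "h (\<tau> (int n) x) = h (\<tau> (int r) x)" using per[rule_format, of n] by simp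
          then show "h (\<tau> (int n) x) * g (\<sigma> (a n) x) = h (\<tau> (int r) x) * g (\<sigma> (a n) x)" by simp
        qed
        then show "(\<Sum>n\<in>{n\<in>{1..N}. n mod D = r}. h (\<tau> (int n) x) * g (\<sigma> (a n) x)) = h (\<tau> (int r) x) * (\<Sum>n\<in>{n\<in>{1..N}. [n = r] (mod D)}. g (\<sigma> (a n) x))"
          unfolding set by (simp only: sum_distrib_left)
      qed
      finally have "joint \<sigma> a h g N x = (\<Sum>r<D. h (\<tau> (int r) x) * (\<Sum>n\<in>{n\<in>{1..N}. [n = r] (mod D)}. g (\<sigma> (a n) x))) / of_nat N"
        unfolding joint_def by (rule arg_cong)
      also have "\<dots> = (\<Sum>r<D. h (\<tau> (int r) x) * S.res_avg a D r g N x)"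
        unfolding S.res_avg_def sum_divide_distrib[of _ "{..<D}"] times_divide_eq_right ..
      finally have "joint \<sigma> a h g N x = (\<Sum>r<D. h (\<tau> (int r) x) * S.res_avg a D r g N x)" .
      moreover have "(LINT y|M. h y) * m = (\<Sum>r<D. h (\<tau> (int r) x) * (m / of_nat D))"
        unfolding mean[symmetric] sum_distrib_right[symmetric] by simp
      ultimately show "joint \<sigma> a h g N x - (LINT y|M. h y) * m = (\<Sum>r<D. h (\<tau> (int r) x) * R r N x)"
        unfolding R_def by (simp only: right_diff_distrib sum_subtractf)
    qed
  qed
  have Ri: "integrable M (\<lambda>x. (norm (R r N x))\<^sup>2)" for r N by (rule L2_integrable[where C = "B + B"], measurable) (rule RB)
  have le: "(LINT x|M. (norm (joint \<sigma> a h g N x - (LINT y|M. h y) * m))\<^sup>2) \<le> C\<^sup>2 * real D * (\<Sum>r<D. LINT x|M. (norm (R r N x))\<^sup>2)" for N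
  proof -
    have [measurable]: "joint \<sigma> a h g N \<in> borel_measurable M" by (rule joint_measurable[OF S h g])
    have pt: "(norm (\<Sum>r<D. h (\<tau> (int r) x) * R r N x))\<^sup>2 \<le> C\<^sup>2 * real D * (\<Sum>r<D. (norm (R r N x))\<^sup>2)" for x
    proof -
      have "norm (\<Sum>r<D. h (\<tau> (int r) x) * R r N x) \<le> (\<Sum>r<D. C * norm (R r N x))"
        by (intro sum_norm_le) (auto simp: norm_mult intro: mult_right_mono C)
      then have "(norm (\<Sum>r<D. h (\<tau> (int r) x) * R r N x))\<^sup>2 \<le> (C * (\<Sum>r<D. norm (R r N x)))\<^sup>2"
        unfolding sum_distrib_left by (intro power_mono) auto
      also have "\<dots> = C\<^sup>2 * (\<Sum>r<D. norm (R r N x))\<^sup>2" by (rule power_mult_distrib)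
      also have "\<dots> \<le> C\<^sup>2 * ((\<Sum>r<D. (norm (R r N x))\<^sup>2) * real (card {..<D}))"
        by (intro mult_left_mono sum_squared_le_sum_of_squares) auto
      finally show ?thesis by (simp add: mult_ac)
    qed
    have "(LINT x|M. (norm (joint \<sigma> a h g N x - (LINT y|M. h y) * m))\<^sup>2) = (LINT x|M. (norm (\<Sum>r<D. h (\<tau> (int r) x) * R r N x))\<^sup>2)"
      by (rule integral_cong_AE, measurable) (rule AE_mp[OF split], rule AE_I2, rule impI, drule spec, erule arg_cong)
    also have "\<dots> \<le> (LINT x|M. C\<^sup>2 * real D * (\<Sum>r<D. (norm (R r N x))\<^sup>2))"
      by (rule integral_mono', intro integrable_mult_right Bochner_Integration.integrable_sum Ri, rule pt)
         (intro mult_nonneg_nonneg sum_nonneg zero_le_power2 of_nat_0_le_iff)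
    also have "\<dots> = C\<^sup>2 * real D * (\<Sum>r<D. LINT x|M. (norm (R r N x))\<^sup>2)"
      by (simp only: Bochner_Integration.integral_mult_right_zero Bochner_Integration.integral_sum[OF Ri])
    finally show ?thesis .
  qed
  have "(\<lambda>N. C\<^sup>2 * real D * (\<Sum>r<D. LINT x|M. (norm (R r N x))\<^sup>2)) \<longlonglongrightarrow> C\<^sup>2 * real D * (\<Sum>r<D. 0)"
    unfolding R_def m_def by (intro tendsto_intros S.res_avg_limit[OF erg(2) a D g B]) auto
  then have lim: "(\<lambda>N. C\<^sup>2 * real D * (\<Sum>r<D. LINT x|M. (norm (R r N x))\<^sup>2)) \<longlonglongrightarrow> 0" by simp
  show ?thesis unfolding m_def[symmetric]
    by (rule Lim_null_comparison[OF _ lim]) (use le in \<open>auto intro!: always_eventually\<close>)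
qed

text \<open>There are finitely many level sets of \<open>a\<close> on the primes and the reciprocals
  of the primes diverge, so they diverge on one level set.\<close>

lemma large_prime_class:
  fixes a :: "nat \<Rightarrow> int"
  assumes a: "finitely_generated a"
  shows "\<exists>P v. finite P \<and> (\<forall>p\<in>P. prime p \<and> a p = v) \<and> K \<le> (\<Sum>p\<in>P. 1 / real p)"
proof -
  define Q where "Q v = {p. prime p \<and> a p = v}" for v
  have eq: "{p. prime p} = (\<Union>v\<in>a ` {p. prime p}. Q v)" by (auto simp: Q_def)
  have "\<exists>v. \<not> thin_set (Q v)"
  proof (rule ccontr)
    assume "\<not> ?thesis"
    then have all: "thin_set (Q v)" for v by blast
    have "thin_set (\<Union>v\<in>a ` {p. prime p}. Q v)" by (rule sparse_UN[OF a[unfolded finitely_generated_def] all])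
    then have "thin_set {p :: nat. prime p}" by (simp only: eq[symmetric])
    then show False by (rule notE[OF primes_not_sparse])
  qed
  then obtain v where v: "\<not> thin_set (Q v)" ..
  from not_summable_reciprocals[OF this, of K]
  obtain P where P: "finite P" "P \<subseteq> Q v" "K \<le> (\<Sum>p\<in>P. 1 / real p)" by (elim exE conjE)
  then have "\<forall>p\<in>P. prime p \<and> a p = v" by (auto simp: Q_def)
  with P show ?thesis by (intro exI[of _ P] exI[of _ v] conjI)
qed

text \<open>
  The invariant part of \<open>f\<close> under a high power of the first transformation is handled by averages over
  residue classes; all correlations of the remaining part vanish on average, so that Katai's criterion applies.
\<close>
lemma joint_limit_unimodular:
  assumes S: "mp_action M \<sigma>" and erg: "ergodic M (\<tau> 1)" "ergodic M (\<sigma> 1)"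
    and ca: "completely_additive a" and fg: "finitely_generated a"
    and a: "\<And>\<theta>. \<theta> \<notin> \<int> \<Longrightarrow> residue_mean_zero a \<theta>"
    and f [measurable]: "f \<in> borel_measurable M" and C: "\<And>x. norm (f x) \<le> C"
    and g [measurable]: "g \<in> borel_measurable M" and g1: "\<And>x. norm (g x) = 1"
  shows "(\<lambda>N. LINT x|M. (norm (joint \<sigma> a f g N x - (LINT y|M. f y) * (LINT y|M. g y)))\<^sup>2) \<longlonglongrightarrow> 0"
proof (rule tendstoI)
  fix e :: real assume e: "e > 0"
  interpret S: mp_action M \<sigma> by fact
  \<comment> \<open>The numerator in \<open>katai_average\<close> for the bound \<open>C + C\<close>
    of the remainder; the choice of \<open>P\<close> then makes \<open>2 * (E / L)\<close> at most
    \<open>e / 2\<close>.\<close>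
  define E where "E = 6 * (C + C)\<^sup>2 + 1"
  have E: "E > 0" unfolding E_def by (simp add: add_nonneg_pos)
  obtain P v where P: "finite P" "\<forall>p\<in>P. prime p \<and> a p = v" and L: "4 * E / e \<le> (\<Sum>p\<in>P. 1 / real p)"
    using large_prime_class[OF fg, of "4 * E / e"] by (elim exE conjE)
  define L where "L = (\<Sum>p\<in>P. 1 / real p)"
  have Lpos: "L > 0" unfolding L_def by (rule less_le_trans[OF _ L]) (use E e in simp)
  have LE: "2 * (E / L) \<le> e / 2" using L Lpos E e unfolding L_def[symmetric] by (simp add: field_simps)
  \<comment> \<open>Divisible by all positive differences of elements of \<open>P\<close>; inserting
    0 makes the argument of \<open>Max\<close> nonempty at once.\<close>
  define D where "D = (fact (Max (insert 0 P)) :: nat)"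
  have D: "D \<ge> 1" unfolding D_def by (simp add: fact_ge_1)
  have dvd: "(p - q) dvd D" if "p \<in> P" "q < p" for p q
    unfolding D_def
  proof (rule dvd_fact)
    have "p \<le> Max (insert 0 P)" using P that by (intro Max_ge) auto
    then show "p - q \<le> Max (insert 0 P)" by simp
  qed (use that in simp)
  obtain h where h [measurable]: "h \<in> borel_measurable M" and hC: "\<forall>x. norm (h x) \<le> C" and
      inv: "AE x in M. h (\<tau> (int D) x) = h x" and
      orth: "\<forall>H B. H \<in> borel_measurable M \<longrightarrow> (\<forall>x. norm (H x) \<le> B) \<longrightarrow> (AE x in M. H (\<tau> (int D) x) = H x) \<longrightarrow>
        (LINT x|M. h x * cnj (H x)) = (LINT x|M. f x * cnj (H x))"
    using mean_ergodic[OF f C, of D] by (elim exE conjE)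
  have "(LINT x|M. h x * cnj 1) = (LINT x|M. f x * cnj 1)"
    using orth[rule_format, of "\<lambda>_. 1" 1] by simp
  then have hf: "(LINT x|M. h x) = (LINT x|M. f x)" by simp
  define f' where "f' x = f x - h x" for x
  have f' [measurable]: "f' \<in> borel_measurable M" unfolding f'_def by measurable
  have f'C: "norm (f' x) \<le> C + C" for x unfolding f'_def by (rule order_trans[OF norm_triangle_ineq4 add_mono[OF C hC[rule_format]]])
  have wP: "g (\<sigma> (a (p * m)) x) = g (\<sigma> (a (q * m)) x)" if "p \<in> P" "q \<in> P" "m \<ge> 1" for p q m x
  proof -
    have "a (r * m) = v + a m" if "r \<in> P" for r
      using ca \<open>m \<ge> 1\<close> P(2) that prime_gt_0_nat[of r] unfolding completely_additive_def by (simp add: Suc_le_eq)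
    then show ?thesis using that by simp
  qed
  have J': "\<forall>\<^sub>F N in sequentially. (LINT x|M. (norm (joint \<sigma> a f' g N x))\<^sup>2) \<le> E / L"
    unfolding joint_def E_def L_def
  proof (rule katai_average[where w = "\<lambda>n x. g (\<sigma> (a n) x)", OF f' f'C P(1)])
    show "(\<lambda>N. (\<Sum>n=1..N. corr f' (int ((p - q) * n))) / of_nat N) \<longlonglongrightarrow> 0" if "p \<in> P" "q \<in> P" "q < p" for p q
      unfolding f'_def by (rule corr_average_zero[OF f C h hC[rule_format] dvd orth]) (use that in auto)
    show "0 < (\<Sum>p\<in>P. 1 / real p)" using Lpos unfolding L_def .
    show "prime p" if "p \<in> P" for p using P(2) that by blast
    show "g (\<sigma> (a (p * m)) x) = g (\<sigma> (a (q * m)) x)" if "p \<in> P" "q \<in> P" "m \<ge> 1" for p q m x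
      by (rule wP[OF that])
    show "(\<lambda>x. g (\<sigma> (a n) x)) \<in> borel_measurable M" for n by measurable
    show "norm (g (\<sigma> (a n) x)) = 1" for n x by (rule g1)
  qed
  have J0: "(\<lambda>N. LINT x|M. (norm (joint \<sigma> a h g N x - (LINT y|M. f y) * (LINT y|M. g y)))\<^sup>2) \<longlonglongrightarrow> 0"
    using joint_limit_periodic[OF S erg a D h hC[rule_format] inv g, of 1] g1 unfolding hf by simp
  have lin: "2 * A + 2 * A' < e" if "A \<le> q" "A' < e / 8" "2 * q \<le> e / 2" for A A' q :: real
    using that e by linarith
  have "\<forall>\<^sub>F N in sequentially. (LINT x|M. (norm (joint \<sigma> a h g N x - (LINT y|M. f y) * (LINT y|M. g y)))\<^sup>2) < e / 8"
    using J0 e by (intro order_tendstoD(2)) auto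
  with J' show "\<forall>\<^sub>F N in sequentially. dist (LINT x|M. (norm (joint \<sigma> a f g N x - (LINT y|M. f y) * (LINT y|M. g y)))\<^sup>2) 0 < e"
  proof eventually_elim
    fix N
    define t where "t = (LINT y|M. f y) * (LINT y|M. g y)"
    assume j: "(LINT x|M. (norm (joint \<sigma> a f' g N x))\<^sup>2) \<le> E / L"
      "(LINT x|M. (norm (joint \<sigma> a h g N x - (LINT y|M. f y) * (LINT y|M. g y)))\<^sup>2) < e / 8"
    have [measurable]: "joint \<sigma> a f' g N \<in> borel_measurable M" "joint \<sigma> a h g N \<in> borel_measurable M"
      by (rule joint_measurable[OF S]; measurable)+
    have eq: "joint \<sigma> a f g N x - t = joint \<sigma> a f' g N x + (joint \<sigma> a h g N x - t)" for x
      unfolding joint_def f'_def by (simp add: sum_subtractf diff_divide_distrib left_diff_distrib)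
    have i1: "integrable M (\<lambda>x. (norm (joint \<sigma> a f' g N x))\<^sup>2)"
      by (rule L2_integrable[where C = "(C + C) * 1"], measurable) (rule norm_joint_le[OF f'C], simp add: g1)
    have i2: "integrable M (\<lambda>x. (norm (joint \<sigma> a h g N x - t))\<^sup>2)"
      by (rule L2_integrable[where C = "C * 1 + norm t"], measurable)
         (rule order_trans[OF norm_triangle_ineq4 add_right_mono], rule norm_joint_le[OF hC[rule_format]], simp add: g1)
    have "(LINT x|M. (norm (joint \<sigma> a f g N x - t))\<^sup>2) \<le> (LINT x|M. 2 * (norm (joint \<sigma> a f' g N x))\<^sup>2 + 2 * (norm (joint \<sigma> a h g N x - t))\<^sup>2)"
      unfolding eq
    proof (rule integral_mono')
      show "(norm (joint \<sigma> a f' g N x + (joint \<sigma> a h g N x - t)))\<^sup>2 \<le> 2 * (norm (joint \<sigma> a f' g N x))\<^sup>2 + 2 * (norm (joint \<sigma> a h g N x - t))\<^sup>2" for x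
        by (rule norm_add_squared_le)
    qed (use i1 i2 in auto)
    also have "\<dots> = 2 * (LINT x|M. (norm (joint \<sigma> a f' g N x))\<^sup>2) + 2 * (LINT x|M. (norm (joint \<sigma> a h g N x - t))\<^sup>2)"
      using i1 i2 by simp
    also have "\<dots> < e" by (rule lin[OF j[folded t_def] LE])
    finally have "(LINT x|M. (norm (joint \<sigma> a f g N x - t))\<^sup>2) < e" .
    moreover have "0 \<le> (LINT x|M. (norm (joint \<sigma> a f g N x - t))\<^sup>2)" by (rule Bochner_Integration.integral_nonneg) simp
    ultimately show "dist (LINT x|M. (norm (joint \<sigma> a f g N x - (LINT y|M. f y) * (LINT y|M. g y)))\<^sup>2) 0 < e"
      unfolding t_def[symmetric] dist_real_def by (simp only: diff_zero abs_of_nonneg)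
  qed
qed

end

text \<open>A complex number of modulus at most 1 is the midpoint of two points of the unit circle:
  its direction is turned in both senses by the angle with cosine \<open>r x\<close>.\<close>

lemma unimodular_decomposition:
  fixes g :: "'a \<Rightarrow> complex"
  assumes g [measurable]: "g \<in> borel_measurable M" and B: "\<And>x. norm (g x) \<le> B" and B0: "B > 0"
  shows "\<exists>u v. u \<in> borel_measurable M \<and> v \<in> borel_measurable M \<and> (\<forall>x. norm (u x) = 1) \<and> (\<forall>x. norm (v x) = 1) \<and>
    (\<forall>x. g x = of_real (B / 2) * (u x + v x))"
proof -
  define r where "r x = norm (g x) / B" for x
  define s where "s x = sqrt (1 - (r x)\<^sup>2)" for x
  \<comment> \<open>The direction of \<open>g x\<close>; at zeros of \<open>g\<close> the value 1
    keeps the modulus equal to 1.\<close>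
  define w where "w x = (if norm (g x) = 0 then 1 else g x / of_real (norm (g x)))" for x
  have [measurable]: "r \<in> borel_measurable M" unfolding r_def by measurable
  have [measurable]: "s \<in> borel_measurable M" unfolding s_def by measurable
  have [measurable]: "w \<in> borel_measurable M" unfolding w_def by measurable
  have w1: "norm (w x) = 1" for x unfolding w_def by (simp add: norm_divide)
  have r01: "0 \<le> r x" "r x \<le> 1" for x using B[of x] B0 by (auto simp: r_def)
  have sq: "(r x)\<^sup>2 + (s x)\<^sup>2 = 1" for x
    using r01[of x] by (simp add: s_def power_le_one)
  have c1: "norm (Complex (r x) (s x)) = 1" for x by (simp add: complex_norm sq)
  have c2: "norm (cnj (Complex (r x) (s x))) = 1" for x unfolding complex_mod_cnj by (rule c1)
  have C: "Complex (r x) (s x) = of_real (r x) + \<i> * of_real (s x)" for x by (simp add: complex_eq_iff)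
  have gw: "g x = of_real (B * r x) * w x" for x using B0 unfolding w_def r_def by simp
  have "g x = of_real (B / 2) * (w x * Complex (r x) (s x) + w x * cnj (Complex (r x) (s x)))" for x
    unfolding gw distrib_left[symmetric] complex_add_cnj by simp
  moreover have "(\<lambda>x. w x * Complex (r x) (s x)) \<in> borel_measurable M" unfolding C by measurable
  moreover have "(\<lambda>x. w x * cnj (Complex (r x) (s x))) \<in> borel_measurable M" unfolding C by measurable
  moreover have "norm (w x * Complex (r x) (s x)) = 1" "norm (w x * cnj (Complex (r x) (s x))) = 1" for x
    unfolding norm_mult w1 c1 c2 by simp_all
  ultimately show ?thesis
    by (intro exI[of _ "\<lambda>x. w x * Complex (r x) (s x)"] exI[of _ "\<lambda>x. w x * cnj (Complex (r x) (s x))"] conjI allI)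
qed

context mp_action
begin

text \<open>The average and its limit are both linear in \<open>g\<close>, so the two unimodular
  parts are treated separately.\<close>

theorem joint_limit:
  assumes S: "mp_action M \<sigma>" and erg: "ergodic M (\<tau> 1)" "ergodic M (\<sigma> 1)"
    and ca: "completely_additive a" and fg: "finitely_generated a"
    and a: "\<And>\<theta>. \<theta> \<notin> \<int> \<Longrightarrow> residue_mean_zero a \<theta>"
    and f [measurable]: "f \<in> borel_measurable M" and C: "\<And>x. norm (f x) \<le> C"
    and g [measurable]: "g \<in> borel_measurable M" and B: "\<And>x. norm (g x) \<le> B" and B0: "B > 0"
  shows "(\<lambda>N. LINT x|M. (norm (joint \<sigma> a f g N x - (LINT y|M. f y) * (LINT y|M. g y)))\<^sup>2) \<longlonglongrightarrow> 0"
proof -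
  obtain u v where u [measurable]: "u \<in> borel_measurable M" and v [measurable]: "v \<in> borel_measurable M"
    and u1: "\<forall>x. norm (u x) = 1" and v1: "\<forall>x. norm (v x) = 1" and guv: "\<forall>x. g x = of_real (B / 2) * (u x + v x)"
    using unimodular_decomposition[OF g B B0] by (elim exE conjE)
  define t where "t g = (LINT y|M. f y) * (LINT y|M. g y)" for g
  have ui: "integrable M u" and vi: "integrable M v"
    by (rule integrable_bounded[where C = 1]; use u1 v1 in simp)+
  have tg: "t g = of_real (B / 2) * (t u + t v)"
  proof -
    have "(LINT y|M. g y) = (LINT y|M. of_real (B / 2) * (u y + v y))" by (simp only: guv[rule_format])
    also have "\<dots> = of_real (B / 2) * ((LINT y|M. u y) + (LINT y|M. v y))"
      by (simp only: Bochner_Integration.integral_mult_right_zero Bochner_Integration.integral_add[OF ui vi])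
    finally show ?thesis unfolding t_def by (simp only: distrib_left mult.left_commute)
  qed
  have jg: "joint \<sigma> a f g N x = of_real (B / 2) * (joint \<sigma> a f u N x + joint \<sigma> a f v N x)" for N x
  proof -
    have "(\<Sum>n=1..N. f (\<tau> (int n) x) * g (\<sigma> (a n) x)) = (\<Sum>n=1..N. of_real (B / 2) * (f (\<tau> (int n) x) * u (\<sigma> (a n) x) + f (\<tau> (int n) x) * v (\<sigma> (a n) x)))"
      by (rule sum.cong[OF refl]) (simp only: guv[rule_format] distrib_left mult.left_commute)
    also have "\<dots> = of_real (B / 2) * ((\<Sum>n=1..N. f (\<tau> (int n) x) * u (\<sigma> (a n) x)) + (\<Sum>n=1..N. f (\<tau> (int n) x) * v (\<sigma> (a n) x)))"
      by (simp only: sum_distrib_left[symmetric] sum.distrib)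
    finally show ?thesis unfolding joint_def by (simp only: times_divide_eq_right[symmetric] add_divide_distrib)
  qed
  have le: "(LINT x|M. (norm (joint \<sigma> a f g N x - t g))\<^sup>2) \<le>
    (B / 2)\<^sup>2 * (2 * (LINT x|M. (norm (joint \<sigma> a f u N x - t u))\<^sup>2) + 2 * (LINT x|M. (norm (joint \<sigma> a f v N x - t v))\<^sup>2))" for N
  proof -
    have m: "joint \<sigma> a f u N \<in> borel_measurable M" "joint \<sigma> a f v N \<in> borel_measurable M"
      by (rule joint_measurable[OF S f]; measurable)+
    have i: "integrable M (\<lambda>x. (norm (joint \<sigma> a f w N x - t w))\<^sup>2)" if w: "joint \<sigma> a f w N \<in> borel_measurable M" "\<forall>x. norm (w x) = 1" for w
    proof (rule L2_integrable[where C = "C * 1 + norm (t w)"])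
      show "(\<lambda>x. joint \<sigma> a f w N x - t w) \<in> borel_measurable M" using w(1) by measurable
      show "norm (joint \<sigma> a f w N x - t w) \<le> C * 1 + norm (t w)" for x
        by (rule order_trans[OF norm_triangle_ineq4 add_right_mono], rule norm_joint_le[OF C]) (simp add: w(2))
    qed
    note iu = i[OF m(1) u1] and iv = i[OF m(2) v1]
    have "(LINT x|M. (norm (joint \<sigma> a f g N x - t g))\<^sup>2) \<le>
       (LINT x|M. (B / 2)\<^sup>2 * (2 * (norm (joint \<sigma> a f u N x - t u))\<^sup>2 + 2 * (norm (joint \<sigma> a f v N x - t v))\<^sup>2))"
    proof (rule integral_mono')
      show "integrable M (\<lambda>x. (B / 2)\<^sup>2 * (2 * (norm (joint \<sigma> a f u N x - t u))\<^sup>2 + 2 * (norm (joint \<sigma> a f v N x - t v))\<^sup>2))"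
        by (intro integrable_mult_right Bochner_Integration.integrable_add iu iv)
      fix x
      have "joint \<sigma> a f g N x - t g = of_real (B / 2) * ((joint \<sigma> a f u N x - t u) + (joint \<sigma> a f v N x - t v))"
        unfolding jg tg by (simp only: right_diff_distrib[symmetric] add_diff_add)
      then have "(norm (joint \<sigma> a f g N x - t g))\<^sup>2 = (B / 2)\<^sup>2 * (norm ((joint \<sigma> a f u N x - t u) + (joint \<sigma> a f v N x - t v)))\<^sup>2"
        by (simp only: norm_mult power_mult_distrib norm_of_real power2_abs)
      then show "(norm (joint \<sigma> a f g N x - t g))\<^sup>2 \<le> (B / 2)\<^sup>2 * (2 * (norm (joint \<sigma> a f u N x - t u))\<^sup>2 + 2 * (norm (joint \<sigma> a f v N x - t v))\<^sup>2)"
        by (simp only:) (rule mult_left_mono[OF norm_add_squared_le zero_le_power2])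
      show "0 \<le> (B / 2)\<^sup>2 * (2 * (norm (joint \<sigma> a f u N x - t u))\<^sup>2 + 2 * (norm (joint \<sigma> a f v N x - t v))\<^sup>2)" by simp
    qed
    also have "\<dots> = (B / 2)\<^sup>2 * (2 * (LINT x|M. (norm (joint \<sigma> a f u N x - t u))\<^sup>2) + 2 * (LINT x|M. (norm (joint \<sigma> a f v N x - t v))\<^sup>2))"
      using iu iv by simp
    finally show ?thesis .
  qed
  have lu: "(\<lambda>N. LINT x|M. (norm (joint \<sigma> a f u N x - t u))\<^sup>2) \<longlonglongrightarrow> 0" unfolding t_def
    by (rule joint_limit_unimodular[OF S erg ca fg a f C u u1[rule_format]])
  have lv: "(\<lambda>N. LINT x|M. (norm (joint \<sigma> a f v N x - t v))\<^sup>2) \<longlonglongrightarrow> 0" unfolding t_def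
    by (rule joint_limit_unimodular[OF S erg ca fg a f C v v1[rule_format]])
  have "(\<lambda>N. (B / 2)\<^sup>2 * (2 * (LINT x|M. (norm (joint \<sigma> a f u N x - t u))\<^sup>2) + 2 * (LINT x|M. (norm (joint \<sigma> a f v N x - t v))\<^sup>2)))
     \<longlonglongrightarrow> (B / 2)\<^sup>2 * (2 * 0 + 2 * 0)"
    by (rule tendsto_mult[OF tendsto_const tendsto_add[OF tendsto_mult[OF tendsto_const lu] tendsto_mult[OF tendsto_const lv]]])
  then have lim: "(\<lambda>N. (B / 2)\<^sup>2 * (2 * (LINT x|M. (norm (joint \<sigma> a f u N x - t u))\<^sup>2) + 2 * (LINT x|M. (norm (joint \<sigma> a f v N x - t v))\<^sup>2)))
     \<longlonglongrightarrow> 0" by simp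
  have "(\<lambda>N. LINT x|M. (norm (joint \<sigma> a f g N x - t g))\<^sup>2) \<longlonglongrightarrow> 0"
    by (rule Lim_null_comparison[OF _ lim]) (use le in \<open>auto intro!: always_eventually\<close>)
  then show ?thesis unfolding t_def .
qed

end

lemma L_infinity_bounded_version:
  assumes "F \<in> L_infinity M"
  shows "\<exists>f C. f \<in> borel_measurable M \<and> (\<forall>x. norm (f x) \<le> C) \<and> C > 0 \<and> (AE x in M. F x = f x)"
proof -
  obtain C where [measurable]: "F \<in> borel_measurable M" and C: "AE x in M. norm (F x) \<le> C"
    using assms unfolding L_infinity_def by blast
  define f where "f x = (if norm (F x) \<le> C then F x else 0)" for x
  have "f \<in> borel_measurable M" unfolding f_def by measurable
  moreover have "\<forall>x. norm (f x) \<le> \<bar>C\<bar> + 1" by (auto simp: f_def)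
  moreover have "AE x in M. F x = f x" using C by eventually_elim (simp add: f_def)
  moreover have "\<bar>C\<bar> + 1 > 0" by simp
  ultimately show ?thesis by blast
qed

text \<open>Transfer to versions of \<open>F\<close> and \<open>G\<close> that are bounded
  everywhere: as the measure is invariant and there are countably many times, the averages agree
  almost everywhere.\<close>

lemma joint_average_limit:
  fixes M :: "'a::metric_space measure"
  assumes M: "regular_prob_space M"
    and T1: "invertible_measure_preserving M T1" "ergodic M T1"
    and T2: "invertible_measure_preserving M T2" "ergodic M T2"
    and F: "F \<in> L_infinity M" and G: "G \<in> L_infinity M"
    and ca: "completely_additive a" and fg: "finitely_generated a"
    and a: "\<And>\<theta>. \<theta> \<notin> \<int> \<Longrightarrow> residue_mean_zero a \<theta>"
  shows "tendsto_L_two M (joint_average M T1 T2 a F G) (\<lambda>x. (LINT y|M. F y) * (LINT y|M. G y))"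
proof -
  have "prob_space M" using M unfolding regular_prob_space_def by blast
  note mp1 = interpret_mp_action[OF this T1(1)] and mp2 = interpret_mp_action[OF this T2(1)]
  interpret A: mp_action M "int_iterate M T1" by (rule mp1)
  interpret B: mp_action M "int_iterate M T2" by (rule mp2)
  have it1: "int_iterate M T 1 = T" for T :: "'a \<Rightarrow> 'a" by (simp add: int_iterate_def)
  obtain f C where f [measurable]: "f \<in> borel_measurable M" and fC: "\<forall>x. norm (f x) \<le> C" and Ff: "AE x in M. F x = f x"
    using L_infinity_bounded_version[OF F] by (elim exE conjE)
  obtain g D where g [measurable]: "g \<in> borel_measurable M" and gD: "\<forall>x. norm (g x) \<le> D" and D0: "D > 0" and Gg: "AE x in M. G x = g x"
    using L_infinity_bounded_version[OF G] by (elim exE conjE)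
  have [measurable]: "F \<in> borel_measurable M" "G \<in> borel_measurable M" using F G unfolding L_infinity_def by auto
  define t where "t = (LINT y|M. F y) * (LINT y|M. G y)"
  have IF: "(LINT y|M. F y) = (LINT y|M. f y)" by (rule integral_cong_AE) (use Ff in auto)
  have IG: "(LINT y|M. G y) = (LINT y|M. g y)" by (rule integral_cong_AE) (use Gg in auto)
  have Sm [measurable]: "joint_average M T1 T2 a F G N \<in> borel_measurable M" for N
    unfolding joint_average_def koopman_def by measurable
  have jm [measurable]: "A.joint (int_iterate M T2) a f g N \<in> borel_measurable M" for N
    by (rule A.joint_measurable[OF mp2 f g])
  have jB: "norm (A.joint (int_iterate M T2) a f g N x) \<le> C * D" for N x
    by (rule A.norm_joint_le[OF fC[rule_format] gD[rule_format]])
  have "AE x in M. \<forall>n. F (int_iterate M T1 (int n) x) = f (int_iterate M T1 (int n) x)"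
    unfolding AE_all_countable by (rule allI, rule A.AE_shift[OF Ff])
  moreover have "AE x in M. \<forall>n. G (int_iterate M T2 (a n) x) = g (int_iterate M T2 (a n) x)"
    unfolding AE_all_countable by (rule allI, rule B.AE_shift[OF Gg])
  ultimately have eq: "AE x in M. \<forall>N. joint_average M T1 T2 a F G N x = A.joint (int_iterate M T2) a f g N x"
  proof eventually_elim
    case (elim x)
    then show ?case unfolding joint_average_def koopman_def A.joint_def by simp
  qed
  have eqN: "AE x in M. joint_average M T1 T2 a F G N x = A.joint (int_iterate M T2) a f g N x" for N
    using eq by eventually_elim blast
  have "joint_average M T1 T2 a F G N \<in> L_two M" for N
  proof -
    have "integrable M (\<lambda>x. (norm (A.joint (int_iterate M T2) a f g N x))\<^sup>2)" by (rule A.L2_integrable[OF jm jB])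
    moreover have "integrable M (\<lambda>x. (norm (joint_average M T1 T2 a F G N x))\<^sup>2) = integrable M (\<lambda>x. (norm (A.joint (int_iterate M T2) a f g N x))\<^sup>2)"
      by (rule integrable_cong_AE) (use eqN[of N] in auto)
    ultimately show ?thesis unfolding L_two_def using Sm by simp
  qed
  moreover have "(\<lambda>x. t) \<in> L_two M" unfolding L_two_def by simp
  moreover have "(\<lambda>N. L_two_norm M (\<lambda>x. joint_average M T1 T2 a F G N x - t)) \<longlonglongrightarrow> 0"
  proof -
    have "(LINT x|M. (norm (joint_average M T1 T2 a F G N x - t))\<^sup>2) = (LINT x|M. (norm (A.joint (int_iterate M T2) a f g N x - t))\<^sup>2)" for N
      by (rule integral_cong_AE) (use eqN[of N] in auto)
    moreover have "(\<lambda>N. LINT x|M. (norm (A.joint (int_iterate M T2) a f g N x - t))\<^sup>2) \<longlonglongrightarrow> 0"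
      unfolding t_def IF IG
      by (rule A.joint_limit[OF mp2 _ _ ca fg _ f fC[rule_format] g gD[rule_format] D0]) (simp only: it1 T1(2), simp only: it1 T2(2), erule a)
    ultimately have "(\<lambda>N. LINT x|M. (norm (joint_average M T1 T2 a F G N x - t))\<^sup>2) \<longlonglongrightarrow> 0" by simp
    then have "(\<lambda>N. sqrt (LINT x|M. (norm (joint_average M T1 T2 a F G N x - t))\<^sup>2)) \<longlonglongrightarrow> sqrt 0" by (rule tendsto_real_sqrt)
    then show ?thesis unfolding L_two_norm_def by simp
  qed
  ultimately show ?thesis unfolding tendsto_L_two_def t_def by blast
qed

theorem corollary1p33:
  fixes M :: "'a::metric_space measure"
    and T1 T2 :: "'a \<Rightarrow> 'a"
    and F G :: "'a \<Rightarrow> complex"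
  assumes "regular_prob_space M"
    and "invertible_measure_preserving M T1" and "ergodic M T1"
    and "invertible_measure_preserving M T2" and "ergodic M T2"
    and "F \<in> L_infinity M" and "G \<in> L_infinity M"
  shows "tendsto_L_two M (joint_average M T1 T2 (\<lambda>n. int (Omega n)) F G)
           (\<lambda>x. (LINT y|M. F y) * (LINT y|M. G y))
       \<and> (\<forall>P. P \<subseteq> {p. prime p} \<and> contains_almost_every_prime P \<longrightarrow>
            tendsto_L_two M (joint_average M T1 T2 (\<lambda>n. int (Omega_in P n)) F G)
              (\<lambda>x. (LINT y|M. F y) * (LINT y|M. G y)))
       \<and> (\<forall>a :: nat \<Rightarrow> int.
            completely_additive a \<and> finitely_generated a \<and>
            (\<forall>\<alpha> \<in> {0<..<1} \<inter> \<rat>. aperiodic (\<lambda>n. e_char (of_int (a n) * \<alpha>))) \<longrightarrow>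
            tendsto_L_two M (joint_average M T1 T2 a F G)
              (\<lambda>x. (LINT y|M. F y) * (LINT y|M. G y)))"
proof -
  have Om: "tendsto_L_two M (joint_average M T1 T2 (\<lambda>n. int (Omega_in P n)) F G) (\<lambda>x. (LINT y|M. F y) * (LINT y|M. G y))"
    if P: "contains_almost_every_prime P" for P
    by (rule joint_average_limit[OF assms completely_additive_Omega_in finitely_generated_Omega_in residue_mean_zero_Omega_in[OF P]])
  \<comment> \<open>\<open>Omega\<close> is the case of all primes, in which the exceptional set is
    empty.\<close>
  have "contains_almost_every_prime {p. prime p}" unfolding contains_almost_every_prime_def by simp
  then have "tendsto_L_two M (joint_average M T1 T2 (\<lambda>n. int (Omega n)) F G) (\<lambda>x. (LINT y|M. F y) * (LINT y|M. G y))"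
    unfolding Omega_eq_Omega_in by (rule Om)
  moreover have "tendsto_L_two M (joint_average M T1 T2 a F G) (\<lambda>x. (LINT y|M. F y) * (LINT y|M. G y))"
    if a: "completely_additive a" "finitely_generated a" "\<forall>\<alpha> \<in> {0<..<1} \<inter> \<rat>. aperiodic (\<lambda>n. e_char (of_int (a n) * \<alpha>))" for a
    by (rule joint_average_limit[OF assms a(1,2) residue_mean_zero_all[OF a]])
  ultimately show ?thesis using Om by blast
qed

end
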